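(* Let $\Omega$ be a bounded Jones domain in $\mathbb R^n$, with $n\ge2$, and let $m\in\mathbb N$ with $m<n$. **(A)** Assume that $p,q\in[1,\infty]$, $\alpha,\beta\in\mathbb R$ are LZ-admissible. Then $W^mL^{p,q;\alpha,\beta}(\Omega)\hookrightarrow C^0_b(\Omega)$ if and only if one of the following holds: - $p=\frac nm$, $q=1$, $\alpha=\beta=0$; - $p=\frac nm$, $q\in[1,\infty]$, $\alpha=\frac1{q'}$, $\beta>\frac1{q'}$; - $p=\frac nm$, $q\in[1,\infty]$, $\alpha>\frac1{q'}$, $\beta\in\mathbb R$; - $p\in(\frac nm,\infty]$. **(B)** If $q\in[1,\infty]$, $\alpha,\beta\in\mathbb R$ are $L^1$-admissible, then $W^mL^{(1,q;\alpha,\beta)}(\Omega)\not\hookrightarrow C^0_b(\Omega)$.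
   Context: Conventions: $p'=\frac p{p-1}$ for $p\in(1,\infty)$, $1'=\infty$, $\infty'=1$; $\frac1\infty=0$. The arrow $\hookrightarrow$ denotes continuous embedding (for continuous targets, after choosing a suitable representative). $C^0_b(\Omega)$ is the space of bounded continuous functions on $\Omega$ with the supremum norm. For measurable $u$ on $E$: $u^*(s)=\inf\{t\ge0:|\{x\in E:|u(x)|>t\}|\le s\}$, $u^{**}(s)=\frac1s\int_0^su^*(t)\,dt$. Let $\ell(s)=1+|\log s|$, $\ell\ell(s)=1+\log\ell(s)$ and $\|f\|_{L^{p,q;\alpha,\beta}(0,1)}=\|s^{\frac1p-\frac1q}\ell^\alpha(s)\ell\ell^\beta(s)f^*(s)\|_{L^q(0,1)}$, $\|f\|_{L^{(p,q;\alpha,\beta)}(0,1)}=\|s^{\frac1p-\frac1q}\ell^\alpha(s)\ell\ell^\beta(s)f^{**}(s)\|_{L^q(0,1)}$. For $X$ any of these, $X(\Omega)$ is the space of measurable $u$ on $\Omega$ with $\|u\|_{X(\Omega)}=\|u^*(|\Omega|\,\cdot)\|_{X(0,1)}<\infty$. $(p,q,\alpha,\beta)$ is LZ-admissible if one of the following holds (exactly the cases where $\|\cdot\|_{L^{p,q;\alpha,\beta}(0,1)}$ is equivalent to a rearrangement-invariant function norm): $p=q=1,\alpha=0,\beta\ge0$; $p=q=1,\alpha>0,\beta\in\mathbb R$; $p\in(1,\infty),q\in[1,\infty],\alpha,\beta\in\mathbb R$; $p=\infty,q\in[1,\infty],\alpha<-\frac1q,\beta\in\mathbb R$; $p=\infty,q\in[1,\infty],\alpha=-\frac1q,\beta<-\frac1q$;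 $p=q=\infty,\alpha=\beta=0$. $(q,\alpha,\beta)$ is $L^1$-admissible if one of the following holds: $q\in[1,\infty],\alpha>-\frac1q,\beta\in\mathbb R$; $q\in[1,\infty],\alpha=-\frac1q,\beta>-\frac1q$; $q\in[1,\infty),\alpha=\beta=-\frac1q$. $W^mX(\Omega)$ is the space of $m$-times weakly differentiable $u$ on $\Omega$ with $|\nabla^ku|\in X(\Omega)$ for $k=0,\dots,m$, normed by $\sum_{k=0}^m\||\nabla^ku|\|_{X(\Omega)}$, where $\nabla^ku$ is the vector of all $k$-th order weak derivatives. A domain is a connected open set. A domain $\Omega$ is a Jones domain (an $(\varepsilon,\delta)$-domain) if there exist $\varepsilon\in(0,1)$ and $\delta\in(1,\infty]$ such that for all $x,y\in\Omega$ with $|x-y|<\delta$ there is a rectifiable arc $\gamma\subset\Omega$ joining $x$ to $y$ whose length satisfies $\ell(\gamma)\le\frac{|x-y|}\varepsilon$ and $\operatorname{dist}(z,\partial\Omega)\ge\varepsilon\frac{|x-z||y-z|}{|x-y|}$ for all $z\in\gamma$. *)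

theory Defs
  imports "HOL-Analysis.Analysis" "HOL-Probability.Essential_Supremum"
begin

section \<open>Exponents in [1, \<infinity>]\<close>

text \<open>Exponents have type \<^typ>\<open>ennreal\<close>; \<open>recip p\<close> is the real number 1/p, with 1/\<infinity> = 0.\<close>

definition recip :: "ennreal \<Rightarrow> real" where
  "recip p = enn2real (1 / p)"

definition conj_exp :: "ennreal \<Rightarrow> ennreal" where
  "conj_exp p = (if p = 1 then \<infinity> else if p = \<infinity> then 1 else p / (p - 1))"

text \<open>Power with a positive real exponent, with \<open>\<infinity>\<close> sent to \<open>\<infinity>\<close>.\<close>

definition enn_powr :: "ennreal \<Rightarrow> real \<Rightarrow> ennreal" where
  "enn_powr x r = (if x = \<infinity> then \<infinity> else ennreal (enn2real x powr r))"

definition Lq_norm01 :: "ennreal \<Rightarrow> (real \<Rightarrow> ennreal) \<Rightarrow> ennreal" where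
  "Lq_norm01 q g =
     (if q = \<infinity> then esssup (lebesgue_on {0<..<1}) g
      else enn_powr (\<integral>\<^sup>+ s. enn_powr (g s) (enn2real q) \<partial>lebesgue_on {0<..<1}) (recip q))"

section \<open>Rearrangements and Lorentz--Zygmund functionals\<close>

text \<open>
  Rearrangements may be infinite, and the functionals below are applied to functions that are
  themselves rearrangements. Hence \<open>f\<close> is \<^typ>\<open>ennreal\<close>-valued and stands for \<open>|u|\<close>.
\<close>

definition rearr :: "'a::euclidean_space set \<Rightarrow> ('a \<Rightarrow> ennreal) \<Rightarrow> real \<Rightarrow> ennreal" where
  "rearr E f s = Inf {t. emeasure lebesgue {x \<in> E. f x > t} \<le> ennreal s}"

definition max_rearr :: "'a::euclidean_space set \<Rightarrow> ('a \<Rightarrow> ennreal) \<Rightarrow> real \<Rightarrow> ennreal" where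
  "max_rearr E f s = (\<integral>\<^sup>+ t. rearr E f t \<partial>lebesgue_on {0<..<s}) / ennreal s"

definition ell :: "real \<Rightarrow> real" where
  "ell s = 1 + \<bar>ln s\<bar>"

definition ellell :: "real \<Rightarrow> real" where
  "ellell s = 1 + ln (ell s)"

definition LZ_weight :: "ennreal \<Rightarrow> ennreal \<Rightarrow> real \<Rightarrow> real \<Rightarrow> real \<Rightarrow> real" where
  "LZ_weight p q \<alpha> \<beta> s = s powr (recip p - recip q) * ell s powr \<alpha> * ellell s powr \<beta>"

definition LZ_norm ::
  "ennreal \<Rightarrow> ennreal \<Rightarrow> real \<Rightarrow> real \<Rightarrow> (real \<Rightarrow> ennreal) \<Rightarrow> ennreal" where
  "LZ_norm p q \<alpha> \<beta> f =
     Lq_norm01 q (\<lambda>s. ennreal (LZ_weight p q \<alpha> \<beta> s) * rearr {0<..<1} f s)"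

text \<open>The functional of \<open>L\<^bsup>(p,q;\<alpha>,\<beta>)\<^esup>\<close>, with the maximal function in place of the rearrangement.\<close>

definition LZ_max_norm ::
  "ennreal \<Rightarrow> ennreal \<Rightarrow> real \<Rightarrow> real \<Rightarrow> (real \<Rightarrow> ennreal) \<Rightarrow> ennreal" where
  "LZ_max_norm p q \<alpha> \<beta> f =
     Lq_norm01 q (\<lambda>s. ennreal (LZ_weight p q \<alpha> \<beta> s) * max_rearr {0<..<1} f s)"

definition LZ_admissible :: "ennreal \<Rightarrow> ennreal \<Rightarrow> real \<Rightarrow> real \<Rightarrow> bool" where
  "LZ_admissible p q \<alpha> \<beta> \<longleftrightarrow>
     (p = 1 \<and> q = 1 \<and> \<alpha> = 0 \<and> \<beta> \<ge> 0) \<or>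
     (p = 1 \<and> q = 1 \<and> \<alpha> > 0) \<or>
     (1 < p \<and> p < \<infinity> \<and> 1 \<le> q) \<or>
     (p = \<infinity> \<and> 1 \<le> q \<and> \<alpha> < - recip q) \<or>
     (p = \<infinity> \<and> 1 \<le> q \<and> \<alpha> = - recip q \<and> \<beta> < - recip q) \<or>
     (p = \<infinity> \<and> q = \<infinity> \<and> \<alpha> = 0 \<and> \<beta> = 0)"

definition L1_admissible :: "ennreal \<Rightarrow> real \<Rightarrow> real \<Rightarrow> bool" where
  "L1_admissible q \<alpha> \<beta> \<longleftrightarrow>
     (1 \<le> q \<and> \<alpha> > - recip q) \<or>
     (1 \<le> q \<and> \<alpha> = - recip q \<and> \<beta> > - recip q) \<or>
     (1 \<le> q \<and> q < \<infinity> \<and> \<alpha> = - recip q \<and> \<beta> = - recip q)"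

text \<open>
  \<open>X\<close> is a functional on nonnegative functions on (0,1); \<open>fn_norm X \<Omega>\<close> and \<open>fn_space X \<Omega>\<close> are the
  norm and the space \<open>X(\<Omega>)\<close>. Functions are not identified when they agree almost everywhere.
\<close>

definition fn_norm ::
  "((real \<Rightarrow> ennreal) \<Rightarrow> ennreal) \<Rightarrow> 'a::euclidean_space set \<Rightarrow> ('a \<Rightarrow> real) \<Rightarrow> ennreal" where
  "fn_norm X \<Omega> u = X (\<lambda>s. rearr \<Omega> (\<lambda>x. ennreal \<bar>u x\<bar>) (measure lebesgue \<Omega> * s))"

definition fn_space ::
  "((real \<Rightarrow> ennreal) \<Rightarrow> ennreal) \<Rightarrow> 'a::euclidean_space set \<Rightarrow> ('a \<Rightarrow> real) set" where
  "fn_space X \<Omega> = {u. u \<in> borel_measurable (lebesgue_on \<Omega>) \<and> fn_norm X \<Omega> u < \<infinity>}"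

section \<open>Weak derivatives and Sobolev spaces\<close>

definition partial_drv :: "'n::finite \<Rightarrow> (real^'n \<Rightarrow> real) \<Rightarrow> real^'n \<Rightarrow> real" where
  "partial_drv i f x = frechet_derivative f (at x) (axis i 1)"

text \<open>A partial derivative of order \<open>k\<close> is indexed by the list of its \<open>k\<close> directions.\<close>

primrec iter_partial :: "'n::finite list \<Rightarrow> (real^'n \<Rightarrow> real) \<Rightarrow> real^'n \<Rightarrow> real" where
  "iter_partial [] f = f"
| "iter_partial (i # js) f = partial_drv i (iter_partial js f)"

text \<open>
  Infinitely differentiable with compact support in \<open>\<Omega>\<close>. Differentiability of every iterated partial
  derivative also gives continuity of all of them.
\<close>

definition test_function :: "(real^'n::finite) set \<Rightarrow> (real^'n \<Rightarrow> real) \<Rightarrow> bool" where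
  "test_function \<Omega> \<phi> \<longleftrightarrow>
     (\<forall>js x. iter_partial js \<phi> differentiable (at x)) \<and>
     compact (closure {x. \<phi> x \<noteq> 0}) \<and> closure {x. \<phi> x \<noteq> 0} \<subseteq> \<Omega>"

definition locally_integrable :: "(real^'n::finite) set \<Rightarrow> (real^'n \<Rightarrow> real) \<Rightarrow> bool" where
  "locally_integrable \<Omega> u \<longleftrightarrow> (\<forall>K. compact K \<and> K \<subseteq> \<Omega> \<longrightarrow> u absolutely_integrable_on K)"

definition has_weak_derivative ::
  "(real^'n::finite) set \<Rightarrow> 'n list \<Rightarrow> (real^'n \<Rightarrow> real) \<Rightarrow> (real^'n \<Rightarrow> real) \<Rightarrow> bool" where
  "has_weak_derivative \<Omega> js u v \<longleftrightarrow>
     locally_integrable \<Omega> u \<and> locally_integrable \<Omega> v \<and>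
     (\<forall>\<phi>. test_function \<Omega> \<phi> \<longrightarrow>
        (LINT x:\<Omega>|lebesgue. u x * iter_partial js \<phi> x) =
        (-1) ^ length js * (LINT x:\<Omega>|lebesgue. v x * \<phi> x))"

definition weakly_differentiable ::
  "nat \<Rightarrow> (real^'n::finite) set \<Rightarrow> (real^'n \<Rightarrow> real) \<Rightarrow> bool" where
  "weakly_differentiable m \<Omega> u \<longleftrightarrow>
     (\<forall>js. length js \<le> m \<longrightarrow> (\<exists>v. has_weak_derivative \<Omega> js u v))"

text \<open>
  Weak derivatives are unique up to null sets, which rearrangements do not see, so the choice of
  representative is immaterial.
\<close>

definition weak_derivative ::
  "(real^'n::finite) set \<Rightarrow> 'n list \<Rightarrow> (real^'n \<Rightarrow> real) \<Rightarrow> real^'n \<Rightarrow> real" where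
  "weak_derivative \<Omega> js u = (SOME v. has_weak_derivative \<Omega> js u v)"

definition weak_grad_norm ::
  "(real^'n::finite) set \<Rightarrow> nat \<Rightarrow> (real^'n \<Rightarrow> real) \<Rightarrow> real^'n \<Rightarrow> real" where
  "weak_grad_norm \<Omega> k u x = sqrt (\<Sum>js | length js = k. (weak_derivative \<Omega> js u x)\<^sup>2)"

definition sobolev_space ::
  "nat \<Rightarrow> ((real \<Rightarrow> ennreal) \<Rightarrow> ennreal) \<Rightarrow> (real^'n::finite) set \<Rightarrow> (real^'n \<Rightarrow> real) set" where
  "sobolev_space m X \<Omega> =
     {u. weakly_differentiable m \<Omega> u \<and> (\<forall>k\<le>m. weak_grad_norm \<Omega> k u \<in> fn_space X \<Omega>)}"

definition sobolev_norm ::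
  "nat \<Rightarrow> ((real \<Rightarrow> ennreal) \<Rightarrow> ennreal) \<Rightarrow> (real^'n::finite) set \<Rightarrow> (real^'n \<Rightarrow> real) \<Rightarrow> ennreal" where
  "sobolev_norm m X \<Omega> u = (\<Sum>k\<le>m. fn_norm X \<Omega> (weak_grad_norm \<Omega> k u))"

section \<open>Embedding into bounded continuous functions\<close>

definition Cb_space :: "(real^'n::finite) set \<Rightarrow> (real^'n \<Rightarrow> real) set" where
  "Cb_space \<Omega> = {g. continuous_on \<Omega> g \<and> bounded (g ` \<Omega>)}"

definition Cb_norm :: "(real^'n::finite) set \<Rightarrow> (real^'n \<Rightarrow> real) \<Rightarrow> real" where
  "Cb_norm \<Omega> g = (SUP x\<in>\<Omega>. \<bar>g x\<bar>)"

definition sobolev_embeds_Cb ::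
  "nat \<Rightarrow> ((real \<Rightarrow> ennreal) \<Rightarrow> ennreal) \<Rightarrow> (real^'n::finite) set \<Rightarrow> bool" where
  "sobolev_embeds_Cb m X \<Omega> \<longleftrightarrow>
     (\<exists>C::real. \<forall>u\<in>sobolev_space m X \<Omega>. \<exists>g\<in>Cb_space \<Omega>.
        (AE x in lebesgue_on \<Omega>. g x = u x) \<and>
        ennreal (Cb_norm \<Omega> g) \<le> ennreal C * sobolev_norm m X \<Omega> u)"

section \<open>Jones domains\<close>

definition curve_length :: "(real \<Rightarrow> 'a::metric_space) \<Rightarrow> ennreal" where
  "curve_length \<gamma> =
     (SUP ts\<in>{ts. sorted ts \<and> set ts \<subseteq> {0..1}}.
        \<Sum>i<length ts - 1. ennreal (dist (\<gamma> (ts ! i)) (\<gamma> (ts ! Suc i))))"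

definition is_domain :: "'a::topological_space set \<Rightarrow> bool" where
  "is_domain \<Omega> \<longleftrightarrow> open \<Omega> \<and> connected \<Omega> \<and> \<Omega> \<noteq> {}"

text \<open>
  The points \<open>x\<close> and \<open>y\<close> are distinct, since otherwise the quotient is meaningless and there is no
  arc from \<open>x\<close> to \<open>y\<close>. The library has \<^term>\<open>infdist z {} = 0\<close>, whereas here the distance to an empty
  boundary is infinite. The length bound forces the arc to be rectifiable.
\<close>

definition jones_domain :: "'a::euclidean_space set \<Rightarrow> bool" where
  "jones_domain \<Omega> \<longleftrightarrow> is_domain \<Omega> \<and>
     (\<exists>\<epsilon>::real. \<exists>\<delta>::ennreal. 0 < \<epsilon> \<and> \<epsilon> < 1 \<and> 1 < \<delta> \<and>
       (\<forall>x\<in>\<Omega>. \<forall>y\<in>\<Omega>. x \<noteq> y \<and> ennreal (dist x y) < \<delta> \<longrightarrow>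
         (\<exists>\<gamma>. arc \<gamma> \<and> path_image \<gamma> \<subseteq> \<Omega> \<and> pathstart \<gamma> = x \<and> pathfinish \<gamma> = y \<and>
              curve_length \<gamma> \<le> ennreal (dist x y / \<epsilon>) \<and>
              (\<forall>z\<in>path_image \<gamma>. frontier \<Omega> = {} \<or>
                 infdist z (frontier \<Omega>) \<ge> \<epsilon> * (dist x z * dist y z / dist x y)))))"

end

(*
  Sufficiency. Two points of a Jones domain are joined by a chain of cubes whose sizes are comparable
  to the distances to the two points. Along a segment of cubes the average of a function moves, by the
  continuity equation, by at most the length of the segment times the average of the gradient. Applying
  this to the derivatives of all orders and summing along the chain bounds u and its oscillation by the
  integrals of s^(m/n - 1) |D^j u|^*(s) over (0, |Omega|), and Hoelder's inequality bounds these by the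
  Lorentz--Zygmund norms.

  Necessity. Near an interior point let u be the sum of a_k b(2^k x) for k at most J, where b is a
  bump function and 1 / a_k = k log k log log k up to constants, so that u is unbounded at the point
  as J grows. The derivatives of order at most m have rearrangements bounded by
  s^(-m/n) / (l log l log log l), l = log (1/s), uniformly in J, and this function has finite norm in
  all the remaining cases.
*)

theory Submission
  imports Defs
begin


section \<open>Smooth functions\<close>

text \<open>The obstacle in the sufficiency part is that nothing is available pointwise: u is only
  weakly differentiable and the norm sees it only through rearrangements. Moving a cube together
  with a smooth weight makes each comparison of two averages one application of the definition of
  weak derivative. A weight close to the sign of the function turns this into bounds for averages of
  absolute values, which can be iterated through the orders. A cube of side r has averages at most
  r^(-n) times the integral of the rearrangement over (0, r^n), and each order integrated brings one
  factor r per dyadic scale; summing r^(m-n) over the scales above s^(1/n) yields s^(m/n-1). The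
  third logarithm in the amplitudes is forced by the endpoint \<alpha> = \<beta> = 1/q' with 1 < q <
  \<infinity>, where two logarithms just fail to give a finite norm. With a third one, exponent 1
  still makes the sum of the amplitudes diverge, while the q-th power inside the norm raises the
  exponent above 1 and gives convergence. In (B) there is no endpoint: m < n leaves a positive power
  of s that absorbs every logarithm.\<close>

definition smooth :: "(real^'n::finite \<Rightarrow> real) \<Rightarrow> bool" where
  "smooth f \<longleftrightarrow> (\<forall>js x. iter_partial js f differentiable (at x))"

text \<open>Smoothness quantifies over all iterated partial derivatives. A class of differentiable
  functions closed under \<open>partial_drv\<close> settles all orders at once, without formulas for
  higher derivatives.\<close>

lemma smooth_coinduct:
  assumes "f \<in> S"
    and "\<And>f x. f \<in> S \<Longrightarrow> f differentiable (at x)"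
    and "\<And>f i. f \<in> S \<Longrightarrow> partial_drv i f \<in> S"
  shows "smooth f"
proof -
  have "iter_partial js f \<in> S" for js
    by (induction js) (use assms in auto)
  then show ?thesis
    using assms(2) by (auto simp: smooth_def)
qed

lemma partial_drv_eq:
  assumes "(f has_derivative f') (at x)"
  shows "partial_drv i f x = f' (axis i 1)"
  using frechet_derivative_at[OF assms] by (simp add: partial_drv_def)

lemma iter_partial_append: "iter_partial (js @ ks) f = iter_partial js (iter_partial ks f)"
  by (induction js) auto

lemma smooth_iter_partial: "smooth f \<Longrightarrow> smooth (iter_partial ks f)"
  by (simp add: smooth_def flip: iter_partial_append)

lemma smooth_partial_drv: "smooth f \<Longrightarrow> smooth (partial_drv i f)"
  using smooth_iter_partial[of f "[i]"] by simp

lemma smooth_differentiable: "smooth f \<Longrightarrow> f differentiable (at x)"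
  unfolding smooth_def by (metis iter_partial.simps(1))

lemma smooth_continuous_on: "smooth f \<Longrightarrow> continuous_on S f"
  by (meson continuous_at_imp_continuous_on differentiable_imp_continuous_within smooth_differentiable)

lemma smooth_has_derivative:
  assumes "smooth f"
  shows "(f has_derivative (\<lambda>h. \<Sum>i\<in>UNIV. h $ i * partial_drv i f x)) (at x)"
proof -
  obtain f' where f': "(f has_derivative f') (at x)"
    using smooth_differentiable[OF assms] by (auto simp: differentiable_def)
  interpret bounded_linear f' using f' by (rule has_derivative_bounded_linear)
  have "f' h = (\<Sum>i\<in>UNIV. h $ i * partial_drv i f x)" for h
  proof -
    have "f' h = f' (\<Sum>i\<in>UNIV. h $ i *\<^sub>R axis i 1)"
      using basis_expansion[of h] by (simp add: scalar_mult_eq_scaleR)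
    also have "\<dots> = (\<Sum>i\<in>UNIV. h $ i * partial_drv i f x)"
      by (simp add: sum scaleR partial_drv_eq[OF f'])
    finally show ?thesis .
  qed
  then have "f' = (\<lambda>h. \<Sum>i\<in>UNIV. h $ i * partial_drv i f x)" by auto
  with f' show ?thesis by simp
qed

lemma smooth_const: "smooth (\<lambda>x. c)"
proof (rule smooth_coinduct[of _ "range (\<lambda>c x. c)"])
  show "partial_drv i f \<in> range (\<lambda>c x. c)" if f: "f \<in> range (\<lambda>c x. c)" for i and f :: "real^'n \<Rightarrow> real"
  proof -
    obtain c where c: "f = (\<lambda>x. c)" using f by auto
    have "partial_drv i f x = 0" for x
      unfolding c by (rule partial_drv_eq[where f' = "\<lambda>h. 0"]) (auto intro: derivative_eq_intros)
    then show ?thesis by (auto simp: image_def)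
  qed
qed auto

lemma partial_drv_add:
  assumes "smooth f" "smooth g"
  shows "partial_drv i (\<lambda>x. f x + g x) x = partial_drv i f x + partial_drv i g x"
  by (subst partial_drv_eq[OF has_derivative_add[OF smooth_has_derivative[OF assms(1)] smooth_has_derivative[OF assms(2)]]])
     (simp add: axis_def if_distrib if_distribR sum.delta' cong: if_cong)

lemma partial_drv_mult:
  assumes "smooth f" "smooth g"
  shows "partial_drv i (\<lambda>x. f x * g x) x = f x * partial_drv i g x + partial_drv i f x * g x"
  by (subst partial_drv_eq[OF has_derivative_mult[OF smooth_has_derivative[OF assms(1)] smooth_has_derivative[OF assms(2)]]])
     (simp add: axis_def if_distrib if_distribR sum.delta' cong: if_cong)

lemma smooth_add:
  fixes f g :: "real^'n::finite \<Rightarrow> real"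
  assumes "smooth f" "smooth g"
  shows "smooth (\<lambda>x. f x + g x)"
proof (rule smooth_coinduct[of _ "{\<lambda>x. f x + g x |f g. smooth f \<and> smooth g}"])
  fix h :: "real^'n \<Rightarrow> real" and i x
  assume "h \<in> {\<lambda>x. f x + g x |f g. smooth f \<and> smooth g}"
  then obtain f g where h: "h = (\<lambda>x. f x + g x)" "smooth f" "smooth g" by auto
  show "h differentiable (at x)"
    unfolding h(1) using h by (intro differentiable_add smooth_differentiable) auto
  have "partial_drv i h = (\<lambda>x. partial_drv i f x + partial_drv i g x)"
    unfolding h(1) using h by (auto simp: partial_drv_add)
  then show "partial_drv i h \<in> {\<lambda>x. f x + g x |f g. smooth f \<and> smooth g}"
    using h smooth_partial_drv by blast
qed (use assms in auto)

text \<open>Products alone are not closed under differentiation, but by the Leibniz rule finite sums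
  of products are; this class is the invariant for \<open>smooth_mult\<close>.\<close>

inductive_set prod_sums :: "(real^'n::finite \<Rightarrow> real) set" where
  mult: "smooth f \<Longrightarrow> smooth g \<Longrightarrow> (\<lambda>x. f x * g x) \<in> prod_sums"
| add: "f \<in> prod_sums \<Longrightarrow> g \<in> prod_sums \<Longrightarrow> (\<lambda>x. f x + g x) \<in> prod_sums"

lemma smooth_mult:
  fixes f g :: "real^'n::finite \<Rightarrow> real"
  assumes "smooth f" "smooth g"
  shows "smooth (\<lambda>x. f x * g x)"
proof (rule smooth_coinduct[of _ prod_sums])
  have *: "(\<forall>x. h differentiable (at x)) \<and> partial_drv i h \<in> prod_sums"
    if "h \<in> prod_sums" for h i
    using that
  proof induction
    case (mult f g)
    have "partial_drv i (\<lambda>x. f x * g x) = (\<lambda>x. f x * partial_drv i g x + partial_drv i f x * g x)"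
      using mult by (auto simp: partial_drv_mult)
    moreover have "(\<lambda>x. f x * g x) differentiable (at x)" for x
      using mult[THEN smooth_differentiable] by (rule differentiable_mult)
    moreover have "(\<lambda>x. f x * partial_drv i g x + partial_drv i f x * g x) \<in> prod_sums"
      by (rule prod_sums.add[OF prod_sums.mult prod_sums.mult, OF mult(1) smooth_partial_drv[OF mult(2)]
            smooth_partial_drv[OF mult(1)] mult(2)])
    ultimately show ?case by simp
  next
    case (add f g)
    have "partial_drv i (\<lambda>x. f x + g x) x = partial_drv i f x + partial_drv i g x" for x
    proof -
      have "f differentiable (at x)" "g differentiable (at x)"
        using add.IH by simp_all
      then obtain f' g' where d: "(f has_derivative f') (at x)" "(g has_derivative g') (at x)"
        unfolding differentiable_def by blast
      then show ?thesis
        by (simp add: partial_drv_eq[OF d(1)] partial_drv_eq[OF d(2)] partial_drv_eq[OF has_derivative_add[OF d]])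
    qed
    then have "partial_drv i (\<lambda>x. f x + g x) = (\<lambda>x. partial_drv i f x + partial_drv i g x)"
      by auto
    moreover have "(\<lambda>x. f x + g x) differentiable (at x)" for x
      by (rule differentiable_add) (simp_all add: add.IH)
    moreover have "(\<lambda>x. partial_drv i f x + partial_drv i g x) \<in> prod_sums"
      by (rule prod_sums.add) (simp_all add: add.IH)
    ultimately show ?case by simp
  qed
  show "\<And>h x. h \<in> prod_sums \<Longrightarrow> h differentiable (at x)" using * by (rule conjunct1[THEN spec])
  show "\<And>h i. h \<in> prod_sums \<Longrightarrow> partial_drv i h \<in> prod_sums" using * by (rule conjunct2)
qed (rule prod_sums.mult[OF assms])

lemma smooth_cmult: "smooth f \<Longrightarrow> smooth (\<lambda>x. c * f x)"
  by (intro smooth_mult smooth_const)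

lemma smooth_diff: "smooth f \<Longrightarrow> smooth g \<Longrightarrow> smooth (\<lambda>x. f x - g x)"
  using smooth_add[OF _ smooth_cmult[of g "-1"], of f] by simp

lemma smooth_sum: "(\<And>a. a \<in> A \<Longrightarrow> smooth (f a)) \<Longrightarrow> smooth (\<lambda>x. \<Sum>a\<in>A. f a x)"
  by (induction A rule: infinite_finite_induct) (auto intro: smooth_const smooth_add)

lemma smooth_prod: "(\<And>a. a \<in> A \<Longrightarrow> smooth (f a)) \<Longrightarrow> smooth (\<lambda>x. \<Prod>a\<in>A. f a x)"
  by (induction A rule: infinite_finite_induct) (auto intro: smooth_const smooth_mult)

lemma smooth_power: "smooth f \<Longrightarrow> smooth (\<lambda>x. f x ^ k)"
  by (induction k) (auto intro: smooth_const smooth_mult)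

lemma partial_drv_cmult: "smooth f \<Longrightarrow> partial_drv i (\<lambda>x. c * f x) x = c * partial_drv i f x"
  by (subst partial_drv_mult[OF smooth_const])
     (auto simp: partial_drv_eq[where f' = "\<lambda>h. 0" and f = "\<lambda>x. c"])

lemma smooth_affine_has_derivative:
  assumes "smooth f"
  shows "((\<lambda>x. f (a + r *\<^sub>R x)) has_derivative
    (\<lambda>h. \<Sum>i\<in>UNIV. (r * h $ i) * partial_drv i f (a + r *\<^sub>R x))) (at x)"
proof -
  have "((\<lambda>x. a + r *\<^sub>R x) has_derivative (\<lambda>h. r *\<^sub>R h)) (at x)"
    by (auto intro!: derivative_eq_intros)
  from diff_chain_at[OF this smooth_has_derivative[OF assms]]
  show ?thesis by (simp add: o_def)
qed

lemma partial_drv_affine: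
  assumes "smooth f"
  shows "partial_drv i (\<lambda>x. f (a + r *\<^sub>R x)) x = r * partial_drv i f (a + r *\<^sub>R x)"
  by (subst partial_drv_eq[OF smooth_affine_has_derivative[OF assms]])
     (simp add: axis_def if_distrib if_distribR sum.delta' cong: if_cong)

lemma smooth_affine:
  fixes f :: "real^'n::finite \<Rightarrow> real"
  assumes "smooth f"
  shows "smooth (\<lambda>x. f (a + r *\<^sub>R x))"
proof -
  \<comment> \<open>The scalar \<open>k\<close> absorbs the factor \<open>r\<close> that each use of
    the chain rule brings out, which keeps the class closed under partial derivatives.\<close>
  let ?S = "{\<lambda>x. k * f (a + r *\<^sub>R x) |k f. smooth f}"
  have "smooth (\<lambda>x. 1 * f (a + r *\<^sub>R x))"
  proof (rule smooth_coinduct[of _ ?S])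
    fix h :: "real^'n \<Rightarrow> real" and i x
    assume "h \<in> ?S"
    then obtain f k where h: "h = (\<lambda>x. k * f (a + r *\<^sub>R x))" "smooth f" by auto
    have d: "(h has_derivative (\<lambda>h. k * (\<Sum>i\<in>UNIV. (r * h $ i) * partial_drv i f (a + r *\<^sub>R x)))) (at x)" for x
      unfolding h(1) by (intro has_derivative_mult_right smooth_affine_has_derivative h)
    then show "h differentiable (at x)" by (auto simp: differentiable_def)
    have "partial_drv i h = (\<lambda>x. (k * r) * partial_drv i f (a + r *\<^sub>R x))"
      by (intro ext, subst partial_drv_eq[OF d])
         (simp add: axis_def if_distrib if_distribR sum.delta' cong: if_cong)
    then show "partial_drv i h \<in> ?S" using smooth_partial_drv[OF h(2)] by blast
  qed (use assms in blast)
  then show ?thesis by simp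
qed

lemma smooth_coord: "smooth (\<lambda>x::real^'n::finite. x $ i)"
proof (rule smooth_coinduct[of _ "insert (\<lambda>x. x $ i) (range (\<lambda>c x. c))"])
  fix f :: "real^'n \<Rightarrow> real" and j x
  assume "f \<in> insert (\<lambda>x. x $ i) (range (\<lambda>c x. c))"
  then consider "f = (\<lambda>x. x $ i)" | c where "f = (\<lambda>x. c)" by auto
  then have "\<exists>d. (\<forall>x. (f has_derivative d) (at x))"
  proof cases
    case 1
    then show ?thesis using bounded_linear_imp_has_derivative[OF bounded_linear_vec_nth] by blast
  next
    case 2
    then show ?thesis by (metis has_derivative_const)
  qed
  then obtain d where d: "\<And>x. (f has_derivative d) (at x)" by auto
  then show "f differentiable (at x)" by (auto simp: differentiable_def)
  show "partial_drv j f \<in> insert (\<lambda>x. x $ i) (range (\<lambda>c x. c))"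
    using partial_drv_eq[OF d, of j] by auto
qed auto

text \<open>The peak functions below are superpositions of rescaled copies of one bump; each
  derivative brings out one more factor \<open>r k\<close>. For infinite \<open>K\<close> all the
  sums are 0 by convention.\<close>

lemma iter_partial_affine_sum:
  fixes f :: "real^'n::finite \<Rightarrow> real"
  assumes "smooth f"
  shows "iter_partial js (\<lambda>x. \<Sum>k\<in>K. c k * f (a k + r k *\<^sub>R x)) =
    (\<lambda>x. \<Sum>k\<in>K. c k * r k ^ length js * iter_partial js f (a k + r k *\<^sub>R x))"
proof (cases "finite K")
  case True
  show ?thesis
  proof (induction js)
    case (Cons i js)
    let ?g = "iter_partial js f"
    have g: "smooth ?g" using assms by (rule smooth_iter_partial)
    have sm: "smooth (\<lambda>x. c k * r k ^ length js * ?g (a k + r k *\<^sub>R x))" for k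
      by (intro smooth_cmult smooth_affine g)
    have "partial_drv i (\<lambda>x. \<Sum>k\<in>K. c k * r k ^ length js * ?g (a k + r k *\<^sub>R x)) x =
      (\<Sum>k\<in>K. c k * r k ^ length js * (r k * partial_drv i ?g (a k + r k *\<^sub>R x)))" for x
      using True
    proof (induction K)
      case empty
      then show ?case by (simp add: partial_drv_eq[where f' = "\<lambda>h. 0"])
    next
      case (insert k K)
      then show ?case
        by (simp add: partial_drv_add[OF sm smooth_sum[OF sm]] partial_drv_cmult smooth_affine g
            partial_drv_affine)
    qed
    then show ?case by (simp add: Cons.IH mult_ac)
  qed simp
next
  case False
  have "iter_partial js (\<lambda>x. 0) = (\<lambda>x::real^'n. 0)"
    by (induction js) (auto simp: partial_drv_eq[where f' = "\<lambda>h. 0"])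
  then show ?thesis using False by simp
qed

lemma iter_partial_eq_0:
  fixes f :: "real^'n::finite \<Rightarrow> real"
  assumes "open S" "\<And>x. x \<in> S \<Longrightarrow> f x = 0" "x \<in> S"
  shows "iter_partial js f x = 0"
  using assms(3)
proof (induction js arbitrary: x)
  case (Cons i js)
  have "((\<lambda>x. 0) has_derivative (\<lambda>h. 0)) (at x)" by simp
  then have "(iter_partial js f has_derivative (\<lambda>h. 0)) (at x)"
    by (rule has_derivative_transform_within_open[OF _ assms(1) Cons.prems]) (use Cons.IH in auto)
  then show ?case by (simp add: partial_drv_eq)
qed (use assms in auto)

subsection \<open>A bump function\<close>

text \<open>The polynomial in 1/t is carried along because the derivative of p(1/t) exp(-1/t) is
  again of this form, with x^2 (p - p') in place of p. The family is thus closed under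
  differentiation; p = 1 gives the classical function exp(-1/t).\<close>

definition expinv :: "real poly \<Rightarrow> real \<Rightarrow> real" where
  "expinv p t = (if t > 0 then poly p (1/t) * exp (- (1/t)) else 0)"

lemma tendsto_poly_mult_exp_minus: "((\<lambda>x. poly p x * exp (- x)) \<longlongrightarrow> (0::real)) at_top"
proof -
  have "((\<lambda>x. \<Sum>i\<le>degree p. coeff p i * (x ^ i / exp x)) \<longlongrightarrow> (\<Sum>i\<le>degree p. coeff p i * 0)) at_top"
    by (intro tendsto_sum tendsto_mult tendsto_const tendsto_power_div_exp_0)
  moreover have "(\<lambda>x. \<Sum>i\<le>degree p. coeff p i * (x ^ i / exp x)) = (\<lambda>x. poly p x * exp (- x))"
    by (simp add: poly_altdef sum_distrib_right exp_minus field_simps sum_divide_distrib)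
  ultimately show ?thesis by simp
qed

lemma expinv_has_derivative:
  "(expinv p has_real_derivative expinv ([:0, 0, 1:] * (p - pderiv p)) t) (at t)"
proof -
  consider "t > 0" | "t < 0" | "t = 0" by linarith
  then show ?thesis
  proof cases
    case 1
    have "((\<lambda>t. poly p (1/t) * exp (- (1/t))) has_real_derivative
       expinv ([:0, 0, 1:] * (p - pderiv p)) t) (at t)"
      using 1 by (auto intro!: derivative_eq_intros DERIV_chain2[OF poly_DERIV]
          simp: expinv_def field_simps power2_eq_square)
    then show ?thesis
      by (rule has_field_derivative_transform_within_open[of _ _ _ "{0<..}"])
         (use 1 in \<open>auto simp: expinv_def\<close>)
  next
    case 2
    have "((\<lambda>t. 0) has_real_derivative expinv ([:0, 0, 1:] * (p - pderiv p)) t) (at t)"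
      using 2 by (auto simp: expinv_def)
    then show ?thesis
      by (rule has_field_derivative_transform_within_open[of _ _ _ "{..<0}"])
         (use 2 in \<open>auto simp: expinv_def\<close>)
  next
    case 3
    \<comment> \<open>From the right the difference quotient at 0 is (1/h) p(1/h) exp(-1/h);
      \<open>pCons 0 p\<close> accounts for the extra factor 1/h. From the left it vanishes.\<close>
    have "((\<lambda>x. poly (pCons 0 p) x * exp (- x)) \<longlongrightarrow> 0) at_top"
      by (rule tendsto_poly_mult_exp_minus)
    then have "((\<lambda>h. poly (pCons 0 p) (inverse h) * exp (- inverse h)) \<longlongrightarrow> 0) (at_right 0)"
      by (rule filterlim_compose[OF _ filterlim_inverse_at_top_right])
    then have "((\<lambda>h. expinv p h / h) \<longlongrightarrow> 0) (at_right 0)"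
      by (rule Lim_transform_eventually)
         (auto simp: eventually_at_filter expinv_def field_simps)
    moreover have "((\<lambda>h. expinv p h / h) \<longlongrightarrow> 0) (at_left 0)"
      by (rule Lim_transform_eventually[OF tendsto_const])
         (auto simp: eventually_at_filter expinv_def)
    ultimately have "((\<lambda>h. expinv p h / h) \<longlongrightarrow> 0) (at 0)"
      by (simp add: filterlim_split_at)
    then show ?thesis
      using 3 by (simp add: DERIV_def expinv_def)
  qed
qed

lemma smooth_expinv_coord: "smooth (\<lambda>x::real^'n::finite. expinv p (x $ i))"
proof -
  let ?S = "insert (\<lambda>x. 0) (range (\<lambda>p x. expinv p (x $ i)))"
  show ?thesis
  proof (rule smooth_coinduct[of _ ?S])
    fix f :: "real^'n \<Rightarrow> real" and j x
    assume "f \<in> ?S"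
    then consider "f = (\<lambda>x. 0)" | p where "f = (\<lambda>x. expinv p (x $ i))" by auto
    then have "(\<forall>x. f differentiable (at x)) \<and> partial_drv j f \<in> ?S"
    proof cases
      case 1
      then show ?thesis by (auto simp: partial_drv_eq[where f' = "\<lambda>h. 0"])
    next
      case 2
      let ?p = "[:0, 0, 1:] * (p - pderiv p)"
      have d: "(f has_derivative (\<lambda>h. expinv ?p (x $ i) * (h $ i))) (at x)" for x
        unfolding 2
        using diff_chain_at[OF bounded_linear_imp_has_derivative[OF bounded_linear_vec_nth]
          expinv_has_derivative[unfolded has_field_derivative_def]]
        by (simp add: o_def)
      have "partial_drv j f = (if j = i then (\<lambda>x. expinv ?p (x $ i)) else (\<lambda>x. 0))"
        by (auto simp: partial_drv_eq[OF d] axis_def)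
      with d show ?thesis by (auto simp: differentiable_def)
    qed
    then show "f differentiable (at x)" "partial_drv j f \<in> ?S" by auto
  qed auto
qed

text \<open>A product over the coordinates is positive exactly on the open unit cube, so that its
  rescaled copies fit the cubes used throughout.\<close>

definition bump :: "real^'n::finite \<Rightarrow> real" where
  "bump x = (\<Prod>i\<in>UNIV. expinv 1 (x $ i) * expinv 1 (1 - x $ i))"

lemma sum_Basis_nth [simp]: "(\<Sum>b\<in>Basis. (b :: real^'n::finite) $ i) = 1"
proof -
  have "(\<Sum>b\<in>Basis. b :: real^'n) $ i = 1" by (simp only: cart_eq_inner_axis) simp
  then show ?thesis by simp
qed

lemma smooth_bump: "smooth (bump :: real^'n::finite \<Rightarrow> real)"
proof -
  have "smooth (\<lambda>x::real^'n. expinv 1 ((One + (-1) *\<^sub>R x) $ i))" for i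
    by (rule smooth_affine[OF smooth_expinv_coord])
  moreover have "((One::real^'n) + (-1) *\<^sub>R x) $ i = 1 - x $ i" for x i
    by simp
  ultimately show ?thesis
    unfolding bump_def by (intro smooth_prod smooth_mult smooth_expinv_coord) auto
qed

lemma expinv_1: "0 \<le> expinv 1 t" "expinv 1 t \<le> 1" "expinv 1 t > 0 \<longleftrightarrow> t > 0" "t \<le> 0 \<Longrightarrow> expinv 1 t = 0"
  by (auto simp: expinv_def)

lemma bump_nonneg: "0 \<le> bump x"
  unfolding bump_def by (intro prod_nonneg mult_nonneg_nonneg ballI) (auto simp: expinv_1)

lemma bump_le_1: "bump x \<le> 1"
  unfolding bump_def by (intro prod_le_1 conjI mult_nonneg_nonneg mult_le_one) (auto simp: expinv_1)

lemma bump_pos: "bump x > 0 \<longleftrightarrow> x \<in> box 0 (One :: real^'n::finite)"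
proof -
  have "bump x > 0 \<longleftrightarrow> (\<forall>i. expinv 1 (x $ i) * expinv 1 (1 - x $ i) \<noteq> 0)"
    using bump_nonneg[of x] by (auto simp: bump_def less_le)
  also have "\<dots> \<longleftrightarrow> x \<in> box 0 One"
    using expinv_1(3,1) by (auto simp: mem_box_cart less_le)
  finally show ?thesis .
qed

lemma bump_eq_0: "x \<notin> box 0 (One :: real^'n::finite) \<Longrightarrow> bump x = 0"
  using bump_nonneg[of x] bump_pos[of x] by linarith


section \<open>Cubes, smooth approximation and weak derivatives\<close>

text \<open>The parameter \<open>c\<close> is the lower corner, not the centre. Cubes with a common
  corner are nested, \<open>(y - c) / r\<close> maps the cube onto \<open>cube 0 1\<close>, and
  shrinking to the corner is the form of Lebesgue differentiation used later.\<close>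

definition cube :: "real^'n::finite \<Rightarrow> real \<Rightarrow> (real^'n) set" where
  "cube c r = cbox c (c + r *\<^sub>R One)"

lemma mem_cube: "y \<in> cube c r \<longleftrightarrow> (\<forall>i. c $ i \<le> y $ i \<and> y $ i \<le> c $ i + r)"
  by (simp add: cube_def mem_box_cart)

lemma compact_cube [simp]: "compact (cube c r)"
  by (simp add: cube_def)

lemma closed_cube [simp]: "closed (cube c r)"
  by (simp add: compact_imp_closed)

lemma cube_sets [simp]: "cube c r \<in> sets lebesgue"
  by (simp add: cube_def)

lemma mem_cube_affine:
  assumes "r > 0"
  shows "(1/r) *\<^sub>R (y - c) \<in> cube 0 1 \<longleftrightarrow> y \<in> cube c r"
  using assms by (auto simp: mem_cube field_simps)

lemma measure_cube:
  assumes "r \<ge> 0"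
  shows "measure lebesgue (cube (c :: real^'n::finite) r) = r ^ CARD('n)"
proof -
  have "c \<in> cube c r" using assms by (simp add: mem_cube)
  then have "cube c r \<noteq> {}" by blast
  then show ?thesis
    unfolding cube_def by (subst measure_completion) (simp_all add: content_cbox_cart)
qed

lemma emeasure_cube:
  assumes "r \<ge> 0"
  shows "emeasure lebesgue (cube (c :: real^'n::finite) r) = ennreal (r ^ CARD('n))"
  using measure_cube[OF assms, of c]
  by (metis compact_cube emeasure_eq_ennreal_measure lmeasurable_compact fmeasurableD2)

lemma cube_subset_cball:
  fixes c :: "real^'n::finite" and r :: real
  assumes "0 \<le> r"
  shows "cube c r \<subseteq> cball c (CARD('n) * r)"
proof
  fix y assume y: "y \<in> cube c r"
  have "norm (y - c) \<le> (\<Sum>i\<in>UNIV. \<bar>(y - c) $ i\<bar>)"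
    by (rule norm_le_l1_cart)
  also have "\<dots> \<le> (\<Sum>i\<in>(UNIV :: 'n set). r)"
  proof (rule sum_mono)
    fix i show "\<bar>(y - c) $ i\<bar> \<le> r"
      using y[unfolded mem_cube, rule_format, of i] assms by (simp add: abs_le_iff)
  qed
  finally show "y \<in> cball c (CARD('n) * r)"
    by (simp add: dist_norm norm_minus_commute)
qed

lemma test_functionI:
  assumes "smooth \<phi>" "compact K" "K \<subseteq> \<Omega>" "\<And>x. x \<notin> K \<Longrightarrow> \<phi> x = 0"
  shows "test_function \<Omega> \<phi>"
proof -
  have "closure {x. \<phi> x \<noteq> 0} \<subseteq> K"
    using assms by (intro closure_minimal) (auto dest: compact_imp_closed)
  moreover have "compact (closure {x. \<phi> x \<noteq> 0})"
    using calculation assms(2) by (metis closed_closure compact_Int_closed inf.absorb_iff2)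
  ultimately show ?thesis
    using assms by (auto simp: test_function_def smooth_def)
qed

lemma test_functionD:
  assumes "test_function \<Omega> \<phi>"
  obtains K where "smooth \<phi>" "compact K" "K \<subseteq> \<Omega>" "\<And>x. x \<notin> K \<Longrightarrow> \<phi> x = 0"
  using assms closure_subset[of "{x. \<phi> x \<noteq> 0}"]
  by (auto simp: test_function_def smooth_def intro!: that[of "closure {x. \<phi> x \<noteq> 0}"])

lemma real_polynomial_function_smooth:
  "real_polynomial_function p \<Longrightarrow> smooth (p :: real^'n::finite \<Rightarrow> real)"
proof (induction rule: real_polynomial_function.induct)
  case (linear f)
  then interpret bounded_linear f .
  have "f x = (\<Sum>i\<in>UNIV. f (axis i 1) * x $ i)" for x
  proof -
    have "f x = f (\<Sum>i\<in>UNIV. x $ i *\<^sub>R axis i 1)"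
      using basis_expansion[of x] by (simp add: scalar_mult_eq_scaleR)
    then show ?thesis by (simp add: sum scaleR mult.commute)
  qed
  then have *: "(\<lambda>x. \<Sum>i\<in>UNIV. f (axis i 1) * x $ i) = f" by (intro ext) (rule sym)
  have "smooth (\<lambda>x. \<Sum>i\<in>UNIV. f (axis i 1) * x $ i)"
    by (rule smooth_sum, rule smooth_cmult, rule smooth_coord)
  then show ?case unfolding * .
next
  case (const c)
  show ?case by (rule smooth_const)
next
  case (add f g)
  then show ?case by (intro smooth_add)
next
  case (mult f g)
  then show ?case by (intro smooth_mult)
qed

text \<open>The powers in \<open>1 - (1 - \<theta>) ^ k\<close> push the value to 1 wherever the
  bump \<theta> is positive and keep it 0 where \<theta> vanishes, so smooth functions reach the
  indicator of the open cube.\<close>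

lemma smooth_cutoff:
  fixes c :: "real^'n::finite"
  assumes r: "r > 0"
  obtains \<zeta> :: "nat \<Rightarrow> real^'n \<Rightarrow> real"
  where "\<And>k. smooth (\<zeta> k)" "\<And>k x. 0 \<le> \<zeta> k x" "\<And>k x. \<zeta> k x \<le> 1"
    "\<And>k x. x \<notin> cube c r \<Longrightarrow> \<zeta> k x = 0"
    "\<And>x. x \<in> box c (c + r *\<^sub>R One) \<Longrightarrow> (\<lambda>k. \<zeta> k x) \<longlonglongrightarrow> 1"
proof -
  define \<theta> where "\<theta> x = bump ((- (1/r) *\<^sub>R c) + (1/r) *\<^sub>R x)" for x
  have \<theta>_eq: "\<theta> x = bump ((1/r) *\<^sub>R (x - c))" for x
    by (simp add: \<theta>_def scaleR_diff_right)
  have "smooth \<theta>"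
    unfolding \<theta>_def by (rule smooth_affine[OF smooth_bump])
  have box: "(1/r) *\<^sub>R (x - c) \<in> box 0 One \<longleftrightarrow> x \<in> box c (c + r *\<^sub>R One)" for x
    using r by (auto simp: mem_box_cart field_simps)
  define \<zeta> where "\<zeta> k x = 1 - (1 - \<theta> x) ^ k" for k x
  have b: "0 \<le> 1 - \<theta> x" "1 - \<theta> x \<le> 1" for x
    by (auto simp: \<theta>_eq bump_nonneg bump_le_1)
  show ?thesis
  proof
    show "smooth (\<zeta> k)" for k
      unfolding \<zeta>_def by (intro smooth_diff smooth_const smooth_power \<open>smooth \<theta>\<close>)
    show "0 \<le> \<zeta> k x" "\<zeta> k x \<le> 1" for k x
      using b[of x] by (auto simp: \<zeta>_def power_le_one)
    show "\<zeta> k x = 0" if "x \<notin> cube c r" for k x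
    proof -
      have "x \<notin> box c (c + r *\<^sub>R One)" using that box_subset_cbox by (auto simp: cube_def)
      then show ?thesis by (simp add: \<zeta>_def \<theta>_eq bump_eq_0 box)
    qed
    show "(\<lambda>k. \<zeta> k x) \<longlonglongrightarrow> 1" if x: "x \<in> box c (c + r *\<^sub>R One)" for x
    proof -
      have "\<theta> x > 0" using x by (simp add: \<theta>_eq bump_pos box)
      then have "(\<lambda>k. (1 - \<theta> x) ^ k) \<longlonglongrightarrow> 0"
        using b[of x] by (intro LIMSEQ_realpow_zero) auto
      then have "(\<lambda>k. 1 - (1 - \<theta> x) ^ k) \<longlonglongrightarrow> 1 - 0"
        by (intro tendsto_diff tendsto_const)
      then show "(\<lambda>k. \<zeta> k x) \<longlonglongrightarrow> 1" by (simp add: \<zeta>_def)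
    qed
  qed
qed

lemma AE_cube_box:
  "AE x in lebesgue. x \<in> cube c r \<longrightarrow> x \<in> box c (c + r *\<^sub>R One)"
proof -
  have "negligible (cube c r - box c (c + r *\<^sub>R One))"
    unfolding cube_def by (rule negligible_frontier_interval)
  then have "AE x in lebesgue. x \<notin> cube c r - box c (c + r *\<^sub>R One)"
    by (intro AE_not_in) (simp add: negligible_iff_null_sets)
  then show ?thesis by eventually_elim blast
qed

text \<open>A measurable function is almost everywhere a limit of continuous ones; truncated to
  [-1, 1], these are uniformly close to polynomials on the cube by Stone--Weierstrass, and the
  cutoffs make the result vanish outside the cube.\<close>

lemma smooth_approx:
  fixes g :: "real^'n::finite \<Rightarrow> real"
  assumes g: "g \<in> borel_measurable lebesgue" "\<And>x. \<bar>g x\<bar> \<le> 1" and r: "r > 0"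
  obtains H :: "nat \<Rightarrow> real^'n \<Rightarrow> real"
  where "\<And>k. smooth (H k)" "\<And>k x. \<bar>H k x\<bar> \<le> 1" "\<And>k x. x \<notin> cube c r \<Longrightarrow> H k x = 0"
    "AE x in lebesgue. x \<in> cube c r \<longrightarrow> (\<lambda>k. H k x) \<longlonglongrightarrow> g x"
proof -
  have "g measurable_on UNIV"
    using g(1) by (intro lebesgue_measurable_imp_measurable_on) auto
  then obtain N h where N: "negligible N" "\<And>n. continuous_on UNIV (h n)"
    "\<And>x. x \<notin> N \<Longrightarrow> (\<lambda>n. h n x) \<longlonglongrightarrow> g x"
    by (auto simp: measurable_on_def)
  define h' where "h' n x = max (-1) (min 1 (h n x))" for n x
  have "\<exists>p. real_polynomial_function p \<and> (\<forall>x\<in>cube c r. \<bar>h' n x - p x\<bar> < 1 / Suc n)" for n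
  proof -
    have "continuous_on (cube c r) (h' n)"
      unfolding h'_def by (intro continuous_intros continuous_on_subset[OF N(2)]) auto
    then obtain p where "real_polynomial_function p" "\<And>x. x \<in> cube c r \<Longrightarrow> \<bar>h' n x - p x\<bar> < 1 / Suc n"
      by (rule Stone_Weierstrass_real_polynomial_function[OF compact_cube, of c r "h' n" "1 / Suc n"]) auto
    then show ?thesis by blast
  qed
  then obtain p where p: "\<And>n. real_polynomial_function (p n)"
    "\<And>n x. x \<in> cube c r \<Longrightarrow> \<bar>h' n x - p n x\<bar> < 1 / Suc n" by metis
  obtain \<zeta> :: "nat \<Rightarrow> real^'n \<Rightarrow> real" where \<zeta>: "\<And>k. smooth (\<zeta> k)" "\<And>k x. 0 \<le> \<zeta> k x" "\<And>k x. \<zeta> k x \<le> 1"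
    "\<And>k x. x \<notin> cube c r \<Longrightarrow> \<zeta> k x = 0"
    "\<And>x. x \<in> box c (c + r *\<^sub>R One) \<Longrightarrow> (\<lambda>k. \<zeta> k x) \<longlonglongrightarrow> 1"
    by (rule smooth_cutoff[where c = c, OF r]) blast
  \<comment> \<open>On the cube the polynomials may overshoot to 1 + 1/(n+1) = (n+2)/(n+1). The
    prefactor is the reciprocal of this and restores the bound 1.\<close>
  define H where "H n x = (real (Suc n) / (real (Suc n) + 1)) * (\<zeta> n x * p n x)" for n x
  show ?thesis
  proof
    show "smooth (H k)" for k
      unfolding H_def by (intro smooth_cmult smooth_mult \<zeta> real_polynomial_function_smooth p)
    show "H k x = 0" if "x \<notin> cube c r" for k x
      using \<zeta>(4)[OF that] by (simp add: H_def)
    show "\<bar>H k x\<bar> \<le> 1" for k x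
    proof (cases "x \<in> cube c r")
      case True
      have "\<bar>h' k x\<bar> \<le> 1" by (auto simp: h'_def)
      then have "\<bar>p k x\<bar> \<le> 1 + 1 / Suc k"
        using p(2)[OF True, of k] by linarith
      then have "\<bar>\<zeta> k x * p k x\<bar> \<le> 1 * (1 + 1 / Suc k)"
        unfolding abs_mult using \<zeta>(2,3)[of k x] by (intro mult_mono) auto
      then have "\<bar>H k x\<bar> \<le> (real (Suc k) / (real (Suc k) + 1)) * (1 * (1 + 1 / Suc k))"
        unfolding H_def abs_mult[of "_ / _"] by (intro mult_mono) (auto simp: divide_nonneg_nonneg)
      also have "\<dots> = 1"
      proof -
        have "t / (t + 1) * (1 * (1 + 1 / t)) = 1" if "t > 0" for t :: real
          using that by (simp add: divide_simps)
        from this[of "real (Suc k)"] show ?thesis by (simp only: of_nat_0_less_iff zero_less_Suc simp_thms)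
      qed
      finally show ?thesis .
    next
      case False
      then show ?thesis using \<zeta>(4)[OF False] by (simp add: H_def)
    qed
    have "AE x in lebesgue. x \<notin> N"
      using N(1) by (intro AE_not_in) (simp add: negligible_iff_null_sets)
    with AE_cube_box[of c r] show "AE x in lebesgue. x \<in> cube c r \<longrightarrow> (\<lambda>k. H k x) \<longlonglongrightarrow> g x"
    proof eventually_elim
      case (elim x)
      show ?case
      proof
        assume x: "x \<in> cube c r"
        have "(\<lambda>n. h' n x) \<longlonglongrightarrow> max (-1) (min 1 (g x))"
          unfolding h'_def using N(3) elim by (intro tendsto_intros) auto
        moreover have "max (-1) (min 1 (g x)) = g x" using g(2)[of x] by auto
        ultimately have h': "(\<lambda>n. h' n x) \<longlonglongrightarrow> g x" by simp
        have "(\<lambda>n. p n x - h' n x) \<longlonglongrightarrow> 0"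
        proof (rule Lim_null_comparison[OF _ LIMSEQ_inverse_real_of_nat])
          show "\<forall>\<^sub>F n in sequentially. norm (p n x - h' n x) \<le> inverse (real (Suc n))"
            using p(2)[OF x] by (auto simp: inverse_eq_divide abs_minus_commute less_imp_le)
        qed
        from tendsto_add[OF this h'] have pn: "(\<lambda>n. p n x) \<longlonglongrightarrow> g x" by simp
        have "(\<lambda>n. real (Suc n) / (real (Suc n) + 1)) \<longlonglongrightarrow> 1"
          using LIMSEQ_n_over_Suc_n LIMSEQ_Suc by fastforce
        moreover have "(\<lambda>k. \<zeta> k x) \<longlonglongrightarrow> 1" using elim x \<zeta>(5) by blast
        ultimately have "(\<lambda>n. real (Suc n) / (real (Suc n) + 1) * (\<zeta> n x * p n x)) \<longlonglongrightarrow> 1 * (1 * g x)"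
          by (intro tendsto_mult pn)
        then show "(\<lambda>k. H k x) \<longlonglongrightarrow> g x" by (simp only: H_def mult_1)
      qed
    qed
  qed
qed

section \<open>Local integrability, the fundamental lemma and uniqueness of weak derivatives\<close>

lemma smooth_measurable: "smooth f \<Longrightarrow> f \<in> borel_measurable lebesgue"
  by (intro measurable_completion) (simp add: borel_measurable_continuous_onI smooth_continuous_on)

lemma locally_integrable_cube:
  assumes "locally_integrable \<Omega> f" "compact K" "K \<subseteq> \<Omega>"
  shows "integrable lebesgue (\<lambda>x. indicator K x * f x)"
  using assms by (auto simp: locally_integrable_def set_integrable_def)

lemma integral_support:
  fixes f \<phi> :: "real^'n::finite \<Rightarrow> real"
  assumes "\<And>x. x \<notin> K \<Longrightarrow> \<phi> x = 0" "K \<subseteq> \<Omega>"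
  shows "(LINT x:\<Omega>|lebesgue. f x * \<phi> x) = (\<integral>x. (indicator K x * f x) * \<phi> x \<partial>lebesgue)"
  unfolding set_lebesgue_integral_def
proof (rule Bochner_Integration.integral_cong)
  fix x show "indicator \<Omega> x *\<^sub>R (f x * \<phi> x) = indicator K x * f x * \<phi> x"
    by (cases "x \<in> K") (use assms(1)[of x] assms(2) in \<open>auto simp: indicator_def\<close>)
qed simp

text \<open>Smooth \<open>H\<close> close to \<open>sgn f\<close> recover the integral of \<open>\<bar>f\<bar>\<close>.\<close>

lemma smooth_approx_abs:
  fixes f :: "real^'n::finite \<Rightarrow> real"
  assumes f: "integrable lebesgue (\<lambda>x. indicator (cube c r) x * f x)" and r: "r > 0"
  obtains H :: "nat \<Rightarrow> real^'n \<Rightarrow> real"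
  where "\<And>k. smooth (H k)" "\<And>k x. \<bar>H k x\<bar> \<le> 1" "\<And>k x. x \<notin> cube c r \<Longrightarrow> H k x = 0"
    "(\<lambda>k. \<integral>x. (indicator (cube c r) x * f x) * H k x \<partial>lebesgue)
      \<longlonglongrightarrow> (\<integral>x. \<bar>indicator (cube c r) x * f x\<bar> \<partial>lebesgue)"
proof -
  let ?f = "\<lambda>x. indicator (cube c r) x * f x"
  have fm [measurable]: "?f \<in> borel_measurable lebesgue" using f by (rule borel_measurable_integrable)
  have sg: "(\<lambda>x. sgn (?f x)) \<in> borel_measurable lebesgue" by measurable
  have sg1: "\<bar>sgn (?f x)\<bar> \<le> 1" for x by (simp add: sgn_if)
  obtain H :: "nat \<Rightarrow> real^'n \<Rightarrow> real"
    where H: "\<And>k. smooth (H k)" "\<And>k x. \<bar>H k x\<bar> \<le> 1" "\<And>k x. x \<notin> cube c r \<Longrightarrow> H k x = 0"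
    "AE x in lebesgue. x \<in> cube c r \<longrightarrow> (\<lambda>k. H k x) \<longlonglongrightarrow> sgn (?f x)"
    by (rule smooth_approx[where c = c, OF sg sg1 r]) blast
  have [measurable]: "H k \<in> borel_measurable lebesgue" for k
    by (rule smooth_measurable[OF H(1)])
  have "(\<lambda>k. \<integral>x. ?f x * H k x \<partial>lebesgue) \<longlonglongrightarrow> (\<integral>x. \<bar>?f x\<bar> \<partial>lebesgue)"
  proof (rule integral_dominated_convergence[where w = "\<lambda>x. \<bar>?f x\<bar>"])
    show "integrable lebesgue (\<lambda>x. \<bar>?f x\<bar>)" using f by (rule integrable_abs)
    show "AE x in lebesgue. (\<lambda>k. ?f x * H k x) \<longlonglongrightarrow> \<bar>?f x\<bar>"
      using H(4)
    proof eventually_elim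
      case (elim x)
      show ?case
      proof (cases "x \<in> cube c r")
        case True
        then have "(\<lambda>k. ?f x * H k x) \<longlonglongrightarrow> ?f x * sgn (?f x)"
          using elim by (intro tendsto_mult tendsto_const) auto
        then show ?thesis by (simp only: abs_sgn)
      qed auto
    qed
    show "AE x in lebesgue. norm (?f x * H k x) \<le> \<bar>?f x\<bar>" for k
      using H(2)[of k] by (intro AE_I2) (simp add: abs_mult mult_left_le)
  qed auto
  with H that show thesis by blast
qed

text \<open>The open cubes whose closures lie in \<Omega> cover it, and by Lindelof countably many
  suffice, so the exceptional null sets can be united.\<close>

lemma AE_on_open_if_AE_on_cubes:
  fixes \<Omega> :: "(real^'n::finite) set"
  assumes "open \<Omega>" and ae: "\<And>c r. r > 0 \<Longrightarrow> cube c r \<subseteq> \<Omega> \<Longrightarrow> AE x in lebesgue. x \<in> cube c r \<longrightarrow> P x"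
  shows "AE x in lebesgue. x \<in> \<Omega> \<longrightarrow> P x"
proof -
  let ?F = "{box c (c + r *\<^sub>R One) |c r. r > 0 \<and> cube c r \<subseteq> \<Omega>}"
  have "open B" if "B \<in> ?F" for B using that by auto
  then obtain F' where F': "F' \<subseteq> ?F" "countable F'" "\<Union>F' = \<Union>?F"
    by (rule Lindelof) blast+
  have "\<Omega> \<subseteq> \<Union>?F"
  proof
    fix x assume "x \<in> \<Omega>"
    then obtain e where e: "e > 0" "cball x e \<subseteq> \<Omega>"
      using \<open>open \<Omega>\<close> open_contains_cball by blast
    \<comment> \<open>The corner is shifted by half the side so that \<open>x\<close> is the centre
      of the cube. The l1 norm bounds distances from \<open>x\<close> by
      \<open>CARD('n) * r = e / 2\<close>.\<close>
    define r where "r = e / (2 * CARD('n))"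
    define c where "c = x - (r/2) *\<^sub>R One"
    have r: "r > 0" using e by (simp add: r_def)
    have "cube c r \<subseteq> cball x e"
    proof
      fix y assume y: "y \<in> cube c r"
      have "norm (y - x) \<le> (\<Sum>i\<in>UNIV. \<bar>(y - x) $ i\<bar>)"
        by (rule norm_le_l1_cart)
      also have "\<dots> \<le> (\<Sum>i\<in>(UNIV :: 'n set). r)"
      proof (rule sum_mono)
        fix i show "\<bar>(y - x) $ i\<bar> \<le> r"
          using y[unfolded mem_cube, rule_format, of i] r by (auto simp: c_def abs_le_iff)
      qed
      also have "\<dots> = e / 2" by (simp add: r_def)
      finally show "y \<in> cball x e" using e by (simp add: dist_norm norm_minus_commute)
    qed
    moreover have "x \<in> box c (c + r *\<^sub>R One)"
      using r by (auto simp: mem_box_cart c_def)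
    ultimately show "x \<in> \<Union>?F" using r e by blast
  qed
  moreover have "AE x in lebesgue. \<forall>B\<in>F'. x \<in> B \<longrightarrow> P x"
  proof (rule AE_ball_countable'[OF _ F'(2)])
    fix B assume "B \<in> F'"
    then obtain c r where B: "B = box c (c + r *\<^sub>R One)" "r > 0" "cube c r \<subseteq> \<Omega>" using F'(1) by blast
    then have "B \<subseteq> cube c r" by (simp only: box_subset_cbox cube_def)
    show "AE x in lebesgue. x \<in> B \<longrightarrow> P x"
      using ae[OF B(2,3)] by eventually_elim (use \<open>B \<subseteq> cube c r\<close> in blast)
  qed
  ultimately show ?thesis
    using F'(3) by (auto elim!: eventually_mono)
qed

text \<open>Testing with the smooth functions that imitate the sign of \<open>w\<close> on a cube
  shows that the integral of \<open>\<bar>w x\<bar>\<close> over that cube is 0.\<close>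

lemma fundamental_lemma:
  fixes \<Omega> :: "(real^'n::finite) set"
  assumes "open \<Omega>" and w: "locally_integrable \<Omega> w"
    and "\<And>\<phi>. test_function \<Omega> \<phi> \<Longrightarrow> (LINT x:\<Omega>|lebesgue. w x * \<phi> x) = 0"
  shows "AE x in lebesgue. x \<in> \<Omega> \<longrightarrow> w x = 0"
proof (rule AE_on_open_if_AE_on_cubes[OF \<open>open \<Omega>\<close>])
  fix c :: "real^'n" and r :: real assume r: "r > 0" and Q: "cube c r \<subseteq> \<Omega>"
  let ?w = "\<lambda>x. indicator (cube c r) x * w x"
  have int: "integrable lebesgue ?w"
    by (rule locally_integrable_cube[OF w _ Q]) simp
  obtain H where H: "\<And>k. smooth (H k)" "\<And>k x. \<bar>H k x\<bar> \<le> 1" "\<And>k x. x \<notin> cube c r \<Longrightarrow> H k x = 0"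
    "(\<lambda>k. \<integral>x. ?w x * H k x \<partial>lebesgue) \<longlonglongrightarrow> (\<integral>x. \<bar>?w x\<bar> \<partial>lebesgue)"
    by (rule smooth_approx_abs[OF int r]) blast
  have "(\<integral>x. ?w x * H k x \<partial>lebesgue) = 0" for k
    using assms(3)[OF test_functionI[OF H(1) _ Q H(3)]] integral_support[OF H(3) Q, where f = w] by simp
  with H(4) have "(\<integral>x. \<bar>?w x\<bar> \<partial>lebesgue) = 0"
    by (simp add: LIMSEQ_const_iff)
  then have "AE x in lebesgue. \<bar>?w x\<bar> = 0"
    using int by (subst (asm) integral_nonneg_eq_0_iff_AE) auto
  then show "AE x in lebesgue. x \<in> cube c r \<longrightarrow> w x = 0"
    by eventually_elim (auto simp: indicator_def split: if_splits)
qed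

lemma locally_integrable_mult_smooth:
  assumes "locally_integrable \<Omega> v" "smooth \<phi>" "compact K" "K \<subseteq> \<Omega>" "\<And>x. x \<notin> K \<Longrightarrow> \<phi> x = 0"
  shows "set_integrable lebesgue \<Omega> (\<lambda>x. v x * \<phi> x)"
proof -
  have v: "integrable lebesgue (\<lambda>x. indicator K x * v x)"
    using locally_integrable_cube[OF assms(1,3,4)] .
  have "bounded (\<phi> ` K)"
    by (intro compact_imp_bounded compact_continuous_image smooth_continuous_on assms)
  then obtain C where C: "\<And>x. x \<in> K \<Longrightarrow> \<bar>\<phi> x\<bar> \<le> C" by (auto simp: bounded_iff)
  have "integrable lebesgue (\<lambda>x. (indicator K x * v x) * \<phi> x)"
  proof (rule Bochner_Integration.integrable_bound[OF integrable_mult_right[OF v, of C]])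
    show "(\<lambda>x. indicator K x * v x * \<phi> x) \<in> borel_measurable lebesgue"
      using v smooth_measurable[OF assms(2)] by measurable
    show "AE x in lebesgue. norm (indicator K x * v x * \<phi> x) \<le> norm (C * (indicator K x * v x))"
    proof (intro AE_I2)
      fix x
      show "norm (indicator K x * v x * \<phi> x) \<le> norm (C * (indicator K x * v x))"
      proof (cases "x \<in> K")
        case True
        with C[OF True] show ?thesis
          by (simp add: abs_mult mult.commute) (meson abs_ge_self abs_ge_zero mult_right_mono order_trans)
      qed simp
    qed
  qed
  moreover have "(\<lambda>x. (indicator K x * v x) * \<phi> x) = (\<lambda>x. indicator \<Omega> x *\<^sub>R (v x * \<phi> x))"
  proof
    fix x show "(indicator K x * v x) * \<phi> x = indicator \<Omega> x *\<^sub>R (v x * \<phi> x)"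
      by (cases "x \<in> K") (use assms(4) assms(5)[of x] in \<open>auto simp: indicator_def\<close>)
  qed
  ultimately show ?thesis by (simp add: set_integrable_def)
qed

lemma weak_derivative_unique:
  fixes \<Omega> :: "(real^'n::finite) set"
  assumes "open \<Omega>" "has_weak_derivative \<Omega> js u v" "has_weak_derivative \<Omega> js u w"
  shows "AE x in lebesgue. x \<in> \<Omega> \<longrightarrow> v x = w x"
proof -
  have lv: "locally_integrable \<Omega> v" and lw: "locally_integrable \<Omega> w"
    using assms by (auto simp: has_weak_derivative_def)
  have "AE x in lebesgue. x \<in> \<Omega> \<longrightarrow> v x - w x = 0"
  proof (rule fundamental_lemma[OF assms(1)])
    show "locally_integrable \<Omega> (\<lambda>x. v x - w x)"
      using lv lw unfolding locally_integrable_def by (auto intro: set_integral_diff)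
    fix \<phi> assume t: "test_function \<Omega> \<phi>"
    then obtain K where K: "smooth \<phi>" "compact K" "K \<subseteq> \<Omega>" "\<And>x. x \<notin> K \<Longrightarrow> \<phi> x = 0"
      by (rule test_functionD) blast
    have "(LINT x:\<Omega>|lebesgue. v x * \<phi> x) = (LINT x:\<Omega>|lebesgue. w x * \<phi> x)"
      using assms(2,3) t by (simp add: has_weak_derivative_def)
    then show "(LINT x:\<Omega>|lebesgue. (v x - w x) * \<phi> x) = 0"
      using set_integral_diff(2)[OF locally_integrable_mult_smooth[OF lv K] locally_integrable_mult_smooth[OF lw K]]
      by (simp add: left_diff_distrib)
  qed
  then show ?thesis by eventually_elim auto
qed

lemma has_weak_derivative_Nil:
  "locally_integrable \<Omega> u \<Longrightarrow> has_weak_derivative \<Omega> [] u u"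
  by (simp add: has_weak_derivative_def)

text \<open>A derivative of order j+1 is a first order weak derivative of one of order j, so later
  estimates can treat one order at a time. The new direction stands on the right because
  \<open>iter_partial (js @ [i])\<close> applies \<open>partial_drv i\<close> first, and this maps
  test functions to test functions.\<close>

lemma has_weak_derivative_snoc:
  assumes "has_weak_derivative \<Omega> js u v" "has_weak_derivative \<Omega> (js @ [i]) u w"
  shows "has_weak_derivative \<Omega> [i] v w"
proof -
  have "(LINT x:\<Omega>|lebesgue. v x * partial_drv i \<phi> x) = - (LINT x:\<Omega>|lebesgue. w x * \<phi> x)"
    if t: "test_function \<Omega> \<phi>" for \<phi>
  proof -
    obtain K where K: "smooth \<phi>" "compact K" "K \<subseteq> \<Omega>" "\<And>x. x \<notin> K \<Longrightarrow> \<phi> x = 0"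
      by (rule test_functionD[OF t]) blast
    have "partial_drv i \<phi> x = 0" if "x \<notin> K" for x
      using iter_partial_eq_0[of "- K" \<phi> x "[i]"] that K(2,4) by (auto dest: compact_imp_closed)
    then have t': "test_function \<Omega> (partial_drv i \<phi>)"
      using K by (intro test_functionI[of _ K] smooth_partial_drv)
    have "(LINT x:\<Omega>|lebesgue. u x * iter_partial js (partial_drv i \<phi>) x) =
        (-1) ^ length js * (LINT x:\<Omega>|lebesgue. v x * partial_drv i \<phi> x)"
      using assms(1) t' by (simp add: has_weak_derivative_def)
    moreover have "(LINT x:\<Omega>|lebesgue. u x * iter_partial (js @ [i]) \<phi> x) =
        (-1) ^ length (js @ [i]) * (LINT x:\<Omega>|lebesgue. w x * \<phi> x)"
      using assms(2) t by (simp add: has_weak_derivative_def)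
    ultimately have "(-1) ^ length js * (LINT x:\<Omega>|lebesgue. v x * partial_drv i \<phi> x) =
        (-1) ^ length js * (- (LINT x:\<Omega>|lebesgue. w x * \<phi> x))"
      by (simp add: iter_partial_append)
    then show ?thesis by (subst (asm) mult_left_cancel) auto
  qed
  then show ?thesis using assms by (simp add: has_weak_derivative_def)
qed


section \<open>Transport of averages along segments of cubes\<close>

text \<open>The mean value inequality bounds the difference quotients of the kernel by the bound on
  its derivative, so a multiple of \<open>\<bar>f x\<bar>\<close> dominates. Derivatives are taken
  within {0..1} because the hypotheses hold for these parameters only.\<close>

lemma has_derivative_lint:
  fixes f :: "'a \<Rightarrow> real" and K K' :: "real \<Rightarrow> 'a \<Rightarrow> real"
  assumes f: "integrable M f"
    and K: "\<And>s. s \<in> {0..1} \<Longrightarrow> K s \<in> borel_measurable M" "\<And>s x. s \<in> {0..1} \<Longrightarrow> \<bar>K s x\<bar> \<le> C"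
    and K': "\<And>s. s \<in> {0..1} \<Longrightarrow> K' s \<in> borel_measurable M"
      "\<And>s x. s \<in> {0..1} \<Longrightarrow> ((\<lambda>s. K s x) has_real_derivative K' s x) (at s within {0..1})"
      "\<And>s x. s \<in> {0..1} \<Longrightarrow> \<bar>K' s x\<bar> \<le> C"
    and t: "t \<in> {0..1}"
  shows "((\<lambda>s. \<integral>x. f x * K s x \<partial>M) has_real_derivative (\<integral>x. f x * K' t x \<partial>M)) (at t within {0..1})"
proof -
  have fm [measurable]: "f \<in> borel_measurable M" using f by (rule borel_measurable_integrable)
  have int: "integrable M (\<lambda>x. f x * K s x)" if s: "s \<in> {0..1}" for s
  proof (rule Bochner_Integration.integrable_bound[OF integrable_mult_left[OF f, of C]])
    show "(\<lambda>x. f x * K s x) \<in> borel_measurable M"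
      using K(1)[OF s] by measurable
    show "AE x in M. norm (f x * K s x) \<le> norm (f x * C)"
    proof (intro AE_I2)
      fix x
      have "\<bar>K s x\<bar> \<le> \<bar>C\<bar>" using K(2)[OF s, of x] by linarith
      then show "norm (f x * K s x) \<le> norm (f x * C)"
        by (simp add: abs_mult mult_left_mono)
    qed
  qed
  show ?thesis
    unfolding has_field_derivative_iff tendsto_at_iff_sequentially
  proof (intro allI impI)
    fix X :: "nat \<Rightarrow> real"
    assume X: "\<forall>i. X i \<in> {0..1} - {t}" "X \<longlonglongrightarrow> t"
    have X01: "X i \<in> {0..1}" "X i \<noteq> t" for i using X(1) by auto
    have [measurable]: "K (X i) \<in> borel_measurable M" "K t \<in> borel_measurable M" "K' t \<in> borel_measurable M" for i
      using K(1)[OF X01(1)] K(1)[OF t] K'(1)[OF t] by auto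
    have eq: "((\<integral>x. f x * K (X i) x \<partial>M) - (\<integral>x. f x * K t x \<partial>M)) / (X i - t) =
        (\<integral>x. f x * ((K (X i) x - K t x) / (X i - t)) \<partial>M)" for i
    proof -
      have "(\<integral>x. f x * ((K (X i) x - K t x) / (X i - t)) \<partial>M) =
          (\<integral>x. (f x * K (X i) x - f x * K t x) / (X i - t) \<partial>M)"
        by (simp add: right_diff_distrib)
      also have "\<dots> = (\<integral>x. (f x * K (X i) x - f x * K t x) \<partial>M) / (X i - t)"
        by (rule integral_divide_zero)
      also have "\<dots> = ((\<integral>x. f x * K (X i) x \<partial>M) - (\<integral>x. f x * K t x \<partial>M)) / (X i - t)"
        by (subst Bochner_Integration.integral_diff[OF int[OF X01(1)] int[OF t]]) (rule refl)
      finally show ?thesis by (rule sym)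
    qed
    have "(\<lambda>i. \<integral>x. f x * ((K (X i) x - K t x) / (X i - t)) \<partial>M) \<longlonglongrightarrow> (\<integral>x. f x * K' t x \<partial>M)"
    proof (rule integral_dominated_convergence[where w = "\<lambda>x. \<bar>f x\<bar> * \<bar>C\<bar>"])
      show "integrable M (\<lambda>x. \<bar>f x\<bar> * \<bar>C\<bar>)"
        using f by (intro integrable_mult_left integrable_abs)
      show "AE x in M. (\<lambda>i. f x * ((K (X i) x - K t x) / (X i - t))) \<longlonglongrightarrow> f x * K' t x"
      proof (intro AE_I2 tendsto_mult tendsto_const)
        fix x
        show "(\<lambda>i. (K (X i) x - K t x) / (X i - t)) \<longlonglongrightarrow> K' t x"
          using K'(2)[OF t, of x, unfolded has_field_derivative_iff tendsto_at_iff_sequentially] X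
          by (simp add: o_def)
      qed
      show "AE x in M. norm (f x * ((K (X i) x - K t x) / (X i - t))) \<le> \<bar>f x\<bar> * \<bar>C\<bar>" for i
      proof (intro AE_I2)
        fix x
        have "norm (K (X i) x - K t x) \<le> C * norm (X i - t)"
          by (rule field_differentiable_bound[of "{0..1}" "\<lambda>s. K s x" "\<lambda>s. K' s x"])
             (use K' X01 t in auto)
        also have "\<dots> \<le> \<bar>C\<bar> * norm (X i - t)" by (intro mult_right_mono) auto
        finally have "\<bar>(K (X i) x - K t x) / (X i - t)\<bar> \<le> \<bar>C\<bar>"
          using X01(2)[of i] by (simp add: field_simps)
        then show "norm (f x * ((K (X i) x - K t x) / (X i - t))) \<le> \<bar>f x\<bar> * \<bar>C\<bar>"
          unfolding real_norm_def abs_mult by (intro mult_left_mono) auto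
      qed
    qed measurable
    then show "((\<lambda>y. ((\<integral>x. f x * K y x \<partial>M) - (\<integral>x. f x * K t x \<partial>M)) / (y - t)) \<circ> X)
        \<longlonglongrightarrow> (\<integral>x. f x * K' t x \<partial>M)"
      by (simp add: o_def eq)
  qed
qed

lemma bounded_of_compact_support:
  assumes "continuous_on UNIV g" "compact K" "\<And>z. z \<notin> K \<Longrightarrow> g z = (0::real)"
  obtains C where "C \<ge> 0" "\<And>z. \<bar>g z\<bar> \<le> C"
proof -
  have "bounded (g ` K)"
    by (intro compact_imp_bounded compact_continuous_image continuous_on_subset[OF assms(1)] assms) auto
  then obtain C where C: "\<And>z. z \<in> K \<Longrightarrow> \<bar>g z\<bar> \<le> C" by (auto simp: bounded_iff)
  have "\<bar>g z\<bar> \<le> \<bar>C\<bar>" for z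
    using C[of z] assms(3)[of z] by (cases "z \<in> K") auto
  then show thesis using that[of "\<bar>C\<bar>"] by auto
qed

lemma partial_drv_eq_0:
  assumes "closed K" "\<And>z. z \<notin> K \<Longrightarrow> g z = 0" "z \<notin> K"
  shows "partial_drv i g z = 0"
  using iter_partial_eq_0[of "- K" g z "[i]"] assms by auto

definition cubes_between :: "(real^'n::finite) \<times> real \<Rightarrow> (real^'n) \<times> real \<Rightarrow> real \<Rightarrow> (real^'n) set" where
  "cubes_between P P' s = cube (fst P + s *\<^sub>R (fst P' - fst P)) (snd P + s * (snd P' - snd P))"

text \<open>The weight \<open>H\<close> lives on the unit cube and is carried along with the cube,
  so that averages over different cubes are compared with the same weight. For the constant weight 1
  this is the mean value.\<close>

definition avg :: "(real^'n::finite \<Rightarrow> real) \<Rightarrow> (real^'n \<Rightarrow> real) \<Rightarrow> real^'n \<Rightarrow> real \<Rightarrow> real" where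
  "avg H f c r = (1/r) ^ CARD('n) * (\<integral>y. (indicator (cube c r) y * f y) * H ((1/r) *\<^sub>R (y - c)) \<partial>lebesgue)"

text \<open>
  With \<open>V\<close> the velocity field of the moving cube, \<open>r\<^sup>-\<^sup>n H ((y - c) / r)\<close> satisfies the continuity
  equation \<open>\<partial>\<^sub>s \<Phi> = - div (V \<Phi>)\<close>, so the derivative of its pairing with \<open>f\<close> is the pairing of
  \<open>V \<Phi>\<close> with the weak gradient of \<open>f\<close>.
\<close>

lemma transport_smooth:
  fixes \<Omega> :: "(real^'n::finite) set" and c0 c1 :: "real^'n"
  assumes weak: "\<And>i. has_weak_derivative \<Omega> [i] f (v i)"
    and H: "smooth H" "\<And>z. \<bar>H z\<bar> \<le> 1" "\<And>z. z \<notin> cube 0 1 \<Longrightarrow> H z = 0"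
    and r: "r0 > 0" "r1 > 0"
    and sub: "\<And>s. s \<in> {0..1} \<Longrightarrow> cubes_between (c0, r0) (c1, r1) s \<subseteq> \<Omega>"
    and B: "\<And>s. s \<in> {0..1} \<Longrightarrow>
      (\<Sum>i\<in>UNIV. avg (\<lambda>z. 1) (\<lambda>y. \<bar>v i y\<bar>) (c0 + s *\<^sub>R (c1 - c0)) (r0 + s * (r1 - r0))) \<le> B"
  shows "\<bar>avg H f c1 r1 - avg H f c0 r0\<bar> \<le> (norm (c1 - c0) + \<bar>r1 - r0\<bar>) * B"
proof -
  let ?n = "CARD('n)"
  define dc where "dc = c1 - c0"
  define dr where "dr = r1 - r0"
  define c where "c s = c0 + s *\<^sub>R dc" for s
  define r where "r s = r0 + s * dr" for s
  \<comment> \<open>The region swept out by the moving cube. It is a compact part of \<Omega>, so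
    one integrable restriction of \<open>f\<close> serves for all s.\<close>
  define K where "K = (\<lambda>(s, z). c s + r s *\<^sub>R z) ` ({0..1} \<times> cube 0 1)"
  have rpos: "r s > 0" if "s \<in> {0..1}" for s
  proof -
    have "r s = (1 - s) * r0 + s * r1" by (simp add: r_def dr_def algebra_simps)
    moreover have "(1 - s) * r0 \<ge> 0" "s * r1 \<ge> 0" using that assms(5,6) by auto
    moreover have "(1 - s) * r0 > 0 \<or> s * r1 > 0"
      using that assms(5,6) by (cases "s = 0") auto
    ultimately show ?thesis by linarith
  qed
  have cubeK: "cube (c s) (r s) \<subseteq> K" if s: "s \<in> {0..1}" for s
  proof
    fix y assume "y \<in> cube (c s) (r s)"
    then have "(1 / r s) *\<^sub>R (y - c s) \<in> cube 0 1" using mem_cube_affine[OF rpos[OF s]] by blast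
    moreover have "y = c s + r s *\<^sub>R ((1 / r s) *\<^sub>R (y - c s))" using rpos[OF s] by simp
    ultimately show "y \<in> K" using s unfolding K_def by force
  qed
  have "K \<subseteq> \<Omega>"
  proof
    fix y assume "y \<in> K"
    then obtain s z where s: "s \<in> {0..1}" and z: "z \<in> cube 0 1" and y: "y = c s + r s *\<^sub>R z"
      by (auto simp: K_def)
    have "(1 / r s) *\<^sub>R (y - c s) = z" using rpos[OF s] by (simp add: y)
    then have "y \<in> cube (c s) (r s)" using z mem_cube_affine[OF rpos[OF s]] by metis
    then show "y \<in> \<Omega>" using sub[OF s] by (auto simp: cubes_between_def c_def r_def dc_def dr_def)
  qed
  have "compact K"
    unfolding K_def c_def r_def split_def
    by (intro compact_continuous_image compact_Times continuous_intros) auto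
  have lf: "locally_integrable \<Omega> f" and lv: "locally_integrable \<Omega> (v i)" for i
    using weak[of i] by (auto simp: has_weak_derivative_def)
  define fK where "fK y = indicator K y * f y" for y
  have fK: "integrable lebesgue fK"
    unfolding fK_def by (rule locally_integrable_cube[OF lf \<open>compact K\<close> \<open>K \<subseteq> \<Omega>\<close>])
  \<comment> \<open>In coordinates of the unit cube the point z moves with velocity
    \<open>dc + dr *\<^sub>R z\<close>; \<open>G\<close> is this velocity times the weight.\<close>
  define G where "G i z = (dc $ i + dr * z $ i) * H z" for i z
  have G_smooth: "smooth (G i)" for i
    unfolding G_def by (intro smooth_mult smooth_add smooth_const smooth_coord H)
  have G0: "G i z = 0" if "z \<notin> cube 0 1" for i z
    using H(3)[OF that] by (simp add: G_def)
  \<comment> \<open>The divergence of the field \<open>G\<close>; up to a power of the side it is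
    minus the derivative of the moving kernel in s.\<close>
  define D where "D z = (\<Sum>i\<in>UNIV. partial_drv i (G i) z)" for z
  have D_smooth: "smooth D"
    unfolding D_def by (intro smooth_sum smooth_partial_drv G_smooth)
  have D0: "D z = 0" if "z \<notin> cube 0 1" for z
    unfolding D_def using G0 that by (intro sum.neutral ballI partial_drv_eq_0[of "cube 0 1"]) auto
  have D_eq: "D z = real ?n * dr * H z + (\<Sum>i\<in>UNIV. (dc $ i + dr * z $ i) * partial_drv i H z)" for z
  proof -
    have "partial_drv i (G i) z = dr * H z + (dc $ i + dr * z $ i) * partial_drv i H z" for i
    proof -
      have "((\<lambda>z. dc $ i + dr * z $ i) has_derivative (\<lambda>h. dr * h $ i)) (at z)"
        by (auto intro!: derivative_eq_intros bounded_linear_imp_has_derivative bounded_linear_vec_nth)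
      then have "partial_drv i (\<lambda>z. dc $ i + dr * z $ i) z = dr"
        by (simp add: partial_drv_eq)
      moreover have "smooth (\<lambda>z. dc $ i + dr * z $ i)"
        by (intro smooth_mult smooth_add smooth_const smooth_coord)
      ultimately show ?thesis
        unfolding G_def by (subst partial_drv_mult) (use H(1) in auto)
    qed
    then show ?thesis unfolding D_def by (simp add: sum.distrib)
  qed
  obtain CD where CD: "CD \<ge> 0" "\<And>z. \<bar>D z\<bar> \<le> CD"
    using bounded_of_compact_support[OF smooth_continuous_on[OF D_smooth] compact_cube D0] by blast
  \<comment> \<open>Every intermediate side is a convex combination of \<open>r0\<close> and
    \<open>r1\<close>, hence at least this minimum, which bounds the rescaled kernels uniformly in
    s.\<close>
  define m where "m = min r0 r1"
  have "m > 0" using assms(5,6) by (auto simp: m_def)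
  have rm: "m \<le> r s" if "s \<in> {0..1}" for s
  proof -
    have "r s = (1 - s) * r0 + s * r1" by (simp add: r_def dr_def algebra_simps)
    moreover have "(1 - s) * m \<le> (1 - s) * r0" "s * m \<le> s * r1"
      using that by (auto simp: m_def intro!: mult_left_mono)
    ultimately show ?thesis by (simp add: algebra_simps)
  qed
  define \<Phi> where "\<Phi> s y = (1 / r s) ^ ?n * H ((1 / r s) *\<^sub>R (y - c s))" for s y
  define \<Phi>' where "\<Phi>' s y = - ((1 / r s) ^ Suc ?n * D ((1 / r s) *\<^sub>R (y - c s)))" for s y
  have aff: "(1 / r s) *\<^sub>R (y - c s) = (- (1 / r s) *\<^sub>R c s) + (1 / r s) *\<^sub>R y" for s y
    by (simp add: scaleR_diff_right)
  have smooth_resc: "smooth (\<lambda>y. a * g ((1 / r s) *\<^sub>R (y - c s)))" if "smooth g" for g a s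
    unfolding aff by (intro smooth_cmult smooth_affine that)
  have \<Phi>'_deriv: "((\<lambda>s. \<Phi> s y) has_real_derivative \<Phi>' s y) (at s within {0..1})" if s: "s \<in> {0..1}" for s y
  proof -
    have rs: "r s > 0" by (rule rpos[OF s])
    define \<rho> where "\<rho> = 1 / r s"
    define z where "z s = (1 / r s) *\<^sub>R (y - c s)" for s
    have d\<rho>: "((\<lambda>s. 1 / r s) has_real_derivative - (\<rho> * \<rho> * dr)) (at s)"
      unfolding r_def using rs[unfolded r_def]
      by (auto intro!: derivative_eq_intros simp: \<rho>_def r_def)
    have dz: "(z has_derivative (\<lambda>h. h *\<^sub>R (- \<rho> *\<^sub>R (dc + dr *\<^sub>R z s)))) (at s)"
    proof -
      have "((\<lambda>s. (1 / r s) *\<^sub>R (y - c s)) has_derivative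
          (\<lambda>h. (1 / r s) *\<^sub>R (- (h *\<^sub>R dc)) + (- (\<rho> * \<rho> * dr) * h) *\<^sub>R (y - c s))) (at s)"
      proof (rule has_derivative_scaleR[OF d\<rho>[unfolded has_field_derivative_def]])
        show "((\<lambda>s. y - c s) has_derivative (\<lambda>h. - (h *\<^sub>R dc))) (at s)"
          unfolding c_def by (auto intro!: derivative_eq_intros)
      qed
      moreover have "(\<lambda>h. (1 / r s) *\<^sub>R (- (h *\<^sub>R dc)) + (- (\<rho> * \<rho> * dr) * h) *\<^sub>R (y - c s)) =
          (\<lambda>h. h *\<^sub>R (- \<rho> *\<^sub>R (dc + dr *\<^sub>R z s)))"
        by (simp add: z_def \<rho>_def algebra_simps fun_eq_iff)
      ultimately show ?thesis unfolding z_def by simp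
    qed
    have dH: "((\<lambda>s. H (z s)) has_real_derivative
        (- \<rho> * (\<Sum>i\<in>UNIV. (dc $ i + dr * z s $ i) * partial_drv i H (z s)))) (at s)"
    proof -
      have "((\<lambda>s. H (z s)) has_derivative
        (\<lambda>h. \<Sum>i\<in>UNIV. (h *\<^sub>R (- \<rho> *\<^sub>R (dc + dr *\<^sub>R z s))) $ i * partial_drv i H (z s))) (at s)"
        using diff_chain_at[OF dz smooth_has_derivative[OF H(1)]] by (simp add: o_def)
      moreover have "(\<lambda>h. \<Sum>i\<in>UNIV. (h *\<^sub>R (- \<rho> *\<^sub>R (dc + dr *\<^sub>R z s))) $ i * partial_drv i H (z s)) =
         (*) (- \<rho> * (\<Sum>i\<in>UNIV. (dc $ i + dr * z s $ i) * partial_drv i H (z s)))"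
        by (simp add: fun_eq_iff sum_distrib_left sum_distrib_right mult_ac)
      ultimately show ?thesis by (simp add: has_field_derivative_def)
    qed
    have dpow: "((\<lambda>s. (1 / r s) ^ ?n) has_real_derivative (real ?n * \<rho> ^ (?n - 1) * - (\<rho> * \<rho> * dr))) (at s)"
      using DERIV_power[OF d\<rho>, of ?n] by (simp add: \<rho>_def mult_ac)
    have e: "real ?n * \<rho> ^ (?n - 1) * - (\<rho> * \<rho> * dr) = - (real ?n * \<rho> ^ Suc ?n * dr)"
    proof -
      have "\<rho> ^ (?n - 1) * \<rho> = \<rho> ^ ?n" by (rule power_minus_mult) simp
      then show ?thesis by (simp add: algebra_simps)
    qed
    have "((\<lambda>s. (1 / r s) ^ ?n * H (z s)) has_real_derivative
       - (real ?n * \<rho> ^ Suc ?n * dr) * H (z s) +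
       (- \<rho> * (\<Sum>i\<in>UNIV. (dc $ i + dr * z s $ i) * partial_drv i H (z s))) * \<rho> ^ ?n) (at s)"
      using DERIV_mult[OF dpow dH] unfolding e \<rho>_def[symmetric] .
    moreover have "- (real ?n * \<rho> ^ Suc ?n * dr) * H (z s) +
       (- \<rho> * (\<Sum>i\<in>UNIV. (dc $ i + dr * z s $ i) * partial_drv i H (z s))) * \<rho> ^ ?n = \<Phi>' s y"
    proof -
      have zs: "\<rho> *\<^sub>R (y - c s) = z s" by (simp only: z_def \<rho>_def)
      show ?thesis unfolding \<Phi>'_def D_eq \<rho>_def[symmetric] zs by (simp add: algebra_simps)
    qed
    ultimately show ?thesis
      unfolding \<Phi>_def z_def by (auto intro: has_field_derivative_at_within)
  qed
  define C where "C = max ((1 / m) ^ ?n) ((1 / m) ^ Suc ?n * CD)"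
  have \<rho>_bound: "0 \<le> 1 / r s" "1 / r s \<le> 1 / m" if "s \<in> {0..1}" for s
    using rm[OF that] rpos[OF that] \<open>m > 0\<close> by (auto simp: field_simps)
  have deriv: "((\<lambda>s. \<integral>y. fK y * \<Phi> s y \<partial>lebesgue) has_real_derivative (\<integral>y. fK y * \<Phi>' s y \<partial>lebesgue))
      (at s within {0..1})" if "s \<in> {0..1}" for s
  proof (rule has_derivative_lint[where C = C, OF fK _ _ _ \<Phi>'_deriv _ that])
    fix s :: real assume s: "s \<in> {0..1}"
    show "\<Phi> s \<in> borel_measurable lebesgue"
      unfolding \<Phi>_def by (intro smooth_measurable smooth_resc H)
    have "(\<lambda>y. (- ((1 / r s) ^ Suc ?n)) * D ((1 / r s) *\<^sub>R (y - c s))) \<in> borel_measurable lebesgue"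
      by (intro smooth_measurable smooth_resc D_smooth)
    then show "\<Phi>' s \<in> borel_measurable lebesgue"
      unfolding \<Phi>'_def by simp
    fix y
    have "\<bar>\<Phi> s y\<bar> \<le> (1 / m) ^ ?n * 1"
      unfolding \<Phi>_def abs_mult using \<rho>_bound[OF s] H(2) \<open>m > 0\<close>
      by (intro mult_mono) (auto simp: power_abs intro!: power_mono)
    then show "\<bar>\<Phi> s y\<bar> \<le> C" by (simp add: C_def)
    have "\<bar>\<Phi>' s y\<bar> \<le> (1 / m) ^ Suc ?n * CD"
      unfolding \<Phi>'_def abs_mult abs_minus_cancel using \<rho>_bound[OF s] CD \<open>m > 0\<close>
      by (intro mult_mono) (auto simp del: power_Suc simp add: power_abs intro!: power_mono)
    then show "\<bar>\<Phi>' s y\<bar> \<le> C" by (simp add: C_def)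
  qed
  have bound: "\<bar>\<integral>y. fK y * \<Phi>' s y \<partial>lebesgue\<bar> \<le> (norm dc + \<bar>dr\<bar>) * B" if s: "s \<in> {0..1}" for s
  proof -
    let ?\<rho> = "1 / r s" and ?Q = "cube (c s) (r s)"
    have rs: "r s > 0" by (rule rpos[OF s])
    have Q: "?Q \<subseteq> \<Omega>" using cubeK[OF s] \<open>K \<subseteq> \<Omega>\<close> by blast
    \<comment> \<open>The components of velocity times kernel as functions of y. They are test
      functions supported in the current cube, so the weak derivatives \<open>v i\<close> can be
      paired with them.\<close>
    define \<Psi> where "\<Psi> i y = ?\<rho> ^ ?n * G i (?\<rho> *\<^sub>R (y - c s))" for i y
    have \<Psi>: "smooth (\<Psi> i)" for i
      unfolding \<Psi>_def by (intro smooth_resc G_smooth)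
    have \<Psi>0: "\<Psi> i y = 0" if "y \<notin> ?Q" for i y
      using G0[of "?\<rho> *\<^sub>R (y - c s)" i] mem_cube_affine[OF rs, of y "c s"] that by (simp add: \<Psi>_def)
    have d\<Psi>: "partial_drv i (\<Psi> i) y = ?\<rho> ^ Suc ?n * partial_drv i (G i) (?\<rho> *\<^sub>R (y - c s))" for i y
    proof -
      have "partial_drv i (\<Psi> i) y = ?\<rho> ^ ?n * (?\<rho> * partial_drv i (G i) (?\<rho> *\<^sub>R (y - c s)))"
        unfolding \<Psi>_def aff
        by (subst partial_drv_cmult[OF smooth_affine[OF G_smooth]], subst partial_drv_affine[OF G_smooth]) simp
      then show ?thesis by simp
    qed
    have d\<Psi>0: "partial_drv i (\<Psi> i) y = 0" if "y \<notin> K" for i y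
      using \<Psi>0 that cubeK[OF s] by (intro partial_drv_eq_0[of ?Q]) auto
    have d\<Psi>_int: "integrable lebesgue (\<lambda>y. fK y * partial_drv i (\<Psi> i) y)" for i
    proof -
      have "set_integrable lebesgue \<Omega> (\<lambda>y. f y * partial_drv i (\<Psi> i) y)"
        using d\<Psi>0 by (intro locally_integrable_mult_smooth[OF lf smooth_partial_drv[OF \<Psi>] \<open>compact K\<close> \<open>K \<subseteq> \<Omega>\<close>])
      moreover have "indicator \<Omega> y *\<^sub>R (f y * partial_drv i (\<Psi> i) y) = fK y * partial_drv i (\<Psi> i) y" for y
        by (cases "y \<in> K") (use d\<Psi>0[of y i] \<open>K \<subseteq> \<Omega>\<close> in \<open>auto simp: fK_def indicator_def\<close>)
      ultimately show ?thesis unfolding set_integrable_def by (simp only:)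
    qed
    have part: "(\<integral>y. fK y * partial_drv i (\<Psi> i) y \<partial>lebesgue) = - (\<integral>y. (indicator ?Q y * v i y) * \<Psi> i y \<partial>lebesgue)" for i
    proof -
      have "(LINT y:\<Omega>|lebesgue. f y * partial_drv i (\<Psi> i) y) = - (LINT y:\<Omega>|lebesgue. v i y * \<Psi> i y)"
        using weak[of i] test_functionI[OF \<Psi> compact_cube Q \<Psi>0] by (simp add: has_weak_derivative_def)
      then show ?thesis
        unfolding fK_def using integral_support[OF d\<Psi>0 \<open>K \<subseteq> \<Omega>\<close>] integral_support[OF \<Psi>0 Q] by simp
    qed
    have "(\<integral>y. fK y * \<Phi>' s y \<partial>lebesgue) = - (\<Sum>i\<in>UNIV. \<integral>y. fK y * partial_drv i (\<Psi> i) y \<partial>lebesgue)"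
    proof -
      have "fK y * \<Phi>' s y = - (\<Sum>i\<in>UNIV. fK y * partial_drv i (\<Psi> i) y)" for y
        unfolding \<Phi>'_def D_def d\<Psi> by (simp add: sum_distrib_left)
      then show ?thesis using d\<Psi>_int by (simp add: Bochner_Integration.integral_sum)
    qed
    also have "\<dots> = (\<Sum>i\<in>UNIV. \<integral>y. (indicator ?Q y * v i y) * \<Psi> i y \<partial>lebesgue)"
      by (simp add: part sum_negf)
    finally have eq: "(\<integral>y. fK y * \<Phi>' s y \<partial>lebesgue) = \<dots>" .
    have bi: "\<bar>\<integral>y. (indicator ?Q y * v i y) * \<Psi> i y \<partial>lebesgue\<bar> \<le>
        (norm dc + \<bar>dr\<bar>) * avg (\<lambda>z. 1) (\<lambda>y. \<bar>v i y\<bar>) (c s) (r s)" for i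
    proof -
      let ?L = "norm dc + \<bar>dr\<bar>"
      have vi: "integrable lebesgue (\<lambda>y. indicator ?Q y * v i y)"
        by (rule locally_integrable_cube[OF lv compact_cube Q])
      have pw: "\<bar>(indicator ?Q y * v i y) * \<Psi> i y\<bar> \<le> (?L * ?\<rho> ^ ?n) * \<bar>indicator ?Q y * v i y\<bar>" for y
      proof (cases "y \<in> ?Q")
        case True
        then have z: "?\<rho> *\<^sub>R (y - c s) \<in> cube 0 1" using mem_cube_affine[OF rs] by blast
        let ?z = "?\<rho> *\<^sub>R (y - c s)"
        \<comment> \<open>Coordinates in the unit cube are at most 1, so each velocity component is
          at most \<open>norm dc + \<bar>dr\<bar>\<close>. This is the origin of the length factor
          in the estimate.\<close>
        have "\<bar>?z $ i\<bar> \<le> 1"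
          using z[unfolded mem_cube, rule_format, of i] unfolding abs_le_iff by simp
        then have "\<bar>dr * ?z $ i\<bar> \<le> \<bar>dr\<bar> * 1" unfolding abs_mult by (intro mult_left_mono) auto
        then have "\<bar>dc $ i + dr * ?z $ i\<bar> \<le> ?L"
          using component_le_norm_cart[of dc i] by linarith
        then have "\<bar>G i ?z\<bar> \<le> ?L * 1"
          unfolding G_def abs_mult using H(2) by (intro mult_mono) auto
        then have "\<bar>\<Psi> i y\<bar> \<le> ?\<rho> ^ ?n * ?L"
          unfolding \<Psi>_def abs_mult using rs by (intro mult_mono) auto
        then have "\<bar>indicator ?Q y * v i y\<bar> * \<bar>\<Psi> i y\<bar> \<le> \<bar>indicator ?Q y * v i y\<bar> * (?\<rho> ^ ?n * ?L)"
          by (intro mult_left_mono) auto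
        then show ?thesis unfolding abs_mult[of "indicator ?Q y * v i y"] by (simp only: mult_ac)
      qed simp
      have "\<bar>\<integral>y. (indicator ?Q y * v i y) * \<Psi> i y \<partial>lebesgue\<bar> \<le> (\<integral>y. \<bar>(indicator ?Q y * v i y) * \<Psi> i y\<bar> \<partial>lebesgue)"
        by (rule integral_abs_bound)
      also have "\<dots> \<le> (\<integral>y. (?L * ?\<rho> ^ ?n) * \<bar>indicator ?Q y * v i y\<bar> \<partial>lebesgue)"
        using vi rs by (intro integral_mono' pw integrable_mult_right integrable_abs) auto
      also have "\<dots> = ?L * (?\<rho> ^ ?n * (\<integral>y. \<bar>indicator ?Q y * v i y\<bar> \<partial>lebesgue))"
        by simp
      also have "\<dots> = ?L * avg (\<lambda>z. 1) (\<lambda>y. \<bar>v i y\<bar>) (c s) (r s)"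
        by (simp add: avg_def abs_mult)
      finally show ?thesis .
    qed
    have "\<bar>\<integral>y. fK y * \<Phi>' s y \<partial>lebesgue\<bar> \<le> (\<Sum>i\<in>UNIV. \<bar>\<integral>y. (indicator ?Q y * v i y) * \<Psi> i y \<partial>lebesgue\<bar>)"
      unfolding eq by (rule sum_abs)
    also have "\<dots> \<le> (\<Sum>i\<in>UNIV. (norm dc + \<bar>dr\<bar>) * avg (\<lambda>z. 1) (\<lambda>y. \<bar>v i y\<bar>) (c s) (r s))"
      by (intro sum_mono bi)
    also have "\<dots> = (norm dc + \<bar>dr\<bar>) * (\<Sum>i\<in>UNIV. avg (\<lambda>z. 1) (\<lambda>y. \<bar>v i y\<bar>) (c s) (r s))"
      by (simp add: sum_distrib_left)
    also have "\<dots> \<le> (norm dc + \<bar>dr\<bar>) * B"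
      using B[OF s] by (intro mult_left_mono) (auto simp: c_def r_def dc_def dr_def)
    finally show ?thesis .
  qed
  have "norm ((\<integral>y. fK y * \<Phi> 1 y \<partial>lebesgue) - (\<integral>y. fK y * \<Phi> 0 y \<partial>lebesgue)) \<le> ((norm dc + \<bar>dr\<bar>) * B) * norm (1 - 0 :: real)"
    by (rule field_differentiable_bound[of "{0..1}" "\<lambda>s. \<integral>y. fK y * \<Phi> s y \<partial>lebesgue" "\<lambda>s. \<integral>y. fK y * \<Phi>' s y \<partial>lebesgue"])
       (use deriv bound in auto)
  moreover have "(\<integral>y. fK y * \<Phi> s y \<partial>lebesgue) = avg H f (c s) (r s)" if s: "s \<in> {0..1}" for s
  proof -
    have "fK y * \<Phi> s y = (1 / r s) ^ ?n * ((indicator (cube (c s) (r s)) y * f y) * H ((1 / r s) *\<^sub>R (y - c s)))" for y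
    proof (cases "y \<in> cube (c s) (r s)")
      case True
      then have "y \<in> K" using cubeK[OF s] by blast
      with True show ?thesis by (simp add: fK_def \<Phi>_def)
    next
      case False
      then have "H ((1 / r s) *\<^sub>R (y - c s)) = 0"
        using H(3) mem_cube_affine[OF rpos[OF s]] by blast
      then show ?thesis by (simp add: \<Phi>_def)
    qed
    then show ?thesis by (simp add: avg_def)
  qed
  moreover have "c 0 = c0" "c 1 = c1" "r 0 = r0" "r 1 = r1"
    by (simp_all add: c_def r_def dc_def dr_def)
  ultimately show ?thesis by (simp add: dc_def dr_def)
qed


abbreviation mean :: "(real^'n::finite \<Rightarrow> real) \<Rightarrow> real^'n \<Rightarrow> real \<Rightarrow> real" where
  "mean \<equiv> avg (\<lambda>z. 1)"

lemma mean_abs_nonneg: "r > 0 \<Longrightarrow> mean (\<lambda>y. \<bar>f y\<bar>) c r \<ge> 0"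
  unfolding avg_def by (intro mult_nonneg_nonneg integral_nonneg_AE) auto

text \<open>The weight imitates the sign of \<open>f\<close> on the final cube: there the weighted
  average tends to the mean of the absolute value, while on the initial cube any weight bounded by 1
  gives at most that mean. The estimate is therefore one-sided.\<close>

lemma transport_abs:
  fixes \<Omega> :: "(real^'n::finite) set" and c0 c1 :: "real^'n"
  assumes weak: "\<And>i. has_weak_derivative \<Omega> [i] f (v i)"
    and r: "r0 > 0" "r1 > 0"
    and sub: "\<And>s. s \<in> {0..1} \<Longrightarrow> cubes_between (c0, r0) (c1, r1) s \<subseteq> \<Omega>"
    and B: "\<And>s. s \<in> {0..1} \<Longrightarrow>
      (\<Sum>i\<in>UNIV. mean (\<lambda>y. \<bar>v i y\<bar>) (c0 + s *\<^sub>R (c1 - c0)) (r0 + s * (r1 - r0))) \<le> B"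
  shows "mean (\<lambda>y. \<bar>f y\<bar>) c1 r1 \<le> mean (\<lambda>y. \<bar>f y\<bar>) c0 r0 + (norm (c1 - c0) + \<bar>r1 - r0\<bar>) * B"
proof -
  let ?n = "CARD('n)"
  have lf: "locally_integrable \<Omega> f" using weak by (auto simp: has_weak_derivative_def)
  have Q0: "cube c0 r0 \<subseteq> \<Omega>" and Q1: "cube c1 r1 \<subseteq> \<Omega>"
    using sub[of 0] sub[of 1] by (simp_all add: cubes_between_def)
  have f0: "integrable lebesgue (\<lambda>y. indicator (cube c0 r0) y * f y)"
    by (rule locally_integrable_cube[OF lf compact_cube Q0])
  have f1: "integrable lebesgue (\<lambda>y. indicator (cube c1 r1) y * f y)"
    by (rule locally_integrable_cube[OF lf compact_cube Q1])
  obtain G where G: "\<And>k. smooth (G k)" "\<And>k x. \<bar>G k x\<bar> \<le> 1" "\<And>k x. x \<notin> cube c1 r1 \<Longrightarrow> G k x = 0"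
    "(\<lambda>k. \<integral>x. (indicator (cube c1 r1) x * f x) * G k x \<partial>lebesgue)
      \<longlonglongrightarrow> (\<integral>x. \<bar>indicator (cube c1 r1) x * f x\<bar> \<partial>lebesgue)"
    by (rule smooth_approx_abs[OF f1 r(2)]) blast
  \<comment> \<open>The approximate sign, pulled back from the final cube to the unit cube, where
    weights live.\<close>
  define H where "H k z = G k (c1 + r1 *\<^sub>R z)" for k z
  have H: "smooth (H k)" "\<bar>H k z\<bar> \<le> 1" for k z
    unfolding H_def by (intro smooth_affine G)+
  have H0: "H k z = 0" if "z \<notin> cube 0 1" for k z
  proof -
    have "(1/r1) *\<^sub>R ((c1 + r1 *\<^sub>R z) - c1) \<notin> cube 0 1" using that r by simp
    then show ?thesis unfolding H_def mem_cube_affine[OF r(2)] by (rule G(3))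
  qed
  have lower: "avg (H k) f c0 r0 \<le> mean (\<lambda>y. \<bar>f y\<bar>) c0 r0" for k
  proof -
    have "(\<integral>y. (indicator (cube c0 r0) y * f y) * H k ((1/r0) *\<^sub>R (y - c0)) \<partial>lebesgue)
        \<le> (\<integral>y. \<bar>indicator (cube c0 r0) y * f y\<bar> \<partial>lebesgue)"
    proof (rule integral_mono'[OF integrable_abs[OF f0]])
      fix y
      show "(indicator (cube c0 r0) y * f y) * H k ((1/r0) *\<^sub>R (y - c0)) \<le> \<bar>indicator (cube c0 r0) y * f y\<bar>"
      proof -
        have "\<bar>(indicator (cube c0 r0) y * f y) * H k ((1/r0) *\<^sub>R (y - c0))\<bar> \<le> \<bar>indicator (cube c0 r0) y * f y\<bar> * 1"
          unfolding abs_mult[of "_ * f y"] by (intro mult_left_mono H) auto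
        then show ?thesis by linarith
      qed
    qed auto
    then show ?thesis
      unfolding avg_def using r by (intro mult_left_mono) (auto simp: abs_mult)
  qed
  have upper: "(\<lambda>k. avg (H k) f c1 r1) \<longlonglongrightarrow> mean (\<lambda>y. \<bar>f y\<bar>) c1 r1"
  proof -
    have e: "H k ((1/r1) *\<^sub>R (y - c1)) = G k y" for k y
      using r by (simp add: H_def)
    show ?thesis
      unfolding avg_def e using tendsto_mult[OF tendsto_const[of "(1/r1) ^ ?n"] G(4)] by (simp add: abs_mult)
  qed
  have "\<bar>avg (H k) f c1 r1 - avg (H k) f c0 r0\<bar> \<le> (norm (c1 - c0) + \<bar>r1 - r0\<bar>) * B" for k
    by (rule transport_smooth[OF weak H H0 r sub B])
  then have "avg (H k) f c1 r1 \<le> mean (\<lambda>y. \<bar>f y\<bar>) c0 r0 + (norm (c1 - c0) + \<bar>r1 - r0\<bar>) * B" for k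
    using lower[of k] by (smt (verit))
  then show ?thesis
    by (intro LIMSEQ_le_const2[OF upper]) auto
qed

text \<open>The indicator of the unit cube is not a smooth weight; it is approached by cutoffs, and
  the bound of \<open>transport_smooth\<close> passes to the limit.\<close>

lemma transport_mean:
  fixes \<Omega> :: "(real^'n::finite) set" and c0 c1 :: "real^'n"
  assumes weak: "\<And>i. has_weak_derivative \<Omega> [i] f (v i)"
    and r: "r0 > 0" "r1 > 0"
    and sub: "\<And>s. s \<in> {0..1} \<Longrightarrow> cubes_between (c0, r0) (c1, r1) s \<subseteq> \<Omega>"
    and B: "\<And>s. s \<in> {0..1} \<Longrightarrow>
      (\<Sum>i\<in>UNIV. mean (\<lambda>y. \<bar>v i y\<bar>) (c0 + s *\<^sub>R (c1 - c0)) (r0 + s * (r1 - r0))) \<le> B"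
  shows "\<bar>mean f c1 r1 - mean f c0 r0\<bar> \<le> (norm (c1 - c0) + \<bar>r1 - r0\<bar>) * B"
proof -
  let ?n = "CARD('n)"
  have lf: "locally_integrable \<Omega> f" using weak by (auto simp: has_weak_derivative_def)
  have Q0: "cube c0 r0 \<subseteq> \<Omega>" and Q1: "cube c1 r1 \<subseteq> \<Omega>"
    using sub[of 0] sub[of 1] by (simp_all add: cubes_between_def)
  have one: "(1::real) > 0" by simp
  obtain \<zeta> :: "nat \<Rightarrow> real^'n \<Rightarrow> real" where \<zeta>: "\<And>k. smooth (\<zeta> k)" "\<And>k x. 0 \<le> \<zeta> k x" "\<And>k x. \<zeta> k x \<le> 1"
    "\<And>k x. x \<notin> cube 0 1 \<Longrightarrow> \<zeta> k x = 0"
    "\<And>x. x \<in> box 0 (0 + 1 *\<^sub>R One) \<Longrightarrow> (\<lambda>k. \<zeta> k x) \<longlonglongrightarrow> 1"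
    by (rule smooth_cutoff[where c = 0, OF one]) blast
  have lim: "(\<lambda>k. avg (\<zeta> k) f c r) \<longlonglongrightarrow> mean f c r" if r: "r > 0" and Q: "cube c r \<subseteq> \<Omega>" for c r
  proof -
    let ?f = "\<lambda>y. indicator (cube c r) y * f y"
    have f: "integrable lebesgue ?f" by (rule locally_integrable_cube[OF lf compact_cube Q])
    then have [measurable]: "?f \<in> borel_measurable lebesgue" by (rule borel_measurable_integrable)
    have aff: "(1 / r) *\<^sub>R (y - c) = (- (1 / r) *\<^sub>R c) + (1 / r) *\<^sub>R y" for y
      by (simp add: scaleR_diff_right)
    have [measurable]: "(\<lambda>y. \<zeta> k ((1/r) *\<^sub>R (y - c))) \<in> borel_measurable lebesgue" for k
      unfolding aff by (intro smooth_measurable smooth_affine \<zeta>)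
    have "(\<lambda>k. \<integral>y. ?f y * \<zeta> k ((1/r) *\<^sub>R (y - c)) \<partial>lebesgue) \<longlonglongrightarrow> (\<integral>y. ?f y * 1 \<partial>lebesgue)"
    proof (rule integral_dominated_convergence[where w = "\<lambda>y. \<bar>?f y\<bar>"])
      show "integrable lebesgue (\<lambda>y. \<bar>?f y\<bar>)" using f by (rule integrable_abs)
      show "AE y in lebesgue. (\<lambda>k. ?f y * \<zeta> k ((1/r) *\<^sub>R (y - c))) \<longlonglongrightarrow> ?f y * 1"
        using AE_cube_box[of c r]
      proof eventually_elim
        case (elim y)
        show ?case
        proof (cases "y \<in> cube c r")
          case True
          then have y: "y \<in> box c (c + r *\<^sub>R One)" using elim by blast
          have "(1/r) *\<^sub>R (y - c) \<in> box 0 (0 + 1 *\<^sub>R One)"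
            using y r by (auto simp: mem_box_cart field_simps)
          then show ?thesis by (intro tendsto_mult tendsto_const \<zeta>(5))
        next
          case False
          then show ?thesis by simp
        qed
      qed
      show "AE y in lebesgue. norm (?f y * \<zeta> k ((1/r) *\<^sub>R (y - c))) \<le> \<bar>?f y\<bar>" for k
      proof (intro AE_I2)
        fix y
        have "\<bar>?f y\<bar> * \<bar>\<zeta> k ((1/r) *\<^sub>R (y - c))\<bar> \<le> \<bar>?f y\<bar> * 1"
          using \<zeta>(2,3) by (intro mult_left_mono) auto
        then show "norm (?f y * \<zeta> k ((1/r) *\<^sub>R (y - c))) \<le> \<bar>?f y\<bar>"
          unfolding real_norm_def abs_mult[of "?f y"] by simp
      qed
    qed measurable
    then show ?thesis unfolding avg_def by (intro tendsto_mult tendsto_const)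
  qed
  have "\<bar>avg (\<zeta> k) f c1 r1 - avg (\<zeta> k) f c0 r0\<bar> \<le> (norm (c1 - c0) + \<bar>r1 - r0\<bar>) * B" for k
  proof (rule transport_smooth[OF weak \<zeta>(1) _ \<zeta>(4) r sub B])
    show "\<bar>\<zeta> k z\<bar> \<le> 1" for z using \<zeta>(2,3)[of k z] by simp
  qed
  then show ?thesis
    by (intro LIMSEQ_le_const2[OF tendsto_rabs[OF tendsto_diff[OF lim[OF r(2) Q1] lim[OF r(1) Q0]]]]) auto
qed

lemma mean_eq:
  "mean f (c :: real^'n::finite) r = (1/r) ^ CARD('n) * (\<integral>y. indicator (cube c r) y * f y \<partial>lebesgue)"
  unfolding avg_def mult_1_right by (rule refl)

section \<open>Chains of cubes\<close>

text \<open>Cubes are treated as points (corner, side). The distance of two of them is the bound on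
  the velocity when one moves to the other in unit time.\<close>

definition pdist :: "(real^'n::finite) \<times> real \<Rightarrow> (real^'n) \<times> real \<Rightarrow> real" where
  "pdist P P' = norm (fst P' - fst P) + \<bar>snd P' - snd P\<bar>"

lemma pdist_nonneg: "pdist P P' \<ge> 0"
  by (simp add: pdist_def)

text \<open>Polygonal paths of cubes with total length \<open>l\<close>. Membership in
  \<open>S\<close> is imposed on the segments, so the trivial path says nothing about its end
  point.\<close>

inductive linked :: "((real^'n::finite) \<times> real) set \<Rightarrow> real \<Rightarrow> (real^'n) \<times> real \<Rightarrow> (real^'n) \<times> real \<Rightarrow> bool"
  for S where
  refl: "linked S 0 P P"
| step: "linked S l P P' \<Longrightarrow> closed_segment P' P'' \<subseteq> S \<Longrightarrow> linked S (l + pdist P' P'') P P''"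

lemma linked_nonneg: "linked S l P P' \<Longrightarrow> l \<ge> 0"
  by (induction rule: linked.induct) (simp_all add: pdist_nonneg del: split_paired_All)

locale weakly_diff =
  fixes \<Omega> :: "(real^'n::finite) set" and m :: nat and u :: "real^'n \<Rightarrow> real"
  assumes open_dom: "open \<Omega>" and wd: "weakly_differentiable m \<Omega> u"
begin

text \<open>Fixes one representative of each weak derivative. In particular \<open>w []\<close>
  agrees with \<open>u\<close> only almost everywhere.\<close>

definition w :: "'n list \<Rightarrow> real^'n \<Rightarrow> real" where
  "w js = weak_derivative \<Omega> js u"

lemma w: "length js \<le> m \<Longrightarrow> has_weak_derivative \<Omega> js u (w js)"
  unfolding w_def weak_derivative_def
  by (rule someI_ex[where P = "has_weak_derivative \<Omega> js u"]) (use wd in \<open>simp add: weakly_differentiable_def\<close>)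

lemma w_step: "length js < m \<Longrightarrow> has_weak_derivative \<Omega> [i] (w js) (w (js @ [i]))"
  by (rule has_weak_derivative_snoc[of _ js u]) (auto intro: w)

lemma w_locally_integrable: "length js \<le> m \<Longrightarrow> locally_integrable \<Omega> (w js)"
  using w by (auto simp: has_weak_derivative_def)

definition F :: "nat \<Rightarrow> (real^'n) \<times> real \<Rightarrow> real" where
  "F j P = (\<Sum>js | length js = j. mean (\<lambda>y. \<bar>w js y\<bar>) (fst P) (snd P))"

lemma finite_lists [simp]: "finite {js :: 'n list. length js = j}"
  using finite_lists_length_eq[of "UNIV :: 'n set" j] by simp

lemma card_lists [simp]: "card {js :: 'n list. length js = j} = CARD('n) ^ j"
  using card_lists_length_eq[of "UNIV :: 'n set" j] by simp

definition good :: "(real^'n) \<times> real \<Rightarrow> bool" where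
  "good P \<longleftrightarrow> snd P > 0 \<and> cube (fst P) (snd P) \<subseteq> \<Omega>"

lemma sum_mean_le_F:
  assumes js: "length js = j" and P: "snd P > 0"
  shows "(\<Sum>i\<in>UNIV. mean (\<lambda>y. \<bar>w (js @ [i]) y\<bar>) (fst P) (snd P)) \<le> F (Suc j) P"
proof -
  have inj: "inj_on (\<lambda>i. js @ [i]) UNIV" by (auto simp: inj_on_def)
  have "(\<Sum>i\<in>UNIV. mean (\<lambda>y. \<bar>w (js @ [i]) y\<bar>) (fst P) (snd P)) =
      (\<Sum>ks\<in>range (\<lambda>i. js @ [i]). mean (\<lambda>y. \<bar>w ks y\<bar>) (fst P) (snd P))"
    by (simp add: sum.reindex[OF inj] o_def)
  also have "\<dots> \<le> F (Suc j) P"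
    unfolding F_def using js P by (intro sum_mono2) (auto intro: mean_abs_nonneg)
  finally show ?thesis .
qed

lemma segment_between:
  assumes "closed_segment P P' \<subseteq> S" "s \<in> {0..1}"
  shows "(fst P + s *\<^sub>R (fst P' - fst P), snd P + s * (snd P' - snd P)) \<in> S"
proof -
  have "(fst P + s *\<^sub>R (fst P' - fst P), snd P + s * (snd P' - snd P)) = (1 - s) *\<^sub>R P + s *\<^sub>R P'"
    by (rule prod_eqI) (auto simp: algebra_simps)
  then show ?thesis
    using assms by (auto simp: closed_segment_def)
qed

text \<open>Applies transport to each derivative of order \<open>j\<close>; the factor
  \<open>CARD('n) ^ j\<close> counts the lists of directions. For order 0 the signed mean is
  controlled as well, which later makes the means converge.\<close>

lemma F_segment:
  fixes B :: real
  assumes j: "j < m" and seg: "closed_segment P P' \<subseteq> S"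
    and S: "\<And>Q. Q \<in> S \<Longrightarrow> good Q" "\<And>Q. Q \<in> S \<Longrightarrow> F (Suc j) Q \<le> B"
  shows "F j P' \<le> F j P + CARD('n) ^ j * (pdist P P' * B)"
    and "j = 0 \<Longrightarrow> \<bar>mean (w []) (fst P') (snd P') - mean (w []) (fst P) (snd P)\<bar> \<le> pdist P P' * B"
proof -
  have PS: "P \<in> S" "P' \<in> S" using seg by auto
  have pos: "snd P > 0" "snd P' > 0" using S(1) PS by (auto simp: good_def)
  have sub: "cubes_between (fst P, snd P) (fst P', snd P') s \<subseteq> \<Omega>" if "s \<in> {0..1}" for s
    using S(1)[OF segment_between[OF seg that]] by (simp add: good_def cubes_between_def)
  have bd: "(\<Sum>i\<in>UNIV. mean (\<lambda>y. \<bar>w (js @ [i]) y\<bar>) (fst P + s *\<^sub>R (fst P' - fst P)) (snd P + s * (snd P' - snd P))) \<le> B"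
    if "s \<in> {0..1}" "length js = j" for s js
  proof -
    let ?Q = "(fst P + s *\<^sub>R (fst P' - fst P), snd P + s * (snd P' - snd P))"
    have Q: "?Q \<in> S" by (rule segment_between[OF seg that(1)])
    have "snd ?Q > 0" using S(1)[OF Q] by (simp only: good_def)
    from sum_mean_le_F[OF that(2) this] S(2)[OF Q] show ?thesis by simp
  qed
  have "mean (\<lambda>y. \<bar>w js y\<bar>) (fst P') (snd P') \<le> mean (\<lambda>y. \<bar>w js y\<bar>) (fst P) (snd P) + pdist P P' * B"
    if "length js = j" for js
    unfolding pdist_def using that j
    by (intro transport_abs[OF w_step pos sub bd]) auto
  then have "F j P' \<le> (\<Sum>js::'n list | length js = j. mean (\<lambda>y. \<bar>w js y\<bar>) (fst P) (snd P) + pdist P P' * B)"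
    unfolding F_def by (intro sum_mono) auto
  also have "\<dots> = F j P + CARD('n) ^ j * (pdist P P' * B)"
    by (simp add: F_def sum.distrib)
  finally show "F j P' \<le> F j P + CARD('n) ^ j * (pdist P P' * B)" .
  show "\<bar>mean (w []) (fst P') (snd P') - mean (w []) (fst P) (snd P)\<bar> \<le> pdist P P' * B" if "j = 0"
    unfolding pdist_def using that j bd[where js = "[]"]
    by (intro transport_mean[OF w_step pos sub]) auto
qed

lemma F_linked:
  fixes l B :: real
  assumes "linked S l P P'" and j: "j < m"
    and S: "\<And>Q. Q \<in> S \<Longrightarrow> good Q" "\<And>Q. Q \<in> S \<Longrightarrow> F (Suc j) Q \<le> B"
  shows "F j P' \<le> F j P + CARD('n) ^ j * (l * B)"
  using assms(1)
proof (induction rule: linked.induct)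
  case (step l P P' P'')
  from F_segment(1)[OF j step.hyps(2) S] step.IH show ?case by (simp add: algebra_simps)
qed simp

end

text \<open>
  \<open>majorant b0 \<kappa> \<rho> \<beta> i k\<close> bounds the averages of the derivatives of order \<open>m - i\<close> over the cubes of
  the \<open>k\<close>-th generation.
\<close>

primrec majorant :: "real \<Rightarrow> real \<Rightarrow> (nat \<Rightarrow> real) \<Rightarrow> (nat \<Rightarrow> real) \<Rightarrow> nat \<Rightarrow> nat \<Rightarrow> real" where
  "majorant b0 \<kappa> \<rho> \<beta> 0 k = \<beta> k"
| "majorant b0 \<kappa> \<rho> \<beta> (Suc i) k = b0 + (\<Sum>l<k. \<kappa> * \<rho> (Suc l) * majorant b0 \<kappa> \<rho> \<beta> i (Suc l))"

lemma majorant_nonneg: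
  assumes "b0 \<ge> 0" "\<kappa> \<ge> 0" "\<And>k. \<rho> k \<ge> 0" "\<And>k. \<beta> k \<ge> 0"
  shows "majorant b0 \<kappa> \<rho> \<beta> i k \<ge> 0"
  by (induction i arbitrary: k) (use assms in \<open>auto intro!: add_nonneg_nonneg sum_nonneg mult_nonneg_nonneg\<close>)

text \<open>A discrete Hardy inequality for geometrically decaying weights. The second term on the
  left feeds the induction: the step costs \<open>2 * \<rho> (Suc K)\<close> times the old partial
  sum, and \<open>\<rho> K\<close> times it is available.\<close>

lemma weighted_partial_sums:
  fixes \<rho> b :: "nat \<Rightarrow> real"
  assumes \<rho>: "\<And>k. 0 \<le> \<rho> k" "\<And>k. 2 * \<rho> (Suc k) \<le> \<rho> k" and b: "\<And>k. b k \<ge> 0"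
  shows "(\<Sum>k\<le>K. \<rho> k * (\<Sum>l\<le>k. b l)) + \<rho> K * (\<Sum>l\<le>K. b l) \<le> 2 * (\<Sum>l\<le>K. \<rho> l * b l)"
proof (induction K)
  case (Suc K)
  have "2 * \<rho> (Suc K) * (\<Sum>l\<le>K. b l) \<le> \<rho> K * (\<Sum>l\<le>K. b l)"
    using \<rho> b by (intro mult_right_mono sum_nonneg) auto
  with Suc show ?case by (simp add: algebra_simps)
qed simp

text \<open>Each integration trades one power of the side: by the discrete Hardy inequality the sum
  of \<rho>^(m-i) times the i-th majorant is controlled by the sum for i-1 with one power more. At i
  = m no power is left, and the recursion itself gives a bound uniform in k.\<close>

lemma majorant_sums:
  fixes \<beta> :: "nat \<Rightarrow> real"
  assumes nn: "b0 \<ge> 0" "\<kappa> \<ge> 0" "\<And>k. \<beta> k \<ge> 0" and R: "0 < R" "R \<le> 1"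
  defines "\<rho> \<equiv> \<lambda>k. R / 2 ^ k"
  assumes S: "\<And>K. (\<Sum>k\<le>K. \<rho> k ^ m * \<beta> k) \<le> S"
  shows "i < m \<Longrightarrow> (\<Sum>k\<le>K. \<rho> k ^ (m - i) * majorant b0 \<kappa> \<rho> \<beta> i k) \<le> (2 + 2 * \<kappa>) ^ i * (i * b0 + S)"
    and "1 \<le> m \<Longrightarrow> majorant b0 \<kappa> \<rho> \<beta> m k \<le> (2 + 2 * \<kappa>) ^ m * (m * b0 + S)"
proof -
  have \<rho>: "0 \<le> \<rho> k" "\<rho> k \<le> 1" "2 * \<rho> (Suc k) = \<rho> k" for k
  proof -
    have "(1::real) \<le> 2 ^ k" by simp
    then have "R \<le> 2 ^ k" using R by linarith
    then show "0 \<le> \<rho> k" "\<rho> k \<le> 1" "2 * \<rho> (Suc k) = \<rho> k" using R by (auto simp: \<rho>_def)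
  qed
  let ?M = "majorant b0 \<kappa> \<rho> \<beta>"
  have Mnn: "?M i k \<ge> 0" for i k by (rule majorant_nonneg) (use nn \<rho> in auto)
  have S0: "S \<ge> 0"
  proof -
    have "0 \<le> (\<Sum>k\<le>0. \<rho> k ^ m * \<beta> k)" using nn \<rho> by (intro sum_nonneg mult_nonneg_nonneg) auto
    then show ?thesis using S[of 0] by linarith
  qed
  \<comment> \<open>Increments of the next majorant, with \<open>b0\<close> stored at index 0, so
    that \<open>?M (Suc i) k\<close> is the partial sum up to and including k.\<close>
  define b where "b i k = (case k of 0 \<Rightarrow> b0 | Suc l \<Rightarrow> \<kappa> * \<rho> (Suc l) * ?M i (Suc l))" for i k
  have bnn: "b i k \<ge> 0" for i k
    using nn \<rho> Mnn by (auto simp: b_def split: nat.split)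
  have M_Suc: "?M (Suc i) k = (\<Sum>l\<le>k. b i l)" for i k
    by (simp add: b_def sum.atMost_shift)
  have bsum: "(\<Sum>l\<le>K. \<rho> l ^ j * b i l) \<le> b0 + \<kappa> * (\<Sum>l\<le>K. \<rho> l ^ Suc j * ?M i l)" for i j K
  proof -
    have "(\<Sum>l\<le>K. \<rho> l ^ j * b i l) \<le> (\<Sum>l\<le>K. (if l = 0 then b0 else 0) + \<kappa> * (\<rho> l ^ Suc j * ?M i l))"
    proof (rule sum_mono)
      fix l
      show "\<rho> l ^ j * b i l \<le> (if l = 0 then b0 else 0) + \<kappa> * (\<rho> l ^ Suc j * ?M i l)"
      proof (cases l)
        case 0
        have "\<rho> 0 ^ j * b0 \<le> 1 * b0" using \<rho>[of 0] nn by (intro mult_right_mono power_le_one) auto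
        moreover have "0 \<le> \<kappa> * (\<rho> 0 ^ Suc j * ?M i 0)"
          using nn \<rho> Mnn by (intro mult_nonneg_nonneg zero_le_power) auto
        ultimately show ?thesis using 0 by (simp add: b_def)
      next
        case (Suc l')
        then show ?thesis by (simp add: b_def mult_ac)
      qed
    qed
    also have "\<dots> = b0 + \<kappa> * (\<Sum>l\<le>K. \<rho> l ^ Suc j * ?M i l)"
      by (simp add: sum.distrib sum_distrib_left sum.delta)
    finally show ?thesis .
  qed
  let ?c = "2 + 2 * \<kappa>"
  have c1: "1 \<le> ?c ^ i" for i using nn by (intro one_le_power) auto
  have A: "(\<Sum>k\<le>K. \<rho> k ^ (m - i) * ?M i k) \<le> ?c ^ i * (i * b0 + S)" if "i < m" for i K
    using that
  proof (induction i arbitrary: K)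
    case 0
    then show ?case using S by simp
  next
    case (Suc i)
    define j where "j = m - Suc i"
    have j: "1 \<le> j" "m - i = Suc j" using Suc.prems by (auto simp: j_def)
    \<comment> \<open>Halving the weight needs a positive exponent; this is why i = m is treated
      apart from this induction.\<close>
    have "2 * \<rho> (Suc k) ^ j \<le> \<rho> k ^ j" for k
    proof -
      have "2 * \<rho> (Suc k) ^ j \<le> 2 ^ j * \<rho> (Suc k) ^ j"
        using self_le_power[of "2::real" j] j \<rho> by (intro mult_right_mono) auto
      also have "\<dots> = \<rho> k ^ j" by (simp add: \<rho>(3)[of k, symmetric] power_mult_distrib)
      finally show ?thesis .
    qed
    then have "(\<Sum>k\<le>K. \<rho> k ^ j * (\<Sum>l\<le>k. b i l)) + \<rho> K ^ j * (\<Sum>l\<le>K. b i l) \<le> 2 * (\<Sum>l\<le>K. \<rho> l ^ j * b i l)"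
      using \<rho> bnn by (intro weighted_partial_sums) auto
    moreover have "0 \<le> \<rho> K ^ j * (\<Sum>l\<le>K. b i l)"
      using \<rho> bnn by (intro mult_nonneg_nonneg sum_nonneg) auto
    ultimately have "(\<Sum>k\<le>K. \<rho> k ^ j * ?M (Suc i) k) \<le> 2 * (\<Sum>l\<le>K. \<rho> l ^ j * b i l)"
      unfolding M_Suc by linarith
    also have "\<dots> \<le> 2 * (b0 + \<kappa> * (\<Sum>l\<le>K. \<rho> l ^ Suc j * ?M i l))"
      using bsum[of j i K] by simp
    also have "\<dots> \<le> 2 * (b0 + \<kappa> * (?c ^ i * (i * b0 + S)))"
      using Suc.IH[of K] Suc.prems nn j by (intro mult_left_mono add_left_mono) auto
    also have "\<dots> \<le> ?c ^ Suc i * (Suc i * b0 + S)"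
    proof -
      let ?X = "?c ^ i"
      have X: "1 \<le> ?X" by (rule c1)
      have "2 * b0 \<le> 2 * (?X * b0)"
        using mult_right_mono[OF X nn(1)] by simp
      moreover have "0 \<le> 2 * \<kappa> * ?X * b0 + 2 * (?X * (i * b0 + S))"
        using nn S0 X by (intro add_nonneg_nonneg mult_nonneg_nonneg) auto
      ultimately show ?thesis by (simp add: algebra_simps)
    qed
    finally show ?case by (simp add: j_def)
  qed
  then show "i < m \<Longrightarrow> (\<Sum>k\<le>K. \<rho> k ^ (m - i) * ?M i k) \<le> ?c ^ i * (i * b0 + S)" .
  show "?M m k \<le> ?c ^ m * (m * b0 + S)" if m1: "1 \<le> m"
  proof -
    obtain i where i: "m = Suc i" using m1 by (cases m) auto
    have "?M m k = (\<Sum>l\<le>k. \<rho> l ^ 0 * b i l)" unfolding i M_Suc by simp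
    also have "\<dots> \<le> b0 + \<kappa> * (\<Sum>l\<le>k. \<rho> l ^ Suc 0 * ?M i l)"
      by (rule bsum)
    also have "\<dots> \<le> b0 + \<kappa> * (?c ^ i * (i * b0 + S))"
      using A[of i k] nn i by (intro mult_left_mono add_left_mono) auto
    also have "\<dots> \<le> ?c ^ m * (m * b0 + S)"
    proof -
      let ?X = "?c ^ i"
      have X: "1 \<le> ?X" by (rule c1)
      have "b0 \<le> ?X * b0"
        using mult_right_mono[OF X nn(1)] by simp
      moreover have "0 \<le> 2 * \<kappa> * ?X * b0 + ?X * b0 + 2 * (?X * (i * b0 + S)) + \<kappa> * (?X * (i * b0 + S))"
        using nn S0 X by (intro add_nonneg_nonneg mult_nonneg_nonneg) auto
      ultimately show ?thesis by (simp add: i algebra_simps)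
    qed
    finally show ?thesis .
  qed
qed

context weakly_diff
begin

text \<open>Outer induction on the number \<open>i\<close> of orders gained, inner induction on the
  generation \<open>k\<close>. The path to a cube of generation \<open>Suc k\<close> runs inside
  \<open>C (Suc k)\<close>, where the bound for the next higher order is already known.\<close>

lemma chain:
  fixes C :: "nat \<Rightarrow> ((real^'n) \<times> real) set" and b0 \<Lambda> :: real and \<rho> \<beta> :: "nat \<Rightarrow> real"
  assumes nn: "b0 \<ge> 0" "\<Lambda> \<ge> 0" "\<And>k. \<rho> k \<ge> 0" "\<And>k. \<beta> k \<ge> 0"
    and good: "\<And>k Q. Q \<in> C k \<Longrightarrow> good Q"
    and link: "\<And>k Q. Q \<in> C (Suc k) \<Longrightarrow> \<exists>P\<in>C k. \<exists>l\<le>\<Lambda> * \<rho> (Suc k). linked (C (Suc k)) l P Q"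
    and base: "\<And>j Q. j \<le> m \<Longrightarrow> Q \<in> C 0 \<Longrightarrow> F j Q \<le> b0"
    and top: "\<And>k Q. Q \<in> C k \<Longrightarrow> F m Q \<le> \<beta> k"
  shows "i \<le> m \<Longrightarrow> Q \<in> C k \<Longrightarrow> F (m - i) Q \<le> majorant b0 (CARD('n) ^ m * \<Lambda>) \<rho> \<beta> i k"
proof (induction i arbitrary: k Q)
  case 0
  then show ?case using top by simp
next
  case (Suc i)
  let ?\<kappa> = "real (CARD('n) ^ m) * \<Lambda>"
  let ?M = "majorant b0 ?\<kappa> \<rho> \<beta>"
  have Mnn: "?M i k \<ge> 0" for i k by (rule majorant_nonneg) (use nn in auto)
  define j where "j = m - Suc i"
  have j: "j < m" "m - i = Suc j" using Suc.prems by (auto simp: j_def)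
  note outer = Suc.IH and im = Suc.prems(1)
  from Suc.prems(2) show ?case
    unfolding j_def[symmetric]
  proof (induction k arbitrary: Q)
    case 0
    then show ?case using base j by simp
  next
    case (Suc k)
    obtain P l where P: "P \<in> C k" "l \<le> \<Lambda> * \<rho> (Suc k)" "linked (C (Suc k)) l P Q"
      using link[OF Suc.prems] by blast
    have "F j Q \<le> F j P + CARD('n) ^ j * (l * ?M i (Suc k))"
    proof (rule F_linked[OF P(3) j(1)])
      show "F (Suc j) Q \<le> ?M i (Suc k)" if "Q \<in> C (Suc k)" for Q
        using outer[OF _ that] im j by simp
    qed (use good in auto)
    also have "F j P \<le> ?M (Suc i) k" by (rule Suc.IH[OF P(1)])
    also have "CARD('n) ^ j * (l * ?M i (Suc k)) \<le> CARD('n) ^ m * (\<Lambda> * \<rho> (Suc k) * ?M i (Suc k))"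
    proof (intro mult_mono)
      show "real (CARD('n) ^ j) \<le> real (CARD('n) ^ m)"
        using j by (intro of_nat_mono power_increasing) auto
    qed (use P(2) Mnn nn linked_nonneg[OF P(3)] in \<open>auto intro: mult_nonneg_nonneg\<close>)
    finally show ?case by (simp add: mult_ac)
  qed
qed

end


section \<open>Rearrangements\<close>

lemma layer_cake:
  assumes "sigma_finite_measure M" and g [measurable]: "g \<in> borel_measurable M"
  shows "(\<integral>\<^sup>+x. g x \<partial>M) =
    (\<integral>\<^sup>+t. emeasure M {x \<in> space M. ennreal t < g x} * indicator {0<..} t \<partial>lborel)"
proof -
  interpret M: sigma_finite_measure M by fact
  interpret P: pair_sigma_finite M lborel ..
  have a: "(\<integral>\<^sup>+t. (if 0 < t \<and> ennreal t < a then 1 else 0) \<partial>lborel) = a" for a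
  proof (cases a)
    case (real b)
    have "(\<integral>\<^sup>+t. (if 0 < t \<and> ennreal t < a then 1 else 0) \<partial>lborel) = (\<integral>\<^sup>+t. indicator {0<..<b} t \<partial>lborel)"
      using real by (intro nn_integral_cong) (auto simp: indicator_def ennreal_less_iff)
    then show ?thesis using real by simp
  next
    case top
    have "(\<integral>\<^sup>+t. (if 0 < t \<and> ennreal t < a then 1 else 0) \<partial>lborel) = (\<integral>\<^sup>+t. indicator ({0<..} :: real set) t * 1 \<partial>lborel)"
      using top by (intro nn_integral_cong) (auto simp: indicator_def)
    also have "\<dots> = emeasure lborel ({0<..} :: real set)" by simp
    also have "\<dots> = \<infinity>"
    proof -
      have "ennreal k \<le> emeasure lborel ({0<..} :: real set)" if "k > 0" for k :: real
        using emeasure_mono[of "{0<..<k}" "{0<..} :: real set" lborel] that by (simp add: subset_iff)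
      then have "of_nat k \<le> emeasure lborel ({0<..} :: real set)" for k :: nat
        by (cases "k = 0") (auto simp: ennreal_of_nat_eq_real_of_nat)
      then have "(SUP k. of_nat k) \<le> emeasure lborel ({0<..} :: real set)"
        by (intro SUP_least)
      then show ?thesis by (simp add: ennreal_SUP_of_nat_eq_top top_unique)
    qed
    finally show ?thesis using top by simp
  qed
  have "(\<integral>\<^sup>+x. g x \<partial>M) = (\<integral>\<^sup>+x. \<integral>\<^sup>+t. (if 0 < t \<and> ennreal t < g x then 1 else 0) \<partial>lborel \<partial>M)"
    by (simp add: a)
  also have "\<dots> = (\<integral>\<^sup>+t. \<integral>\<^sup>+x. (if 0 < t \<and> ennreal t < g x then 1 else 0) \<partial>M \<partial>lborel)"
    by (rule P.Fubini'[symmetric]) measurable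
  also have "\<dots> = (\<integral>\<^sup>+t. emeasure M {x \<in> space M. ennreal t < g x} * indicator {0<..} t \<partial>lborel)"
  proof (intro nn_integral_cong)
    fix t :: real
    have "(\<integral>\<^sup>+x. (if 0 < t \<and> ennreal t < g x then 1 else 0) \<partial>M) =
        (\<integral>\<^sup>+x. indicator {0<..} t * indicator {x \<in> space M. ennreal t < g x} x \<partial>M)"
      by (intro nn_integral_cong) (auto simp: indicator_def)
    also have "\<dots> = indicator {0<..} t * emeasure M {x \<in> space M. ennreal t < g x}"
      by (rule nn_integral_cmult_indicator) measurable
    finally show "(\<integral>\<^sup>+x. (if 0 < t \<and> ennreal t < g x then 1 else 0) \<partial>M) =
        emeasure M {x \<in> space M. ennreal t < g x} * indicator {0<..} t"
      by (simp add: mult.commute)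
  qed
  finally show ?thesis .
qed

text \<open>Superlevel sets are closed downwards, so minus their indicator is a monotone real
  function and hence measurable.\<close>

lemma antimono_borel_measurable:
  fixes f :: "real \<Rightarrow> ennreal"
  assumes "antimono f"
  shows "f \<in> borel_measurable borel"
proof (rule borel_measurableI_greater)
  fix y
  let ?S = "{x. y < f x}"
  have down: "a \<in> ?S" if "a \<le> b" "b \<in> ?S" for a b
    using that antimonoD[OF assms that(1)] by auto
  have "mono (\<lambda>x. - indicator ?S x :: real)"
  proof (rule monoI)
    fix a b :: real assume "a \<le> b"
    with down[of a b] show "- indicator ?S a \<le> (- indicator ?S b :: real)"
      by (auto simp: indicator_def)
  qed
  then have "(\<lambda>x. - indicator ?S x :: real) \<in> borel_measurable borel"
    by (rule borel_measurable_mono)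
  then have "(\<lambda>x. - indicator ?S x :: real) -` {..<0} \<inter> space borel \<in> sets borel"
    by (rule measurable_sets) simp
  moreover have "(\<lambda>x. - indicator ?S x :: real) -` {..<0} \<inter> space borel = ?S"
    by (auto simp: indicator_def)
  ultimately have "?S \<in> sets borel" by simp
  then show "{x \<in> space borel. y < f x} \<in> sets borel" by simp
qed

lemma rearr_antimono: "antimono (rearr E f)"
proof (rule antimonoI)
  fix s s' :: real assume "s \<le> s'"
  then show "rearr E f s' \<le> rearr E f s"
    unfolding rearr_def by (intro Inf_superset_mono) (auto intro: order_trans ennreal_leI)
qed

lemma rearr_measurable [measurable]: "rearr E f \<in> borel_measurable borel"
  by (rule antimono_borel_measurable[OF rearr_antimono])

text \<open>If the rearrangement at \<open>s\<close> were at most t, all sets where f > b with b > t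
  would have measure at most \<open>s\<close>. As b decreases to t these sets increase to the set
  where f > t, whose measure would then be at most \<open>s\<close> too.\<close>

lemma less_rearr:
  assumes f: "f \<in> borel_measurable (lebesgue_on E)" and E: "E \<in> sets lebesgue"
    and less: "ennreal s < emeasure lebesgue {x \<in> E. f x > ennreal t}"
  shows "ennreal t < rearr E f s"
proof (rule ccontr)
  assume "\<not> ennreal t < rearr E f s"
  then have le: "rearr E f s \<le> ennreal t" by simp
  have meas: "{x \<in> E. f x > a} \<in> sets lebesgue" for a
  proof -
    have "{x \<in> space (lebesgue_on E). f x > a} \<in> sets (lebesgue_on E)"
      using f by measurable
    then show ?thesis using E by (simp add: sets_restrict_space_iff space_restrict_space)
  qed
  have small: "emeasure lebesgue {x \<in> E. f x > b} \<le> ennreal s" if "ennreal t < b" for b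
  proof -
    have "rearr E f s < b" using le that by simp
    then obtain a where "a < b" "emeasure lebesgue {x \<in> E. f x > a} \<le> ennreal s"
      unfolding rearr_def Inf_less_iff by blast
    moreover have "emeasure lebesgue {x \<in> E. f x > b} \<le> emeasure lebesgue {x \<in> E. f x > a}"
      using \<open>a < b\<close> by (intro emeasure_mono meas) auto
    ultimately show ?thesis by simp
  qed
  define A where "A n = {x \<in> E. f x > ennreal t + ennreal (1 / Suc n)}" for n :: nat
  have "(\<Union>n. A n) = {x \<in> E. f x > ennreal t}"
  proof (intro equalityI subsetI)
    fix x assume "x \<in> (\<Union>n. A n)"
    then show "x \<in> {x \<in> E. f x > ennreal t}"
      by (auto simp: A_def elim!: le_less_trans[rotated])
  next
    fix x assume x: "x \<in> {x \<in> E. f x > ennreal t}"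
    show "x \<in> (\<Union>n. A n)"
    proof (cases "f x")
      case (real b)
      show ?thesis
      proof (cases "t \<ge> 0")
        case True
        have "t < b" using x real True by (auto simp: ennreal_less_iff)
        then obtain n where "inverse (real (Suc n)) < b - t" using reals_Archimedean[of "b - t"] by auto
        then have "ennreal t + ennreal (1 / Suc n) < f x"
          using True real by (simp add: ennreal_plus[symmetric] ennreal_less_iff inverse_eq_divide del: ennreal_plus)
        then show ?thesis using x by (auto simp: A_def)
      next
        case False
        have "0 < b" using x real False by (auto simp: ennreal_neg)
        then obtain n where "inverse (real (Suc n)) < b" using reals_Archimedean[of b] by auto
        then have "ennreal t + ennreal (1 / Suc n) < f x"
          using False real by (simp add: ennreal_neg ennreal_less_iff inverse_eq_divide)
        then show ?thesis using x by (auto simp: A_def)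
      qed
    next
      case top
      then show ?thesis using x by (auto simp: A_def ennreal_add_less_top less_top[symmetric])
    qed
  qed
  moreover have "incseq A"
  proof (rule incseq_SucI)
    fix n
    have "ennreal t + ennreal (1 / Suc (Suc n)) \<le> ennreal t + ennreal (1 / Suc n)"
      by (intro add_left_mono ennreal_leI) (simp add: frac_le)
    then show "A n \<le> A (Suc n)" unfolding A_def by (auto elim!: le_less_trans[rotated] simp del: of_nat_Suc)
  qed
  moreover have "range A \<subseteq> sets lebesgue" using meas by (auto simp: A_def)
  ultimately have "emeasure lebesgue {x \<in> E. f x > ennreal t} = (SUP n. emeasure lebesgue (A n))"
    using SUP_emeasure_incseq[of A lebesgue] by (simp only: mem_Collect_eq)
  also have "\<dots> \<le> ennreal s"
  proof (rule SUP_least)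
    fix n
    have "ennreal t < ennreal t + ennreal (1 / Suc n)"
      using ennreal_add_left_cancel_less[of "ennreal t" 0 "ennreal (1 / Suc n)"] by simp
    then show "emeasure lebesgue (A n) \<le> ennreal s" unfolding A_def by (rule small)
  qed
  finally show False using less by simp
qed

text \<open>Level sets are compared through the layer cake formula: if f exceeds t on a part of
  \<open>Q\<close> of measure b, then its rearrangement exceeds t on (0, b), and b is at most the
  measure of \<open>Q\<close>.\<close>

lemma nn_integral_le_rearr:
  assumes f: "f \<in> borel_measurable (lebesgue_on E)" and E: "E \<in> sets lebesgue"
    and Q: "Q \<in> lmeasurable" "Q \<subseteq> E"
  shows "(\<integral>\<^sup>+x\<in>Q. f x \<partial>lebesgue) \<le> (\<integral>\<^sup>+s\<in>{0<..<measure lebesgue Q}. rearr E f s \<partial>lebesgue)"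
proof -
  let ?v = "measure lebesgue Q"
  have Qs: "Q \<in> sets lebesgue" using Q by (auto dest: fmeasurableD)
  have fQ: "f \<in> borel_measurable (lebesgue_on Q)" by (rule measurable_restrict_mono[OF f Q(2)])
  have sf1: "sigma_finite_measure (lebesgue_on Q)"
    using finite_measure_lebesgue_on[OF Q(1)] by (rule finite_measure.axioms)
  have sf2: "sigma_finite_measure (lebesgue_on {0<..<?v})"
    using finite_measure_lebesgue_on[of "{0<..<?v}"] by (auto dest: finite_measure.axioms)
  have rm: "rearr E f \<in> borel_measurable (lebesgue_on {0<..<?v})"
    by (intro measurable_restrict_space1 measurable_completion) simp
  have "(\<integral>\<^sup>+x\<in>Q. f x \<partial>lebesgue) = (\<integral>\<^sup>+x. f x \<partial>lebesgue_on Q)"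
    using Qs by (simp add: nn_integral_restrict_space)
  also have "\<dots> = (\<integral>\<^sup>+t. emeasure (lebesgue_on Q) {x \<in> space (lebesgue_on Q). ennreal t < f x} * indicator {0<..} t \<partial>lborel)"
    by (rule layer_cake[OF sf1 fQ])
  also have "\<dots> \<le> (\<integral>\<^sup>+t. emeasure (lebesgue_on {0<..<?v}) {s \<in> space (lebesgue_on {0<..<?v}). ennreal t < rearr E f s}
      * indicator {0<..} t \<partial>lborel)"
  proof (intro nn_integral_mono mult_right_mono)
    fix t :: real
    define a where "a = emeasure (lebesgue_on Q) {x \<in> space (lebesgue_on Q). ennreal t < f x}"
    have Qt: "{x \<in> Q. ennreal t < f x} \<in> sets lebesgue"
    proof -
      have "{x \<in> space (lebesgue_on Q). ennreal t < f x} \<in> sets (lebesgue_on Q)"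
        using fQ by measurable
      then show ?thesis using Qs by (simp add: sets_restrict_space_iff space_restrict_space)
    qed
    have Et: "{x \<in> E. ennreal t < f x} \<in> sets lebesgue"
    proof -
      have "{x \<in> space (lebesgue_on E). ennreal t < f x} \<in> sets (lebesgue_on E)"
        using f by measurable
      then show ?thesis using E by (simp add: sets_restrict_space_iff space_restrict_space)
    qed
    have a: "a = emeasure lebesgue {x \<in> Q. ennreal t < f x}"
      unfolding a_def using Qs by (subst emeasure_restrict_space) (auto simp: space_restrict_space)
    have a1: "a \<le> emeasure lebesgue {x \<in> E. ennreal t < f x}"
      unfolding a using Q(2) by (intro emeasure_mono Et) auto
    have "a \<le> emeasure lebesgue Q" unfolding a by (intro emeasure_mono Qs) auto
    also have "\<dots> = ennreal ?v" by (rule emeasure_eq_measure2[OF Q(1)])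
    finally have a2: "a \<le> ennreal ?v" .
    then obtain b where b: "a = ennreal b" "0 \<le> b" "b \<le> ?v"
      by (cases a) (auto simp: top_unique)
    have "{0<..<b} \<subseteq> {s \<in> {0<..<?v}. ennreal t < rearr E f s}"
    proof
      fix s assume s: "s \<in> {0<..<b}"
      then have "ennreal s < a" using b by (simp add: ennreal_less_iff)
      then have "ennreal t < rearr E f s" using a1 by (intro less_rearr[OF f E]) (simp add: less_le_trans)
      then show "s \<in> {s \<in> {0<..<?v}. ennreal t < rearr E f s}" using s b by auto
    qed
    moreover have "{s \<in> {0<..<?v}. ennreal t < rearr E f s} \<in> sets lebesgue"
    proof -
      have "{s \<in> space borel. ennreal t < rearr E f s} \<in> sets borel" by measurable
      then have "{0<..<?v} \<inter> {s. ennreal t < rearr E f s} \<in> sets borel" by auto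
      moreover have "{s \<in> {0<..<?v}. ennreal t < rearr E f s} = {0<..<?v} \<inter> {s. ennreal t < rearr E f s}" by auto
      ultimately show ?thesis by simp
    qed
    ultimately have "emeasure lebesgue {0<..<b} \<le> emeasure lebesgue {s \<in> {0<..<?v}. ennreal t < rearr E f s}"
      by (intro emeasure_mono)
    moreover have "emeasure lebesgue {0<..<b} = a" using b by simp
    moreover have "emeasure (lebesgue_on {0<..<?v}) {s \<in> space (lebesgue_on {0<..<?v}). ennreal t < rearr E f s} =
        emeasure lebesgue {s \<in> {0<..<?v}. ennreal t < rearr E f s}"
      by (subst emeasure_restrict_space) (auto simp: space_restrict_space)
    ultimately show "emeasure (lebesgue_on Q) {x \<in> space (lebesgue_on Q). ennreal t < f x} \<le>
        emeasure (lebesgue_on {0<..<?v}) {s \<in> space (lebesgue_on {0<..<?v}). ennreal t < rearr E f s}"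
      by (simp add: a_def)
  qed simp
  also have "\<dots> = (\<integral>\<^sup>+s. rearr E f s \<partial>lebesgue_on {0<..<?v})"
    by (rule layer_cake[OF sf2 rm, symmetric])
  also have "\<dots> = (\<integral>\<^sup>+s\<in>{0<..<?v}. rearr E f s \<partial>lebesgue)"
    by (simp add: nn_integral_restrict_space)
  finally show ?thesis .
qed

section \<open>Averages of top order derivatives\<close>

text \<open>A geometric sum over the scales above \<sigma>: since \<open>1 \<le> e\<close> the ratio
  is at least 2, so the sum is at most twice its last term, and that term is at most
  \<open>(1 / \<sigma>) ^ e\<close>.\<close>

lemma sum_powers_below:
  fixes R \<sigma> :: real
  assumes R: "R > 0" and \<sigma>: "\<sigma> > 0" and e: "1 \<le> e"
  shows "(\<Sum>k\<le>K. if \<sigma> < R / 2 ^ k then (1 / (R / 2 ^ k)) ^ e else 0) \<le> 2 * (1 / \<sigma>) ^ e"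
proof (induction K)
  case 0
  have pos: "0 \<le> (1 / \<sigma>) ^ e" using \<sigma> by simp
  show ?case
  proof (cases "\<sigma> < R")
    case True
    then have "(1 / R) ^ e \<le> (1 / \<sigma>) ^ e"
      using R \<sigma> by (intro power_mono frac_le) auto
    with pos have "(1 / R) ^ e \<le> 2 * (1 / \<sigma>) ^ e" by linarith
    with True show ?thesis by simp
  qed (use pos in simp)
next
  case (Suc K)
  show ?case
  proof (cases "\<sigma> < R / 2 ^ Suc K")
    case False
    then show ?thesis using Suc by simp
  next
    case True
    have "(\<Sum>k\<le>K'. (1 / (R / 2 ^ k)) ^ e) \<le> 2 * (1 / (R / 2 ^ K')) ^ e" for K' :: nat
    proof (induction K')
      case 0
      show ?case using R by simp
    next
      case (Suc K')
      have two: "(2::real) \<le> 2 ^ e" using self_le_power[of "2::real" e] e by simp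
      have eq: "(1 / (R / 2 ^ Suc K')) ^ e = 2 ^ e * (1 / (R / 2 ^ K')) ^ e"
        by (simp add: power_mult_distrib[symmetric] del: power_mult_distrib)
      have "2 * (1 / (R / 2 ^ K')) ^ e \<le> 2 ^ e * (1 / (R / 2 ^ K')) ^ e"
        using two R by (intro mult_right_mono) auto
      then show ?case using Suc eq by simp
    qed
    from this[of "Suc K"]
    have "(\<Sum>k\<le>Suc K. if \<sigma> < R / 2 ^ k then (1 / (R / 2 ^ k)) ^ e else 0) \<le> 2 * (1 / (R / 2 ^ Suc K)) ^ e"
    proof (rule order_trans[rotated])
      show "(\<Sum>k\<le>Suc K. if \<sigma> < R / 2 ^ k then (1 / (R / 2 ^ k)) ^ e else 0) \<le> (\<Sum>k\<le>Suc K. (1 / (R / 2 ^ k)) ^ e)"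
        using R by (intro sum_mono) auto
    qed
    also have "(1 / (R / 2 ^ Suc K)) ^ e \<le> (1 / \<sigma>) ^ e"
      using True R \<sigma> by (intro power_mono frac_le) auto
    finally show ?thesis by simp
  qed
qed

text \<open>This is the functional of the Lorentz space L^(n/m,1) on \<Omega>, the endpoint space
  for boundedness. The whole sufficiency part passes through it.\<close>

definition potential :: "(real^'n::finite) set \<Rightarrow> nat \<Rightarrow> (real^'n \<Rightarrow> ennreal) \<Rightarrow> ennreal" where
  "potential \<Omega> m f = (\<integral>\<^sup>+s\<in>{0<..<measure lebesgue \<Omega>}.
     rearr \<Omega> f s * ennreal (s powr (m / CARD('n) - 1)) \<partial>lebesgue)"

text \<open>Because m < n the kernel s^(m/n-1) decreases, so on (0, v) it is at least its value at
  v.\<close>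

lemma rearr_integral_le_potential:
  fixes \<Omega> :: "(real^'n::finite) set"
  assumes m: "m < CARD('n)" and v: "0 < v" "v \<le> measure lebesgue \<Omega>"
  shows "(\<integral>\<^sup>+s\<in>{0<..<v}. rearr \<Omega> f s \<partial>lebesgue) \<le> ennreal (v powr (1 - m / CARD('n))) * potential \<Omega> m f"
proof -
  let ?p = "real m / real CARD('n) - 1"
  have p: "?p \<le> 0" using m by (simp add: field_simps)
  have "(\<integral>\<^sup>+s\<in>{0<..<v}. rearr \<Omega> f s \<partial>lebesgue) \<le>
      (\<integral>\<^sup>+s. ennreal (v powr - ?p) * (rearr \<Omega> f s * ennreal (s powr ?p) * indicator {0<..<measure lebesgue \<Omega>} s) \<partial>lebesgue)"
  proof (intro nn_integral_mono)
    fix s :: real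
    show "rearr \<Omega> f s * indicator {0<..<v} s \<le>
        ennreal (v powr - ?p) * (rearr \<Omega> f s * ennreal (s powr ?p) * indicator {0<..<measure lebesgue \<Omega>} s)"
    proof (cases "s \<in> {0<..<v}")
      case True
      have "1 = v powr - ?p * v powr ?p" using v by (simp add: powr_add[symmetric])
      also have "\<dots> \<le> v powr - ?p * s powr ?p"
        using True p by (intro mult_left_mono powr_mono2') auto
      finally have "1 \<le> ennreal (v powr - ?p) * ennreal (s powr ?p)"
        by (simp add: ennreal_mult[symmetric])
      then have "rearr \<Omega> f s * 1 \<le> rearr \<Omega> f s * (ennreal (v powr - ?p) * ennreal (s powr ?p))"
        by (intro mult_left_mono) auto
      then show ?thesis using True v by (simp add: mult_ac)
    qed simp
  qed
  also have "\<dots> = ennreal (v powr - ?p) * potential \<Omega> m f"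
    unfolding potential_def
    by (intro nn_integral_cmult borel_measurable_times_ennreal measurable_completion) auto
  finally show ?thesis by simp
qed

text \<open>After exchanging sum and integral, a point s counts only at the scales whose cubes have
  volume above s; the geometric sum over these scales produces the kernel of
  \<open>potential\<close>.\<close>

lemma rearr_dyadic_sum_le_potential:
  fixes \<Omega> :: "(real^'n::finite) set"
  assumes m: "m < CARD('n)" and R: "0 < R" "R ^ CARD('n) \<le> measure lebesgue \<Omega>"
  defines "\<rho> \<equiv> \<lambda>k. R / 2 ^ k"
  shows "(\<Sum>k\<le>K. ennreal ((1 / \<rho> k) ^ (CARD('n) - m)) * (\<integral>\<^sup>+s\<in>{0<..<\<rho> k ^ CARD('n)}. rearr \<Omega> f s \<partial>lebesgue))
    \<le> 2 * potential \<Omega> m f"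
proof -
  let ?n = "CARD('n)"
  let ?e = "?n - m"
  have \<rho>: "\<rho> k > 0" "\<rho> k \<le> R" for k
  proof -
    have "R / 2 ^ k \<le> R / 1" using R by (intro divide_left_mono) auto
    then show "\<rho> k > 0" "\<rho> k \<le> R" using R by (auto simp: \<rho>_def)
  qed
  have meas: "(\<lambda>s. rearr \<Omega> f s * indicator {0<..<v} s) \<in> borel_measurable lebesgue" for v :: real
    by (intro measurable_completion borel_measurable_times_ennreal) auto
  have "(\<Sum>k\<le>K. ennreal ((1 / \<rho> k) ^ ?e) * (\<integral>\<^sup>+s\<in>{0<..<\<rho> k ^ ?n}. rearr \<Omega> f s \<partial>lebesgue)) =
      (\<integral>\<^sup>+s. (\<Sum>k\<le>K. ennreal ((1 / \<rho> k) ^ ?e) * (rearr \<Omega> f s * indicator {0<..<\<rho> k ^ ?n} s)) \<partial>lebesgue)"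
    using meas by (simp add: nn_integral_sum nn_integral_cmult)
  also have "\<dots> \<le> (\<integral>\<^sup>+s. 2 * (rearr \<Omega> f s * ennreal (s powr (m / ?n - 1)) * indicator {0<..<measure lebesgue \<Omega>} s) \<partial>lebesgue)"
  proof (intro nn_integral_mono)
    fix s :: real
    show "(\<Sum>k\<le>K. ennreal ((1 / \<rho> k) ^ ?e) * (rearr \<Omega> f s * indicator {0<..<\<rho> k ^ ?n} s)) \<le>
        2 * (rearr \<Omega> f s * ennreal (s powr (m / ?n - 1)) * indicator {0<..<measure lebesgue \<Omega>} s)"
    proof (cases "0 < s \<and> s < R ^ ?n")
      case False
      have "indicator {0<..<\<rho> k ^ ?n} s = (0 :: ennreal)" for k
      proof -
        have "\<rho> k ^ ?n \<le> R ^ ?n" using \<rho>[of k] by (intro power_mono) auto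
        then show ?thesis using False by (auto simp: indicator_def)
      qed
      then show ?thesis by simp
    next
      case True
      \<comment> \<open>The side of a cube of volume s, so that
        \<open>s < \<rho> k ^ CARD('n)\<close> becomes the condition
        \<open>\<sigma> < \<rho> k\<close> of \<open>sum_powers_below\<close>.\<close>
      define \<sigma> where "\<sigma> = s powr (1 / ?n)"
      have \<sigma>: "\<sigma> > 0" using True by (simp add: \<sigma>_def)
      have \<sigma>n: "\<sigma> ^ ?n = s"
        using True by (simp add: \<sigma>_def powr_realpow[symmetric] powr_powr)
      have iff: "s < \<rho> k ^ ?n \<longleftrightarrow> \<sigma> < \<rho> k" for k
        unfolding \<sigma>n[symmetric] using \<sigma> \<rho>(1)[of k] power_mono_iff[of "\<rho> k" \<sigma> ?n]
        by (simp add: not_le[symmetric] del: power_mono_iff)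
      have \<sigma>e: "(1 / \<sigma>) ^ ?e = s powr (m / ?n - 1)"
      proof -
        have "(1 / \<sigma>) ^ ?e = (s powr (- (1 / ?n))) powr ?e"
          using True by (simp add: \<sigma>_def powr_minus_divide powr_realpow)
        also have "\<dots> = s powr (- (1 / ?n) * ?e)" by (simp add: powr_powr)
        also have "- (1 / ?n) * ?e = m / ?n - 1"
          using m by (simp add: of_nat_diff field_simps)
        finally show ?thesis .
      qed
      have eq: "(\<Sum>k\<le>K. ennreal ((1 / \<rho> k) ^ ?e) * (rearr \<Omega> f s * indicator {0<..<\<rho> k ^ ?n} s)) =
         rearr \<Omega> f s * (\<Sum>k\<le>K. ennreal (if \<sigma> < \<rho> k then (1 / \<rho> k) ^ ?e else 0))"
        unfolding sum_distrib_left using True iff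
        by (intro sum.cong) (auto simp: mult_ac indicator_def)
      have "(\<Sum>k\<le>K. ennreal (if \<sigma> < \<rho> k then (1 / \<rho> k) ^ ?e else 0)) =
          ennreal (\<Sum>k\<le>K. if \<sigma> < \<rho> k then (1 / \<rho> k) ^ ?e else 0)"
        using \<rho> by (intro sum_ennreal) (auto intro: less_imp_le)
      also have "\<dots> \<le> ennreal (2 * (1 / \<sigma>) ^ ?e)"
        unfolding \<rho>_def using m by (intro ennreal_leI sum_powers_below R \<sigma>) simp
      also have "\<dots> = 2 * ennreal (s powr (m / ?n - 1))"
        by (simp add: \<sigma>e ennreal_mult)
      finally have "rearr \<Omega> f s * (\<Sum>k\<le>K. ennreal (if \<sigma> < \<rho> k then (1 / \<rho> k) ^ ?e else 0)) \<le>
          rearr \<Omega> f s * (2 * ennreal (s powr (m / ?n - 1)))"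
        by (rule mult_left_mono) simp
      moreover have "indicator {0<..<measure lebesgue \<Omega>} s = (1 :: ennreal)"
        using True R by simp
      ultimately show ?thesis unfolding eq by (simp only: mult_ac mult_1_right mult_1_left)
    qed
  qed
  also have "\<dots> = 2 * potential \<Omega> m f"
    unfolding potential_def
    by (intro nn_integral_cmult borel_measurable_times_ennreal measurable_completion) auto
  finally show ?thesis .
qed


section \<open>Chains of cubes in Jones domains\<close>

text \<open>A segment from \<open>z\<close> to a point of the ball outside \<Omega> would meet the
  frontier at a distance below \<eta>.\<close>

lemma ball_subset_if_infdist_frontier:
  fixes \<Omega> :: "'a::euclidean_space set"
  assumes z: "z \<in> \<Omega>" and d: "\<eta> \<le> infdist z (frontier \<Omega>)"
  shows "ball z \<eta> \<subseteq> \<Omega>"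
proof
  fix y assume y: "y \<in> ball z \<eta>"
  show "y \<in> \<Omega>"
  proof (rule ccontr)
    assume "y \<notin> \<Omega>"
    then have "closed_segment z y \<inter> frontier \<Omega> \<noteq> {}"
      using z by (intro connected_Int_frontier connected_segment) auto
    then obtain p where p: "p \<in> closed_segment z y" "p \<in> frontier \<Omega>" by blast
    have "infdist z (frontier \<Omega>) \<le> dist z p" by (rule infdist_le[OF p(2)])
    also have "\<dots> \<le> dist z y" using segment_bound(1)[OF p(1)] by (simp add: dist_norm norm_minus_commute)
    finally show False using y d by simp
  qed
qed

lemma connected_dist_ivt:
  assumes "connected S" "a \<in> S" "b \<in> S" "dist x a \<le> t" "t \<le> dist x b"
  obtains y where "y \<in> S" "dist x y = t"
proof -
  have "connected (dist x ` S)"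
    by (intro connected_continuous_image continuous_intros assms)
  then have "{dist x a..dist x b} \<subseteq> dist x ` S"
    using assms(2,3) by (intro connected_contains_Icc) auto
  then have "t \<in> dist x ` S" using assms(4,5) by auto
  then show thesis using that by auto
qed

lemma curve_length_partition:
  fixes \<gamma> :: "real \<Rightarrow> 'a::metric_space"
  assumes "curve_length \<gamma> \<le> ennreal L" "0 \<le> L" "N > 0"
  shows "(\<Sum>i<N. dist (\<gamma> (i / N)) (\<gamma> (Suc i / N))) \<le> L"
proof -
  define ts where "ts = map (\<lambda>i. real i / real N) [0..<Suc N]"
  have len: "length ts - 1 = N" by (simp add: ts_def)
  have nth: "ts ! i = real i / real N" if "i \<le> N" for i
    using that unfolding ts_def by (subst nth_map) (auto simp del: upt_Suc)
  have "sorted ts"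
    unfolding ts_def sorted_iff_nth_mono by (auto simp: divide_right_mono simp del: upt_Suc)
  moreover have "set ts \<subseteq> {0..1}"
    using assms(3) by (auto simp: ts_def simp del: upt_Suc)
  ultimately have "(\<Sum>i<length ts - 1. ennreal (dist (\<gamma> (ts ! i)) (\<gamma> (ts ! Suc i)))) \<le> curve_length \<gamma>"
    unfolding curve_length_def by (intro SUP_upper) auto
  also have "(\<Sum>i<length ts - 1. ennreal (dist (\<gamma> (ts ! i)) (\<gamma> (ts ! Suc i)))) =
      (\<Sum>i<N. ennreal (dist (\<gamma> (i / N)) (\<gamma> (Suc i / N))))"
    unfolding len by (intro sum.cong) (auto simp: nth)
  also have "\<dots> = ennreal (\<Sum>i<N. dist (\<gamma> (i / N)) (\<gamma> (Suc i / N)))"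
    by (rule sum_ennreal) simp
  finally have "ennreal (\<Sum>i<N. dist (\<gamma> (i / N)) (\<gamma> (Suc i / N))) \<le> ennreal L"
    using assms(1) by (rule order_trans)
  then show ?thesis using assms(2) by (simp add: ennreal_le_iff)
qed

text \<open>Isolates the condition for one pair of points. A bounded nonempty domain has a nonempty
  frontier, so there the cigar inequality holds outright.\<close>

definition jones_at :: "'a::euclidean_space set \<Rightarrow> real \<Rightarrow> 'a \<Rightarrow> 'a \<Rightarrow> bool" where
  "jones_at \<Omega> \<epsilon> x y \<longleftrightarrow>
    (\<exists>\<gamma>. path \<gamma> \<and> path_image \<gamma> \<subseteq> \<Omega> \<and> pathstart \<gamma> = x \<and> pathfinish \<gamma> = y \<and>
      curve_length \<gamma> \<le> ennreal (dist x y / \<epsilon>) \<and>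
      (\<forall>z\<in>path_image \<gamma>. infdist z (frontier \<Omega>) \<ge> \<epsilon> * (dist x z * dist y z / dist x y)))"

text \<open>The curve has a point at distance d/2 from \<open>x\<close>, which is then at least d/2
  away from \<open>y\<close>; the cigar condition gives \<epsilon> (d/2)(d/2)/d. Thus near each
  point, at each small scale, there is a point whose distance to the frontier is comparable to the
  scale.\<close>

lemma jones_at_midpoint:
  assumes j: "jones_at \<Omega> \<epsilon> x y" and \<epsilon>: "\<epsilon> > 0" and d: "dist x y = d" "d > 0"
  obtains z where "z \<in> \<Omega>" "dist x z = d / 2" "infdist z (frontier \<Omega>) \<ge> \<epsilon> * d / 4"
proof -
  obtain \<gamma> where \<gamma>: "path \<gamma>" "path_image \<gamma> \<subseteq> \<Omega>" "pathstart \<gamma> = x" "pathfinish \<gamma> = y"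
    "\<And>z. z \<in> path_image \<gamma> \<Longrightarrow> infdist z (frontier \<Omega>) \<ge> \<epsilon> * (dist x z * dist y z / dist x y)"
    using j by (auto simp: jones_at_def)
  have "x \<in> path_image \<gamma>" "y \<in> path_image \<gamma>"
    using \<gamma>(3,4) pathstart_in_path_image[of \<gamma>] pathfinish_in_path_image[of \<gamma>] by auto
  moreover have "dist x x \<le> d / 2" "d / 2 \<le> dist x y" using d by auto
  ultimately obtain z where z: "z \<in> path_image \<gamma>" "dist x z = d / 2"
    by (rule connected_dist_ivt[OF connected_path_image[OF \<gamma>(1)]])
  have "d / 2 \<le> dist y z" using dist_triangle[of x y z] z(2) d by (simp add: dist_commute)
  then have "d / 2 * (d / 2) \<le> dist x z * dist y z"
    unfolding z(2) using d by (intro mult_left_mono) auto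
  then have "d / 2 * (d / 2) / d \<le> dist x z * dist y z / dist x y"
    unfolding d(1) using d(2) by (intro divide_right_mono) auto
  moreover have "d / 2 * (d / 2) / d = d / 4" using d(2) by simp
  ultimately have "d / 4 \<le> dist x z * dist y z / dist x y" by linarith
  then have "\<epsilon> * (d / 4) \<le> \<epsilon> * (dist x z * dist y z / dist x y)"
    using \<epsilon> by (rule mult_left_mono[OF _ less_imp_le])
  then have "infdist z (frontier \<Omega>) \<ge> \<epsilon> * (d / 4)" using \<gamma>(5)[OF z(1)] by linarith
  then have "infdist z (frontier \<Omega>) \<ge> \<epsilon> * d / 4" by (simp only: times_divide_eq_right)
  then show thesis using that z \<gamma>(2) by blast
qed

text \<open>
  Near its end points the arc inherits their distance to the boundary; away from both of them the
  cigar condition applies.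
\<close>

lemma jones_at_polygon:
  assumes j: "jones_at \<Omega> \<epsilon> x y" and \<epsilon>: "\<epsilon> > 0" and xy: "x \<noteq> y" "dist x y \<le> D"
    and h: "h > 0" "infdist x (frontier \<Omega>) \<ge> h" "infdist y (frontier \<Omega>) \<ge> h" and \<eta>: "\<eta> > 0"
  obtains N :: nat and p where "p 0 = x" "p N = y" "\<And>i. i < N \<Longrightarrow> dist (p i) (p (Suc i)) \<le> \<eta>"
    "(\<Sum>i<N. dist (p i) (p (Suc i))) \<le> D / \<epsilon>"
    "\<And>i. i \<le> N \<Longrightarrow> p i \<in> \<Omega> \<and> infdist (p i) (frontier \<Omega>) \<ge> min (h / 2) (\<epsilon> * (h / 2)\<^sup>2 / D)"
proof -
  obtain \<gamma> where \<gamma>: "path \<gamma>" "path_image \<gamma> \<subseteq> \<Omega>" "pathstart \<gamma> = x" "pathfinish \<gamma> = y"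
    "curve_length \<gamma> \<le> ennreal (dist x y / \<epsilon>)"
    "\<And>z. z \<in> path_image \<gamma> \<Longrightarrow> infdist z (frontier \<Omega>) \<ge> \<epsilon> * (dist x z * dist y z / dist x y)"
    using j by (auto simp: jones_at_def)
  have "uniformly_continuous_on {0..1} \<gamma>"
    using \<gamma>(1) by (intro compact_uniformly_continuous) (auto simp: path_def)
  then obtain d where d: "d > 0" "\<And>s t. s \<in> {0..1} \<Longrightarrow> t \<in> {0..1} \<Longrightarrow> dist t s < d \<Longrightarrow> dist (\<gamma> t) (\<gamma> s) < \<eta>"
    using \<eta> unfolding uniformly_continuous_on_def by metis
  obtain N where N: "N > 0" "1 / real N < d"
    using reals_Archimedean[OF d(1)] by (metis inverse_eq_divide zero_less_Suc)
  define p where "p i = \<gamma> (real i / real N)" for i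
  have in01: "real i / real N \<in> {0..1}" if "i \<le> N" for i
    using that N by auto
  have pim: "p i \<in> path_image \<gamma>" if "i \<le> N" for i
    using in01[OF that] by (auto simp: p_def path_image_def)
  have dpos: "dist x y > 0" using xy by simp
  show thesis
  proof
    show "p 0 = x" "p N = y"
      using \<gamma>(3,4) N by (auto simp: p_def pathstart_def pathfinish_def)
    show "dist (p i) (p (Suc i)) \<le> \<eta>" if "i < N" for i
    proof -
      have "real (Suc i) / real N - real i / real N = 1 / real N"
        by (simp add: diff_divide_distrib[symmetric])
      then have "dist (real i / real N) (real (Suc i) / real N) < d"
        unfolding dist_real_def abs_minus_commute[of "real i / real N"] using N by simp
      then have "dist (p i) (p (Suc i)) < \<eta>"
        unfolding p_def using that by (intro d(2) in01) auto
      then show ?thesis by simp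
    qed
    have "(\<Sum>i<N. dist (p i) (p (Suc i))) \<le> dist x y / \<epsilon>"
      unfolding p_def using \<epsilon> N by (intro curve_length_partition[OF \<gamma>(5)]) auto
    also have "\<dots> \<le> D / \<epsilon>" using xy \<epsilon> by (intro divide_right_mono) auto
    finally show "(\<Sum>i<N. dist (p i) (p (Suc i))) \<le> D / \<epsilon>" .
    show "p i \<in> \<Omega> \<and> infdist (p i) (frontier \<Omega>) \<ge> min (h / 2) (\<epsilon> * (h / 2)\<^sup>2 / D)" if "i \<le> N" for i
    proof
      show "p i \<in> \<Omega>" using pim[OF that] \<gamma>(2) by blast
      have tri: "infdist q (frontier \<Omega>) \<le> infdist (p i) (frontier \<Omega>) + dist q (p i)" for q
        by (rule infdist_triangle)
      consider "dist x (p i) \<le> h / 2" | "dist y (p i) \<le> h / 2"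
        | "dist x (p i) > h / 2" "dist y (p i) > h / 2" by linarith
      then show "infdist (p i) (frontier \<Omega>) \<ge> min (h / 2) (\<epsilon> * (h / 2)\<^sup>2 / D)"
      proof cases
        case 1
        then show ?thesis using tri[of x] h by linarith
      next
        case 2
        then show ?thesis using tri[of y] h by linarith
      next
        case 3
        have "(h / 2)\<^sup>2 / D \<le> dist x (p i) * dist y (p i) / dist x y"
        proof (rule frac_le)
          show "(h / 2)\<^sup>2 \<le> dist x (p i) * dist y (p i)"
            unfolding power2_eq_square using 3 h by (intro mult_mono) auto
        qed (use dpos xy in auto)
        then have "\<epsilon> * ((h / 2)\<^sup>2 / D) \<le> \<epsilon> * (dist x (p i) * dist y (p i) / dist x y)"
          using \<epsilon> by (intro mult_left_mono) auto
        also have "\<dots> \<le> infdist (p i) (frontier \<Omega>)" by (rule \<gamma>(6)[OF pim[OF that]])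
        finally show ?thesis by simp
      qed
    qed
  qed
qed

lemma closed_segment_Pair_subset:
  assumes "closed_segment a a' \<subseteq> S" "closed_segment b b' \<subseteq> T"
  shows "closed_segment (a, b) (a', b') \<subseteq> S \<times> T"
proof
  fix q assume "q \<in> closed_segment (a, b) (a', b')"
  then obtain t where t: "0 \<le> t" "t \<le> 1" "q = (1 - t) *\<^sub>R (a, b) + t *\<^sub>R (a', b')"
    by (auto simp: closed_segment_def)
  then have "(1 - t) *\<^sub>R a + t *\<^sub>R a' \<in> closed_segment a a'" "(1 - t) *\<^sub>R b + t *\<^sub>R b' \<in> closed_segment b b'"
    by (auto simp: closed_segment_def)
  then show "q \<in> S \<times> T" using t(3) assms by auto
qed

text \<open>The path follows the vertices with the side fixed at the maximum \<open>b\<close>, then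
  moves the corner from \<open>p i\<close> to \<open>c\<close>, and finally shrinks the side to
  \<open>r\<close>. The three summands of the length correspond to these stages.\<close>

lemma polygon_linked:
  fixes p :: "nat \<Rightarrow> real^'n::finite" and \<eta> a b :: real
  assumes step: "\<And>i. i < N \<Longrightarrow> dist (p i) (p (Suc i)) \<le> \<eta>" and ab: "a \<le> b" and \<eta>: "0 \<le> \<eta>"
    and i: "i \<le> N" and Q: "dist (p i) c \<le> \<eta>" "a \<le> r" "r \<le> b"
  defines "S \<equiv> (\<Union>i\<le>N. cball (p i) \<eta>) \<times> {a..b}"
  shows "\<exists>l \<le> (\<Sum>i<N. dist (p i) (p (Suc i))) + \<eta> + (b - a). linked S l (p 0, b) (c, r)"
proof -
  have chain: "linked S (\<Sum>i<k. dist (p i) (p (Suc i))) (p 0, b) (p k, b)" if "k \<le> N" for k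
    using that
  proof (induction k)
    case 0
    show ?case by (simp add: linked.refl)
  next
    case (Suc k)
    have "closed_segment (p k, b) (p (Suc k), b) \<subseteq> S"
      unfolding S_def
    proof (rule closed_segment_Pair_subset)
      have "closed_segment (p k) (p (Suc k)) \<subseteq> cball (p k) \<eta>"
        using step[of k] Suc.prems \<eta> by (intro closed_segment_subset) auto
      then show "closed_segment (p k) (p (Suc k)) \<subseteq> (\<Union>i\<le>N. cball (p i) \<eta>)"
        using Suc.prems by (intro order_trans[OF _ UN_upper[of k]]) auto
    qed (use ab in auto)
    from linked.step[OF Suc.IH this] Suc.prems show ?case
      by (simp add: pdist_def dist_norm norm_minus_commute)
  qed
  have cb: "closed_segment (p i) c \<subseteq> cball (p i) \<eta>"
    using Q \<eta> by (intro closed_segment_subset) auto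
  have seg1: "closed_segment (p i, b) (c, b) \<subseteq> S"
    unfolding S_def by (rule closed_segment_Pair_subset) (use cb i ab in auto)
  have seg2: "closed_segment (c, b) (c, r) \<subseteq> S"
    unfolding S_def
  proof (rule closed_segment_Pair_subset)
    show "closed_segment b r \<subseteq> {a..b}" using Q by (intro closed_segment_subset) auto
  qed (use Q i in auto)
  have "linked S ((\<Sum>i<i. dist (p i) (p (Suc i))) + pdist (p i, b) (c, b) + pdist (c, b) (c, r)) (p 0, b) (c, r)"
    by (intro linked.step[OF linked.step[OF chain[OF i] seg1] seg2])
  moreover have "pdist (p i, b) (c, b) \<le> \<eta>" "pdist (c, b) (c, r) \<le> b - a"
    using Q by (auto simp: pdist_def dist_norm norm_minus_commute)
  moreover have "(\<Sum>i<i. dist (p i) (p (Suc i))) \<le> (\<Sum>i<N. dist (p i) (p (Suc i)))"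
    using i by (intro sum_mono2) auto
  ultimately show ?thesis by (intro exI conjI) auto
qed

text \<open>Since \<delta> > 1, every pair at distance at most 1 is covered; the scales in the
  construction of the chain are kept below 1 for this reason.\<close>

lemma jones_domain_jones_at:
  fixes \<Omega> :: "(real^'n::finite) set"
  assumes "bounded \<Omega>" "jones_domain \<Omega>"
  obtains \<epsilon> where "0 < \<epsilon>" "\<epsilon> < 1"
    "\<And>x y. x \<in> \<Omega> \<Longrightarrow> y \<in> \<Omega> \<Longrightarrow> x \<noteq> y \<Longrightarrow> dist x y \<le> 1 \<Longrightarrow> jones_at \<Omega> \<epsilon> x y"
proof -
  have ne: "\<Omega> \<noteq> {}" using assms(2) by (simp add: jones_domain_def is_domain_def)
  have "\<Omega> \<noteq> UNIV" using assms(1) not_bounded_UNIV by blast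
  then have fr: "frontier \<Omega> \<noteq> {}" using ne by (simp add: frontier_eq_empty)
  obtain \<epsilon> :: real and \<delta> :: ennreal where \<epsilon>: "0 < \<epsilon>" "\<epsilon> < 1" "1 < \<delta>"
    and J: "\<forall>x\<in>\<Omega>. \<forall>y\<in>\<Omega>. x \<noteq> y \<and> ennreal (dist x y) < \<delta> \<longrightarrow>
         (\<exists>\<gamma>. arc \<gamma> \<and> path_image \<gamma> \<subseteq> \<Omega> \<and> pathstart \<gamma> = x \<and> pathfinish \<gamma> = y \<and>
              curve_length \<gamma> \<le> ennreal (dist x y / \<epsilon>) \<and>
              (\<forall>z\<in>path_image \<gamma>. frontier \<Omega> = {} \<or>
                 infdist z (frontier \<Omega>) \<ge> \<epsilon> * (dist x z * dist y z / dist x y)))"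
    using assms(2) unfolding jones_domain_def by blast
  have "jones_at \<Omega> \<epsilon> x y" if "x \<in> \<Omega>" "y \<in> \<Omega>" "x \<noteq> y" "dist x y \<le> 1" for x y
  proof -
    have "ennreal (dist x y) \<le> 1" using that(4) by simp
    then have "ennreal (dist x y) < \<delta>" using \<epsilon>(3) by (rule le_less_trans)
    with J that have "\<exists>\<gamma>. arc \<gamma> \<and> path_image \<gamma> \<subseteq> \<Omega> \<and> pathstart \<gamma> = x \<and> pathfinish \<gamma> = y \<and>
              curve_length \<gamma> \<le> ennreal (dist x y / \<epsilon>) \<and>
              (\<forall>z\<in>path_image \<gamma>. frontier \<Omega> = {} \<or>
                 infdist z (frontier \<Omega>) \<ge> \<epsilon> * (dist x z * dist y z / dist x y))" by blast
    then show ?thesis unfolding jones_at_def using fr arc_imp_path by fastforce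
  qed
  then show thesis using that \<epsilon> by blast
qed

text \<open>Two points of the domain at distance e from each other are fixed. Every \<open>x\<close>
  is at least e/2 away from one of them, and connectedness supplies all smaller distances, so the
  bound on \<rho> is uniform in \<open>x\<close>.\<close>

lemma domain_points_at_distance:
  fixes \<Omega> :: "(real^'n::finite) set"
  assumes "is_domain \<Omega>"
  obtains \<rho>0 where "0 < \<rho>0" "\<rho>0 \<le> 1 / 2"
    "\<And>x \<rho>. x \<in> \<Omega> \<Longrightarrow> 0 \<le> \<rho> \<Longrightarrow> \<rho> \<le> \<rho>0 \<Longrightarrow> \<exists>y\<in>\<Omega>. dist x y = \<rho>"
proof -
  have dom: "open \<Omega>" "connected \<Omega>" "\<Omega> \<noteq> {}" using assms by (auto simp: is_domain_def)
  then obtain a where a: "a \<in> \<Omega>" by blast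
  obtain e where e: "e > 0" "cball a e \<subseteq> \<Omega>" using a dom(1) open_contains_cball by blast
  obtain v :: "real^'n" where v: "norm v = e" using vector_choose_size[of e] e by auto
  define b where "b = a + v"
  have b: "b \<in> \<Omega>" "dist a b = e" using e v by (auto simp: b_def dist_norm)
  define \<rho>0 where "\<rho>0 = min (1/2) (e / 2)"
  show thesis
  proof
    show "0 < \<rho>0" "\<rho>0 \<le> 1/2" using e by (auto simp: \<rho>0_def)
    fix x \<rho> assume x: "x \<in> \<Omega>" and \<rho>: "0 \<le> \<rho>" "\<rho> \<le> \<rho>0"
    have "e \<le> dist x a + dist x b" using dist_triangle[of a b x] b by (simp add: dist_commute)
    then have "e / 2 \<le> dist x a \<or> e / 2 \<le> dist x b" by linarith
    then obtain q where q: "q \<in> \<Omega>" "e / 2 \<le> dist x q" using a b by blast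
    have "dist x x \<le> \<rho>" "\<rho> \<le> dist x q" using \<rho> q by (auto simp: \<rho>0_def)
    then obtain y where "y \<in> \<Omega>" "dist x y = \<rho>"
      by (rule connected_dist_ivt[OF dom(2) x q(1)])
    then show "\<exists>y\<in>\<Omega>. dist x y = \<rho>" by blast
  qed
qed

text \<open>At scale d_k a point z_k is taken at distance d_k/2 from \<open>x\<close> and well
  inside \<Omega>; consecutive points are joined by a polygon that stays away from the frontier, and
  the cubes have sides between half of \<tau> d_k and \<tau> d_k. \<open>R\<close> and \<Lambda> do
  not depend on \<open>x\<close>.\<close>

lemma jones_chain:
  fixes \<Omega> :: "(real^'n::finite) set"
  assumes "bounded \<Omega>" "jones_domain \<Omega>"
  obtains R \<Lambda> :: real where "0 < R" "R \<le> 1" "0 \<le> \<Lambda>"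
    "\<And>x. x \<in> \<Omega> \<Longrightarrow> \<exists>C z.
       (\<forall>k. \<forall>Q\<in>C k. cube (fst Q) (snd Q) \<subseteq> \<Omega> \<and> R / 2 ^ Suc k \<le> snd Q \<and> snd Q \<le> R / 2 ^ k) \<and>
       (\<forall>k. \<forall>Q\<in>C (Suc k). \<exists>P\<in>C k. \<exists>l\<le>\<Lambda> * (R / 2 ^ Suc k). linked (C (Suc k)) l P Q) \<and>
       (\<forall>k. (z k, R / 2 ^ k) \<in> C k \<and> dist x (z k) \<le> 1 / 2 ^ k)"
proof -
  obtain \<epsilon> where \<epsilon>: "0 < \<epsilon>" "\<epsilon> < 1"
    and J: "\<And>x y. x \<in> \<Omega> \<Longrightarrow> y \<in> \<Omega> \<Longrightarrow> x \<noteq> y \<Longrightarrow> dist x y \<le> 1 \<Longrightarrow> jones_at \<Omega> \<epsilon> x y"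
    by (rule jones_domain_jones_at[OF assms]) blast
  have "is_domain \<Omega>" using assms(2) by (simp add: jones_domain_def)
  then obtain \<rho>0 where \<rho>0: "0 < \<rho>0" "\<rho>0 \<le> 1 / 2"
    and pts: "\<And>x \<rho>. x \<in> \<Omega> \<Longrightarrow> 0 \<le> \<rho> \<Longrightarrow> \<rho> \<le> \<rho>0 \<Longrightarrow> \<exists>y\<in>\<Omega>. dist x y = \<rho>"
    by (rule domain_points_at_distance) blast
  let ?n = "real CARD('n)"
  \<comment> \<open>A cube whose corner is within \<tau> d of a vertex and whose side is at most
    \<tau> d stays within \<tau> (n+1) d of the vertex. This has to be below the distance
    \<epsilon>^3 d / 96 of the vertices to the frontier.\<close>
  define \<tau> where "\<tau> = \<epsilon> ^ 3 / (96 * (?n + 2))"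
  have \<epsilon>3: "0 < \<epsilon> ^ 3" "\<epsilon> ^ 3 \<le> 1" using \<epsilon> by (auto simp: power_le_one)
  have \<tau>: "0 < \<tau>" "\<tau> \<le> 1" "\<tau> * (?n + 1) < \<epsilon> ^ 3 / 96"
  proof -
    show "0 < \<tau>" using \<epsilon>3 by (simp add: \<tau>_def)
    have "\<epsilon> ^ 3 \<le> 96 * (?n + 2)" using \<epsilon>3 by simp
    then show "\<tau> \<le> 1" by (simp add: \<tau>_def)
    have "\<tau> * (?n + 1) < \<tau> * (?n + 2)" using \<open>0 < \<tau>\<close> by (intro mult_strict_left_mono) auto
    also have "\<dots> = \<epsilon> ^ 3 / 96" by (simp add: \<tau>_def field_simps)
    finally show "\<tau> * (?n + 1) < \<epsilon> ^ 3 / 96" .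
  qed
  define R where "R = \<tau> * \<rho>0"
  \<comment> \<open>Multiplied by the side \<tau> d this is 3/2 d / \<epsilon>, the length of the
    polygon, plus 2 \<tau> d for moving the corner and shrinking the side.\<close>
  define \<Lambda> where "\<Lambda> = 3 / 2 / (\<epsilon> * \<tau>) + 2"
  show thesis
  proof
    show "0 < R" using \<tau> \<rho>0 by (simp add: R_def)
    show "R \<le> 1" using mult_mono[of \<tau> 1 \<rho>0 1] \<tau> \<rho>0 by (simp add: R_def)
    show "0 \<le> \<Lambda>" using \<epsilon> \<tau> by (simp add: \<Lambda>_def)
    fix x assume x: "x \<in> \<Omega>"
    define d where "d k = \<rho>0 / 2 ^ k" for k :: nat
    have d: "0 < d k" "d k \<le> \<rho>0" "d (Suc k) = d k / 2" for k
    proof -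
      have "\<rho>0 / 2 ^ k \<le> \<rho>0 / 1" using \<rho>0 by (intro divide_left_mono) auto
      then show "0 < d k" "d k \<le> \<rho>0" "d (Suc k) = d k / 2" using \<rho>0 by (auto simp: d_def)
    qed
    have Rd: "R / 2 ^ k = \<tau> * d k" for k by (simp add: R_def d_def)
    have "\<exists>z. z \<in> \<Omega> \<and> dist x z = d k / 2 \<and> infdist z (frontier \<Omega>) \<ge> \<epsilon> * d k / 4" for k
    proof -
      obtain y where y: "y \<in> \<Omega>" "dist x y = d k" using pts[OF x, of "d k"] d[of k] by auto
      then have "x \<noteq> y" using d(1)[of k] by auto
      have "jones_at \<Omega> \<epsilon> x y" using J[OF x y(1) \<open>x \<noteq> y\<close>] y(2) d(2)[of k] \<rho>0 by simp
      from jones_at_midpoint[OF this \<epsilon>(1) y(2) d(1)] show ?thesis by blast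
    qed
    then obtain z where z: "\<And>k. z k \<in> \<Omega>" "\<And>k. dist x (z k) = d k / 2"
      "\<And>k. infdist (z k) (frontier \<Omega>) \<ge> \<epsilon> * d k / 4" by metis
    have poly: "\<exists>N p. p 0 = z k \<and> p N = z (Suc k) \<and> (\<forall>i<N. dist (p i) (p (Suc i)) \<le> \<tau> * d (Suc k)) \<and>
        (\<Sum>i<N. dist (p i) (p (Suc i))) \<le> (3 / 2 * d (Suc k)) / \<epsilon> \<and>
        (\<forall>i\<le>N. p i \<in> \<Omega> \<and> infdist (p i) (frontier \<Omega>) \<ge> \<epsilon> ^ 3 / 96 * d (Suc k))" for k
    proof -
      let ?d = "d (Suc k)"
      have dk: "d k = 2 * ?d" using d(3)[of k] by simp
      \<comment> \<open>The distances of \<open>z k\<close> and \<open>z (Suc k)\<close> from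
        \<open>x\<close> are \<open>?d\<close> and \<open>?d / 2\<close>; this gives both the bound
        3/2 and the fact that the points differ.\<close>
      have le: "dist (z k) (z (Suc k)) \<le> 3 / 2 * ?d"
        using dist_triangle[of "z k" "z (Suc k)" x] z(2)[of k] z(2)[of "Suc k"] dk by (simp add: dist_commute)
      have "dist x (z k) \<le> dist x (z (Suc k)) + dist (z (Suc k)) (z k)" by (rule dist_triangle)
      then have ne: "z k \<noteq> z (Suc k)"
        using z(2)[of k] z(2)[of "Suc k"] dk d(1)[of "Suc k"] by auto
      have "dist (z k) (z (Suc k)) \<le> 1" using le d(2)[of "Suc k"] \<rho>0 by simp
      then have j: "jones_at \<Omega> \<epsilon> (z k) (z (Suc k))" by (intro J z ne)
      have h: "0 < \<epsilon> * ?d / 4" "\<epsilon> * ?d / 4 \<le> infdist (z k) (frontier \<Omega>)"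
          "\<epsilon> * ?d / 4 \<le> infdist (z (Suc k)) (frontier \<Omega>)"
        using z(3)[of k] z(3)[of "Suc k"] dk mult_pos_pos[OF \<epsilon>(1) d(1)[of "Suc k"]] by simp_all
      have \<eta>: "0 < \<tau> * ?d" using \<tau> d(1) by simp
      \<comment> \<open>With h = \<epsilon> d / 4 and D = 3 d / 2, the cigar bound \<epsilon>
        (h/2)^2 / D equals \<epsilon>^3 d / 96, and the other bound h/2 is larger.\<close>
      have "\<epsilon> ^ 3 / 96 * ?d \<le> min (\<epsilon> * ?d / 4 / 2) (\<epsilon> * (\<epsilon> * ?d / 4 / 2)\<^sup>2 / (3 / 2 * ?d))"
      proof (rule min.boundedI)
        have "\<epsilon> ^ 3 \<le> \<epsilon> ^ 1" using \<epsilon> by (intro power_decreasing) auto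
        then have "\<epsilon> ^ 3 / 96 \<le> \<epsilon> / 8" using \<epsilon> by simp
        then have "\<epsilon> ^ 3 / 96 * ?d \<le> \<epsilon> / 8 * ?d" using d(1)[of "Suc k"] by (intro mult_right_mono) auto
        then show "\<epsilon> ^ 3 / 96 * ?d \<le> \<epsilon> * ?d / 4 / 2" by simp
        show "\<epsilon> ^ 3 / 96 * ?d \<le> \<epsilon> * (\<epsilon> * ?d / 4 / 2)\<^sup>2 / (3 / 2 * ?d)"
          using d(1)[of "Suc k"] by (simp add: power2_eq_square power3_eq_cube)
      qed
      note bd = this
      show ?thesis
      proof (rule jones_at_polygon[OF j \<epsilon>(1) ne le h \<eta>])
        fix N :: nat and p
        assume p: "p 0 = z k" "p N = z (Suc k)" "\<And>i. i < N \<Longrightarrow> dist (p i) (p (Suc i)) \<le> \<tau> * ?d"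
          "(\<Sum>i<N. dist (p i) (p (Suc i))) \<le> 3 / 2 * ?d / \<epsilon>"
          "\<And>i. i \<le> N \<Longrightarrow> p i \<in> \<Omega> \<and> infdist (p i) (frontier \<Omega>) \<ge>
             min (\<epsilon> * ?d / 4 / 2) (\<epsilon> * (\<epsilon> * ?d / 4 / 2)\<^sup>2 / (3 / 2 * ?d))"
        have "p i \<in> \<Omega> \<and> infdist (p i) (frontier \<Omega>) \<ge> \<epsilon> ^ 3 / 96 * ?d" if "i \<le> N" for i
          using p(5)[OF that] bd by linarith
        then show ?thesis using p(1-4) by blast
      qed
    qed
    let ?P = "\<lambda>k N p. p 0 = z k \<and> p N = z (Suc k) \<and> (\<forall>i<N. dist (p i) (p (Suc i)) \<le> \<tau> * d (Suc k)) \<and>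
        (\<Sum>i<N. dist (p i) (p (Suc i))) \<le> (3 / 2 * d (Suc k)) / \<epsilon> \<and>
        (\<forall>i\<le>N. p i \<in> \<Omega> \<and> infdist (p i) (frontier \<Omega>) \<ge> \<epsilon> ^ 3 / 96 * d (Suc k))"
    have "\<exists>N. \<forall>k. \<exists>p. ?P k (N k) p" by (rule choice) (rule allI, rule poly)
    then obtain N :: "nat \<Rightarrow> nat" where "\<forall>k. \<exists>p. ?P k (N k) p" by (rule exE)
    then have "\<exists>p. \<forall>k. ?P k (N k) (p k)" by (rule choice)
    then obtain p where "\<forall>k. ?P k (N k) (p k)" by (rule exE)
    then have p: "\<And>k. p k 0 = z k" "\<And>k. p k (N k) = z (Suc k)"
      "\<And>k i. i < N k \<Longrightarrow> dist (p k i) (p k (Suc i)) \<le> \<tau> * d (Suc k)"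
      "\<And>k. (\<Sum>i<N k. dist (p k i) (p k (Suc i))) \<le> (3 / 2 * d (Suc k)) / \<epsilon>"
      "\<And>k i. i \<le> N k \<Longrightarrow> p k i \<in> \<Omega> \<and> infdist (p k i) (frontier \<Omega>) \<ge> \<epsilon> ^ 3 / 96 * d (Suc k)"
      by blast+
    \<comment> \<open>Generation 0 has the single corner \<open>z 0\<close>; generation k+1 consists
      of all corners near the polygon from \<open>z k\<close> to \<open>z (Suc k)\<close>. Sides
      range over one dyadic interval, so neighbouring generations share a side length.\<close>
    define C where "C k = (case k of 0 \<Rightarrow> {z 0} | Suc j \<Rightarrow> (\<Union>i\<le>N j. cball (p j i) (\<tau> * d (Suc j))))
       \<times> {\<tau> * d (Suc k)..\<tau> * d k}" for k
    have \<tau>d: "0 < \<tau> * d k" "\<tau> * d (Suc k) \<le> \<tau> * d k" for k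
      using \<tau> d(1)[of k] d(3)[of k] by auto
    have ball: "cube c r \<subseteq> \<Omega>"
      if q: "q \<in> \<Omega>" "infdist q (frontier \<Omega>) \<ge> \<epsilon> ^ 3 / 96 * d k" and c: "dist q c \<le> \<tau> * d k"
        and r: "0 \<le> r" "r \<le> \<tau> * d k" for q c r k
    proof
      fix y assume "y \<in> cube c r"
      then have "y \<in> cball c (?n * r)" by (rule subsetD[OF cube_subset_cball[OF r(1)]])
      then have "dist c y \<le> ?n * r" by simp
      also have "\<dots> \<le> ?n * (\<tau> * d k)" using r by (intro mult_left_mono) auto
      finally have "dist q y \<le> (\<tau> * (?n + 1)) * d k"
        using c dist_triangle[of q y c] by (simp add: algebra_simps)
      also have "\<dots> < \<epsilon> ^ 3 / 96 * d k" using \<tau>(3) d(1) by (intro mult_strict_right_mono)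
      finally have "y \<in> ball q (\<epsilon> ^ 3 / 96 * d k)" by simp
      then show "y \<in> \<Omega>" using ball_subset_if_infdist_frontier[OF q] by blast
    qed
    have C1: "cube (fst Q) (snd Q) \<subseteq> \<Omega> \<and> R / 2 ^ Suc k \<le> snd Q \<and> snd Q \<le> R / 2 ^ k" if Q: "Q \<in> C k" for k Q
    proof -
      have r: "\<tau> * d (Suc k) \<le> snd Q" "snd Q \<le> \<tau> * d k" using Q by (auto simp: C_def)
      have r0: "0 \<le> snd Q" using r(1) \<tau>d(1)[of "Suc k"] by linarith
      have "cube (fst Q) (snd Q) \<subseteq> \<Omega>"
      proof (cases k)
        case 0
        then have "fst Q = z 0" using Q by (auto simp: C_def)
        moreover have "\<epsilon> ^ 3 / 96 * d 0 \<le> infdist (z 0) (frontier \<Omega>)"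
        proof -
          have "\<epsilon> ^ 3 \<le> \<epsilon> ^ 1" using \<epsilon> by (intro power_decreasing) auto
          then have "\<epsilon> ^ 3 / 96 \<le> \<epsilon> / 4" using \<epsilon> by simp
          then have "\<epsilon> ^ 3 / 96 * d 0 \<le> \<epsilon> / 4 * d 0" using d(1)[of 0] by (intro mult_right_mono) auto
          moreover have "\<epsilon> / 4 * d 0 = \<epsilon> * d 0 / 4" by simp
          ultimately show ?thesis using z(3)[of 0] by linarith
        qed
        ultimately show ?thesis
          using ball[OF z(1)[of 0], of 0 "fst Q" "snd Q"] r r0 0 \<tau>d(1)[of 0] by simp
      next
        case (Suc j)
        then obtain i where i: "i \<le> N j" "dist (p j i) (fst Q) \<le> \<tau> * d (Suc j)"
          using Q by (auto simp: C_def)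
        show ?thesis
          using ball[OF _ _ i(2) r0] p(5)[OF i(1)] r(2) Suc by simp
      qed
      then show ?thesis unfolding Rd using r by blast
    qed
    have zC: "(z k, \<tau> * d k) \<in> C k" for k
    proof (cases k)
      case 0
      then show ?thesis using \<tau>d(2)[of 0] by (simp add: C_def)
    next
      case (Suc j)
      have "z k \<in> cball (p j (N j)) (\<tau> * d (Suc j))" using p(2)[of j] \<tau>d(1)[of k] Suc by simp
      then show ?thesis using \<tau>d(2)[of k] Suc by (auto simp: C_def)
    qed
    have C2: "\<exists>P\<in>C k. \<exists>l\<le>\<Lambda> * (R / 2 ^ Suc k). linked (C (Suc k)) l P Q" if Q: "Q \<in> C (Suc k)" for k Q
    proof
      obtain i where i: "i \<le> N k" "dist (p k i) (fst Q) \<le> \<tau> * d (Suc k)"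
        and r: "\<tau> * d (Suc (Suc k)) \<le> snd Q" "snd Q \<le> \<tau> * d (Suc k)"
        using Q by (auto simp: C_def)
      have "\<exists>l\<le>(\<Sum>i<N k. dist (p k i) (p k (Suc i))) + \<tau> * d (Suc k) + (\<tau> * d (Suc k) - \<tau> * d (Suc (Suc k))).
          linked ((\<Union>i\<le>N k. cball (p k i) (\<tau> * d (Suc k))) \<times> {\<tau> * d (Suc (Suc k))..\<tau> * d (Suc k)}) l
            (p k 0, \<tau> * d (Suc k)) (fst Q, snd Q)"
        by (rule polygon_linked[OF p(3) _ _ i r]) (use \<tau>d(2)[of "Suc k"] \<tau>d(1)[of "Suc k"] in auto)
      then obtain l where l: "l \<le> (\<Sum>i<N k. dist (p k i) (p k (Suc i))) + \<tau> * d (Suc k) + (\<tau> * d (Suc k) - \<tau> * d (Suc (Suc k)))"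
        "linked (C (Suc k)) l (z k, \<tau> * d (Suc k)) Q"
        by (auto simp: C_def p(1))
      have "l \<le> 3 / 2 * d (Suc k) / \<epsilon> + 2 * (\<tau> * d (Suc k))"
        using l(1) p(4)[of k] \<tau>d(1)[of "Suc (Suc k)"] by linarith
      also have "\<dots> = \<Lambda> * (R / 2 ^ Suc k)"
        unfolding Rd \<Lambda>_def using \<epsilon> \<tau> by (simp add: field_simps)
      finally show "\<exists>l\<le>\<Lambda> * (R / 2 ^ Suc k). linked (C (Suc k)) l (z k, \<tau> * d (Suc k)) Q" using l(2) by blast
      have "z k \<in> (case k of 0 \<Rightarrow> {z 0} | Suc j \<Rightarrow> (\<Union>i\<le>N j. cball (p j i) (\<tau> * d (Suc j))))"
        using zC[of k] unfolding C_def mem_Times_iff fst_conv by (rule conjunct1)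
      moreover have "\<tau> * d (Suc k) \<in> {\<tau> * d (Suc k)..\<tau> * d k}" using \<tau>d(2)[of k] by simp
      ultimately show "(z k, \<tau> * d (Suc k)) \<in> C k" unfolding C_def mem_Times_iff fst_conv snd_conv by (rule conjI)
    qed
    have zC': "(z k, R / 2 ^ k) \<in> C k" for k
      unfolding Rd by (rule zC)
    have "dist x (z k) \<le> 1 / 2 ^ k" for k
    proof -
      have "d k / 2 \<le> 1 / 2 ^ k" using \<rho>0 by (simp add: d_def field_simps)
      then show ?thesis using z(2)[of k] by simp
    qed
    then show "\<exists>C z.
       (\<forall>k. \<forall>Q\<in>C k. cube (fst Q) (snd Q) \<subseteq> \<Omega> \<and> R / 2 ^ Suc k \<le> snd Q \<and> snd Q \<le> R / 2 ^ k) \<and>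
       (\<forall>k. \<forall>Q\<in>C (Suc k). \<exists>P\<in>C k. \<exists>l\<le>\<Lambda> * (R / 2 ^ Suc k). linked (C (Suc k)) l P Q) \<and>
       (\<forall>k. (z k, R / 2 ^ k) \<in> C k \<and> dist x (z k) \<le> 1 / 2 ^ k)"
      using C1 C2 zC' by (intro exI[of _ C] exI[of _ z]) blast
  qed
qed


section \<open>The embedding\<close>

text \<open>The function space enters only through \<open>A\<close>, a common bound for the
  potentials of all gradients up to order m.\<close>

locale sobolev_bound = weakly_diff \<Omega> m u
  for \<Omega> :: "(real^'n::finite) set" and m :: nat and u :: "real^'n \<Rightarrow> real" +
  fixes A :: real
  assumes bdd: "bounded \<Omega>" and ne: "\<Omega> \<noteq> {}" and m: "1 \<le> m" "m < CARD('n)" and A: "0 \<le> A"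
    and grad_measurable: "\<And>j. j \<le> m \<Longrightarrow> weak_grad_norm \<Omega> j u \<in> borel_measurable (lebesgue_on \<Omega>)"
    and potential_le: "\<And>j. j \<le> m \<Longrightarrow> potential \<Omega> m (\<lambda>x. ennreal \<bar>weak_grad_norm \<Omega> j u x\<bar>) \<le> ennreal A"
begin

abbreviation "V \<equiv> measure lebesgue \<Omega>"

definition grad_rearr :: "nat \<Rightarrow> real \<Rightarrow> ennreal" where
  "grad_rearr j = rearr \<Omega> (\<lambda>x. ennreal \<bar>weak_grad_norm \<Omega> j u x\<bar>)"

lemma dom_lmeasurable: "\<Omega> \<in> lmeasurable"
  by (rule lmeasurable_open[OF bdd open_dom])

lemma dom_sets: "\<Omega> \<in> sets lebesgue"
  using dom_lmeasurable by (rule fmeasurableD)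

lemma cube_measure_le:
  assumes "good P"
  shows "snd P ^ CARD('n) \<le> V"
proof -
  have P: "0 \<le> snd P" "cube (fst P) (snd P) \<subseteq> \<Omega>" using assms by (auto simp: good_def)
  have "measure lebesgue (cube (fst P) (snd P)) \<le> V"
    by (rule measure_mono_fmeasurable[OF P(2) cube_sets dom_lmeasurable])
  then show ?thesis unfolding measure_cube[OF P(1)] .
qed

lemma w_le_grad:
  assumes "length js = j"
  shows "\<bar>w js y\<bar> \<le> weak_grad_norm \<Omega> j u y"
proof -
  have "(w js y)\<^sup>2 \<le> (\<Sum>ks | length ks = j. (w ks y)\<^sup>2)"
    using assms by (intro member_le_sum) auto
  then have "sqrt ((w js y)\<^sup>2) \<le> sqrt (\<Sum>ks | length ks = j. (w ks y)\<^sup>2)"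
    by (rule real_sqrt_le_mono)
  then show ?thesis by (simp add: weak_grad_norm_def w_def)
qed

lemma nn_integral_w_le:
  assumes js: "length js = j" "j \<le> m" and Q: "Q \<in> lmeasurable" "Q \<subseteq> \<Omega>"
  shows "(\<integral>\<^sup>+x\<in>Q. ennreal \<bar>w js x\<bar> \<partial>lebesgue) \<le> (\<integral>\<^sup>+s\<in>{0<..<measure lebesgue Q}. grad_rearr j s \<partial>lebesgue)"
proof -
  have "(\<integral>\<^sup>+x\<in>Q. ennreal \<bar>w js x\<bar> \<partial>lebesgue) \<le> (\<integral>\<^sup>+x\<in>Q. ennreal \<bar>weak_grad_norm \<Omega> j u x\<bar> \<partial>lebesgue)"
    using w_le_grad[OF js(1)]
    by (intro nn_integral_mono mult_right_mono ennreal_leI) (auto intro: order_trans[OF _ abs_ge_self])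
  also have "\<dots> \<le> (\<integral>\<^sup>+s\<in>{0<..<measure lebesgue Q}. grad_rearr j s \<partial>lebesgue)"
    unfolding grad_rearr_def using grad_measurable[OF js(2)]
    by (intro nn_integral_le_rearr dom_sets Q) measurable
  finally show ?thesis .
qed

lemma mean_w_le:
  assumes js: "length js = j" "j \<le> m" and P: "good P"
  shows "ennreal (mean (\<lambda>y. \<bar>w js y\<bar>) (fst P) (snd P)) \<le>
    ennreal ((1 / snd P) ^ CARD('n)) * (\<integral>\<^sup>+s\<in>{0<..<snd P ^ CARD('n)}. grad_rearr j s \<partial>lebesgue)"
proof -
  let ?Q = "cube (fst P) (snd P)"
  have pos: "snd P > 0" and sub: "?Q \<subseteq> \<Omega>" using P by (auto simp: good_def)
  have "integrable lebesgue (\<lambda>y. indicator ?Q y * w js y)"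
    using js by (intro locally_integrable_cube[OF w_locally_integrable compact_cube sub]) simp
  then have int: "integrable lebesgue (\<lambda>y. \<bar>indicator ?Q y * w js y\<bar>)" by (rule integrable_abs)
  have "ennreal (mean (\<lambda>y. \<bar>w js y\<bar>) (fst P) (snd P)) =
      ennreal ((1 / snd P) ^ CARD('n)) * ennreal (\<integral>y. \<bar>indicator ?Q y * w js y\<bar> \<partial>lebesgue)"
    unfolding mean_eq using pos by (subst ennreal_mult[symmetric]) (auto simp: abs_mult)
  also have "ennreal (\<integral>y. \<bar>indicator ?Q y * w js y\<bar> \<partial>lebesgue) = (\<integral>\<^sup>+y. ennreal \<bar>indicator ?Q y * w js y\<bar> \<partial>lebesgue)"
    by (rule nn_integral_eq_integral[OF int, symmetric]) simp
  also have "\<dots> = (\<integral>\<^sup>+y\<in>?Q. ennreal \<bar>w js y\<bar> \<partial>lebesgue)"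
    by (intro nn_integral_cong) (auto simp: indicator_def)
  finally have eq: "ennreal (mean (\<lambda>y. \<bar>w js y\<bar>) (fst P) (snd P)) =
      ennreal ((1 / snd P) ^ CARD('n)) * (\<integral>\<^sup>+y\<in>?Q. ennreal \<bar>w js y\<bar> \<partial>lebesgue)" .
  have "(\<integral>\<^sup>+y\<in>?Q. ennreal \<bar>w js y\<bar> \<partial>lebesgue) \<le> (\<integral>\<^sup>+s\<in>{0<..<measure lebesgue ?Q}. grad_rearr j s \<partial>lebesgue)"
    by (rule nn_integral_w_le[OF js lmeasurable_compact[OF compact_cube] sub])
  then show ?thesis
    unfolding eq measure_cube[OF less_imp_le[OF pos]] by (rule mult_left_mono) simp
qed

lemma grad_rearr_integral_le:
  assumes j: "j \<le> m" and v: "0 < v" "v \<le> V"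
  shows "(\<integral>\<^sup>+s\<in>{0<..<v}. grad_rearr j s \<partial>lebesgue) \<le> ennreal (V powr (1 - m / CARD('n)) * A)"
proof -
  have "(\<integral>\<^sup>+s\<in>{0<..<v}. grad_rearr j s \<partial>lebesgue) \<le> ennreal (v powr (1 - m / CARD('n))) * ennreal A"
    unfolding grad_rearr_def using potential_le[OF j]
    by (intro order_trans[OF rearr_integral_le_potential[OF m(2) v]] mult_left_mono) auto
  also have "\<dots> = ennreal (v powr (1 - m / CARD('n)) * A)" using A by (simp add: ennreal_mult)
  also have "\<dots> \<le> ennreal (V powr (1 - m / CARD('n)) * A)"
    using v m A by (intro ennreal_leI mult_right_mono powr_mono2) (auto simp: field_simps)
  finally show ?thesis .
qed

definition base_const :: real where
  "base_const = CARD('n) ^ m * V powr (1 - m / CARD('n))"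

lemma base_const_nonneg: "0 \<le> base_const"
  by (simp add: base_const_def)

text \<open>A crude bound that blows up as the side shrinks; it serves for cubes whose side is
  bounded below, at the start of a chain and for the continuity of means at a fixed scale.\<close>

lemma F_le_base:
  assumes j: "j \<le> m" and P: "good P"
  shows "F j P \<le> base_const * (1 / snd P) ^ CARD('n) * A"
proof -
  have pos: "snd P > 0" using P by (simp add: good_def)
  let ?B = "(1 / snd P) ^ CARD('n) * (V powr (1 - m / CARD('n)) * A)"
  have "mean (\<lambda>y. \<bar>w js y\<bar>) (fst P) (snd P) \<le> ?B" if js: "length js = j" for js
  proof -
    have "ennreal (mean (\<lambda>y. \<bar>w js y\<bar>) (fst P) (snd P)) \<le>
        ennreal ((1 / snd P) ^ CARD('n)) * ennreal (V powr (1 - m / CARD('n)) * A)"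
      using j P pos cube_measure_le[OF P]
      by (intro order_trans[OF mean_w_le[OF js j P]] mult_left_mono grad_rearr_integral_le) auto
    also have "\<dots> = ennreal ?B" using pos A by (intro ennreal_mult[symmetric]) auto
    finally show ?thesis using pos A by (subst (asm) ennreal_le_iff) auto
  qed
  then have "F j P \<le> (\<Sum>js::'n list | length js = j. ?B)"
    unfolding F_def by (intro sum_mono) auto
  also have "\<dots> = CARD('n) ^ j * ?B" by simp
  also have "\<dots> \<le> CARD('n) ^ m * ?B"
    using pos A j by (intro mult_right_mono of_nat_mono power_increasing) auto
  finally show ?thesis by (simp add: base_const_def mult_ac)
qed

definition T :: "real \<Rightarrow> nat \<Rightarrow> real" where
  "T R k = enn2real (\<integral>\<^sup>+s\<in>{0<..<(R / 2 ^ k) ^ CARD('n)}. grad_rearr m s \<partial>lebesgue)"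

text \<open>Sides in generation k lie between R/2^(k+1) and R/2^k: the prefactor is taken at the
  smallest side and the integral at the largest.\<close>

definition \<beta> :: "real \<Rightarrow> nat \<Rightarrow> real" where
  "\<beta> R k = CARD('n) ^ m * (1 / (R / 2 ^ Suc k)) ^ CARD('n) * T R k"

context
  fixes R :: real
  assumes R: "0 < R" "R \<le> 1" "R ^ CARD('n) \<le> V"
begin

lemma Rk: "0 < R / 2 ^ k" "(R / 2 ^ k) ^ CARD('n) \<le> V"
proof -
  show "0 < R / 2 ^ k" using R by simp
  have "R / 2 ^ k \<le> R / 1" using R by (intro divide_left_mono) auto
  then have "(R / 2 ^ k) ^ CARD('n) \<le> R ^ CARD('n)" using R by (intro power_mono) auto
  then show "(R / 2 ^ k) ^ CARD('n) \<le> V" using R by linarith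
qed

lemma ennreal_T: "ennreal (T R k) = (\<integral>\<^sup>+s\<in>{0<..<(R / 2 ^ k) ^ CARD('n)}. grad_rearr m s \<partial>lebesgue)"
proof -
  have "(\<integral>\<^sup>+s\<in>{0<..<(R / 2 ^ k) ^ CARD('n)}. grad_rearr m s \<partial>lebesgue) \<le> ennreal (V powr (1 - m / CARD('n)) * A)"
    using Rk[of k] by (intro grad_rearr_integral_le) auto
  then show ?thesis
    unfolding T_def by (intro ennreal_enn2real) (simp add: le_less_trans[OF _ ennreal_less_top])
qed

lemma T_nonneg: "0 \<le> T R k"
  by (simp add: T_def)

lemma \<beta>_nonneg: "0 \<le> \<beta> R k"
  using R T_nonneg by (simp add: \<beta>_def)

lemma F_top:
  assumes P: "good P" and r: "R / 2 ^ Suc k \<le> snd P" "snd P \<le> R / 2 ^ k"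
  shows "F m P \<le> \<beta> R k"
proof -
  have pos: "snd P > 0" using P by (simp add: good_def)
  let ?B = "(1 / (R / 2 ^ Suc k)) ^ CARD('n) * T R k"
  have "mean (\<lambda>y. \<bar>w js y\<bar>) (fst P) (snd P) \<le> ?B" if js: "length js = m" for js
  proof -
    have "ennreal (mean (\<lambda>y. \<bar>w js y\<bar>) (fst P) (snd P)) \<le>
        ennreal ((1 / snd P) ^ CARD('n)) * (\<integral>\<^sup>+s\<in>{0<..<snd P ^ CARD('n)}. grad_rearr m s \<partial>lebesgue)"
      by (rule mean_w_le[OF js order_refl P])
    also have "\<dots> \<le> ennreal ((1 / (R / 2 ^ Suc k)) ^ CARD('n)) * ennreal (T R k)"
      unfolding ennreal_T
    proof (intro mult_mono ennreal_leI power_mono nn_integral_mono)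
      show "1 / snd P \<le> 1 / (R / 2 ^ Suc k)" using r R pos by (intro divide_left_mono mult_pos_pos) auto
      have "snd P ^ CARD('n) \<le> (R / 2 ^ k) ^ CARD('n)" using r pos by (intro power_mono) auto
      then show "indicator {0<..<snd P ^ CARD('n)} s \<le> (indicator {0<..<(R / 2 ^ k) ^ CARD('n)} s :: ennreal)" for s :: real
        by (auto simp: indicator_def)
    qed (use pos in auto)
    also have "\<dots> = ennreal ?B" using R T_nonneg by (intro ennreal_mult[symmetric]) auto
    finally show ?thesis using R T_nonneg by (subst (asm) ennreal_le_iff) auto
  qed
  then have "F m P \<le> (\<Sum>js::'n list | length js = m. ?B)"
    unfolding F_def by (intro sum_mono) auto
  also have "\<dots> = \<beta> R k" by (simp add: \<beta>_def)
  finally show ?thesis .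
qed

text \<open>The weight (R/2^k)^m turns the exponent -n of the prefactor into m - n, the weight of
  the dyadic sum bounded by \<open>potential\<close>. The factor 2^n is the price of halving the
  side in the prefactor.\<close>

lemma sum_\<beta>: "(\<Sum>k\<le>K. (R / 2 ^ k) ^ m * \<beta> R k) \<le> (real CARD('n) ^ m * 2 ^ CARD('n) * 2) * A"
proof -
  let ?n = "CARD('n)" and ?\<rho> = "\<lambda>k. R / 2 ^ k"
  have "ennreal (\<Sum>k\<le>K. (1 / ?\<rho> k) ^ (?n - m) * T R k) =
      (\<Sum>k\<le>K. ennreal ((1 / ?\<rho> k) ^ (?n - m)) * ennreal (T R k))"
    using R T_nonneg by (subst sum_ennreal[symmetric]) (auto simp: ennreal_mult)
  also have "\<dots> \<le> 2 * potential \<Omega> m (\<lambda>x. ennreal \<bar>weak_grad_norm \<Omega> m u x\<bar>)"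
    unfolding ennreal_T grad_rearr_def by (rule rearr_dyadic_sum_le_potential[OF m(2) R(1,3)])
  also have "\<dots> \<le> 2 * ennreal A" using potential_le[of m] by (intro mult_left_mono) auto
  also have "\<dots> = ennreal (2 * A)" using A by (simp add: ennreal_mult)
  finally have le: "(\<Sum>k\<le>K. (1 / ?\<rho> k) ^ (?n - m) * T R k) \<le> 2 * A"
    using A by (subst (asm) ennreal_le_iff) auto
  have "?\<rho> k ^ m * \<beta> R k = (real ?n ^ m * 2 ^ ?n) * ((1 / ?\<rho> k) ^ (?n - m) * T R k)" for k
  proof -
    have "1 / (R / 2 ^ Suc k) = 2 * (1 / ?\<rho> k)" by simp
    then have "(1 / (R / 2 ^ Suc k)) ^ ?n = 2 ^ ?n * (1 / ?\<rho> k) ^ ?n" by (simp only: power_mult_distrib)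
    moreover have "(1 / ?\<rho> k) ^ ?n = (1 / ?\<rho> k) ^ (?n - m) * (1 / ?\<rho> k) ^ m"
      using m by (simp add: power_add[symmetric])
    ultimately have "?\<rho> k ^ m * \<beta> R k = (real ?n ^ m * 2 ^ ?n) * ((1 / ?\<rho> k) ^ (?n - m) * T R k) * (?\<rho> k ^ m * (1 / ?\<rho> k) ^ m)"
      unfolding \<beta>_def of_nat_power by (simp only: mult_ac)
    also have "?\<rho> k ^ m * (1 / ?\<rho> k) ^ m = 1"
      using R by (simp add: power_mult_distrib[symmetric])
    finally have "?\<rho> k ^ m * \<beta> R k = (real ?n ^ m * 2 ^ ?n) * ((1 / ?\<rho> k) ^ (?n - m) * T R k)"
      by (simp only: mult_1_right)
    then show ?thesis .
  qed
  then have "(\<Sum>k\<le>K. ?\<rho> k ^ m * \<beta> R k) = (real ?n ^ m * 2 ^ ?n) * (\<Sum>k\<le>K. (1 / ?\<rho> k) ^ (?n - m) * T R k)"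
    by (simp add: sum_distrib_left)
  also have "\<dots> \<le> (real ?n ^ m * 2 ^ ?n) * (2 * A)"
    using le by (intro mult_left_mono) auto
  finally show ?thesis by (simp add: mult_ac)
qed

definition b0 :: real where
  "b0 = base_const * (2 / R) ^ CARD('n) * A"

lemma b0_nonneg: "0 \<le> b0"
  using base_const_nonneg R A by (simp add: b0_def)

lemma chain_bound:
  fixes C :: "nat \<Rightarrow> ((real^'n) \<times> real) set" and \<Lambda> :: real
  assumes \<Lambda>: "0 \<le> \<Lambda>"
    and C: "\<And>k Q. Q \<in> C k \<Longrightarrow> cube (fst Q) (snd Q) \<subseteq> \<Omega> \<and> R / 2 ^ Suc k \<le> snd Q \<and> snd Q \<le> R / 2 ^ k"
    and link: "\<And>k Q. Q \<in> C (Suc k) \<Longrightarrow> \<exists>P\<in>C k. \<exists>l\<le>\<Lambda> * (R / 2 ^ Suc k). linked (C (Suc k)) l P Q"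
    and Q: "Q \<in> C k" and i: "i \<le> m"
  shows "F (m - i) Q \<le> majorant b0 (CARD('n) ^ m * \<Lambda>) (\<lambda>k. R / 2 ^ k) (\<beta> R) i k"
proof (rule chain[OF b0_nonneg \<Lambda> _ \<beta>_nonneg _ link _ _ i Q])
  show good: "good Q" if "Q \<in> C k" for k Q
  proof -
    have "0 < R / 2 ^ Suc k" using R by simp
    then show ?thesis using C[OF that] unfolding good_def by linarith
  qed
  show "0 \<le> R / 2 ^ k" for k using R by simp
  show "F m Q \<le> \<beta> R k" if "Q \<in> C k" for k Q
    using C[OF that] by (intro F_top good[OF that]) auto
  show "F j Q \<le> b0" if j: "j \<le> m" and Q: "Q \<in> C 0" for j Q
  proof -
    have "F j Q \<le> base_const * (1 / snd Q) ^ CARD('n) * A" by (rule F_le_base[OF j good[OF Q]])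
    also have "\<dots> \<le> base_const * (1 / (R / 2)) ^ CARD('n) * A"
    proof (intro mult_right_mono mult_left_mono power_mono)
      show "1 / snd Q \<le> 1 / (R / 2)"
        using C[OF Q] R good[OF Q] by (intro divide_left_mono mult_pos_pos) (auto simp: good_def)
      show "0 \<le> 1 / snd Q" using good[OF Q] by (simp add: good_def)
    qed (use A base_const_nonneg in auto)
    finally show ?thesis by (simp add: b0_def)
  qed
qed

text \<open>After m integrations the derivatives are integrated out. The resulting constant depends
  on the domain and the chain only, and the bound is linear in \<open>A\<close>.\<close>

lemma F0_bound:
  fixes C :: "nat \<Rightarrow> ((real^'n) \<times> real) set" and \<Lambda> :: real
  assumes \<Lambda>: "0 \<le> \<Lambda>"
    and C: "\<And>k Q. Q \<in> C k \<Longrightarrow> cube (fst Q) (snd Q) \<subseteq> \<Omega> \<and> R / 2 ^ Suc k \<le> snd Q \<and> snd Q \<le> R / 2 ^ k"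
    and link: "\<And>k Q. Q \<in> C (Suc k) \<Longrightarrow> \<exists>P\<in>C k. \<exists>l\<le>\<Lambda> * (R / 2 ^ Suc k). linked (C (Suc k)) l P Q"
    and Q: "Q \<in> C k"
  shows "F 0 Q \<le> (2 + 2 * (CARD('n) ^ m * \<Lambda>)) ^ m * (m * (base_const * (2 / R) ^ CARD('n)) + (real CARD('n) ^ m * 2 ^ CARD('n) * 2)) * A"
proof -
  have \<kappa>: "0 \<le> real (CARD('n) ^ m) * \<Lambda>" using \<Lambda> by simp
  have "F 0 Q \<le> majorant b0 (CARD('n) ^ m * \<Lambda>) (\<lambda>k. R / 2 ^ k) (\<beta> R) m k"
    using chain_bound[OF \<Lambda> C link Q order_refl] by simp
  also have "\<dots> \<le> (2 + 2 * (CARD('n) ^ m * \<Lambda>)) ^ m * (m * b0 + (real CARD('n) ^ m * 2 ^ CARD('n) * 2) * A)"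
    by (rule majorant_sums(2)[OF b0_nonneg \<kappa> \<beta>_nonneg R(1,2) sum_\<beta> m(1)])
  also have "\<dots> = (2 + 2 * (CARD('n) ^ m * \<Lambda>)) ^ m * (m * (base_const * (2 / R) ^ CARD('n)) + (real CARD('n) ^ m * 2 ^ CARD('n) * 2)) * A"
    by (simp add: b0_def algebra_simps)
  finally show ?thesis .
qed

text \<open>The majorant after m - 1 integrations, that is for first order derivatives, along cubes
  shrinking to a fixed corner. There one generation has path length at most its side, hence the 1 in
  place of \<Lambda>.\<close>

definition first_order_bound :: "nat \<Rightarrow> real" where
  "first_order_bound = majorant b0 (real (CARD('n) ^ m) * 1) (\<lambda>k. R / 2 ^ k) (\<beta> R) (m - 1)"

lemma first_order_bound_nonneg: "0 \<le> first_order_bound k"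
  unfolding first_order_bound_def by (rule majorant_nonneg) (use b0_nonneg \<beta>_nonneg R in auto)

text \<open>At i = m - 1 exactly one power of the side is left in \<open>majorant_sums\<close>,
  which is the weight needed to sum the differences of consecutive means.\<close>

lemma first_order_bound_summable: "summable (\<lambda>k. R / 2 ^ k * first_order_bound k)"
proof (rule bounded_imp_summable)
  show "0 \<le> R / 2 ^ k * first_order_bound k" for k using R first_order_bound_nonneg by simp
  show "(\<Sum>k\<le>K. R / 2 ^ k * first_order_bound k) \<le> (2 + 2 * (real (CARD('n) ^ m) * 1)) ^ (m - 1) * (real (m - 1) * b0 + (real CARD('n) ^ m * 2 ^ CARD('n) * 2) * A)" for K
    using majorant_sums(1)[OF b0_nonneg _ \<beta>_nonneg R(1,2) sum_\<beta>, of "real (CARD('n) ^ m) * 1" "m - 1" K] m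
    by (simp add: first_order_bound_def)
qed

lemma mean_first_order_le:
  assumes sub: "cube x R \<subseteq> \<Omega>" and r: "R / 2 ^ Suc k \<le> r" "r \<le> R / 2 ^ k"
  shows "F 1 (x, r) \<le> first_order_bound k"
proof -
  define C where "C k = {x} \<times> {R / 2 ^ Suc k..R / 2 ^ k}" for k
  have "F (m - (m - 1)) (x, r) \<le> majorant b0 (real (CARD('n) ^ m) * 1) (\<lambda>k. R / 2 ^ k) (\<beta> R) (m - 1) k"
  proof (rule chain_bound[of 1 C])
    fix k Q assume Q: "Q \<in> C k"
    have "R / 2 ^ k \<le> R / 1" using R by (intro divide_left_mono) auto
    then have le: "snd Q \<le> R" using Q by (auto simp: C_def)
    have "cube (fst Q) (snd Q) \<subseteq> cube x R"
    proof
      fix y assume "y \<in> cube (fst Q) (snd Q)"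
      then have y: "\<And>i. x $ i \<le> y $ i \<and> y $ i \<le> x $ i + snd Q" using Q by (auto simp: mem_cube C_def)
      have "x $ i \<le> y $ i \<and> y $ i \<le> x $ i + R" for i using y[of i] le by linarith
      then show "y \<in> cube x R" by (simp add: mem_cube)
    qed
    then show "cube (fst Q) (snd Q) \<subseteq> \<Omega> \<and> R / 2 ^ Suc k \<le> snd Q \<and> snd Q \<le> R / 2 ^ k"
      using sub Q by (auto simp: C_def)
  next
    fix k Q assume Q: "Q \<in> C (Suc k)"
    let ?P = "(x, R / 2 ^ Suc k)"
    have le: "R / 2 ^ Suc j \<le> R / 2 ^ j" "0 < R / 2 ^ j" for j using R by (auto simp: field_simps)
    have PC: "?P \<in> C k" using le[of k] by (simp add: C_def)
    have "closed_segment (x, R / 2 ^ Suc k) (x, snd Q) \<subseteq> C (Suc k)"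
      unfolding C_def
      by (rule closed_segment_Pair_subset, simp, rule closed_segment_subset) (use Q le[of "Suc k"] in \<open>auto simp: C_def\<close>)
    moreover have "(x, snd Q) = Q" using Q by (auto simp: C_def)
    ultimately have "linked (C (Suc k)) (0 + pdist ?P Q) ?P Q"
      using linked.step[OF linked.refl, of ?P Q] by simp
    moreover have "0 + pdist ?P Q \<le> 1 * (R / 2 ^ Suc k)"
      using Q le[of "Suc k"] le[of "Suc (Suc k)"] by (auto simp: pdist_def C_def)
    ultimately show "\<exists>P\<in>C k. \<exists>l\<le>1 * (R / 2 ^ Suc k). linked (C (Suc k)) l P Q"
      using PC by blast
  qed (use r m in \<open>auto simp: C_def\<close>)
  then show ?thesis using m by (simp add: first_order_bound_def)
qed

text \<open>These differences are the terms of the telescoping series that defines the continuous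
  representative.\<close>

lemma mean_halving:
  assumes sub: "cube x R \<subseteq> \<Omega>"
  shows "\<bar>mean (w []) x (R / 2 ^ Suc k) - mean (w []) x (R / 2 ^ k)\<bar> \<le> R / 2 ^ k * first_order_bound k"
proof -
  let ?S = "{x} \<times> {R / 2 ^ Suc k..R / 2 ^ k}"
  have le: "R / 2 ^ Suc j \<le> R / 2 ^ j" "0 < R / 2 ^ j" for j using R by (auto simp: field_simps)
  have seg: "closed_segment (x, R / 2 ^ k) (x, R / 2 ^ Suc k) \<subseteq> ?S"
    by (rule closed_segment_Pair_subset, simp, rule closed_segment_subset) (use le[of k] in auto)
  have "\<bar>mean (w []) (fst (x, R / 2 ^ Suc k)) (snd (x, R / 2 ^ Suc k)) - mean (w []) (fst (x, R / 2 ^ k)) (snd (x, R / 2 ^ k))\<bar>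
      \<le> pdist (x, R / 2 ^ k) (x, R / 2 ^ Suc k) * first_order_bound k"
  proof (rule F_segment(2)[OF _ seg, of 0])
    fix Q assume Q: "Q \<in> ?S"
    have "R / 2 ^ k \<le> R / 1" using R by (intro divide_left_mono) auto
    then have r: "snd Q \<le> R" using Q by auto
    have "cube (fst Q) (snd Q) \<subseteq> cube x R"
    proof
      fix y assume "y \<in> cube (fst Q) (snd Q)"
      then have y: "\<And>i. x $ i \<le> y $ i \<and> y $ i \<le> x $ i + snd Q" using Q by (auto simp: mem_cube)
      have "x $ i \<le> y $ i \<and> y $ i \<le> x $ i + R" for i using y[of i] r by linarith
      then show "y \<in> cube x R" by (simp add: mem_cube)
    qed
    moreover have "0 < snd Q" using Q le(2)[of "Suc k"] by auto
    ultimately show "good Q" using sub by (auto simp: good_def)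
    show "F (Suc 0) Q \<le> first_order_bound k" using mean_first_order_le[OF sub, of k "snd Q"] Q by auto
  qed (use m in auto)
  moreover have "pdist (x, R / 2 ^ k) (x, R / 2 ^ Suc k) \<le> R / 2 ^ k"
    using le[of k] le(2)[of "Suc k"] by (simp add: pdist_def)
  then have "pdist (x, R / 2 ^ k) (x, R / 2 ^ Suc k) * first_order_bound k \<le> R / 2 ^ k * first_order_bound k"
    using first_order_bound_nonneg by (intro mult_right_mono)
  ultimately show ?thesis by simp
qed

end

end


text \<open>An exhaustion of the open set by compact sets exhibits the function as a pointwise limit
  of integrable ones.\<close>

lemma locally_integrable_measurable:
  fixes \<Omega> :: "(real^'n::finite) set"
  assumes "open \<Omega>" and f: "locally_integrable \<Omega> f"
  shows "(\<lambda>x. if x \<in> \<Omega> then f x else 0) \<in> borel_measurable lebesgue"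
proof -
  obtain C :: "nat \<Rightarrow> (real^'n) set" where C: "\<And>n. compact (C n)" "\<And>n. C n \<subseteq> \<Omega>"
    "\<And>n. C n \<subseteq> interior (C (Suc n))" "\<Union>(range C) = \<Omega>"
    by (rule open_Union_compact_subsets[OF \<open>open \<Omega>\<close>]) blast
  have mono: "C n \<subseteq> C n'" if "n \<le> n'" for n n'
    using that by (rule lift_Suc_mono_le[rotated]) (meson C(3) interior_subset order_trans)
  show ?thesis
  proof (rule borel_measurable_LIMSEQ_real)
    show "(\<lambda>x. indicator (C n) x * f x) \<in> borel_measurable lebesgue" for n
      using locally_integrable_cube[OF f C(1,2)] by (rule borel_measurable_integrable)
    show "(\<lambda>n. indicator (C n) x * f x) \<longlonglongrightarrow> (if x \<in> \<Omega> then f x else 0)" for x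
    proof (cases "x \<in> \<Omega>")
      case True
      then obtain n0 where n0: "x \<in> C n0" using C(4) by blast
      have "\<forall>\<^sub>F n in sequentially. indicator (C n) x * f x = f x"
        using eventually_ge_at_top[of n0]
      proof eventually_elim
        case (elim n)
        then have "x \<in> C n" using mono[of n0 n] n0 by blast
        then show ?case by simp
      qed
      then have "(\<lambda>n. indicator (C n) x * f x) \<longlonglongrightarrow> f x" by (rule tendsto_eventually)
      with True show ?thesis by simp
    next
      case False
      then have "x \<notin> C n" for n using C(2) by blast
      then show ?thesis using False by simp
    qed
  qed
qed

section \<open>The continuous representative\<close>

context sobolev_bound
begin

text \<open>The sides 2^(-k) are the same at all points, so the local constructions near different
  points produce the same limit.\<close>

definition rep :: "real^'n \<Rightarrow> real" where
  "rep x = lim (\<lambda>k. mean (w []) x (1 / 2 ^ k))"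

lemma V_pos: "0 < V"
proof -
  obtain x where "x \<in> \<Omega>" using ne by blast
  then obtain e where e: "e > 0" "cball x e \<subseteq> \<Omega>" using open_dom open_contains_cball by blast
  define r where "r = e / CARD('n)"
  have r: "0 < r" using e by (simp add: r_def)
  have "cube x r \<subseteq> cball x (CARD('n) * r)" by (rule cube_subset_cball[OF less_imp_le[OF r]])
  then have "good (x, r)" using e r by (auto simp: good_def r_def)
  from cube_measure_le[OF this] zero_less_power[OF r, of "CARD('n)"] show ?thesis by simp
qed

text \<open>The local side is itself a power of 1/2, so that the local means R/2^k form a tail of
  the sequence in \<open>rep\<close>.\<close>

lemma small_scale:
  assumes "0 < e"
  obtains p :: nat where "CARD('n) * (1 / 2 ^ p) \<le> e" "(1 / 2 ^ p :: real) ^ CARD('n) \<le> V"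
proof -
  let ?b = "min (e / CARD('n)) (min 1 V)"
  have b: "0 < ?b" using assms V_pos by simp
  obtain p where "(1 / 2 :: real) ^ p < ?b" using real_arch_pow_inv[OF b, of "1/2"] by auto
  then have p: "1 / 2 ^ p < e / CARD('n)" "1 / 2 ^ p < (1::real)" "1 / 2 ^ p < V" by (auto simp: power_one_over)
  show thesis
  proof
    show "CARD('n) * (1 / 2 ^ p) \<le> e" using p(1) by (simp add: field_simps)
    have "(1 / 2 ^ p :: real) ^ CARD('n) \<le> (1 / 2 ^ p) ^ 1"
      by (intro power_decreasing) (auto simp: Suc_le_eq)
    then show "(1 / 2 ^ p :: real) ^ CARD('n) \<le> V" using p(3) by simp
  qed
qed

text \<open>Near \<open>x0\<close> all cubes of side at most R lie in \<Omega>. The means telescope,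
  the differences are dominated by a summable sequence independent of the point, and each mean is
  Lipschitz; by the Weierstrass test the limit is continuous.\<close>

lemma rep_local:
  assumes x0: "x0 \<in> \<Omega>"
  obtains e where "0 < e" "ball x0 e \<subseteq> \<Omega>" "continuous_on (ball x0 e) rep"
    "\<And>x. x \<in> ball x0 e \<Longrightarrow> (\<lambda>k. mean (w []) x (1 / 2 ^ k)) \<longlonglongrightarrow> rep x"
proof -
  obtain e0 where e0: "e0 > 0" "cball x0 e0 \<subseteq> \<Omega>"
    using x0 open_dom open_contains_cball by blast
  define e where "e = e0 / 2"
  have e: "0 < e" using e0 by (simp add: e_def)
  obtain p :: nat where p: "CARD('n) * (1 / 2 ^ p) \<le> e" "(1 / 2 ^ p :: real) ^ CARD('n) \<le> V"
    by (rule small_scale[OF e]) blast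
  define R :: real where "R = 1 / 2 ^ p"
  have R: "0 < R" "R \<le> 1" "R ^ CARD('n) \<le> V" using p(2) by (auto simp: R_def)
  have sub: "cube x r \<subseteq> \<Omega>" if x: "x \<in> ball x0 e" and r: "0 \<le> r" "r \<le> R" for x r
  proof
    fix y assume "y \<in> cube x r"
    then have "y \<in> cball x (CARD('n) * r)" by (rule subsetD[OF cube_subset_cball[OF r(1)]])
    then have "dist x y \<le> CARD('n) * r" by simp
    also have "\<dots> \<le> CARD('n) * R" using r(2) by (intro mult_left_mono) auto
    also have "\<dots> \<le> e" using p(1) by (simp add: R_def)
    finally have "dist x y \<le> e" .
    then have "dist x0 y \<le> e0" using x dist_triangle[of x0 y x] by (simp add: e_def)
    then show "y \<in> \<Omega>" using e0 by auto
  qed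
  have sub': "ball x0 e \<subseteq> \<Omega>"
  proof -
    have "ball x0 e \<subseteq> cball x0 e0" using e0 by (auto simp: e_def)
    then show ?thesis using e0(2) by blast
  qed
  define a where "a k x = mean (w []) x (R / 2 ^ k)" for k x
  define f where "f k x = a (Suc k) x - a k x" for k x
  have f_bound: "norm (f k x) \<le> R / 2 ^ k * first_order_bound R k" if "x \<in> ball x0 e" for k x
    using mean_halving[OF R, of x k] sub[OF that, of R] R by (simp add: f_def a_def)
  have "uniform_limit (ball x0 e) (\<lambda>k x. \<Sum>i<k. f i x) (\<lambda>x. suminf (\<lambda>i. f i x)) sequentially"
    by (rule Weierstrass_m_test[OF f_bound first_order_bound_summable[OF R]])
  moreover have "(\<Sum>i<k. f i x) = a k x - a 0 x" for k x
    unfolding f_def by (rule sum_lessThan_telescope)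
  ultimately have ul: "uniform_limit (ball x0 e) (\<lambda>k x. a k x - a 0 x) (\<lambda>x. suminf (\<lambda>i. f i x)) sequentially"
    by simp
  have cont_a: "continuous_on (ball x0 e) (a k)" for k
  proof -
    have Rk: "0 < R / 2 ^ k" "R / 2 ^ k \<le> R" using R by (auto simp: field_simps)
    define B where "B = base_const * (1 / (R / 2 ^ k)) ^ CARD('n) * A"
    have B: "0 \<le> B" using base_const_nonneg A R by (auto simp: B_def)
    \<comment> \<open>Two cubes of equal side are compared by translation. The crude bound suffices,
      as the side is fixed here and the constant may depend on k.\<close>
    have lip: "\<bar>a k y - a k x\<bar> \<le> norm (y - x) * B" if x: "x \<in> ball x0 e" and y: "y \<in> ball x0 e" for x y
    proof -
      let ?S = "ball x0 e \<times> {R / 2 ^ k}"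
      have seg: "closed_segment (x, R / 2 ^ k) (y, R / 2 ^ k) \<subseteq> ?S"
        by (rule closed_segment_Pair_subset, rule closed_segment_subset) (use x y in auto)
      have "\<bar>mean (w []) (fst (y, R / 2 ^ k)) (snd (y, R / 2 ^ k)) - mean (w []) (fst (x, R / 2 ^ k)) (snd (x, R / 2 ^ k))\<bar>
          \<le> pdist (x, R / 2 ^ k) (y, R / 2 ^ k) * B"
      proof (rule F_segment(2)[OF _ seg, of 0])
        fix Q assume Q: "Q \<in> ?S"
        show good: "good Q" using sub[of "fst Q" "snd Q"] Q Rk by (auto simp: good_def)
        have "F (Suc 0) Q \<le> base_const * (1 / snd Q) ^ CARD('n) * A"
          using m by (intro F_le_base good) auto
        then show "F (Suc 0) Q \<le> B" using Q by (auto simp: B_def)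
      qed (use m in auto)
      then show ?thesis by (simp add: a_def pdist_def)
    qed
    show ?thesis
      unfolding continuous_on_iff
    proof (intro ballI allI impI)
      fix x \<epsilon> assume x: "x \<in> ball x0 e" and \<epsilon>: "0 < (\<epsilon>::real)"
      show "\<exists>d>0. \<forall>x'\<in>ball x0 e. dist x' x < d \<longrightarrow> dist (a k x') (a k x) < \<epsilon>"
      proof (intro exI[of _ "\<epsilon> / (B + 1)"] conjI ballI impI)
        show "0 < \<epsilon> / (B + 1)" using \<epsilon> B by simp
        fix y assume y: "y \<in> ball x0 e" and d: "dist y x < \<epsilon> / (B + 1)"
        have "dist (a k y) (a k x) \<le> dist y x * B"
          using lip[OF x y] by (simp add: dist_norm)
        also have "\<dots> \<le> dist y x * (B + 1)" by (intro mult_left_mono) auto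
        also have "\<dots> < \<epsilon>" using d B by (simp add: field_simps)
        finally show "dist (a k y) (a k x) < \<epsilon>" .
      qed
    qed
  qed
  define l where "l x = a 0 x + suminf (\<lambda>i. f i x)" for x
  have "continuous_on (ball x0 e) (\<lambda>x. suminf (\<lambda>i. f i x))"
    by (rule uniform_limit_theorem[OF _ ul]) (auto intro!: always_eventually continuous_intros cont_a)
  then have cont_l: "continuous_on (ball x0 e) l"
    unfolding l_def by (intro continuous_intros cont_a)
  have lim: "(\<lambda>k. mean (w []) x (1 / 2 ^ k)) \<longlonglongrightarrow> l x" if x: "x \<in> ball x0 e" for x
  proof (rule LIMSEQ_offset[of _ p])
    have "(\<lambda>k. a k x - a 0 x) \<longlonglongrightarrow> suminf (\<lambda>i. f i x)"
      by (rule tendsto_uniform_limitI[OF ul x])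
    from tendsto_add[OF tendsto_const[of "a 0 x"] this]
    have "(\<lambda>k. a k x) \<longlonglongrightarrow> l x" by (simp add: l_def)
    moreover have "a k x = mean (w []) x (1 / 2 ^ (k + p))" for k
      by (simp add: a_def R_def power_add mult.commute)
    ultimately show "(\<lambda>k. mean (w []) x (1 / 2 ^ (k + p))) \<longlonglongrightarrow> l x" by simp
  qed
  have rep_l: "rep x = l x" if "x \<in> ball x0 e" for x
    unfolding rep_def by (rule limI[OF lim[OF that]])
  show thesis
  proof
    show "0 < e" by (rule e)
    show "ball x0 e \<subseteq> \<Omega>" by (rule sub')
    show "continuous_on (ball x0 e) rep"
      by (rule continuous_on_eq[OF cont_l]) (simp add: rep_l)
    show "(\<lambda>k. mean (w []) x (1 / 2 ^ k)) \<longlonglongrightarrow> rep x" if "x \<in> ball x0 e" for x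
      using lim[OF that] rep_l[OF that] by simp
  qed
qed

lemma rep_continuous: "continuous_on \<Omega> rep"
proof -
  have "isCont rep x" if x: "x \<in> \<Omega>" for x
  proof (rule rep_local[OF x])
    fix e assume "0 < e" "ball x e \<subseteq> \<Omega>" "continuous_on (ball x e) rep"
    then show "isCont rep x" by (simp add: continuous_on_eq_continuous_at)
  qed
  then show ?thesis by (auto intro: continuous_at_imp_continuous_on)
qed

lemma rep_tendsto:
  assumes x: "x \<in> \<Omega>"
  shows "(\<lambda>k. mean (w []) x (1 / 2 ^ k)) \<longlonglongrightarrow> rep x"
proof (rule rep_local[OF x])
  fix e assume "0 < e" and *: "\<And>y. y \<in> ball x e \<Longrightarrow> (\<lambda>k. mean (w []) y (1 / 2 ^ k)) \<longlonglongrightarrow> rep y"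
  then show ?thesis by (intro *) simp
qed

lemma w_Nil_integrable: "integrable lebesgue (\<lambda>x. if x \<in> \<Omega> then w [] x else 0)"
proof -
  have meas: "(\<lambda>x. if x \<in> \<Omega> then w [] x else 0) \<in> borel_measurable lebesgue"
    by (rule locally_integrable_measurable[OF open_dom w_locally_integrable]) simp
  have "(\<integral>\<^sup>+x. ennreal (norm (if x \<in> \<Omega> then w [] x else 0)) \<partial>lebesgue) = (\<integral>\<^sup>+x\<in>\<Omega>. ennreal \<bar>w [] x\<bar> \<partial>lebesgue)"
    by (intro nn_integral_cong) (auto simp: indicator_def)
  also have "\<dots> \<le> (\<integral>\<^sup>+s\<in>{0<..<V}. grad_rearr 0 s \<partial>lebesgue)"
    by (rule nn_integral_w_le[OF _ _ dom_lmeasurable]) auto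
  also have "\<dots> \<le> ennreal (V powr (1 - m / CARD('n)) * A)"
    by (rule grad_rearr_integral_le) (use V_pos in auto)
  also have "\<dots> < \<infinity>" by simp
  finally show ?thesis using meas by (intro integrableI_bounded)
qed

text \<open>Lebesgue differentiation along cubes with lower corner x, applied to \<open>w []\<close>
  extended by 0 outside \<Omega>.\<close>

lemma rep_AE_w: "AE x in lebesgue. x \<in> \<Omega> \<longrightarrow> rep x = w [] x"
proof -
  let ?f = "\<lambda>x. if x \<in> \<Omega> then w [] x else 0"
  have "?f absolutely_integrable_on UNIV"
    using w_Nil_integrable by (simp add: set_integrable_def)
  then have io: "?f integrable_on cbox a b" for a b
    by (intro integrable_on_subcbox[OF set_lebesgue_integral_eq_integral(1)]) auto
  obtain N where N: "negligible N" and lim: "\<And>x e. x \<notin> N \<Longrightarrow> 0 < e \<Longrightarrow>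
      \<exists>d>0. \<forall>h. 0 < h \<and> h < d \<longrightarrow>
        norm (integral (cbox x (x + h *\<^sub>R One)) ?f /\<^sub>R h ^ DIM(real^'n) - ?f x) < e"
    using integrable_ccontinuous_explicit[OF io] by blast
  have "AE x in lebesgue. x \<notin> N"
    using N by (intro AE_not_in) (simp add: negligible_iff_null_sets)
  then show ?thesis
  proof eventually_elim
    case (elim x)
    show ?case
    proof
      assume x: "x \<in> \<Omega>"
      obtain e where e: "e > 0" "cball x e \<subseteq> \<Omega>" using x open_dom open_contains_cball by blast
      have mean_int: "mean (w []) x h = integral (cbox x (x + h *\<^sub>R One)) ?f /\<^sub>R h ^ DIM(real^'n)"
        if h: "0 < h" "cube x h \<subseteq> \<Omega>" for h
      proof -
        have "integrable lebesgue (\<lambda>y. indicator (cube x h) y * w [] y)"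
          by (rule locally_integrable_cube[OF w_locally_integrable compact_cube h(2)]) simp
        then have "w [] absolutely_integrable_on cube x h" by (simp add: set_integrable_def)
        then have "integral (cube x h) (w []) = (LINT y:cube x h|lebesgue. w [] y)"
          by (simp add: set_lebesgue_integral_eq_integral(2))
        moreover have "integral (cube x h) ?f = integral (cube x h) (w [])"
          using h(2) by (intro Henstock_Kurzweil_Integration.integral_cong) auto
        ultimately have "integral (cube x h) ?f = (\<integral>y. indicator (cube x h) y * w [] y \<partial>lebesgue)"
          by (simp add: set_lebesgue_integral_def)
        then show ?thesis
          using h(1) by (simp add: mean_eq cube_def power_one_over divide_inverse mult.commute power_inverse)
      qed
      have "(\<lambda>k. mean (w []) x (1 / 2 ^ k)) \<longlonglongrightarrow> w [] x"
      proof (rule LIMSEQ_I)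
        fix r :: real assume r: "0 < r"
        obtain d where d: "d > 0" "\<And>h. 0 < h \<Longrightarrow> h < d \<Longrightarrow>
            norm (integral (cbox x (x + h *\<^sub>R One)) ?f /\<^sub>R h ^ DIM(real^'n) - ?f x) < r"
          using lim[OF elim r] by blast
        let ?b = "min d (e / CARD('n))"
        have b: "0 < ?b" using d e by simp
        obtain k0 where k0: "(1 / 2 :: real) ^ k0 < ?b" using real_arch_pow_inv[OF b, of "1/2"] by auto
        show "\<exists>no. \<forall>n\<ge>no. norm (mean (w []) x (1 / 2 ^ n) - w [] x) < r"
        proof (intro exI[of _ k0] allI impI)
          fix k assume "k0 \<le> k"
          then have "(1 / 2 :: real) ^ k \<le> (1 / 2) ^ k0" by (intro power_decreasing) auto
          then have h: "1 / 2 ^ k < d" "1 / 2 ^ k < e / CARD('n)" using k0 by (auto simp: power_one_over)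
          have pos: "0 < (1 / 2 ^ k :: real)" by simp
          have "cube x (1 / 2 ^ k) \<subseteq> cball x (CARD('n) * (1 / 2 ^ k))" by (rule cube_subset_cball) simp
          also have "\<dots> \<subseteq> cball x e" using h(2) by (intro subset_cball) (simp add: field_simps)
          finally have "cube x (1 / 2 ^ k) \<subseteq> \<Omega>" using e by blast
          then show "norm (mean (w []) x (1 / 2 ^ k) - w [] x) < r"
            using d(2)[OF pos h(1)] x by (simp only: mean_int[OF pos] if_True)
        qed
      qed
      from LIMSEQ_unique[OF rep_tendsto[OF x] this] show "rep x = w [] x" .
    qed
  qed
qed

lemma rep_AE: "AE x in lebesgue_on \<Omega>. rep x = u x"
proof -
  have nil: "has_weak_derivative \<Omega> [] u (w [])" by (rule w) simp
  then have "has_weak_derivative \<Omega> [] u u"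
    by (intro has_weak_derivative_Nil) (simp add: has_weak_derivative_def)
  from weak_derivative_unique[OF open_dom nil this] rep_AE_w
  have "AE x in lebesgue. x \<in> \<Omega> \<longrightarrow> rep x = u x" by eventually_elim auto
  then show ?thesis by (simp add: AE_restrict_space_iff dom_sets)
qed

lemma mean_const:
  assumes r: "r > 0"
  shows "mean (\<lambda>y. t) (c :: real^'n) r = t"
proof -
  have "(\<integral>y. indicator (cube c r) y * t \<partial>lebesgue) = measure lebesgue (cube c r) * t"
    by simp
  also have "\<dots> = r ^ CARD('n) * t" by (simp only: measure_cube[OF less_imp_le[OF r]])
  finally have e: "(\<integral>y. indicator (cube c r) y * t \<partial>lebesgue) = r ^ CARD('n) * t" .
  show ?thesis unfolding mean_eq e using r by (simp add: power_one_over)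
qed

text \<open>The cubes of the chain shrink to \<open>x\<close> without having to contain it. By
  continuity the mean of \<open>\<bar>w [] y\<bar>\<close> over a late cube is at least
  \<open>\<bar>rep x\<bar>\<close> up to an arbitrarily small error.\<close>

lemma abs_rep_le:
  assumes x: "x \<in> \<Omega>"
    and Q: "\<And>k. good (Q k)" "\<And>k. F 0 (Q k) \<le> B"
    and lim: "\<And>e. e > 0 \<Longrightarrow> \<exists>k. cube (fst (Q k)) (snd (Q k)) \<subseteq> ball x e"
  shows "\<bar>rep x\<bar> \<le> B"
proof (rule field_le_epsilon)
  fix \<epsilon> :: real assume \<epsilon>: "0 < \<epsilon>"
  have "isCont rep x" using rep_continuous open_dom x by (simp add: continuous_on_eq_continuous_at)
  then obtain e where e: "e > 0" "\<And>y. dist y x < e \<Longrightarrow> dist (rep y) (rep x) < \<epsilon>"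
    using \<epsilon> unfolding continuous_at_eps_delta by blast
  obtain k where k: "cube (fst (Q k)) (snd (Q k)) \<subseteq> ball x e" using lim[OF e(1)] by blast
  define c r where "c = fst (Q k)" and "r = snd (Q k)"
  have r: "r > 0" and sub: "cube c r \<subseteq> \<Omega>" using Q(1)[of k] by (auto simp: good_def c_def r_def)
  have int: "integrable lebesgue (\<lambda>y. indicator (cube c r) y * \<bar>w [] y\<bar>)"
    using integrable_abs[OF locally_integrable_cube[OF w_locally_integrable[of "[]"] compact_cube sub]]
    by (simp add: abs_mult)
  have intc: "integrable lebesgue (\<lambda>y. indicator (cube c r) y * (\<bar>rep x\<bar> - \<epsilon>))"
  proof (intro integrable_mult_left integrable_real_indicator cube_sets)
    show "emeasure lebesgue (cube c r) < \<infinity>"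
      unfolding emeasure_cube[OF less_imp_le[OF r]] by (simp only: ennreal_less_top infinity_ennreal_def)
  qed
  have "\<bar>rep x\<bar> - \<epsilon> = mean (\<lambda>y. \<bar>rep x\<bar> - \<epsilon>) c r" by (rule mean_const[OF r, symmetric])
  also have "\<dots> \<le> mean (\<lambda>y. \<bar>w [] y\<bar>) c r"
    unfolding mean_eq
  proof (intro mult_left_mono integral_mono_AE[OF intc int])
    show "AE y in lebesgue. indicator (cube c r) y * (\<bar>rep x\<bar> - \<epsilon>) \<le> indicator (cube c r) y * \<bar>w [] y\<bar>"
      using rep_AE_w
    proof eventually_elim
      case (elim y)
      show ?case
      proof (cases "y \<in> cube c r")
        case True
        then have "w [] y = rep y" using elim sub by auto
        moreover have "dist (rep y) (rep x) < \<epsilon>"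
          using True k by (intro e(2)) (auto simp: c_def r_def dist_commute)
        ultimately show ?thesis using True by (simp add: dist_real_def)
      qed simp
    qed
  qed (use r in simp)
  also have "\<dots> = F 0 (Q k)" by (simp add: F_def c_def r_def)
  also have "\<dots> \<le> B" by (rule Q(2))
  finally show "\<bar>rep x\<bar> \<le> B + \<epsilon>" by simp
qed

end

text \<open>The constant is fixed before the function: the data \<open>R\<close> and \<Lambda> of
  the chains are uniform over the points of \<Omega>, and \<open>F0_bound\<close> is linear in
  \<open>A\<close>.\<close>

lemma embedding_estimate:
  fixes \<Omega> :: "(real^'n::finite) set"
  assumes "bounded \<Omega>" "jones_domain \<Omega>" and m: "1 \<le> m" "m < CARD('n)"
  obtains K :: real where "0 \<le> K"
    "\<And>u A. sobolev_bound \<Omega> m u A \<Longrightarrow> \<exists>g\<in>Cb_space \<Omega>. (AE x in lebesgue_on \<Omega>. g x = u x) \<and> Cb_norm \<Omega> g \<le> K * A"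
proof (rule jones_chain[OF assms(1,2)])
  fix R \<Lambda> :: real
  assume R: "0 < R" "R \<le> 1" and \<Lambda>: "0 \<le> \<Lambda>"
    and ch: "\<And>x. x \<in> \<Omega> \<Longrightarrow> \<exists>C z.
       (\<forall>k. \<forall>Q\<in>C k. cube (fst Q) (snd Q) \<subseteq> \<Omega> \<and> R / 2 ^ Suc k \<le> snd Q \<and> snd Q \<le> R / 2 ^ k) \<and>
       (\<forall>k. \<forall>Q\<in>C (Suc k). \<exists>P\<in>C k. \<exists>l\<le>\<Lambda> * (R / 2 ^ Suc k). linked (C (Suc k)) l P Q) \<and>
       (\<forall>k. (z k, R / 2 ^ k) \<in> C k \<and> dist x (z k) \<le> 1 / 2 ^ k)"
  let ?n = "CARD('n)"
  define K where "K = (2 + 2 * (?n ^ m * \<Lambda>)) ^ m * (m * ((?n ^ m * measure lebesgue \<Omega> powr (1 - m / ?n)) * (2 / R) ^ ?n)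
    + real ?n ^ m * 2 ^ ?n * 2)"
  have K: "0 \<le> K" unfolding K_def using \<Lambda> R by (intro mult_nonneg_nonneg add_nonneg_nonneg zero_le_power) auto
  show thesis
  proof (rule that[OF K])
    fix u A assume "sobolev_bound \<Omega> m u A"
    then interpret sobolev_bound \<Omega> m u A .
    have bound: "\<bar>rep x\<bar> \<le> K * A" if x: "x \<in> \<Omega>" for x
    proof -
      from ch[OF x] obtain C z where
        c1: "\<forall>k. \<forall>Q\<in>C k. cube (fst Q) (snd Q) \<subseteq> \<Omega> \<and> R / 2 ^ Suc k \<le> snd Q \<and> snd Q \<le> R / 2 ^ k"
        and c2: "\<forall>k. \<forall>Q\<in>C (Suc k). \<exists>P\<in>C k. \<exists>l\<le>\<Lambda> * (R / 2 ^ Suc k). linked (C (Suc k)) l P Q"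
        and c3: "\<forall>k. (z k, R / 2 ^ k) \<in> C k \<and> dist x (z k) \<le> 1 / 2 ^ k"
        by (elim exE conjE)
      note C = c1[rule_format] and link = c2[rule_format]
      have z: "(z k, R / 2 ^ k) \<in> C k" "dist x (z k) \<le> 1 / 2 ^ k" for k
        using c3 by simp_all
      have good: "good (z k, R / 2 ^ k)" for k
        using C[OF z(1)[of k]] R by (simp add: good_def)
      have RV: "R ^ ?n \<le> V" using cube_measure_le[OF good[of 0]] by simp
      show ?thesis
      proof (rule abs_rep_le[OF x, of "\<lambda>k. (z k, R / 2 ^ k)"])
        show "F 0 (z k, R / 2 ^ k) \<le> K * A" for k
          using F0_bound[OF R RV \<Lambda> C link z(1)[of k]] by (simp add: K_def base_const_def)
        fix e :: real assume e: "0 < e"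
        have e': "0 < e / (1 + ?n * R)" using e R by (intro divide_pos_pos add_pos_nonneg) auto
        obtain k where k: "(1 / 2 :: real) ^ k < e / (1 + ?n * R)" using real_arch_pow_inv[OF e', of "1/2"] by auto
        have Rk: "0 \<le> R / 2 ^ k" using R by simp
        have "cube (z k) (R / 2 ^ k) \<subseteq> ball x e"
        proof
          fix y assume "y \<in> cube (z k) (R / 2 ^ k)"
          then have "y \<in> cball (z k) (?n * (R / 2 ^ k))" by (rule subsetD[OF cube_subset_cball[OF Rk]])
          then have "dist x y \<le> 1 / 2 ^ k + ?n * (R / 2 ^ k)"
            using dist_triangle[of x y "z k"] z(2)[of k] by simp
          also have "\<dots> = (1 / 2) ^ k * (1 + ?n * R)" by (simp add: power_one_over field_simps)
          also have "\<dots> < e" using k R by (simp add: pos_less_divide_eq add_pos_nonneg)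
          finally show "y \<in> ball x e" by simp
        qed
        then show "\<exists>k. cube (fst (z k, R / 2 ^ k)) (snd (z k, R / 2 ^ k)) \<subseteq> ball x e" by auto
      qed (rule good)
    qed
    have "rep \<in> Cb_space \<Omega>"
      unfolding Cb_space_def using rep_continuous bound by (auto simp: bounded_iff)
    moreover have "Cb_norm \<Omega> rep \<le> K * A"
      unfolding Cb_norm_def using ne bound by (intro cSUP_least) auto
    ultimately show "\<exists>g\<in>Cb_space \<Omega>. (AE x in lebesgue_on \<Omega>. g x = u x) \<and> Cb_norm \<Omega> g \<le> K * A"
      using rep_AE by blast
  qed
qed


section \<open>Weights\<close>

text \<open>For positive \<open>b\<close> the inequality ln z \<le> z is applied to z = x^(a/b),
  which bounds ln x by (b/a) x^(a/b).\<close>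

lemma log_powr_le:
  fixes a b :: real
  assumes a: "0 < a"
  obtains C where "0 < C" "\<And>x. 1 \<le> x \<Longrightarrow> (1 + ln x) powr b \<le> C * x powr a"
proof (cases "b \<le> 0")
  case True
  show thesis
  proof (rule that[of 1])
    fix x :: real assume x: "1 \<le> x"
    have "(1 + ln x) powr b \<le> (1 + ln x) powr 0" using True x by (intro powr_mono) auto
    also have "\<dots> = 1"
    proof -
      have "1 + ln x \<noteq> 0" using ln_ge_zero[OF x] by linarith
      then show ?thesis by simp
    qed
    also have "\<dots> \<le> x powr a" using x a by (intro ge_one_powr_ge_zero) auto
    finally show "(1 + ln x) powr b \<le> 1 * x powr a" by simp
  qed simp
next
  case False
  then have b: "0 < b" by simp
  show thesis
  proof (rule that[of "(1 + b / a) powr b"])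
    have "0 < 1 + b / a" using a b by (simp add: add_pos_pos)
    then show "0 < (1 + b / a) powr b" unfolding powr_gt_zero by linarith
    fix x :: real assume x: "1 \<le> x"
    have X: "1 \<le> x powr (a / b)" using x a b by (intro ge_one_powr_ge_zero) auto
    have "ln (x powr (a / b)) \<le> x powr (a / b)" using X by (intro ln_bound) auto
    then have "a / b * ln x \<le> x powr (a / b)" using x by (simp add: ln_powr)
    then have "ln x \<le> b / a * x powr (a / b)" using a b by (simp add: field_simps)
    then have "1 + ln x \<le> (1 + b / a) * x powr (a / b)" using X by (simp add: algebra_simps)
    then have "(1 + ln x) powr b \<le> ((1 + b / a) * x powr (a / b)) powr b"
      using x b by (intro powr_mono2) auto
    also have "\<dots> = (1 + b / a) powr b * x powr a"
      using a b x by (simp add: powr_mult powr_powr)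
    finally show "(1 + ln x) powr b \<le> (1 + b / a) powr b * x powr a" .
  qed
qed

lemma log_powr_decay:
  fixes a b :: real
  assumes a: "0 < a"
  obtains C where "0 < C" "\<And>x. 1 \<le> x \<Longrightarrow> x powr - a * (1 + ln x) powr b \<le> C"
proof -
  obtain C where C: "0 < C" "\<And>x. 1 \<le> x \<Longrightarrow> (1 + ln x) powr b \<le> C * x powr a"
    using log_powr_le[OF a, of b] by blast
  show thesis
  proof (rule that[OF C(1)])
    fix x :: real assume x: "1 \<le> x"
    have "x powr - a * (1 + ln x) powr b \<le> x powr - a * (C * x powr a)"
      using C(2)[OF x] by (intro mult_left_mono) auto
    also have "\<dots> = C" using x by (simp add: powr_minus field_simps)
    finally show "x powr - a * (1 + ln x) powr b \<le> C" .
  qed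
qed

text \<open>
  Since \<open>1 / (s * log_weight A0 p s)\<close> is integrable at 0 exactly for \<open>p > 1\<close>, such products are fine enough
  to separate all the cases of the theorem. The shift by \<open>A0\<close> keeps the logarithms positive on (0,1].
\<close>

definition shifted_log :: "real \<Rightarrow> real \<Rightarrow> real" where
  "shifted_log A0 s = A0 - ln s"

definition log_weight :: "real \<Rightarrow> real \<Rightarrow> real \<Rightarrow> real" where
  "log_weight A0 p s = shifted_log A0 s * (1 + ln (shifted_log A0 s)) * (1 + ln (1 + ln (shifted_log A0 s))) powr p"

lemma shifted_log_ge_1:
  assumes "1 \<le> A0" "0 < s" "s \<le> 1"
  shows "1 \<le> shifted_log A0 s"
proof -
  have "ln s \<le> 0" using assms by (subst ln_le_zero_iff)
  then show ?thesis using assms unfolding shifted_log_def by linarith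
qed

lemma shifted_log_1:
  assumes "0 < s" "s \<le> 1"
  shows "shifted_log 1 s = ell s"
proof -
  have "ln s \<le> 0" using assms by (subst ln_le_zero_iff)
  then show ?thesis by (simp add: shifted_log_def ell_def)
qed

lemma DERIV_one_plus_ln:
  "(h has_real_derivative d) (at s) \<Longrightarrow> 0 < h s \<Longrightarrow> ((\<lambda>s. 1 + ln (h s)) has_real_derivative d / h s) (at s)"
  by (auto intro!: derivative_eq_intros)

lemma DERIV_powr_const:
  "(h has_real_derivative d) (at s) \<Longrightarrow> 0 < h s \<Longrightarrow>
    ((\<lambda>s. h s powr r) has_real_derivative r * h s powr (r - 1) * d) (at s)"
  using DERIV_fun_powr[of h d s r] by simp

lemma ell_ge_1: "1 \<le> ell s"
  by (simp add: ell_def)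

lemma ellell_ge_1: "1 \<le> ellell s"
  using ell_ge_1 by (simp add: ellell_def)

lemma log_weight_pos:
  assumes "1 \<le> shifted_log A0 s"
  shows "0 < log_weight A0 p s"
proof -
  have 1: "0 \<le> ln (shifted_log A0 s)" using assms by simp
  then have 2: "0 \<le> ln (1 + ln (shifted_log A0 s))" by simp
  have "0 < shifted_log A0 s" "0 < 1 + ln (shifted_log A0 s)" "1 + ln (1 + ln (shifted_log A0 s)) \<noteq> 0"
    using assms 1 2 by linarith+
  then show ?thesis unfolding log_weight_def by (intro mult_pos_pos) (auto simp: powr_gt_zero)
qed

text \<open>The integrand has the antiderivative \<open>G\<close>, the triple logarithm raised to 1
  - p over p - 1, which takes values between 0 and 1/(p - 1).\<close>

lemma log_weight_integral:
  assumes A0: "1 \<le> A0" and p: "1 < p"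
  shows "(\<integral>\<^sup>+s\<in>{0<..1}. ennreal (1 / (s * log_weight A0 p s)) \<partial>lborel) \<le> ennreal (1 / (p - 1))"
proof -
  define g where "g s = 1 / (s * log_weight A0 p s)" for s
  define G where "G s = (1 + ln (1 + ln (shifted_log A0 s))) powr (1 - p) / (p - 1)" for s
  have G: "(G has_real_derivative g s) (at s)" "0 \<le> g s" "0 \<le> G s" "G s \<le> 1 / (p - 1)" if s: "0 < s" "s \<le> 1" for s
  proof -
    have y: "1 \<le> shifted_log A0 s" by (rule shifted_log_ge_1[OF A0 s])
    then have l0: "0 \<le> ln (shifted_log A0 s)" by simp
    then have l1: "0 \<le> ln (1 + ln (shifted_log A0 s))" by simp
    have d: "(shifted_log A0 has_real_derivative - (1 / s)) (at s)"
      unfolding shifted_log_def using s by (auto intro!: derivative_eq_intros)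
    have d1: "((\<lambda>s. 1 + ln (shifted_log A0 s)) has_real_derivative (- (1 / s)) / shifted_log A0 s) (at s)"
      using y by (intro DERIV_one_plus_ln d) linarith
    have d2: "((\<lambda>s. 1 + ln (1 + ln (shifted_log A0 s))) has_real_derivative
        (- (1 / s)) / shifted_log A0 s / (1 + ln (shifted_log A0 s))) (at s)"
      using l0 by (intro DERIV_one_plus_ln[OF d1]) linarith
    have "(G has_real_derivative ((1 - p) * (1 + ln (1 + ln (shifted_log A0 s))) powr (1 - p - 1) *
        ((- (1 / s)) / shifted_log A0 s / (1 + ln (shifted_log A0 s)))) / (p - 1)) (at s)"
      unfolding G_def using l1
      by (intro DERIV_cdivide DERIV_powr_const[OF d2]) linarith
    moreover have "((1 - p) * (1 + ln (1 + ln (shifted_log A0 s))) powr (1 - p - 1) *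
        ((- (1 / s)) / shifted_log A0 s / (1 + ln (shifted_log A0 s)))) / (p - 1) = g s"
    proof -
      have "(1 + ln (1 + ln (shifted_log A0 s))) powr (1 - p - 1) = 1 / (1 + ln (1 + ln (shifted_log A0 s))) powr p"
        by (simp add: powr_minus_divide)
      then have "(1 - p) * (1 + ln (1 + ln (shifted_log A0 s))) powr (1 - p - 1) * ((- (1 / s)) / shifted_log A0 s / (1 + ln (shifted_log A0 s))) =
          (p - 1) * g s"
      proof -
        have "(1 - p) * (1 / Z) * ((- (1 / s)) / L / Y) = (p - 1) * (1 / (s * (L * Y * Z)))" for Z L Y :: real
          by (simp add: divide_inverse algebra_simps)
        then show ?thesis
          unfolding g_def log_weight_def \<open>(1 + ln (1 + ln (shifted_log A0 s))) powr (1 - p - 1) = 1 / (1 + ln (1 + ln (shifted_log A0 s))) powr p\<close> .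
      qed
      then show ?thesis using p by simp
    qed
    ultimately show "(G has_real_derivative g s) (at s)" by simp
    show "0 \<le> g s" unfolding g_def using log_weight_pos[OF y, of p] s by simp
    show "0 \<le> G s" unfolding G_def using p by simp
    have "(1 + ln (1 + ln (shifted_log A0 s))) powr (1 - p) \<le> (1 + ln (1 + ln (shifted_log A0 s))) powr 0"
      using l1 p by (intro powr_mono) auto
    also have "\<dots> = 1" using l1 by simp
    finally show "G s \<le> 1 / (p - 1)" unfolding G_def using p by (intro divide_right_mono) auto
  qed
  have gm: "g \<in> borel_measurable borel"
    unfolding g_def log_weight_def shifted_log_def by measurable
  \<comment> \<open>The singularity at 0 is avoided by exhausting (0, 1] with closed intervals, on
    which the fundamental theorem of calculus applies.\<close>
  let ?I = "\<lambda>k::nat. {1 / real (Suc k)..1::real}"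
  have "(\<integral>\<^sup>+s\<in>{0<..1}. ennreal (g s) \<partial>lborel) = (\<integral>\<^sup>+s. (SUP k. ennreal (g s) * indicator (?I k) s) \<partial>lborel)"
  proof (intro nn_integral_cong)
    fix s :: real
    show "ennreal (g s) * indicator {0<..1} s = (SUP k. ennreal (g s) * indicator (?I k) s)"
    proof (cases "s \<in> {0<..1}")
      case True
      then obtain k where k: "1 / real (Suc k) \<le> s"
        using reals_Archimedean[of s] by (auto simp: inverse_eq_divide intro: less_imp_le)
      show ?thesis
      proof (intro antisym)
        show "ennreal (g s) * indicator {0<..1} s \<le> (SUP k. ennreal (g s) * indicator (?I k) s)"
          using True k by (intro SUP_upper2[of k]) auto
        show "(SUP k. ennreal (g s) * indicator (?I k) s) \<le> ennreal (g s) * indicator {0<..1} s"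
          using True by (intro SUP_least mult_left_mono) (auto simp: indicator_def)
      qed
    next
      case False
      have "s \<notin> ?I k" for k
      proof
        assume s: "s \<in> ?I k"
        have "0 < 1 / real (Suc k)" by simp
        with s have "0 < s" by (simp only: atLeastAtMost_iff) linarith
        with s False show False by simp
      qed
      with False show ?thesis by simp
    qed
  qed
  also have "\<dots> = (SUP k. \<integral>\<^sup>+s. ennreal (g s) * indicator (?I k) s \<partial>lborel)"
  proof (rule nn_integral_monotone_convergence_SUP)
    show "incseq (\<lambda>k s. ennreal (g s) * indicator (?I k) s)"
    proof (intro incseq_SucI le_funI mult_left_mono)
      fix k :: nat and s :: real
      have "1 / real (Suc (Suc k)) \<le> 1 / real (Suc k)" by (intro frac_le) auto
      then show "indicator (?I k) s \<le> (indicator (?I (Suc k)) s :: ennreal)"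
        by (auto simp: indicator_def simp del: of_nat_Suc)
    qed simp
    show "(\<lambda>s. ennreal (g s) * indicator (?I k) s) \<in> borel_measurable lborel" for k
      using gm by measurable
  qed
  also have "\<dots> \<le> ennreal (1 / (p - 1))"
  proof (rule SUP_least)
    fix k
    have k: "0 < 1 / real (Suc k)" "1 / real (Suc k) \<le> 1" by auto
    have pos: "0 < x" if "x \<in> ?I k" for x
      using that k(1) by (simp only: atLeastAtMost_iff) linarith
    have "(\<integral>\<^sup>+s. ennreal (g s) * indicator (?I k) s \<partial>lborel) = ennreal (G 1 - G (1 / real (Suc k)))"
    proof (rule nn_integral_FTC_Icc[OF gm _ _ k(2)])
      fix x assume x: "x \<in> ?I k"
      then have "x \<le> 1" by simp
      then show "(G has_real_derivative g x) (at x)" "0 \<le> g x" by (rule G(1,2)[OF pos[OF x]])+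
    qed
    also have "\<dots> \<le> ennreal (1 / (p - 1))"
      using G(4)[of 1] G(3)[OF k] by (intro ennreal_leI) simp
    finally show "(\<integral>\<^sup>+s. ennreal (g s) * indicator (?I k) s \<partial>lborel) \<le> ennreal (1 / (p - 1))" .
  qed
  finally show ?thesis by (simp add: g_def)
qed

lemma log_weight_integral_lebesgue_on:
  assumes A0: "1 \<le> A0" and p: "1 < p"
  shows "(\<integral>\<^sup>+s. ennreal (1 / (s * log_weight A0 p s)) \<partial>lebesgue_on {0<..<1}) \<le> ennreal (1 / (p - 1))"
proof -
  have meas: "(\<lambda>s. ennreal (1 / (s * log_weight A0 p s)) * indicator {0<..<1} s) \<in> borel_measurable borel"
    unfolding log_weight_def shifted_log_def by measurable
  have "(\<integral>\<^sup>+s. ennreal (1 / (s * log_weight A0 p s)) \<partial>lebesgue_on {0<..<1}) =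
      (\<integral>\<^sup>+s\<in>{0<..<1}. ennreal (1 / (s * log_weight A0 p s)) \<partial>lebesgue)"
    by (simp add: nn_integral_restrict_space)
  also have "\<dots> = (\<integral>\<^sup>+s\<in>{0<..<1}. ennreal (1 / (s * log_weight A0 p s)) \<partial>lborel)"
    by (rule nn_integral_completion)
  also have "\<dots> \<le> (\<integral>\<^sup>+s\<in>{0<..1}. ennreal (1 / (s * log_weight A0 p s)) \<partial>lborel)"
    by (intro nn_integral_mono mult_left_mono) (auto simp: indicator_def)
  also have "\<dots> \<le> ennreal (1 / (p - 1))" by (rule log_weight_integral[OF A0 p])
  finally show ?thesis .
qed

section \<open>Exponents\<close>

lemma exponent_cases:
  assumes "1 \<le> (q :: ennreal)"
  obtains "q = \<infinity>" "recip q = 0" | Q where "1 \<le> Q" "q = ennreal Q" "recip q = 1 / Q" "enn2real q = Q" "q \<noteq> \<infinity>"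
proof (cases q)
  case (real Q)
  then have "1 \<le> Q" using assms by (simp add: ennreal_1[symmetric] del: ennreal_1)
  moreover have "recip q = 1 / Q"
    using real \<open>1 \<le> Q\<close> by (simp add: recip_def ennreal_1[symmetric] divide_ennreal del: ennreal_1)
  ultimately show thesis using that(2)[of Q] real by simp
next
  case top
  then show thesis using that(1) by (simp add: recip_def)
qed

lemma recip_bounds:
  assumes "1 \<le> q"
  shows "0 \<le> recip q" "recip q \<le> 1"
  using assms by (cases q rule: exponent_cases; simp)+

lemma recip_1 [simp]: "recip 1 = 1"
  by (simp add: recip_def)

lemma recip_conj_exp:
  assumes "1 \<le> q"
  shows "recip (conj_exp q) = 1 - recip q"
  using assms
proof (cases q rule: exponent_cases)
  case 1
  then show ?thesis by (simp add: conj_exp_def)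
next
  case (2 Q)
  show ?thesis
  proof (cases "Q = 1")
    case True
    then show ?thesis using 2 by (simp add: conj_exp_def recip_def)
  next
    case False
    then have Q: "1 < Q" using 2 by simp
    then have "q \<noteq> 1" using 2 by simp
    have "q - 1 = ennreal (Q - 1)" using 2 Q by (simp add: ennreal_minus ennreal_1[symmetric] del: ennreal_1)
    then have "conj_exp q = ennreal (Q / (Q - 1))"
      using 2 Q \<open>q \<noteq> 1\<close> by (simp add: conj_exp_def divide_ennreal)
    then have "recip (conj_exp q) = 1 / (Q / (Q - 1))"
      using Q by (simp add: recip_def ennreal_1[symmetric] divide_ennreal del: ennreal_1)
    then show ?thesis unfolding 2(3) using Q by (simp add: field_simps)
  qed
qed

lemma conj_exp_ge_1:
  assumes "1 \<le> q"
  shows "1 \<le> conj_exp q"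
  using assms
proof (cases q rule: exponent_cases)
  case 1
  then show ?thesis by (simp add: conj_exp_def)
next
  case (2 Q)
  show ?thesis
  proof (cases "Q = 1")
    case True
    then show ?thesis using 2 by (simp add: conj_exp_def)
  next
    case False
    then have Q: "1 < Q" using 2 by simp
    then have "q \<noteq> 1" using 2 by simp
    have "q - 1 = ennreal (Q - 1)" using 2 Q by (simp add: ennreal_minus ennreal_1[symmetric] del: ennreal_1)
    then have "conj_exp q = ennreal (Q / (Q - 1))"
      using 2 Q \<open>q \<noteq> 1\<close> by (simp add: conj_exp_def divide_ennreal)
    moreover have "1 \<le> Q / (Q - 1)" using Q by (simp add: field_simps)
    ultimately show ?thesis by (simp add: ennreal_1[symmetric] del: ennreal_1)
  qed
qed

lemma recip_ennreal_div:
  "0 < a \<Longrightarrow> 0 < b \<Longrightarrow> recip (ennreal (a / b)) = b / a"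
  by (simp add: recip_def ennreal_1[symmetric] divide_ennreal del: ennreal_1)

lemma recip_less:
  assumes "1 \<le> p" "0 < a" "0 < b"
  shows "ennreal (a / b) < p \<Longrightarrow> recip p < b / a" and "p < ennreal (a / b) \<Longrightarrow> b / a < recip p"
proof -
  show "recip p < b / a" if less: "ennreal (a / b) < p"
    using assms(1)
  proof (cases p rule: exponent_cases)
    case (2 P)
    then have "a / b < P" using less assms by (simp add: ennreal_less_iff)
    then show ?thesis unfolding 2(3) using 2(1) assms by (simp add: field_simps)
  qed (use assms in simp)
  show "b / a < recip p" if less: "p < ennreal (a / b)"
    using assms(1)
  proof (cases p rule: exponent_cases)
    case 1
    then show ?thesis using less by simp
  next
    case (2 P)
    then have "P < a / b" using less assms by (simp add: ennreal_less_iff)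
    then show ?thesis unfolding 2(3) using 2(1) assms by (simp add: field_simps)
  qed
qed

section \<open>Finiteness of Lebesgue norms on the unit interval\<close>

text \<open>One criterion for all q: the q-th power of the bound is an integrable function, and at q
  = \<infinity> the exponent 1/q is 0, so the bound is a constant.\<close>

lemma Lq_norm01_finite:
  assumes q: "1 \<le> q" and f: "f \<in> borel_measurable (lebesgue_on {0<..<1})"
    and A0: "1 \<le> A0" and p: "1 < p" and C: "0 \<le> C"
    and le: "\<And>s. 0 < s \<Longrightarrow> s < 1 \<Longrightarrow> f s \<le> ennreal (C * (1 / (s * log_weight A0 p s)) powr recip q)"
  shows "Lq_norm01 q f < \<infinity>"
  using q
proof (cases q rule: exponent_cases)
  case 1
  have "esssup (lebesgue_on {0<..<1}) f \<le> ennreal C"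
  proof (rule esssup_I[OF f])
    show "AE s in lebesgue_on {0<..<1}. f s \<le> ennreal C"
    proof (rule AE_I2)
      fix s assume "s \<in> space (lebesgue_on {0<..<1::real})"
      then have s: "0 < s" "s < 1" by (auto simp: space_restrict_space)
      have "0 < 1 / (s * log_weight A0 p s)" using s log_weight_pos[OF shifted_log_ge_1[OF A0], of s p] by simp
      have "(1 / (s * log_weight A0 p s)) powr recip q = 1"
      proof -
        have "1 / (s * log_weight A0 p s) \<noteq> 0" using \<open>0 < 1 / (s * log_weight A0 p s)\<close> by linarith
        then show ?thesis unfolding 1(2) powr_zero_eq_one by (simp only: if_False)
      qed
      then show "f s \<le> ennreal C" using le[OF s] by (simp only: mult_1_right)
    qed
  qed
  then have "esssup (lebesgue_on {0<..<1}) f < \<infinity>"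
    using ennreal_less_top[of C] by (simp add: le_less_trans)
  then show ?thesis using 1 by (simp add: Lq_norm01_def)
next
  case (2 Q)
  have "(\<integral>\<^sup>+s. enn_powr (f s) Q \<partial>lebesgue_on {0<..<1}) \<le>
      (\<integral>\<^sup>+s. ennreal (C powr Q) * ennreal (1 / (s * log_weight A0 p s)) \<partial>lebesgue_on {0<..<1})"
  proof (rule nn_integral_mono)
    fix s assume "s \<in> space (lebesgue_on {0<..<1::real})"
    then have s: "0 < s" "s < 1" by (auto simp: space_restrict_space)
    let ?d = "1 / (s * log_weight A0 p s)"
    have d: "0 < ?d" using s log_weight_pos[OF shifted_log_ge_1[OF A0], of s p] by simp
    have fin: "f s \<noteq> \<infinity>" using le[OF s] by (auto simp: top_unique)
    have "enn2real (f s) \<le> C * ?d powr (1 / Q)"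
      using le[OF s] 2 C d by (intro enn2real_leI) auto
    then have "enn2real (f s) powr Q \<le> (C * ?d powr (1 / Q)) powr Q"
      using 2 by (intro powr_mono2) auto
    also have "\<dots> = C powr Q * ?d" using C d 2 by (simp add: powr_mult powr_powr)
    finally have "ennreal (enn2real (f s) powr Q) \<le> ennreal (C powr Q) * ennreal ?d"
      by (simp only: ennreal_mult[symmetric, OF powr_ge_zero less_imp_le[OF d]] ennreal_leI)
    then show "enn_powr (f s) Q \<le> ennreal (C powr Q) * ennreal ?d"
      using fin by (simp add: enn_powr_def)
  qed
  also have "\<dots> = ennreal (C powr Q) * (\<integral>\<^sup>+s. ennreal (1 / (s * log_weight A0 p s)) \<partial>lebesgue_on {0<..<1})"
    by (intro nn_integral_cmult measurable_restrict_space1 measurable_completion)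
       (unfold log_weight_def shifted_log_def, measurable)
  also have "\<dots> \<le> ennreal (C powr Q) * ennreal (1 / (p - 1))"
    by (intro mult_left_mono log_weight_integral_lebesgue_on A0 p) simp
  also have "\<dots> < \<infinity>" by (simp add: ennreal_mult_less_top)
  finally have "(\<integral>\<^sup>+s. enn_powr (f s) Q \<partial>lebesgue_on {0<..<1}) \<noteq> \<infinity>" by simp
  then show ?thesis
    using 2 by (simp add: Lq_norm01_def enn_powr_def)
qed

lemma enn_powr_measurable [measurable]: "(\<lambda>x. enn_powr x r) \<in> borel_measurable borel"
  unfolding enn_powr_def by measurable

text \<open>Hoelder's inequality with an unspecified constant. For 1 < q < \<infinity> it follows
  from Young's inequality with a free parameter; at the two end points the essential supremum is
  pulled out of the integral.\<close>

lemma Holder01: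
  assumes q: "1 \<le> q" and k: "\<And>s. 0 < s \<Longrightarrow> s < 1 \<Longrightarrow> 0 \<le> k s" "k \<in> borel_measurable borel"
    and fin: "Lq_norm01 (conj_exp q) (\<lambda>s. ennreal (k s)) < \<infinity>"
  obtains C where "0 \<le> C"
    "\<And>g. g \<in> borel_measurable borel \<Longrightarrow>
      (\<integral>\<^sup>+s. g s * ennreal (k s) \<partial>lebesgue_on {0<..<1}) \<le> ennreal C * Lq_norm01 q g"
proof -
  let ?M = "lebesgue_on {0<..<1::real}"
  have lm: "g \<in> borel_measurable ?M" if "g \<in> borel_measurable borel" for g :: "real \<Rightarrow> ennreal"
    using that by (intro measurable_restrict_space1 measurable_completion) simp
  have km: "(\<lambda>s. ennreal (k s)) \<in> borel_measurable ?M"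
    using k(2) by (intro lm) measurable
  have sp: "space ?M = {0<..<1}" by (simp add: space_restrict_space)
  show thesis
    using q
  proof (cases q rule: exponent_cases)
    case 1
    have "conj_exp q = 1" using 1 by (simp add: conj_exp_def)
    then have "enn_powr (\<integral>\<^sup>+s. enn_powr (ennreal (k s)) 1 \<partial>?M) 1 < \<infinity>"
      using fin by (simp add: Lq_norm01_def)
    moreover have "(\<integral>\<^sup>+s. enn_powr (ennreal (k s)) 1 \<partial>?M) = (\<integral>\<^sup>+s. ennreal (k s) \<partial>?M)"
      by (intro nn_integral_cong) (use k sp in \<open>auto simp: enn_powr_def\<close>)
    ultimately have I: "(\<integral>\<^sup>+s. ennreal (k s) \<partial>?M) < \<infinity>" by (auto simp: enn_powr_def less_top split: if_splits)
    show thesis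
    proof (rule that[of "enn2real (\<integral>\<^sup>+s. ennreal (k s) \<partial>?M)"])
      fix g :: "real \<Rightarrow> ennreal" assume "g \<in> borel_measurable borel"
      have "AE s in ?M. g s \<le> esssup ?M g" by (rule esssup_AE)
      then have "(\<integral>\<^sup>+s. g s * ennreal (k s) \<partial>?M) \<le> (\<integral>\<^sup>+s. esssup ?M g * ennreal (k s) \<partial>?M)"
        by (intro nn_integral_mono_AE) (auto elim!: eventually_mono intro: mult_right_mono)
      also have "\<dots> = esssup ?M g * (\<integral>\<^sup>+s. ennreal (k s) \<partial>?M)"
        by (rule nn_integral_cmult[OF km])
      finally show "(\<integral>\<^sup>+s. g s * ennreal (k s) \<partial>?M) \<le> ennreal (enn2real (\<integral>\<^sup>+s. ennreal (k s) \<partial>?M)) * Lq_norm01 q g"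
        using I 1 by (simp add: Lq_norm01_def mult.commute)
    qed simp
  next
    case (2 Q)
    show thesis
    proof (cases "Q = 1")
      case True
      then have "q = 1" using 2 by simp
      then have "conj_exp q = \<infinity>" by (simp add: conj_exp_def)
      then have I: "esssup ?M (\<lambda>s. ennreal (k s)) < \<infinity>" using fin by (simp add: Lq_norm01_def)
      show thesis
      proof (rule that[of "enn2real (esssup ?M (\<lambda>s. ennreal (k s)))"])
        fix g :: "real \<Rightarrow> ennreal" assume g: "g \<in> borel_measurable borel"
        have "AE s in ?M. ennreal (k s) \<le> esssup ?M (\<lambda>s. ennreal (k s))" by (rule esssup_AE)
        then have "(\<integral>\<^sup>+s. g s * ennreal (k s) \<partial>?M) \<le> (\<integral>\<^sup>+s. esssup ?M (\<lambda>s. ennreal (k s)) * g s \<partial>?M)"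
          by (intro nn_integral_mono_AE) (auto elim!: eventually_mono simp: mult.commute intro: mult_left_mono)
        also have "\<dots> = esssup ?M (\<lambda>s. ennreal (k s)) * (\<integral>\<^sup>+s. g s \<partial>?M)"
          by (rule nn_integral_cmult[OF lm[OF g]])
        also have "(\<integral>\<^sup>+s. g s \<partial>?M) = Lq_norm01 q g"
        proof -
          have "enn_powr x 1 = x" for x by (cases x) (auto simp: enn_powr_def)
          then show ?thesis using \<open>q = 1\<close> by (simp add: Lq_norm01_def)
        qed
        finally show "(\<integral>\<^sup>+s. g s * ennreal (k s) \<partial>?M) \<le> ennreal (enn2real (esssup ?M (\<lambda>s. ennreal (k s)))) * Lq_norm01 q g"
          using I by simp
      qed simp
    next
      case False
      then have Q: "1 < Q" using 2 by simp
      define Q' where "Q' = Q / (Q - 1)"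
      have Q': "1 < Q'" "1 / Q + 1 / Q' = 1" using Q by (auto simp: Q'_def field_simps)
      have "q \<noteq> 1" using 2 Q by simp
      have "q - 1 = ennreal (Q - 1)" using 2 Q by (simp add: ennreal_minus ennreal_1[symmetric] del: ennreal_1)
      then have cq: "conj_exp q = ennreal Q'"
        using 2 Q \<open>q \<noteq> 1\<close> by (simp add: conj_exp_def divide_ennreal Q'_def)
      define H where "H = (\<integral>\<^sup>+s. ennreal (k s powr Q') \<partial>?M)"
      have "(\<integral>\<^sup>+s. enn_powr (ennreal (k s)) Q' \<partial>?M) = H"
        unfolding H_def by (intro nn_integral_cong) (use k sp in \<open>auto simp: enn_powr_def\<close>)
      then have H: "H < \<infinity>"
        using fin Q' by (auto simp: Lq_norm01_def cq enn_powr_def less_top split: if_splits)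
      show thesis
      proof (rule that[of "1 + enn2real H"])
        fix g :: "real \<Rightarrow> ennreal" assume g: "g \<in> borel_measurable borel"
        define G where "G = (\<integral>\<^sup>+s. enn_powr (g s) Q \<partial>?M)"
        have gp: "(\<lambda>s. enn_powr (g s) Q) \<in> borel_measurable ?M"
          by (intro lm measurable_compose[OF g enn_powr_measurable])
        have kp: "(\<lambda>s. ennreal (k s powr Q')) \<in> borel_measurable ?M"
          using k(2) by (intro lm) measurable
        \<comment> \<open>Young's inequality for the product of a/t and k, multiplied by t; its
          factors 1/Q and 1/Q' are estimated by 1.\<close>
        have young: "(\<integral>\<^sup>+s. g s * ennreal (k s) \<partial>?M) \<le> ennreal (t powr (1 - Q)) * G + ennreal t * H" if t: "0 < t" for t
        proof -
          have "(\<integral>\<^sup>+s. g s * ennreal (k s) \<partial>?M) \<le>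
              (\<integral>\<^sup>+s. ennreal (t powr (1 - Q)) * enn_powr (g s) Q + ennreal t * ennreal (k s powr Q') \<partial>?M)"
          proof (rule nn_integral_mono)
            fix s assume "s \<in> space ?M"
            then have ks: "0 \<le> k s" using k sp by auto
            show "g s * ennreal (k s) \<le> ennreal (t powr (1 - Q)) * enn_powr (g s) Q + ennreal t * ennreal (k s powr Q')"
            proof (cases "g s")
              case top
              then show ?thesis using t by (simp add: enn_powr_def ennreal_mult_top)
            next
              case (real a)
              have "(a / t) * k s \<le> (a / t) powr Q / Q + k s powr Q' / Q'"
                using Q Q' real ks t by (intro Youngs_inequality) auto
              also have "\<dots> \<le> (a / t) powr Q + k s powr Q'"
              proof -
                have "x / c \<le> x" if "0 \<le> x" "1 < c" for x c :: real
                  using that mult_left_mono[of 1 c x] by (simp add: pos_divide_le_eq)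
                then show ?thesis using Q Q' by (intro add_mono) auto
              qed
              finally have "t * ((a / t) * k s) \<le> t * ((a / t) powr Q + k s powr Q')"
                using t by (intro mult_left_mono) auto
              moreover have "t * (a / t) powr Q = t powr (1 - Q) * a powr Q"
                using t real by (simp add: powr_divide powr_diff)
              ultimately have "a * k s \<le> t powr (1 - Q) * a powr Q + t * k s powr Q'"
                using t by (simp add: algebra_simps)
              then have "ennreal (a * k s) \<le> ennreal (t powr (1 - Q) * a powr Q + t * k s powr Q')"
                by (rule ennreal_leI)
              then show ?thesis
                using real ks t by (simp add: enn_powr_def ennreal_mult ennreal_plus)
            qed
          qed
          also have "\<dots> = ennreal (t powr (1 - Q)) * G + ennreal t * H"
            unfolding G_def H_def using gp kp by (simp add: nn_integral_add nn_integral_cmult)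
          finally show ?thesis .
        qed
        have norm: "Lq_norm01 q g = enn_powr G (1 / Q)"
          using 2 by (simp add: Lq_norm01_def G_def)
        show "(\<integral>\<^sup>+s. g s * ennreal (k s) \<partial>?M) \<le> ennreal (1 + enn2real H) * Lq_norm01 q g"
        proof (cases G)
          case top
          then show ?thesis by (simp add: norm enn_powr_def ennreal_mult_top)
        next
          case (real b)
          show ?thesis
          proof (cases "b = 0")
            \<comment> \<open>With G = 0 only \<open>t * H\<close> remains, and t may be made
              arbitrarily small.\<close>
            case True
            have eps: "(\<integral>\<^sup>+s. g s * ennreal (k s) \<partial>?M) \<le> 0 + ennreal e" if e: "0 < e" for e :: real
            proof -
              have t: "0 < e / (1 + enn2real H)" using e by (simp add: add_pos_nonneg)
              have "(\<integral>\<^sup>+s. g s * ennreal (k s) \<partial>?M) \<le> ennreal (e / (1 + enn2real H)) * H"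
                using young[OF t] real True by simp
              also have "\<dots> = ennreal (e / (1 + enn2real H) * enn2real H)"
                using H t by (subst ennreal_mult) auto
              also have "\<dots> \<le> ennreal e"
                using e by (intro ennreal_leI) (simp add: field_simps add_pos_nonneg)
              finally show ?thesis by simp
            qed
            have "(\<integral>\<^sup>+s. g s * ennreal (k s) \<partial>?M) \<le> 0"
              by (rule ennreal_le_epsilon) (rule eps)
            then show ?thesis by simp
          next
            case False
            then have b: "0 < b" using real by simp
            \<comment> \<open>This choice balances the two terms, as t^(1-Q) b = t is then the
              q-norm of g.\<close>
            define t where "t = b powr (1 / Q)"
            have t: "0 < t" using b by (simp add: t_def)
            have "t powr (1 - Q) * b = t"
            proof -
              have "t powr (1 - Q) * b = b powr (1 / Q * (1 - Q) + 1)"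
                using b by (simp add: t_def powr_powr powr_add)
              also have "1 / Q * (1 - Q) + 1 = 1 / Q" using Q by (simp add: field_simps)
              finally show ?thesis by (simp add: t_def)
            qed
            then have "ennreal (t powr (1 - Q)) * G = ennreal t"
              using real b by (simp add: ennreal_mult[symmetric])
            then have "(\<integral>\<^sup>+s. g s * ennreal (k s) \<partial>?M) \<le> ennreal t + ennreal t * H"
              using young[OF t] by simp
            also have "\<dots> = ennreal (1 + enn2real H) * ennreal t"
              using H t by (simp add: ennreal_plus distrib_left mult.commute)
            also have "ennreal t = Lq_norm01 q g"
              using real by (simp add: norm enn_powr_def t_def)
            finally show ?thesis .
          qed
        qed
      qed simp
    qed
  qed
qed


section \<open>Comparison of the logarithmic weights\<close>

lemma shifted_log_le: "1 \<le> A0 \<Longrightarrow> 0 < s \<Longrightarrow> s \<le> 1 \<Longrightarrow> shifted_log A0 s \<le> A0 * ell s"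
proof -
  assume a: "1 \<le> A0" "0 < s" "s \<le> 1"
  have "ln s \<le> 0" using a by (subst ln_le_zero_iff)
  then have "1 * (- ln s) \<le> A0 * (- ln s)" using a by (intro mult_right_mono) auto
  then show ?thesis using \<open>ln s \<le> 0\<close> by (simp add: shifted_log_def ell_def algebra_simps)
qed

lemma ell_le_shifted_log: "1 \<le> A0 \<Longrightarrow> 0 < s \<Longrightarrow> s \<le> 1 \<Longrightarrow> ell s \<le> shifted_log A0 s"
proof -
  assume a: "1 \<le> A0" "0 < s" "s \<le> 1"
  have "ln s \<le> 0" using a by (subst ln_le_zero_iff)
  then show ?thesis using a unfolding shifted_log_def ell_def by linarith
qed

lemma one_plus_ln_bounds:
  fixes y :: real
  assumes "1 \<le> y"
  shows "1 \<le> 1 + ln y" "1 + ln y \<le> y"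
  using assms ln_le_minus_one[of y] ln_ge_zero[OF assms] by linarith+

lemma log_weight_factors:
  fixes A0 s :: real
  assumes "1 \<le> A0" "0 < s" "s \<le> 1"
  obtains y Y Z where "y = shifted_log A0 s" "Y = 1 + ln y" "Z = 1 + ln Y" "1 \<le> y" "1 \<le> Y" "1 \<le> Z" "Y \<le> y" "Z \<le> Y"
    "\<And>p. log_weight A0 p s = y * Y * Z powr p"
proof -
  have y: "1 \<le> shifted_log A0 s" by (rule shifted_log_ge_1[OF assms])
  note Y = one_plus_ln_bounds[OF y]
  note Z = one_plus_ln_bounds[OF Y(1)]
  show thesis by (rule that[OF HOL.refl HOL.refl HOL.refl y Y(1) Z(1) Y(2) Z(2)]) (simp add: log_weight_def)
qed

text \<open>A positive power of s absorbs every logarithm, the whole of \<open>log_weight\<close>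
  included. This settles all exponents away from n/m, and part (B).\<close>

lemma slow_bound:
  fixes \<theta> A0 \<rho> p \<alpha> \<beta> :: real
  assumes \<theta>: "0 < \<theta>" and A0: "1 \<le> A0" and \<rho>: "0 \<le> \<rho>" and p: "1 < p"
  obtains C where "0 < C"
    "\<And>s. 0 < s \<Longrightarrow> s < 1 \<Longrightarrow> s powr \<theta> * ell s powr \<alpha> * ellell s powr \<beta> * log_weight A0 p s powr \<rho> \<le> C"
proof -
  let ?b = "\<alpha> + \<bar>\<beta>\<bar> + (2 + p) * \<rho>"
  obtain C where C: "0 < C" "\<And>x. 1 \<le> x \<Longrightarrow> x powr - \<theta> * (1 + ln x) powr ?b \<le> C"
    by (rule log_powr_decay[OF \<theta>, where b = ?b]) blast
  let ?K = "A0 powr ((2 + p) * \<rho>)"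
  show thesis
  proof (rule that[of "?K * C"])
    show "0 < ?K * C" using C A0 by simp
    fix s :: real assume s: "0 < s" "s < 1"
    then have s1: "s \<le> 1" by simp
    let ?L = "ell s"
    have L: "1 \<le> ?L" by (rule ell_ge_1)
    obtain y Y Z where D: "y = shifted_log A0 s" "Y = 1 + ln y" "Z = 1 + ln Y" "1 \<le> y" "1 \<le> Y" "1 \<le> Z" "Y \<le> y" "Z \<le> Y"
      "\<And>p. log_weight A0 p s = y * Y * Z powr p"
      by (rule log_weight_factors[OF A0 s(1) s1]) blast
    have "log_weight A0 p s \<le> y * y * y powr p"
      unfolding D(9) using D p by (intro mult_mono powr_mono2) auto
    also have "\<dots> = y powr (2 + p)" using D(4) by (simp add: powr_add power2_eq_square)
    also have "\<dots> \<le> (A0 * ?L) powr (2 + p)"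
      unfolding D(1) using shifted_log_le[OF A0 s(1) s1] shifted_log_ge_1[OF A0 s(1) s1] p by (intro powr_mono2) auto
    finally have "log_weight A0 p s powr \<rho> \<le> ((A0 * ?L) powr (2 + p)) powr \<rho>"
      using \<rho> log_weight_pos[OF shifted_log_ge_1[OF A0 s(1) s1], of p] by (intro powr_mono2) auto
    also have "\<dots> = ?K * ?L powr ((2 + p) * \<rho>)"
      using A0 L by (simp add: powr_powr powr_mult)
    finally have 1: "log_weight A0 p s powr \<rho> \<le> ?K * ?L powr ((2 + p) * \<rho>)" .
    have "ellell s \<le> ?L" unfolding ellell_def by (rule one_plus_ln_bounds(2)[OF L])
    have 2: "ellell s powr \<beta> \<le> ?L powr \<bar>\<beta>\<bar>"
    proof -
      have "ellell s powr \<beta> \<le> ellell s powr \<bar>\<beta>\<bar>" using ellell_ge_1 by (intro powr_mono) auto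
      also have "\<dots> \<le> ?L powr \<bar>\<beta>\<bar>" using \<open>ellell s \<le> ?L\<close> ellell_ge_1[of s] by (intro powr_mono2) auto
      finally show ?thesis .
    qed
    have "s powr \<theta> * ?L powr \<alpha> * ellell s powr \<beta> * log_weight A0 p s powr \<rho> \<le>
        s powr \<theta> * ?L powr \<alpha> * ?L powr \<bar>\<beta>\<bar> * (?K * ?L powr ((2 + p) * \<rho>))"
      using 1 2 by (intro mult_mono) auto
    also have "\<dots> = ?K * (s powr \<theta> * ?L powr ?b)" using L by (simp add: powr_add mult_ac)
    also have "s powr \<theta> * ?L powr ?b = (1 / s) powr - \<theta> * (1 + ln (1 / s)) powr ?b"
    proof -
      have "?L = 1 + ln (1 / s)" using shifted_log_1[OF s(1) s1] s by (simp add: shifted_log_def ln_div)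
      moreover have "s powr \<theta> = (1 / s) powr - \<theta>" using s by (simp add: powr_minus powr_divide)
      ultimately show ?thesis by simp
    qed
    also have "?K * \<dots> \<le> ?K * C"
      using C(2)[of "1 / s"] s by (intro mult_left_mono) auto
    finally show "s powr \<theta> * ?L powr \<alpha> * ellell s powr \<beta> * log_weight A0 p s powr \<rho> \<le> ?K * C" .
  qed
qed

text \<open>Here \<rho> stands for 1/q. Dividing by the weight of exponent 1 corresponds to
  evaluating the norm of the peak profile at p = n/m, and the weight of exponent p > 1 on the left
  makes the q-th power integrable. For \<rho> < 1 the third logarithm has room to spare; for \<rho>
  = 1 the decay must come from \<alpha> < 0 or \<beta> < 0.\<close>

lemma critical_bound:
  fixes A0 \<rho> \<alpha> \<beta> :: real
  assumes A0: "1 \<le> A0" and \<rho>: "0 \<le> \<rho>" "\<rho> \<le> 1"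
    and bad: "\<alpha> < 1 - \<rho> \<or> \<alpha> = 1 - \<rho> \<and> \<beta> \<le> 1 - \<rho>" "\<not> (\<rho> = 1 \<and> \<alpha> = 0 \<and> \<beta> = 0)"
  obtains C p where "0 < C" "1 < p"
    "\<And>s. 0 < s \<Longrightarrow> s < 1 \<Longrightarrow> ell s powr \<alpha> * ellell s powr \<beta> * log_weight A0 p s powr \<rho> \<le> C * log_weight A0 1 s"
proof (cases "\<rho> = 1")
  case False
  define \<sigma> where "\<sigma> = 1 - \<rho>"
  have \<sigma>: "0 < \<sigma>" using False \<rho> by (simp add: \<sigma>_def)
  have "\<exists>C>0. \<forall>s. ell s powr \<alpha> * ellell s powr \<beta> \<le> C * (ell s powr \<sigma> * ellell s powr \<sigma>)"
  proof (cases "\<alpha> < \<sigma>")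
    case True
    obtain C where C: "0 < C" "\<And>x. 1 \<le> x \<Longrightarrow> x powr - (\<sigma> - \<alpha>) * (1 + ln x) powr (\<beta> - \<sigma>) \<le> C"
      by (rule log_powr_decay[of "\<sigma> - \<alpha>" "\<beta> - \<sigma>"]) (use True in auto)
    have "ell s powr \<alpha> * ellell s powr \<beta> \<le> C * (ell s powr \<sigma> * ellell s powr \<sigma>)" for s
    proof -
      have "ell s powr \<alpha> * ellell s powr \<beta> = (ell s powr - (\<sigma> - \<alpha>) * (1 + ln (ell s)) powr (\<beta> - \<sigma>)) * (ell s powr \<sigma> * ellell s powr \<sigma>)"
        using ell_ge_1[of s] ellell_ge_1[of s] by (simp add: ellell_def[symmetric] powr_add[symmetric] mult_ac)
      also have "\<dots> \<le> C * (ell s powr \<sigma> * ellell s powr \<sigma>)"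
        using C(2)[OF ell_ge_1] by (intro mult_right_mono) auto
      finally show ?thesis .
    qed
    with C(1) show ?thesis by blast
  next
    case False
    then have "\<alpha> = \<sigma>" "\<beta> \<le> \<sigma>" using bad(1) by (auto simp: \<sigma>_def)
    then have "ell s powr \<alpha> * ellell s powr \<beta> \<le> 1 * (ell s powr \<sigma> * ellell s powr \<sigma>)" for s
      using ellell_ge_1[of s] by (auto intro!: mult_left_mono powr_mono)
    then show ?thesis by (intro exI[of _ 1]) auto
  qed
  then obtain C where C: "0 < C" "\<And>s. ell s powr \<alpha> * ellell s powr \<beta> \<le> C * (ell s powr \<sigma> * ellell s powr \<sigma>)"
    by blast
  \<comment> \<open>With p = 1/\<rho> the third logarithm appears to the power p \<rho> = 1, exactly
    as on the right. For \<rho> = 0 it disappears and any value above 1 will do.\<close>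
  define p where "p = (if \<rho> = 0 then 2 else 1 / \<rho>)"
  have p: "1 < p" "p * \<rho> \<le> 1" using \<rho> False by (auto simp: p_def)
  show thesis
  proof (rule that[OF C(1) p(1)])
    fix s :: real assume s: "0 < s" "s < 1"
    then have s1: "s \<le> 1" by simp
    obtain y Y Z where D: "y = shifted_log A0 s" "Y = 1 + ln y" "Z = 1 + ln Y" "1 \<le> y" "1 \<le> Y" "1 \<le> Z" "Y \<le> y" "Z \<le> Y"
      "\<And>p. log_weight A0 p s = y * Y * Z powr p"
      by (rule log_weight_factors[OF A0 s(1) s1]) blast
    have le: "ell s \<le> y" using ell_le_shifted_log[OF A0 s(1) s1] D(1) by simp
    have lle: "ellell s \<le> Y" unfolding ellell_def D(2) using le ell_ge_1[of s] by simp
    have le1: "ell s powr \<alpha> * ellell s powr \<beta> \<le> C * (y powr \<sigma> * Y powr \<sigma>)"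
      using C(1) \<sigma> le lle ell_ge_1[of s] ellell_ge_1[of s]
      by (intro order_trans[OF C(2)] mult_left_mono mult_mono powr_mono2) auto
    have le2: "log_weight A0 p s powr \<rho> \<le> y powr \<rho> * Y powr \<rho> * Z"
    proof -
      have "log_weight A0 p s powr \<rho> = y powr \<rho> * Y powr \<rho> * Z powr (p * \<rho>)"
        unfolding D(9) using D(4-6) by (simp add: powr_mult powr_powr)
      also have "\<dots> \<le> y powr \<rho> * Y powr \<rho> * Z powr 1"
        using D(6) p by (intro mult_left_mono powr_mono) auto
      finally show ?thesis using D(6) by simp
    qed
    have "ell s powr \<alpha> * ellell s powr \<beta> * log_weight A0 p s powr \<rho> \<le>
        (C * (y powr \<sigma> * Y powr \<sigma>)) * (y powr \<rho> * Y powr \<rho> * Z)"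
      by (rule mult_mono[OF le1 le2]) (use C(1) in auto)
    also have "\<dots> = C * ((y powr \<sigma> * y powr \<rho>) * (Y powr \<sigma> * Y powr \<rho>) * Z)" by (simp only: mult_ac)
    also have "\<dots> = C * log_weight A0 1 s"
      unfolding D(9) using D(4-6) by (simp add: powr_add[symmetric] \<sigma>_def)
    finally show "ell s powr \<alpha> * ellell s powr \<beta> * log_weight A0 p s powr \<rho> \<le> C * log_weight A0 1 s" .
  qed
next
  case True
  \<comment> \<open>The shift changes the second logarithm by at most this factor. A negative
    \<beta> needs this comparison from below for \<open>ellell\<close>.\<close>
  define c where "c = 1 + ln A0"
  have c: "1 \<le> c" using one_plus_ln_bounds(1)[OF A0] by (simp add: c_def)
  have Yle: "1 + ln (shifted_log A0 s) \<le> c * ellell s" if s: "0 < s" "s \<le> 1" for s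
  proof -
    have "ln (shifted_log A0 s) \<le> ln (A0 * ell s)"
      using shifted_log_le[OF A0 s] shifted_log_ge_1[OF A0 s] by simp
    also have "\<dots> = ln A0 + ln (ell s)" using A0 ell_ge_1[of s] by (simp add: ln_mult)
    finally have "1 + ln (shifted_log A0 s) \<le> c + ln (ell s)" by (simp add: c_def)
    also have "\<dots> \<le> c * 1 + c * ln (ell s)"
      using c ell_ge_1[of s] mult_right_mono[of 1 c "ln (ell s)"] by simp
    finally show ?thesis by (simp add: ellell_def algebra_simps)
  qed
  have "\<exists>C>0. \<forall>s. 0 < s \<longrightarrow> s \<le> 1 \<longrightarrow> ell s powr \<alpha> * ellell s powr \<beta> * (1 + ln (1 + ln (shifted_log A0 s))) \<le> C"
  proof (cases "\<alpha> < 0")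
    case True
    obtain C where C: "0 < C" "\<And>x. 1 \<le> x \<Longrightarrow> x powr - (- \<alpha>) * (1 + ln x) powr (\<beta> + 1) \<le> C"
      by (rule log_powr_decay[of "- \<alpha>" "\<beta> + 1"]) (use True in auto)
    have "ell s powr \<alpha> * ellell s powr \<beta> * (1 + ln (1 + ln (shifted_log A0 s))) \<le> c * C" if s: "0 < s" "s \<le> 1" for s
    proof -
      have "1 + ln (1 + ln (shifted_log A0 s)) \<le> c * ellell s"
        using one_plus_ln_bounds[OF one_plus_ln_bounds(1)[OF shifted_log_ge_1[OF A0 s]]] Yle[OF s] by linarith
      then have "ell s powr \<alpha> * ellell s powr \<beta> * (1 + ln (1 + ln (shifted_log A0 s))) \<le> ell s powr \<alpha> * ellell s powr \<beta> * (c * ellell s)"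
        by (intro mult_left_mono) auto
      also have "\<dots> = c * (ell s powr - (- \<alpha>) * (1 + ln (ell s)) powr (\<beta> + 1))"
        using ellell_ge_1[of s] by (simp add: ellell_def[symmetric] powr_add)
      also have "\<dots> \<le> c * C" using C(2)[OF ell_ge_1] c by (intro mult_left_mono) auto
      finally show ?thesis .
    qed
    then show ?thesis using C(1) c by (intro exI[of _ "c * C"]) auto
  next
    case False
    then have ab: "\<alpha> = 0" "\<beta> < 0" using bad \<open>\<rho> = 1\<close> by auto
    obtain C where C: "0 < C" "\<And>x. 1 \<le> x \<Longrightarrow> x powr - (- \<beta>) * (1 + ln x) powr 1 \<le> C"
      by (rule log_powr_decay[of "- \<beta>" 1]) (use ab in auto)
    have "ell s powr \<alpha> * ellell s powr \<beta> * (1 + ln (1 + ln (shifted_log A0 s))) \<le> c powr - \<beta> * C" if s: "0 < s" "s \<le> 1" for s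
    proof -
      let ?Y = "1 + ln (shifted_log A0 s)"
      have Y: "1 \<le> ?Y" by (rule one_plus_ln_bounds(1)[OF shifted_log_ge_1[OF A0 s]])
      have Z: "1 \<le> 1 + ln ?Y" by (rule one_plus_ln_bounds(1)[OF Y])
      have "?Y / c \<le> ellell s" using Yle[OF s] c by (simp add: field_simps)
      then have "ellell s powr \<beta> \<le> (?Y / c) powr \<beta>"
        using ab Y c by (intro powr_mono2') auto
      also have "\<dots> = c powr - \<beta> * ?Y powr \<beta>"
        using Y c by (simp add: powr_divide powr_minus field_simps)
      finally have "ellell s powr \<beta> * (1 + ln ?Y) \<le> (c powr - \<beta> * ?Y powr \<beta>) * (1 + ln ?Y)"
        using Z by (intro mult_right_mono) auto
      also have "\<dots> = c powr - \<beta> * (?Y powr - (- \<beta>) * (1 + ln ?Y) powr 1)"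
        using Z by simp
      also have "\<dots> \<le> c powr - \<beta> * C" using C(2)[OF Y] by (intro mult_left_mono) auto
      finally show ?thesis using ab ell_ge_1[of s] by simp
    qed
    moreover have "0 < c powr - \<beta> * C" using C(1) c by simp
    ultimately show ?thesis by blast
  qed
  then obtain C where C: "0 < C" "\<And>s. 0 < s \<Longrightarrow> s \<le> 1 \<Longrightarrow> ell s powr \<alpha> * ellell s powr \<beta> * (1 + ln (1 + ln (shifted_log A0 s))) \<le> C"
    by blast
  show thesis
  proof (rule that[OF C(1), of 2])
    fix s :: real assume s: "0 < s" "s < 1"
    then have s1: "s \<le> 1" by simp
    obtain y Y Z where D: "y = shifted_log A0 s" "Y = 1 + ln y" "Z = 1 + ln Y" "1 \<le> y" "1 \<le> Y" "1 \<le> Z" "Y \<le> y" "Z \<le> Y"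
      "\<And>p. log_weight A0 p s = y * Y * Z powr p"
      by (rule log_weight_factors[OF A0 s(1) s1]) blast
    have D2: "log_weight A0 2 s = Z * log_weight A0 1 s" unfolding D(9) using D(6) by (simp add: power2_eq_square)
    have D1: "0 < log_weight A0 1 s" by (rule log_weight_pos[OF shifted_log_ge_1[OF A0 s(1) s1]])
    have "ell s powr \<alpha> * ellell s powr \<beta> * log_weight A0 2 s powr \<rho> = (ell s powr \<alpha> * ellell s powr \<beta> * Z) * log_weight A0 1 s"
      using D2 D1 D(6) True by simp
    also have "\<dots> \<le> C * log_weight A0 1 s"
      using C(2)[OF s(1) s1] D1 unfolding D(1-3) by (intro mult_right_mono) auto
    finally show "ell s powr \<alpha> * ellell s powr \<beta> * log_weight A0 2 s powr \<rho> \<le> C * log_weight A0 1 s" .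
  qed simp
qed

text \<open>Here \<rho> stands for 1/q'. The bound places the Hoelder kernel at p = n/m in L^q', and
  the cases for \<alpha> and \<beta> are those of the theorem; a strict inequality in one of them
  absorbs the squared third logarithm.\<close>

lemma dual_bound:
  fixes \<rho> \<alpha> \<beta> :: real
  assumes \<rho>: "0 \<le> \<rho>"
    and good: "\<rho> = 0 \<and> \<alpha> = 0 \<and> \<beta> = 0 \<or> \<alpha> = \<rho> \<and> \<rho> < \<beta> \<or> \<rho> < \<alpha>"
  obtains C where "0 < C"
    "\<And>s. 0 < s \<Longrightarrow> s < 1 \<Longrightarrow> ell s powr - \<alpha> * ellell s powr - \<beta> * log_weight 1 2 s powr \<rho> \<le> C"
proof -
  have Ds: "log_weight 1 2 s powr \<rho> = ell s powr \<rho> * ellell s powr \<rho> * (1 + ln (ellell s)) powr (2 * \<rho>)"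
    if s: "0 < s" "s < 1" for s
  proof -
    have l: "shifted_log 1 s = ell s" by (rule shifted_log_1) (use s in auto)
    have "0 \<le> 1 + ln (ellell s)" using one_plus_ln_bounds(1)[OF ellell_ge_1[of s]] by linarith
    then show ?thesis
      unfolding log_weight_def l ellell_def[symmetric] using ell_ge_1[of s] ellell_ge_1[of s]
      by (simp add: powr_mult powr_powr del: powr_numeral)
  qed
  consider "\<rho> = 0 \<and> \<alpha> = 0 \<and> \<beta> = 0" | "\<alpha> = \<rho>" "\<rho> < \<beta>" | "\<rho> < \<alpha>" using good by blast
  then show thesis
  proof cases
    case 1
    show thesis
    proof (rule that[of 1])
      fix s :: real assume s: "0 < s" "s < 1"
      have "0 < log_weight 1 2 s" by (rule log_weight_pos[OF shifted_log_ge_1]) (use s in auto)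
      then show "ell s powr - \<alpha> * ellell s powr - \<beta> * log_weight 1 2 s powr \<rho> \<le> 1"
        using 1 ell_ge_1[of s] ellell_ge_1[of s] by simp
    qed simp
  next
    case 2
    obtain C where C: "0 < C" "\<And>x. 1 \<le> x \<Longrightarrow> x powr - (\<beta> - \<rho>) * (1 + ln x) powr (2 * \<rho>) \<le> C"
      by (rule log_powr_decay[of "\<beta> - \<rho>" "2 * \<rho>"]) (use 2 in auto)
    show thesis
    proof (rule that[OF C(1)])
      fix s :: real assume s: "0 < s" "s < 1"
      have "ell s powr - \<alpha> * ellell s powr - \<beta> * log_weight 1 2 s powr \<rho> =
         (ell s powr - \<alpha> * ell s powr \<rho>) * (ellell s powr - \<beta> * ellell s powr \<rho>) * (1 + ln (ellell s)) powr (2 * \<rho>)"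
        unfolding Ds[OF s] by (simp only: mult_ac)
      also have "\<dots> = ellell s powr - (\<beta> - \<rho>) * (1 + ln (ellell s)) powr (2 * \<rho>)"
        using 2 ell_ge_1[of s] by (simp add: powr_add[symmetric])
      also have "\<dots> \<le> C" by (rule C(2)[OF ellell_ge_1])
      finally show "ell s powr - \<alpha> * ellell s powr - \<beta> * log_weight 1 2 s powr \<rho> \<le> C" .
    qed
  next
    case 3
    obtain C where C: "0 < C" "\<And>x. 1 \<le> x \<Longrightarrow> x powr - (\<alpha> - \<rho>) * (1 + ln x) powr (3 * \<rho> - \<beta>) \<le> C"
      by (rule log_powr_decay[of "\<alpha> - \<rho>" "3 * \<rho> - \<beta>"]) (use 3 in auto)
    show thesis
    proof (rule that[OF C(1)])
      fix s :: real assume s: "0 < s" "s < 1"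
      have Z: "0 \<le> 1 + ln (ellell s)" "1 + ln (ellell s) \<le> ellell s"
        using one_plus_ln_bounds[OF ellell_ge_1[of s]] by linarith+
      have "ell s powr - \<alpha> * ellell s powr - \<beta> * log_weight 1 2 s powr \<rho> =
         (ell s powr - \<alpha> * ell s powr \<rho>) * (ellell s powr - \<beta> * ellell s powr \<rho>) * (1 + ln (ellell s)) powr (2 * \<rho>)"
        unfolding Ds[OF s] by (simp only: mult_ac)
      also have "\<dots> \<le> (ell s powr - \<alpha> * ell s powr \<rho>) * (ellell s powr - \<beta> * ellell s powr \<rho>) * ellell s powr (2 * \<rho>)"
        using Z \<rho> by (intro mult_left_mono powr_mono2) auto
      also have "\<dots> = ell s powr - (\<alpha> - \<rho>) * ellell s powr (3 * \<rho> - \<beta>)"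
        by (simp add: powr_add[symmetric] mult.assoc)
      also have "\<dots> \<le> C" using C(2)[OF ell_ge_1[of s]] by (simp add: ellell_def)
      finally show "ell s powr - \<alpha> * ellell s powr - \<beta> * log_weight 1 2 s powr \<rho> \<le> C" .
    qed
  qed
qed

section \<open>The potential is controlled by the Lorentz--Zygmund norm\<close>

text \<open>The norm rearranges the already rearranged function once more over (0, 1). The
  inequality is a right continuity statement: if the first rearrangement exceeds t at
  \<open>s\<close>, it does so slightly beyond \<open>s\<close> as well.\<close>

lemma rearr_le_rearr_rearr:
  fixes \<Omega> :: "(real^'n::finite) set"
  assumes f: "f \<in> borel_measurable (lebesgue_on \<Omega>)" and \<Omega>: "\<Omega> \<in> sets lebesgue" and V: "0 < V"
    and s: "0 < s" "s < 1"
  shows "rearr \<Omega> f (V * s) \<le> rearr {0<..<1} (\<lambda>s. rearr \<Omega> f (V * s)) s"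
  unfolding rearr_def[of "{0<..<1::real}"]
proof (rule Inf_greatest)
  fix t assume "t \<in> {t. emeasure lebesgue {x \<in> {0<..<1}. t < rearr \<Omega> f (V * x)} \<le> ennreal s}"
  then have t: "emeasure lebesgue {x \<in> {0<..<1}. t < rearr \<Omega> f (V * x)} \<le> ennreal s" by simp
  show "rearr \<Omega> f (V * s) \<le> t"
  proof (rule ccontr)
    assume "\<not> rearr \<Omega> f (V * s) \<le> t"
    then have less: "t < rearr \<Omega> f (V * s)" by simp
    then obtain t' where t': "t = ennreal t'" "0 \<le> t'" by (cases t) auto
    have "ennreal (V * s) < emeasure lebesgue {x \<in> \<Omega>. t < f x}"
    proof (rule ccontr)
      assume "\<not> ennreal (V * s) < emeasure lebesgue {x \<in> \<Omega>. t < f x}"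
      then have "rearr \<Omega> f (V * s) \<le> t" unfolding rearr_def by (intro Inf_lower) simp
      then show False using less by simp
    qed
    then obtain a where a: "V * s < a" "ennreal a < emeasure lebesgue {x \<in> \<Omega>. t < f x}"
    proof -
      obtain b where b: "ennreal (V * s) < b" "b < emeasure lebesgue {x \<in> \<Omega>. t < f x}"
        using dense[OF \<open>ennreal (V * s) < emeasure lebesgue {x \<in> \<Omega>. t < f x}\<close>] by blast
      then obtain a where "b = ennreal a" "0 \<le> a" by (cases b) (auto simp: top_unique)
      then show thesis using that b V s by (simp add: ennreal_less_iff)
    qed
    \<comment> \<open>The gap between \<open>V * s\<close> and \<open>a\<close> leaves room for some
      s' > s, so the superlevel set contains (0, s') and has measure above \<open>s\<close>.\<close>
    define s' where "s' = min (a / V) ((s + 1) / 2)"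
    have s': "s < s'" "s' < 1" "V * s' \<le> a"
      using a(1) V s by (auto simp: s'_def field_simps min_def)
    have sub: "{0<..<s'} \<subseteq> {x \<in> {0<..<1}. t < rearr \<Omega> f (V * x)}"
    proof
      fix x assume x: "x \<in> {0<..<s'}"
      then have "V * x \<le> V * s'" using V by (intro mult_left_mono) auto
      then have "ennreal (V * x) \<le> ennreal a" using s' by (intro ennreal_leI) linarith
      then have "ennreal (V * x) < emeasure lebesgue {x \<in> \<Omega>. ennreal t' < f x}"
        using a(2) t' by (simp add: le_less_trans)
      then have "t < rearr \<Omega> f (V * x)" unfolding t'(1) by (rule less_rearr[OF f \<Omega>])
      then show "x \<in> {x \<in> {0<..<1}. t < rearr \<Omega> f (V * x)}" using x s' by auto
    qed
    have meas: "{x \<in> {0<..<1}. t < rearr \<Omega> f (V * x)} \<in> sets lebesgue"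
    proof -
      have "(\<lambda>x. rearr \<Omega> f (V * x)) \<in> borel_measurable borel" by measurable
      then have "{x \<in> space borel. t < rearr \<Omega> f (V * x)} \<in> sets borel" by measurable
      then have "{0<..<1} \<inter> {x. t < rearr \<Omega> f (V * x)} \<in> sets borel" by auto
      moreover have "{x \<in> {0<..<1}. t < rearr \<Omega> f (V * x)} = {0<..<1} \<inter> {x. t < rearr \<Omega> f (V * x)}" by auto
      ultimately show ?thesis by simp
    qed
    have "emeasure lebesgue {0<..<s'} \<le> ennreal s"
      using emeasure_mono[OF sub meas] t by (rule order_trans)
    then have "ennreal s' \<le> ennreal s" using s s' by simp
    then show False using s s' by (simp add: ennreal_le_iff)
  qed
qed

lemma LZ_weight_pos: "0 < s \<Longrightarrow> 0 < LZ_weight p q \<alpha> \<beta> s"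
  using ell_ge_1[of s] ellell_ge_1[of s] by (simp add: LZ_weight_def)

lemma LZ_weight_measurable [measurable]: "LZ_weight p q \<alpha> \<beta> \<in> borel_measurable borel"
  unfolding LZ_weight_def ell_def ellell_def by measurable

text \<open>The kernel of \<open>potential\<close> divided by the Lorentz--Zygmund weight lies in
  L^q', so Hoelder's inequality applies. Rescaling (0, |\<Omega>|) to (0, 1) contributes the factor
  |\<Omega>|^(m/n).\<close>

lemma potential_le_LZ_norm:
  fixes \<Omega> :: "(real^'n::finite) set"
  assumes q: "1 \<le> q" and p: "1 \<le> p" and \<Omega>: "\<Omega> \<in> sets lebesgue" "0 < measure lebesgue \<Omega>"
    and cond: "recip p < m / CARD('n) \<or> recip p = m / CARD('n) \<and>
      (1 - recip q = 0 \<and> \<alpha> = 0 \<and> \<beta> = 0 \<or> \<alpha> = 1 - recip q \<and> 1 - recip q < \<beta> \<or> 1 - recip q < \<alpha>)"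
  obtains C where "0 \<le> C" "\<And>f. f \<in> borel_measurable (lebesgue_on \<Omega>) \<Longrightarrow>
    potential \<Omega> m f \<le> ennreal C * LZ_norm p q \<alpha> \<beta> (\<lambda>s. rearr \<Omega> f (measure lebesgue \<Omega> * s))"
proof -
  let ?V = "measure lebesgue \<Omega>" and ?\<mu> = "m / CARD('n)" and ?\<rho> = "1 - recip q"
  let ?W = "LZ_weight p q \<alpha> \<beta>"
  define k where "k s = s powr (?\<mu> - 1) / ?W s" for s
  have \<rho>: "0 \<le> ?\<rho>" using recip_bounds[OF q] by simp
  have k_eq: "k s = s powr (?\<mu> - recip p - ?\<rho>) * ell s powr - \<alpha> * ellell s powr - \<beta>" if s: "0 < s" for s
  proof -
    have e: "?\<mu> - recip p - ?\<rho> = (?\<mu> - 1) - (recip p - recip q)" by simp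
    show ?thesis
      unfolding e powr_diff[of s "?\<mu> - 1" "recip p - recip q"] k_def LZ_weight_def powr_minus
      by (simp add: divide_inverse mult_ac)
  qed
  have km: "k \<in> borel_measurable borel" unfolding k_def by measurable
  have k0: "0 \<le> k s" if "0 < s" "s < 1" for s
    using LZ_weight_pos[OF that(1), of p q \<alpha> \<beta>] by (simp add: k_def)
  have "\<exists>C>0. \<forall>s. 0 < s \<longrightarrow> s < 1 \<longrightarrow> s powr (?\<mu> - recip p) * ell s powr - \<alpha> * ellell s powr - \<beta> * log_weight 1 2 s powr ?\<rho> \<le> C"
  proof (cases "recip p < ?\<mu>")
    case True
    then have "0 < ?\<mu> - recip p" by simp
    from slow_bound[OF this order_refl \<rho>, of 2 "- \<alpha>" "- \<beta>"] show ?thesis by (metis one_less_numeral_iff semiring_norm(76))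
  next
    case False
    then have c: "recip p = ?\<mu>" "?\<rho> = 0 \<and> \<alpha> = 0 \<and> \<beta> = 0 \<or> \<alpha> = ?\<rho> \<and> ?\<rho> < \<beta> \<or> ?\<rho> < \<alpha>"
      using cond by auto
    obtain C where C: "0 < C"
      "\<And>s. 0 < s \<Longrightarrow> s < 1 \<Longrightarrow> ell s powr - \<alpha> * ellell s powr - \<beta> * log_weight 1 2 s powr ?\<rho> \<le> C"
      by (rule dual_bound[OF \<rho> c(2)]) blast
    show ?thesis
      using C by (intro exI[of _ C]) (simp add: c(1))
  qed
  then obtain C where C: "0 < C" "\<And>s. 0 < s \<Longrightarrow> s < 1 \<Longrightarrow>
      s powr (?\<mu> - recip p) * ell s powr - \<alpha> * ellell s powr - \<beta> * log_weight 1 2 s powr ?\<rho> \<le> C" by blast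
  have fin: "Lq_norm01 (conj_exp q) (\<lambda>s. ennreal (k s)) < \<infinity>"
  proof (rule Lq_norm01_finite[OF conj_exp_ge_1[OF q], of _ 1 2 C])
    show "(\<lambda>s. ennreal (k s)) \<in> borel_measurable (lebesgue_on {0<..<1})"
      using km by (intro measurable_restrict_space1 measurable_completion) simp
    fix s :: real assume s: "0 < s" "s < 1"
    have D: "0 < log_weight 1 2 s" by (rule log_weight_pos[OF shifted_log_ge_1]) (use s in auto)
    have "k s = (s powr (?\<mu> - recip p) * ell s powr - \<alpha> * ellell s powr - \<beta> * log_weight 1 2 s powr ?\<rho>) * (1 / (s * log_weight 1 2 s)) powr ?\<rho>"
      unfolding k_eq[OF s(1)] using s D by (simp add: powr_diff powr_divide powr_mult)
    also have "\<dots> \<le> C * (1 / (s * log_weight 1 2 s)) powr ?\<rho>"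
      using C(2)[OF s] by (intro mult_right_mono) auto
    finally show "ennreal (k s) \<le> ennreal (C * (1 / (s * log_weight 1 2 s)) powr recip (conj_exp q))"
      unfolding recip_conj_exp[OF q] by (rule ennreal_leI)
  qed (use C in auto)
  have "\<exists>C'\<ge>0. \<forall>g\<in>borel_measurable borel.
      (\<integral>\<^sup>+s. g s * ennreal (k s) \<partial>lebesgue_on {0<..<1}) \<le> ennreal C' * Lq_norm01 q g"
  proof (rule Holder01[where k = k, OF q _ km fin])
    show "0 \<le> k s" if "0 < s" "s < 1" for s using that by (rule k0)
  qed blast
  then obtain C' where C': "0 \<le> C'" "\<And>g. g \<in> borel_measurable borel \<Longrightarrow>
      (\<integral>\<^sup>+s. g s * ennreal (k s) \<partial>lebesgue_on {0<..<1}) \<le> ennreal C' * Lq_norm01 q g"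
    by blast
  show thesis
  proof (rule that[of "?V powr ?\<mu> * C'"])
    show "0 \<le> ?V powr ?\<mu> * C'" using C' by simp
    fix f :: "real^'n \<Rightarrow> ennreal" assume f: "f \<in> borel_measurable (lebesgue_on \<Omega>)"
    let ?\<phi> = "\<lambda>s. rearr \<Omega> f (?V * s)"
    let ?g = "\<lambda>s. ennreal (?W s) * rearr {0<..<1} ?\<phi> s"
    have gm: "?g \<in> borel_measurable borel" by measurable
    have "potential \<Omega> m f = ennreal \<bar>?V\<bar> * (\<integral>\<^sup>+s. rearr \<Omega> f (0 + ?V * s) * ennreal ((0 + ?V * s) powr (?\<mu> - 1)) *
        indicator {0<..<?V} (0 + ?V * s) \<partial>lebesgue)"
      unfolding potential_def
    proof (rule nn_integral_real_affine_lebesgue)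
      show "(\<lambda>s. rearr \<Omega> f s * ennreal (s powr (?\<mu> - 1)) * indicator {0<..<?V} s) \<in> borel_measurable lebesgue"
        by (intro measurable_completion borel_measurable_times_ennreal) auto
    qed (use \<Omega> in simp)
    also have "\<dots> \<le> ennreal ?V * (\<integral>\<^sup>+s. ennreal (?V powr (?\<mu> - 1)) * (?g s * ennreal (k s) * indicator {0<..<1} s) \<partial>lebesgue)"
    proof -
      have pw: "rearr \<Omega> f (0 + ?V * s) * ennreal ((0 + ?V * s) powr (?\<mu> - 1)) * indicator {0<..<?V} (0 + ?V * s) \<le>
          ennreal (?V powr (?\<mu> - 1)) * (?g s * ennreal (k s) * indicator {0<..<1} s)" for s
      proof (cases "0 < s \<and> s < 1")
        case True
        have le: "?\<phi> s \<le> rearr {0<..<1} ?\<phi> s"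
          using True by (intro rearr_le_rearr_rearr[OF f \<Omega>]) auto
        have W: "0 < ?W s" using True by (intro LZ_weight_pos) auto
        have "ennreal ((?V * s) powr (?\<mu> - 1)) = ennreal (?V powr (?\<mu> - 1)) * (ennreal (?W s) * ennreal (k s))"
        proof -
          have "(?V * s) powr (?\<mu> - 1) = ?V powr (?\<mu> - 1) * (?W s * k s)"
            using True \<Omega> W by (simp add: k_def powr_mult)
          then show ?thesis using W k0[of s] True by (simp add: ennreal_mult)
        qed
        then have "?\<phi> s * ennreal ((?V * s) powr (?\<mu> - 1)) \<le>
            rearr {0<..<1} ?\<phi> s * (ennreal (?V powr (?\<mu> - 1)) * (ennreal (?W s) * ennreal (k s)))"
          using le by (simp add: mult_right_mono)
        then show ?thesis
          using True \<Omega> by (simp add: indicator_def mult_ac)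
      next
        case False
        have "\<not> (0 < ?V * s \<and> ?V * s < ?V)"
        proof
          assume "0 < ?V * s \<and> ?V * s < ?V"
          then have "0 < s" "?V * s < ?V * 1" using \<Omega> by (auto simp: zero_less_mult_iff)
          then show False using False \<Omega> by (simp only: mult_less_cancel_left_pos simp_thms)
        qed
        then have z: "indicator {0<..<?V} (0 + ?V * s) = (0 :: ennreal)" by (auto simp: indicator_def)
        show ?thesis unfolding z by simp
      qed
      have "\<bar>?V\<bar> = ?V" using \<Omega> by simp
      then show ?thesis by (simp only:) (rule mult_left_mono[OF nn_integral_mono[OF pw]], simp)
    qed
    also have "(\<integral>\<^sup>+s. ennreal (?V powr (?\<mu> - 1)) * (?g s * ennreal (k s) * indicator {0<..<1} s) \<partial>lebesgue) =
        ennreal (?V powr (?\<mu> - 1)) * (\<integral>\<^sup>+s. ?g s * ennreal (k s) \<partial>lebesgue_on {0<..<1})"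
    proof -
      have "(\<lambda>s. ?g s * ennreal (k s) * indicator {0<..<1} s) \<in> borel_measurable lebesgue"
        using gm km by (intro measurable_completion borel_measurable_times_ennreal) auto
      then show ?thesis by (simp add: nn_integral_cmult nn_integral_restrict_space)
    qed
    also have "ennreal ?V * (ennreal (?V powr (?\<mu> - 1)) * (\<integral>\<^sup>+s. ?g s * ennreal (k s) \<partial>lebesgue_on {0<..<1})) \<le>
        ennreal ?V * (ennreal (?V powr (?\<mu> - 1)) * (ennreal C' * Lq_norm01 q ?g))"
      by (intro mult_left_mono C'(2)[OF gm]) auto
    also have "\<dots> = ennreal (?V * ?V powr (?\<mu> - 1) * C') * Lq_norm01 q ?g"
      using C'(1) by (simp add: ennreal_mult mult.assoc)
    also have "?V * ?V powr (?\<mu> - 1) = ?V powr ?\<mu>"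
      using \<Omega> by (simp add: powr_diff)
    finally show "potential \<Omega> m f \<le> ennreal (?V powr ?\<mu> * C') * LZ_norm p q \<alpha> \<beta> ?\<phi>"
      by (simp add: LZ_norm_def)
  qed
qed


section \<open>Smooth functions have weak derivatives\<close>

lemma integrable_indicator_continuous:
  fixes f :: "real^'n::finite \<Rightarrow> real"
  assumes "compact K" "continuous_on UNIV f"
  shows "integrable lebesgue (\<lambda>x. indicator K x * f x)"
proof -
  have "integrable lborel (\<lambda>x. indicator K x *\<^sub>R f x)"
    using assms by (intro borel_integrable_compact continuous_on_subset[OF assms(2)]) auto
  then show ?thesis by (simp add: integrable_completion borel_measurable_integrable)
qed

text \<open>By translation invariance the integral of F(x + s e) does not depend on s, and its
  derivative at s = 0 is the integral of the partial derivative.\<close>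

lemma integral_partial_drv_eq_0:
  fixes F :: "real^'n::finite \<Rightarrow> real"
  assumes F: "smooth F" and K: "compact K" "\<And>x. x \<notin> K \<Longrightarrow> F x = 0"
  shows "(\<integral>x. partial_drv i F x \<partial>lebesgue) = 0"
proof -
  let ?e = "axis i 1 :: real^'n"
  \<comment> \<open>A compact set containing the supports of all translates with s in {0..1}; its
    indicator plays the role of the fixed integrable factor in
    \<open>has_derivative_lint\<close>.\<close>
  define B where "B = (\<lambda>(s, x). x - s *\<^sub>R ?e) ` ({0..1} \<times> K)"
  have B: "compact B"
    unfolding B_def split_def using K by (intro compact_continuous_image compact_Times continuous_intros) auto
  have cont: "continuous_on UNIV F" "continuous_on UNIV (partial_drv i F)"
    using F smooth_partial_drv[OF F] by (auto intro: smooth_continuous_on)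
  have out: "F (x + s *\<^sub>R ?e) = 0" if "x \<notin> B" "s \<in> {0..1}" for x s
  proof (rule K(2))
    show "x + s *\<^sub>R ?e \<notin> K"
    proof
      assume "x + s *\<^sub>R ?e \<in> K"
      then have "(\<lambda>(s, x). x - s *\<^sub>R ?e) (s, x + s *\<^sub>R ?e) \<in> B" unfolding B_def using that(2) by (intro imageI) auto
      then show False using that(1) by simp
    qed
  qed
  have dK: "partial_drv i F x = 0" if "x \<notin> K" for x
    using K that by (intro partial_drv_eq_0[OF compact_imp_closed]) auto
  have KB: "K \<subseteq> B"
  proof
    fix x assume "x \<in> K"
    then have "(\<lambda>(s, x). x - s *\<^sub>R ?e) (0, x) \<in> B" unfolding B_def by (intro imageI) auto
    then show "x \<in> B" by simp
  qed
  obtain C1 where C1: "C1 \<ge> 0" "\<And>x. \<bar>F x\<bar> \<le> C1" using bounded_of_compact_support[OF cont(1) K] by blast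
  obtain C2 where C2: "C2 \<ge> 0" "\<And>x. \<bar>partial_drv i F x\<bar> \<le> C2" using bounded_of_compact_support[OF cont(2) K(1) dK] by blast
  let ?J = "\<lambda>s. \<integral>x. indicator B x * F (x + s *\<^sub>R ?e) \<partial>lebesgue"
  have shift: "continuous_on UNIV (\<lambda>x. g (x + s *\<^sub>R ?e))" if "continuous_on UNIV g" for g :: "real^'n \<Rightarrow> real" and s
    by (rule continuous_on_compose2[OF that]) (auto intro: continuous_intros)
  have meas: "g \<in> borel_measurable lebesgue" if "continuous_on UNIV g" for g :: "real^'n \<Rightarrow> real"
    using that by (intro measurable_completion) (simp add: borel_measurable_continuous_onI)
  have "(?J has_real_derivative (\<integral>x. indicator B x * partial_drv i F (x + 0 *\<^sub>R ?e) \<partial>lebesgue)) (at 0 within {0..1})"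
  proof (rule has_derivative_lint[where C = "max C1 C2" and K' = "\<lambda>s x. partial_drv i F (x + s *\<^sub>R ?e)"])
    show "integrable lebesgue (indicator B :: real^'n \<Rightarrow> real)"
      using integrable_indicator_continuous[OF B, of "\<lambda>x. 1"] by simp
    fix s :: real assume s: "s \<in> {0..1}"
    show "(\<lambda>x. F (x + s *\<^sub>R ?e)) \<in> borel_measurable lebesgue" by (intro meas shift cont)
    show "(\<lambda>x. partial_drv i F (x + s *\<^sub>R ?e)) \<in> borel_measurable lebesgue" by (intro meas shift cont)
    fix x
    show "\<bar>F (x + s *\<^sub>R ?e)\<bar> \<le> max C1 C2" using C1(2)[of "x + s *\<^sub>R ?e"] by simp
    show "\<bar>partial_drv i F (x + s *\<^sub>R ?e)\<bar> \<le> max C1 C2" using C2(2)[of "x + s *\<^sub>R ?e"] by simp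
    have "((\<lambda>s. x + s *\<^sub>R ?e) has_derivative (\<lambda>h. h *\<^sub>R ?e)) (at s)"
      by (auto intro!: derivative_eq_intros)
    from diff_chain_at[OF this smooth_has_derivative[OF F]]
    have "((\<lambda>s. F (x + s *\<^sub>R ?e)) has_derivative (\<lambda>h. \<Sum>j\<in>UNIV. (h *\<^sub>R ?e) $ j * partial_drv j F (x + s *\<^sub>R ?e))) (at s)"
      by (simp add: o_def)
    moreover have "(\<lambda>h. \<Sum>j\<in>UNIV. (h *\<^sub>R ?e) $ j * partial_drv j F (x + s *\<^sub>R ?e)) = (*) (partial_drv i F (x + s *\<^sub>R ?e))"
      by (auto simp: axis_def if_distrib if_distribR sum.delta' mult.commute cong: if_cong)
    ultimately have "((\<lambda>s. F (x + s *\<^sub>R ?e)) has_real_derivative partial_drv i F (x + s *\<^sub>R ?e)) (at s)"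
      by (simp add: has_field_derivative_def)
    then show "((\<lambda>s. F (x + s *\<^sub>R ?e)) has_real_derivative partial_drv i F (x + s *\<^sub>R ?e)) (at s within {0..1})"
      by (rule has_field_derivative_at_within)
  qed simp
  moreover have J: "?J s = (\<integral>x. F x \<partial>lebesgue)" if s: "s \<in> {0..1}" for s
  proof -
    have Fb: "F \<in> borel_measurable borel" "(\<lambda>x. F (x + s *\<^sub>R ?e)) \<in> borel_measurable borel"
      using cont shift[OF cont(1)] by (auto intro: borel_measurable_continuous_onI)
    have "?J s = (\<integral>x. F (x + s *\<^sub>R ?e) \<partial>lebesgue)"
      using out[OF _ s] by (intro Bochner_Integration.integral_cong refl) (auto simp: indicator_def)
    also have "\<dots> = (\<integral>x. F (x + s *\<^sub>R ?e) \<partial>lborel)" using Fb by (simp add: integral_completion)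
    also have "\<dots> = (\<integral>x. F x \<partial>distr lborel borel ((+) (s *\<^sub>R ?e)))"
      using Fb by (simp add: integral_distr add.commute)
    also have "\<dots> = (\<integral>x. F x \<partial>lebesgue)" using Fb by (simp add: lborel_distr_plus integral_completion)
    finally show ?thesis .
  qed
  ultimately have "((\<lambda>y. (?J y - ?J 0) / (y - 0)) \<longlongrightarrow> (\<integral>x. indicator B x * partial_drv i F (x + 0 *\<^sub>R ?e) \<partial>lebesgue)) (at 0 within {0..1})"
    unfolding has_field_derivative_iff by blast
  moreover have "((\<lambda>y. (?J y - ?J 0) / (y - 0)) \<longlongrightarrow> 0) (at 0 within {0..1})"
  proof (rule tendsto_eventually)
    have "\<forall>\<^sub>F y in at 0 within {0..1::real}. y \<in> {0..1}" by (auto simp: eventually_at_filter)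
    then show "\<forall>\<^sub>F y in at 0 within {0..1}. (?J y - ?J 0) / (y - 0) = 0"
    proof eventually_elim
      case (elim y)
      have "?J y = ?J 0" by (rule HOL.trans[OF J[OF elim] J[symmetric]]) simp
      then show ?case by (simp only: diff_self div_0)
    qed
  qed
  moreover have "at 0 within {0..1::real} \<noteq> bot" by (simp add: at_within_Icc_at_right)
  ultimately have "(\<integral>x. indicator B x * partial_drv i F (x + 0 *\<^sub>R ?e) \<partial>lebesgue) = 0"
    by (intro tendsto_unique)
  moreover have "(\<integral>x. indicator B x * partial_drv i F (x + 0 *\<^sub>R ?e) \<partial>lebesgue) = (\<integral>x. partial_drv i F x \<partial>lebesgue)"
    using dK KB by (intro Bochner_Integration.integral_cong refl) (auto simp: indicator_def)
  ultimately show ?thesis by simp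
qed

lemma continuous_locally_integrable:
  "continuous_on UNIV (f :: real^'n::finite \<Rightarrow> real) \<Longrightarrow> locally_integrable \<Omega> f"
  unfolding locally_integrable_def set_integrable_def
  using integrable_indicator_continuous by (auto simp: real_scaleR_def)

lemma integration_by_parts:
  fixes f \<phi> :: "real^'n::finite \<Rightarrow> real"
  assumes f: "smooth f" and \<phi>: "test_function \<Omega> \<phi>"
  shows "(LINT x:\<Omega>|lebesgue. f x * partial_drv i \<phi> x) = - (LINT x:\<Omega>|lebesgue. partial_drv i f x * \<phi> x)"
proof -
  obtain K where K: "smooth \<phi>" "compact K" "K \<subseteq> \<Omega>" "\<And>x. x \<notin> K \<Longrightarrow> \<phi> x = 0"
    by (rule test_functionD[OF \<phi>]) blast
  have d\<phi>: "partial_drv i \<phi> x = 0" if "x \<notin> K" for x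
    using K that by (intro partial_drv_eq_0[OF compact_imp_closed]) auto
  have int1: "integrable lebesgue (\<lambda>x. (indicator K x * f x) * partial_drv i \<phi> x)"
  proof -
    have "integrable lebesgue (\<lambda>x. indicator K x * (f x * partial_drv i \<phi> x))"
      by (intro integrable_indicator_continuous K continuous_on_mult smooth_continuous_on f smooth_partial_drv)
    then show ?thesis by (simp add: mult.assoc)
  qed
  have int2: "integrable lebesgue (\<lambda>x. (indicator K x * partial_drv i f x) * \<phi> x)"
  proof -
    have "integrable lebesgue (\<lambda>x. indicator K x * (partial_drv i f x * \<phi> x))"
      by (intro integrable_indicator_continuous K continuous_on_mult smooth_continuous_on f smooth_partial_drv)
    then show ?thesis by (simp add: mult.assoc)
  qed
  have "(\<integral>x. partial_drv i (\<lambda>x. f x * \<phi> x) x \<partial>lebesgue) = 0"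
    using K by (intro integral_partial_drv_eq_0 smooth_mult f) auto
  moreover have "partial_drv i (\<lambda>x. f x * \<phi> x) x =
      (indicator K x * f x) * partial_drv i \<phi> x + (indicator K x * partial_drv i f x) * \<phi> x" for x
    by (cases "x \<in> K") (use K(4) d\<phi> in \<open>auto simp: partial_drv_mult[OF f K(1)]\<close>)
  ultimately have "(\<integral>x. (indicator K x * f x) * partial_drv i \<phi> x \<partial>lebesgue) +
      (\<integral>x. (indicator K x * partial_drv i f x) * \<phi> x \<partial>lebesgue) = 0"
    using Bochner_Integration.integral_add[OF int1 int2] by simp
  then show ?thesis
    using integral_support[OF d\<phi> K(3), where f = f] integral_support[OF K(4) K(3), where f = "partial_drv i f"] by simp
qed

lemma test_function_partial_drv:
  assumes "test_function \<Omega> \<phi>"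
  shows "test_function \<Omega> (partial_drv i \<phi>)"
proof -
  obtain K where K: "smooth \<phi>" "compact K" "K \<subseteq> \<Omega>" "\<And>x. x \<notin> K \<Longrightarrow> \<phi> x = 0"
    by (rule test_functionD[OF assms]) blast
  show ?thesis
    using K by (intro test_functionI[of _ K] smooth_partial_drv partial_drv_eq_0[OF compact_imp_closed]) auto
qed

text \<open>Integration by parts strips the directions of \<phi> from the outside, so they reach f
  in reverse order; this gives \<open>rev js\<close> without symmetry of mixed partial
  derivatives.\<close>

lemma smooth_has_weak_derivative:
  fixes f :: "real^'n::finite \<Rightarrow> real"
  assumes f: "smooth f"
  shows "has_weak_derivative \<Omega> js f (iter_partial (rev js) f)"
proof -
  have eq: "(LINT x:\<Omega>|lebesgue. f x * iter_partial js \<phi> x) = (-1) ^ length js * (LINT x:\<Omega>|lebesgue. iter_partial (rev js) f x * \<phi> x)"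
    if "smooth f" "test_function \<Omega> \<phi>" for f \<phi> :: "real^'n \<Rightarrow> real"
    using that(1)
  proof (induction js arbitrary: f)
    case (Cons i js)
    have "test_function \<Omega> (iter_partial js \<phi>)"
      by (induction js) (auto intro: test_function_partial_drv that(2))
    from integration_by_parts[OF Cons.prems this] Cons.IH[OF smooth_partial_drv[OF Cons.prems]]
    show ?case by (simp add: iter_partial_append)
  qed simp
  have "locally_integrable \<Omega> (iter_partial ks f)" for ks
    by (intro continuous_locally_integrable smooth_continuous_on smooth_iter_partial f)
  from this[of "[]"] this[of "rev js"] eq[OF f] show ?thesis by (simp add: has_weak_derivative_def)
qed

section \<open>Failure of the embedding\<close>

lemma rearr_unit_le:
  assumes "\<And>x. s \<le> x \<Longrightarrow> 0 < x \<Longrightarrow> x < 1 \<Longrightarrow> \<phi> x \<le> t" and "0 \<le> s"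
  shows "rearr {0<..<1} \<phi> s \<le> t"
  unfolding rearr_def
proof (rule Inf_lower, rule CollectI)
  have "{x \<in> {0<..<1}. t < \<phi> x} \<subseteq> {0<..<s}"
  proof
    fix x assume x: "x \<in> {x \<in> {0<..<1}. t < \<phi> x}"
    have "\<not> s \<le> x" using assms(1)[of x] x by auto
    then show "x \<in> {0<..<s}" using x by auto
  qed
  then have "emeasure lebesgue {x \<in> {0<..<1}. t < \<phi> x} \<le> emeasure lebesgue {0<..<s}"
    by (intro emeasure_mono) auto
  also have "\<dots> = ennreal s" using assms(2) by simp
  finally show "emeasure lebesgue {x \<in> {0<..<1}. t < \<phi> x} \<le> ennreal s" .
qed

lemma Lq_norm01_mono:
  assumes q: "1 \<le> q" and f: "f \<in> borel_measurable (lebesgue_on {0<..<1})"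
    and le: "\<And>s. 0 < s \<Longrightarrow> s < 1 \<Longrightarrow> f s \<le> g s"
  shows "Lq_norm01 q f \<le> Lq_norm01 q g"
proof -
  have sp: "space (lebesgue_on {0<..<1::real}) = {0<..<1}" by (simp add: space_restrict_space)
  have pm: "enn_powr x r \<le> enn_powr y r" if "x \<le> y" "0 \<le> r" for x y r
    using that by (auto simp: enn_powr_def top_unique less_top intro!: ennreal_leI powr_mono2 enn2real_mono)
  show ?thesis
    using q
  proof (cases q rule: exponent_cases)
    case 1
    have "esssup (lebesgue_on {0<..<1}) f \<le> esssup (lebesgue_on {0<..<1}) g"
      using le sp by (intro esssup_AE_mono f AE_I2) auto
    then show ?thesis using 1 by (simp add: Lq_norm01_def)
  next
    case (2 Q)
    have "(\<integral>\<^sup>+s. enn_powr (f s) Q \<partial>lebesgue_on {0<..<1}) \<le> (\<integral>\<^sup>+s. enn_powr (g s) Q \<partial>lebesgue_on {0<..<1})"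
      using 2 le sp by (intro nn_integral_mono pm) auto
    then show ?thesis using 2 by (simp add: Lq_norm01_def pm)
  qed
qed

text \<open>Each of the three factors grows at most by the ratio of the shifted logarithms, which is
  at most (s/s')^(1/A0) because the shifted logarithm is at least \<open>A0\<close>. A large shift
  makes the total power 3/A0 small.\<close>

lemma log_weight_growth:
  assumes A0: "1 \<le> A0" and s: "0 < s'" "s' \<le> s" "s \<le> 1"
  shows "log_weight A0 1 s' \<le> log_weight A0 1 s * (s / s') powr (3 / A0)"
proof -
  have s1: "0 < s" "s' \<le> 1" using s by linarith+
  obtain y Y Z where D: "y = shifted_log A0 s" "Y = 1 + ln y" "Z = 1 + ln Y" "1 \<le> y" "1 \<le> Y" "1 \<le> Z" "Y \<le> y" "Z \<le> Y"
    "\<And>p. log_weight A0 p s = y * Y * Z powr p"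
    by (rule log_weight_factors[OF A0 s1(1) s(3)]) blast
  obtain y' Y' Z' where D': "y' = shifted_log A0 s'" "Y' = 1 + ln y'" "Z' = 1 + ln Y'" "1 \<le> y'" "1 \<le> Y'" "1 \<le> Z'" "Y' \<le> y'" "Z' \<le> Y'"
    "\<And>p. log_weight A0 p s' = y' * Y' * Z' powr p"
    by (rule log_weight_factors[OF A0 s(1) s1(2)]) blast
  \<comment> \<open>Passing to 1 + ln does not increase the ratio of two numbers above 1, so the
    ratio bound is inherited by the iterated logarithms.\<close>
  have ratio: "1 + ln b \<le> (1 + ln a) * (b / a)" if "1 \<le> a" "a \<le> b" for a b :: real
  proof -
    have "1 + ln b = (1 + ln a) + ln (b / a)" using that by (simp add: ln_div)
    also have "\<dots> \<le> (1 + ln a) + (b / a - 1)" using that by (intro add_left_mono ln_le_minus_one) auto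
    also have "\<dots> \<le> (1 + ln a) + (1 + ln a) * (b / a - 1)"
      using that mult_right_mono[of 1 "1 + ln a" "b / a - 1"] by (simp add: field_simps)
    also have "\<dots> = (1 + ln a) * (b / a)" by (simp add: algebra_simps)
    finally show ?thesis .
  qed
  have yy: "y \<le> y'" unfolding D(1) D'(1) shifted_log_def using s by simp
  then have YY: "Y \<le> Y'" unfolding D(2) D'(2) using D(4) by simp
  then have ZZ: "Z \<le> Z'" unfolding D(3) D'(3) using D(5) by simp
  have Yr: "Y' \<le> Y * (y' / y)" unfolding D(2) D'(2) by (rule ratio[OF D(4) yy])
  have "Z' \<le> Z * (Y' / Y)" unfolding D(3) D'(3) by (rule ratio[OF D(5) YY])
  also have "\<dots> \<le> Z * (y' / y)" using Yr D by (intro mult_left_mono) (auto simp: field_simps)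
  finally have Zr: "Z' \<le> Z * (y' / y)" .
  have A0y: "A0 \<le> y"
  proof -
    have "ln s \<le> 0" using s1 s by (subst ln_le_zero_iff)
    then show ?thesis by (simp add: D(1) shifted_log_def)
  qed
  have "y' / y = 1 + (y' - y) / y" using D(4) by (simp add: field_simps)
  also have "\<dots> \<le> exp ((y' - y) / y)" by (rule exp_ge_add_one_self)
  also have "\<dots> \<le> exp ((y' - y) / A0)" using A0y A0 yy by (simp add: frac_le)
  also have "y' - y = ln (s / s')" unfolding D(1) D'(1) shifted_log_def using s s1 by (simp add: ln_div)
  finally have r: "y' / y \<le> exp (ln (s / s') / A0)" .
  have r0: "0 \<le> y' / y" using D(4) D'(4) by simp
  have "log_weight A0 1 s' = y' * Y' * Z'" unfolding D'(9) using D'(6) by simp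
  also have "\<dots> \<le> (y * (y' / y)) * (Y * (y' / y)) * (Z * (y' / y))"
    using Yr Zr D D' r0 by (intro mult_mono) auto
  also have "\<dots> = (y * Y * Z) * (y' / y) ^ 3" by (simp add: power3_eq_cube)
  also have "\<dots> \<le> (y * Y * Z) * (exp (ln (s / s') / A0)) ^ 3"
    using D r r0 by (intro mult_left_mono power_mono) auto
  also have "(exp (ln (s / s') / A0)) ^ 3 = (s / s') powr (3 / A0)"
    using s s1 by (simp add: powr_def exp_of_nat_mult[symmetric] field_simps)
  also have "y * Y * Z = log_weight A0 1 s" unfolding D(9) using D(6) by simp
  finally show ?thesis .
qed

section \<open>The peak profile and its dyadic amplitudes\<close>

locale peak =
  fixes \<Omega> :: "(real^'n::finite) set" and m :: nat
  assumes dom: "open \<Omega>" "bounded \<Omega>" "\<Omega> \<noteq> {}" and m: "1 \<le> m" "m < CARD('n)"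
begin

text \<open>
  With a shift this large the logarithmic factor changes by a factor of at most \<open>sqrt 2\<close> between
  consecutive dyadic cubes, which is less than the growth of the power of \<open>s\<close>.
\<close>

definition A0 :: real where "A0 = 6 * CARD('n)"

definition profile :: "real \<Rightarrow> real" where
  "profile s = s powr - (m / CARD('n)) / log_weight A0 1 s"

lemma A0: "1 \<le> A0" "3 / A0 = 1 / (2 * real CARD('n))"
  using m by (auto simp: A0_def)

lemma log_weight_gt_0: "0 < s \<Longrightarrow> s \<le> 1 \<Longrightarrow> 0 < log_weight A0 1 s"
  by (intro log_weight_pos shifted_log_ge_1 A0)

lemma profile_nonneg: "0 < s \<Longrightarrow> s \<le> 1 \<Longrightarrow> 0 \<le> profile s"
  using log_weight_gt_0[of s] by (simp add: profile_def)

text \<open>The logarithmic weight can grow at most like the power 3/A0 = 1/(2n), which is below the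
  power m/n of the profile.\<close>

lemma profile_antimono:
  assumes s: "0 < s'" "s' \<le> s" "s \<le> 1"
  shows "profile s \<le> profile s'"
proof -
  let ?\<mu> = "m / CARD('n)"
  have D: "0 < log_weight A0 1 s" "0 < log_weight A0 1 s'" using s by (auto intro!: log_weight_gt_0)
  have "log_weight A0 1 s' \<le> log_weight A0 1 s * (s / s') powr (3 / A0)" by (rule log_weight_growth[OF A0(1) s])
  also have "\<dots> \<le> log_weight A0 1 s * (s / s') powr ?\<mu>"
  proof (intro mult_left_mono powr_mono)
    have "1 / (2 * real CARD('n)) \<le> real m / real CARD('n)"
      using m by (simp add: field_simps)
    then show "3 / A0 \<le> ?\<mu>" unfolding A0(2) .
  qed (use s D in auto)
  finally have le: "log_weight A0 1 s' \<le> log_weight A0 1 s * (s / s') powr ?\<mu>" .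
  have "profile s = s powr - ?\<mu> * ((s / s') powr ?\<mu>) / (log_weight A0 1 s * (s / s') powr ?\<mu>)"
    using s by (simp add: profile_def)
  also have "\<dots> \<le> s powr - ?\<mu> * ((s / s') powr ?\<mu>) / log_weight A0 1 s'"
    using le D by (intro divide_left_mono mult_pos_pos) (auto intro: mult_nonneg_nonneg)
  also have "s powr - ?\<mu> * ((s / s') powr ?\<mu>) = s' powr - ?\<mu>"
    using s by (simp add: powr_divide powr_minus field_simps)
  finally show ?thesis by (simp add: profile_def)
qed

text \<open>The volume of a cube of side 2^(-k); rearrangements are functions of volume rather than
  of side.\<close>

definition scale :: "nat \<Rightarrow> real" where "scale k = (1 / 2 ^ k) ^ CARD('n)"

lemma scale: "0 < scale k" "scale k \<le> 1" "scale (Suc k) = scale k / 2 ^ CARD('n)"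
  by (auto simp: scale_def power_le_one power_divide power_mult_distrib)

definition amplitude :: "nat \<Rightarrow> real" where "amplitude k = 1 / log_weight A0 1 (scale k)"

lemma amplitude_pos: "0 < amplitude k"
  using log_weight_gt_0[OF scale(1,2)] by (simp add: amplitude_def)

lemma profile_scale: "profile (scale k) = amplitude k * 2 ^ (k * m)"
proof -
  have "scale k = 2 powr - (real k * CARD('n))"
    by (simp add: scale_def power_one_over powr_minus_divide powr_realpow[symmetric] powr_powr)
  then have "scale k powr - (m / CARD('n)) = 2 powr (real k * m)"
    by (simp add: powr_powr)
  also have "\<dots> = 2 ^ (k * m)" by (simp add: powr_realpow[symmetric])
  finally show ?thesis by (simp add: profile_def amplitude_def)
qed

text \<open>From one scale to the next the amplitude shrinks at most by 2/3 and the power of 2 at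
  least doubles. Each term is thus at most 3/4 of the following one, and the geometric series sums
  to 4.\<close>

lemma sum_profile_le: "(\<Sum>l\<le>k. amplitude l * 2 ^ (l * m)) \<le> 4 * (amplitude k * 2 ^ (k * m))"
proof (induction k)
  case 0
  show ?case using amplitude_pos[of 0] by simp
next
  case (Suc k)
  have D: "0 < log_weight A0 1 (scale k)" "0 < log_weight A0 1 (scale (Suc k))" by (auto intro!: log_weight_gt_0 scale)
  have "scale (Suc k) \<le> scale k" using scale(1)[of k] by (simp add: scale(3) divide_le_eq)
  then have "log_weight A0 1 (scale (Suc k)) \<le> log_weight A0 1 (scale k) * (scale k / scale (Suc k)) powr (3 / A0)"
    by (intro log_weight_growth A0 scale)
  also have "scale k / scale (Suc k) = 2 powr CARD('n)"
    using scale(1)[of k] by (simp add: scale(3) powr_realpow)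
  also have "(2 powr CARD('n)) powr (3 / A0) = (2::real) powr (1 / 2)"
    unfolding A0(2) by (simp add: powr_powr)
  also have "\<dots> \<le> 3 / 2"
  proof -
    have "sqrt 2 \<le> 3 / (2 :: real)" by (rule real_le_lsqrt) (auto simp: power2_eq_square)
    then show ?thesis by (simp only: powr_half_sqrt[of 2, simplified])
  qed
  finally have "log_weight A0 1 (scale (Suc k)) \<le> 3 / 2 * log_weight A0 1 (scale k)" using D by simp
  then have "amplitude k \<le> 3 / 2 * amplitude (Suc k)"
    using D by (simp add: amplitude_def field_simps)
  moreover have "2 * (2::real) ^ (k * m) \<le> 2 ^ (Suc k * m)"
  proof -
    have "2 * (2::real) ^ (k * m) = 2 ^ (k * m + 1)" by simp
    also have "\<dots> \<le> 2 ^ (Suc k * m)" using m by (intro power_increasing) auto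
    finally show ?thesis .
  qed
  then have "amplitude (Suc k) * (2 * 2 ^ (k * m)) \<le> amplitude (Suc k) * 2 ^ (Suc k * m)"
    using amplitude_pos[of "Suc k"] by (intro mult_left_mono) auto
  moreover have "amplitude k * 2 ^ (k * m) \<le> 3 / 2 * amplitude (Suc k) * 2 ^ (k * m)"
    using \<open>amplitude k \<le> 3 / 2 * amplitude (Suc k)\<close> by (intro mult_right_mono) auto
  moreover have "amplitude (Suc k) * (2 * 2 ^ (k * m)) = 2 * (amplitude (Suc k) * 2 ^ (k * m))"
    "3 / 2 * amplitude (Suc k) * 2 ^ (k * m) = 3 / 2 * (amplitude (Suc k) * 2 ^ (k * m))" by simp_all
  ultimately have "4 * (amplitude k * 2 ^ (k * m)) \<le> 3 * (amplitude (Suc k) * 2 ^ (Suc k * m))" by linarith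
  then show ?case using Suc by simp
qed

text \<open>An amplitude times \<open>d\<close> dominates the increment of the triple logarithm
  \<open>T\<close>, by ln b' - ln b \<le> (b' - b)/b used three times, and \<open>T\<close> tends to
  infinity.\<close>

lemma sum_amplitude_unbounded: "\<exists>J. B \<le> (\<Sum>k\<le>J. amplitude k)"
proof -
  \<comment> \<open>The increment of the shifted logarithm between consecutive scales.\<close>
  define d where "d = CARD('n) * ln 2"
  have d: "0 < d" by (simp add: d_def)
  have shifted_log_scale: "shifted_log A0 (scale k) = A0 + k * d" for k
    by (simp add: shifted_log_def scale_def d_def ln_realpow ln_div)
  define T where "T k = ln (1 + ln (1 + ln (A0 + real k * d)))" for k
  have step: "T (Suc k) - T k \<le> d * amplitude k" for k
  proof -
    define y y' where "y = A0 + k * d" and "y' = A0 + Suc k * d"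
    define Y Y' where "Y = 1 + ln y" and "Y' = 1 + ln y'"
    define Z Z' where "Z = 1 + ln Y" and "Z' = 1 + ln Y'"
    have "0 \<le> k * d" using d by simp
    then have y: "1 \<le> y" "y' = y + d" using A0(1) by (auto simp: y_def y'_def distrib_right)
    have Y: "1 \<le> Y" unfolding Y_def by (rule one_plus_ln_bounds(1)[OF y(1)])
    have Z: "1 \<le> Z" unfolding Z_def by (rule one_plus_ln_bounds(1)[OF Y])
    have diff: "ln b' - ln b \<le> (b' - b) / b" if "1 \<le> b" "b \<le> b'" for b b' :: real
    proof -
      have "ln b' - ln b = ln (b' / b)" using that by (simp add: ln_div)
      also have "\<dots> \<le> b' / b - 1" using that by (intro ln_le_minus_one) auto
      also have "\<dots> = (b' - b) / b" using that by (simp add: field_simps)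
      finally show ?thesis .
    qed
    have "Y' - Y \<le> d / y" using diff[of y y'] y d by (simp add: Y_def Y'_def)
    moreover have YY: "Y \<le> Y'" unfolding Y_def Y'_def using y d by simp
    ultimately have "(Y' - Y) / Y \<le> d / y / Y" using Y by (intro divide_right_mono) auto
    then have "Z' - Z \<le> d / y / Y" using diff[OF Y YY] by (simp add: Z_def Z'_def)
    moreover have ZZ: "Z \<le> Z'" unfolding Z_def Z'_def using Y YY by simp
    ultimately have "(Z' - Z) / Z \<le> d / y / Y / Z" using Z by (intro divide_right_mono) auto
    then have "ln Z' - ln Z \<le> d / y / Y / Z" using diff[OF Z ZZ] by linarith
    moreover have "amplitude k = 1 / (y * Y * Z)"
      unfolding amplitude_def log_weight_def shifted_log_scale using Z by (simp add: y_def Y_def Z_def)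
    ultimately show ?thesis by (simp add: T_def y_def y'_def Y_def Y'_def Z_def Z'_def)
  qed
  have tel: "T J - T 0 \<le> d * (\<Sum>k\<le>J. amplitude k)" for J
  proof -
    have "T J - T 0 = (\<Sum>k<J. T (Suc k) - T k)" by (simp add: sum_lessThan_telescope)
    also have "\<dots> \<le> (\<Sum>k<J. d * amplitude k)" by (intro sum_mono step)
    also have "\<dots> = d * (\<Sum>k<J. amplitude k)" by (simp add: sum_distrib_left)
    also have "\<dots> \<le> d * (\<Sum>k\<le>J. amplitude k)"
      using d amplitude_pos by (intro mult_left_mono sum_mono2) (auto intro: less_imp_le)
    finally show ?thesis .
  qed
  have "filterlim T at_top sequentially"
  proof -
    have "filterlim (\<lambda>k. real k * d) at_top sequentially"
      using d by (intro filterlim_at_top_mult_tendsto_pos[OF tendsto_const _ filterlim_real_sequentially])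
    then have 1: "filterlim (\<lambda>k. A0 + real k * d) at_top sequentially"
      by (rule filterlim_tendsto_add_at_top[OF tendsto_const])
    have 2: "filterlim (\<lambda>k. 1 + ln (A0 + real k * d)) at_top sequentially"
      by (rule filterlim_tendsto_add_at_top[OF tendsto_const filterlim_compose[OF ln_at_top 1]])
    have 3: "filterlim (\<lambda>k. 1 + ln (1 + ln (A0 + real k * d))) at_top sequentially"
      by (rule filterlim_tendsto_add_at_top[OF tendsto_const filterlim_compose[OF ln_at_top 2]])
    show ?thesis unfolding T_def by (rule filterlim_compose[OF ln_at_top 3])
  qed
  then have "\<forall>\<^sub>F k in sequentially. d * B + T 0 \<le> T k" by (simp add: filterlim_at_top)
  then obtain J where "d * B + T 0 \<le> T J" by (auto simp: eventually_sequentially)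
  then have "d * B \<le> d * (\<Sum>k\<le>J. amplitude k)" using tel[of J] by linarith
  then show ?thesis using d by auto
qed

end


lemma borel_measurable_weak_grad_norm:
  fixes \<Omega> :: "(real^'n::finite) set"
  assumes "open \<Omega>" and u: "weakly_differentiable j \<Omega> u"
  shows "weak_grad_norm \<Omega> j u \<in> borel_measurable (lebesgue_on \<Omega>)"
proof -
  have "weak_derivative \<Omega> js u \<in> borel_measurable (lebesgue_on \<Omega>)" if "length js = j" for js
  proof -
    have "\<exists>v. has_weak_derivative \<Omega> js u v" using u that by (auto simp: weakly_differentiable_def)
    then have "has_weak_derivative \<Omega> js u (weak_derivative \<Omega> js u)"
      unfolding weak_derivative_def by (rule someI_ex)
    then have "locally_integrable \<Omega> (weak_derivative \<Omega> js u)" by (simp add: has_weak_derivative_def)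
    from locally_integrable_measurable[OF \<open>open \<Omega>\<close> this] show ?thesis by (rule borel_measurable_if_D)
  qed
  then have "(\<lambda>x. \<Sum>js | length js = j. (weak_derivative \<Omega> js u x)\<^sup>2) \<in> borel_measurable (lebesgue_on \<Omega>)"
    by (intro borel_measurable_sum borel_measurable_power) auto
  then show ?thesis
    unfolding weak_grad_norm_def by (rule measurable_compose[OF _ borel_measurable_sqrt])
qed

text \<open>The set of disagreement is open and null, hence empty. This allows the representative
  given by an embedding to be evaluated at the peak.\<close>

lemma continuous_AE_eq_imp_eq:
  fixes f g :: "'a::euclidean_space \<Rightarrow> real"
  assumes "open S" "continuous_on S f" "continuous_on S g" "AE x in lebesgue_on S. f x = g x" "x \<in> S"
  shows "f x = g x"
proof (rule ccontr)
  assume ne: "f x \<noteq> g x"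
  let ?N = "S \<inter> (\<lambda>x. f x - g x) -` (- {0})"
  have op: "open ?N"
    using assms by (intro continuous_open_preimage continuous_on_diff) auto
  have "AE x in lebesgue. x \<in> S \<longrightarrow> f x = g x"
    using assms(1,4) by (subst (asm) AE_restrict_space_iff) auto
  then have "AE x in lebesgue. x \<notin> ?N" by eventually_elim auto
  moreover have "?N \<in> sets lborel" using borel_open[OF op] by (simp only: sets_lborel)
  then have "?N \<in> sets lebesgue" by (rule sets_completionI_sets)
  ultimately have "negligible ?N" by (simp only: negligible_iff_null_sets AE_iff_null_sets)
  moreover have "?N \<noteq> {}" using ne assms(5) by auto
  ultimately show False using open_not_negligible[OF op] by blast
qed

lemma bump_derivatives_bounded:
  obtains M where "0 \<le> M"
    "\<And>js x. length js \<le> m \<Longrightarrow> \<bar>iter_partial js (bump :: real^'n::finite \<Rightarrow> real) x\<bar> \<le> M * indicator (cube 0 1) x"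
proof -
  have zero: "iter_partial js (bump :: real^'n \<Rightarrow> real) x = 0" if "x \<notin> cube 0 1" for js x
  proof (rule iter_partial_eq_0[where S = "- cube 0 1"])
    fix y :: "real^'n" assume "y \<in> - cube 0 1"
    moreover have "box 0 One \<subseteq> cube (0 :: real^'n) 1" unfolding cube_def by (simp add: box_subset_cbox)
    ultimately show "bump y = 0" by (intro bump_eq_0) blast
  qed (use that in \<open>auto intro: open_Compl\<close>)
  have "\<exists>C\<ge>0. \<forall>x. \<bar>iter_partial js (bump :: real^'n \<Rightarrow> real) x\<bar> \<le> C" for js
    by (rule bounded_of_compact_support[OF smooth_continuous_on[OF smooth_iter_partial[OF smooth_bump]] compact_cube zero])
      auto
  then obtain C where C: "\<And>js. 0 \<le> C js" "\<And>js x. \<bar>iter_partial js (bump :: real^'n \<Rightarrow> real) x\<bar> \<le> C js"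
    by metis
  let ?L = "{js :: 'n list. length js \<le> m}"
  have fin: "finite ?L" using finite_lists_length_le[of "UNIV :: 'n set" m] by simp
  show thesis
  proof (rule that)
    show "0 \<le> (\<Sum>js\<in>?L. C js)" by (intro sum_nonneg C)
    fix js :: "'n list" and x assume js: "length js \<le> m"
    have "C js \<le> (\<Sum>js\<in>?L. C js)" using fin js C by (intro member_le_sum) auto
    then show "\<bar>iter_partial js (bump :: real^'n \<Rightarrow> real) x\<bar> \<le> (\<Sum>js\<in>?L. C js) * indicator (cube 0 1) x"
      using C(2)[of js x] zero[of x js] by (cases "x \<in> cube 0 1") auto
  qed
qed

text \<open>The bound holds only almost everywhere, since \<open>weak_derivative\<close> is an
  arbitrary choice; finitely many lists of directions give one common null set.\<close>

lemma weak_grad_norm_le: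
  fixes \<Omega> :: "(real^'n::finite) set" and b :: "real^'n \<Rightarrow> real"
  assumes "open \<Omega>" "smooth u"
    and le: "\<And>js x. length js = j \<Longrightarrow> \<bar>iter_partial js u x\<bar> \<le> b x"
  shows "AE x in lebesgue. x \<in> \<Omega> \<longrightarrow> weak_grad_norm \<Omega> j u x \<le> real CARD('n) ^ j * b x"
proof -
  let ?L = "{js :: 'n list. length js = j}"
  have fin: "finite ?L" "card ?L = CARD('n) ^ j"
    using finite_lists_length_eq[of "UNIV :: 'n set" j] card_lists_length_eq[of "UNIV :: 'n set" j] by simp_all
  have "AE x in lebesgue. x \<in> \<Omega> \<longrightarrow> weak_derivative \<Omega> js u x = iter_partial (rev js) u x" for js
  proof (rule weak_derivative_unique[OF assms(1)])
    show d: "has_weak_derivative \<Omega> js u (iter_partial (rev js) u)" by (rule smooth_has_weak_derivative[OF assms(2)])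
    show "has_weak_derivative \<Omega> js u (weak_derivative \<Omega> js u)"
      unfolding weak_derivative_def by (rule someI[of "has_weak_derivative \<Omega> js u", OF d])
  qed
  then have "AE x in lebesgue. \<forall>js\<in>?L. x \<in> \<Omega> \<longrightarrow> weak_derivative \<Omega> js u x = iter_partial (rev js) u x"
    by (intro AE_finite_allI fin)
  then show ?thesis
  proof eventually_elim
    case (elim x)
    show ?case
    proof
      assume x: "x \<in> \<Omega>"
      have "weak_grad_norm \<Omega> j u x = L2_set (\<lambda>js. weak_derivative \<Omega> js u x) ?L"
        by (simp add: weak_grad_norm_def L2_set_def)
      also have "\<dots> \<le> (\<Sum>js\<in>?L. \<bar>weak_derivative \<Omega> js u x\<bar>)" by (rule L2_set_le_sum_abs)
      also have "\<dots> \<le> (\<Sum>js\<in>?L. b x)"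
        using elim x by (intro sum_mono) (auto intro!: le)
      also have "\<dots> = real CARD('n) ^ j * b x" by (simp only: sum_constant fin of_nat_power)
      finally show "weak_grad_norm \<Omega> j u x \<le> real CARD('n) ^ j * b x" .
    qed
  qed
qed

section \<open>Peak functions and the failure criterion\<close>

context peak
begin

abbreviation "V \<equiv> measure lebesgue \<Omega>"

text \<open>
  The sum grows geometrically as the layers \<open>B l\<close> shrink, so it is comparable to its last nonzero
  summand, which at the scale \<open>scale k\<close> is \<open>profile (scale k)\<close>.
\<close>

lemma rearr_layers:
  assumes B: "\<And>l. B l \<in> sets lebesgue" "\<And>l. emeasure lebesgue (B l) = ennreal (v * scale l)"
      "\<And>l k. l \<le> k \<Longrightarrow> B k \<subseteq> B l"
    and v: "0 < v" "v \<le> V" and K: "0 \<le> K"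
    and f: "AE x in lebesgue. x \<in> \<Omega> \<longrightarrow> f x \<le> ennreal (K * (\<Sum>l\<le>J. amplitude l * 2 ^ (l * m) * indicator (B l) x))"
    and s: "0 < s" "s < 1"
  shows "rearr \<Omega> f (V * s) \<le> ennreal (4 * K * profile s)"
proof -
  let ?\<Psi> = "\<lambda>x. \<Sum>l\<le>J. amplitude l * 2 ^ (l * m) * indicator (B l) x"
  \<comment> \<open>The layers of measure above V s. The first layer beyond the last of these, if
    there is one, has measure at most V s and is discarded; outside it only the layers up to k
    count.\<close>
  let ?E = "{l. l \<le> J \<and> V * s < v * scale l}"
  have hs: "0 \<le> profile s" by (rule profile_nonneg) (use s in auto)
  have "\<exists>S\<in>sets lebesgue. emeasure lebesgue S \<le> ennreal (V * s) \<and> (\<forall>x. x \<notin> S \<longrightarrow> ?\<Psi> x \<le> 4 * profile s)"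
  proof (cases "?E = {}")
    case True
    then have "v * scale 0 \<le> V * s" by (auto simp: not_less)
    moreover have "?\<Psi> x \<le> 4 * profile s" if "x \<notin> B 0" for x
    proof -
      have "x \<notin> B l" for l using that B(3)[of 0 l] by blast
      then show ?thesis using hs by simp
    qed
    ultimately show ?thesis using B(1,2)[of 0] by (intro bexI[of _ "B 0"]) (auto intro: ennreal_leI)
  next
    case False
    define k where "k = Max ?E"
    have "k \<in> ?E" unfolding k_def by (rule Max_in) (use False in auto)
    then have k: "k \<le> J" "V * s < v * scale k" by auto
    have "v * scale k \<le> V * scale k" using v scale(1)[of k] by (intro mult_right_mono) auto
    then have "V * s < V * scale k" using k by linarith
    then have "s \<le> scale k" using v by (simp add: mult_less_cancel_left)
    then have hk: "profile (scale k) \<le> profile s" using s scale by (intro profile_antimono) auto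
    have le: "?\<Psi> x \<le> 4 * profile s" if out: "\<And>l. l \<le> J \<Longrightarrow> k < l \<Longrightarrow> x \<notin> B l" for x
    proof -
      have "?\<Psi> x = (\<Sum>l\<le>k. amplitude l * 2 ^ (l * m) * indicator (B l) x)"
        using k(1) out by (intro sum.mono_neutral_right) auto
      also have "\<dots> \<le> (\<Sum>l\<le>k. amplitude l * 2 ^ (l * m))"
      proof (rule sum_mono)
        fix l
        have "0 \<le> amplitude l * 2 ^ (l * m)" using amplitude_pos[of l] by simp
        then show "amplitude l * 2 ^ (l * m) * indicator (B l) x \<le> amplitude l * 2 ^ (l * m)" by (simp add: indicator_def)
      qed
      also have "\<dots> \<le> 4 * profile (scale k)" unfolding profile_scale by (rule sum_profile_le)
      finally show ?thesis using hk by linarith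
    qed
    show ?thesis
    proof (cases "k = J")
      case True
      then show ?thesis using le by (intro bexI[of _ "{}"]) auto
    next
      case False
      have "Suc k \<notin> ?E"
      proof
        assume "Suc k \<in> ?E"
        then have "Suc k \<le> Max ?E" by (intro Max_ge) auto
        then show False by (simp add: k_def)
      qed
      then have "v * scale (Suc k) \<le> V * s" using False k(1) by auto
      moreover have "?\<Psi> x \<le> 4 * profile s" if x: "x \<notin> B (Suc k)" for x
      proof (rule le)
        fix l assume "k < l"
        then have "B l \<subseteq> B (Suc k)" by (intro B(3)) simp
        then show "x \<notin> B l" using x by blast
      qed
      ultimately show ?thesis using B(1,2)[of "Suc k"] by (intro bexI[of _ "B (Suc k)"]) (auto intro: ennreal_leI)
    qed
  qed
  then obtain S where S: "S \<in> sets lebesgue" "emeasure lebesgue S \<le> ennreal (V * s)" "\<And>x. x \<notin> S \<Longrightarrow> ?\<Psi> x \<le> 4 * profile s"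
    by blast
  have "emeasure lebesgue {x \<in> \<Omega>. f x > ennreal (4 * K * profile s)} \<le> emeasure lebesgue S"
  proof (rule emeasure_mono_AE[OF _ S(1)])
    show "AE x in lebesgue. x \<in> {x \<in> \<Omega>. f x > ennreal (4 * K * profile s)} \<longrightarrow> x \<in> S"
      using f
    proof eventually_elim
      case (elim x)
      show ?case
      proof (rule impI, rule ccontr)
        assume x: "x \<in> {x \<in> \<Omega>. f x > ennreal (4 * K * profile s)}" and "x \<notin> S"
        then have "K * ?\<Psi> x \<le> K * (4 * profile s)" by (intro mult_left_mono S(3) K)
        then have "ennreal (K * ?\<Psi> x) \<le> ennreal (4 * K * profile s)" by (intro ennreal_leI) (simp add: mult_ac)
        moreover have "f x \<le> ennreal (K * ?\<Psi> x)" using elim x by blast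
        ultimately have "f x \<le> ennreal (4 * K * profile s)" by (rule order_trans[rotated])
        then show False using x by auto
      qed
    qed
  qed
  then show ?thesis
    unfolding rearr_def using S(2) by (intro Inf_lower) (auto intro: order_trans)
qed

lemma dom_lmeasurable: "\<Omega> \<in> lmeasurable"
  by (rule lmeasurable_open[OF dom(2,1)])

lemma cube_in_dom:
  obtains c r where "0 < r" "r \<le> 1" "cube c r \<subseteq> \<Omega>"
proof -
  obtain x where x: "x \<in> \<Omega>" using dom by blast
  then obtain e where e: "0 < e" "cball x e \<subseteq> \<Omega>" using dom(1) open_contains_cball by blast
  define r where "r = min 1 (e / CARD('n))"
  have r: "0 < r" "r \<le> 1" using e by (auto simp: r_def)
  have "CARD('n) * r \<le> CARD('n) * (e / CARD('n))" unfolding r_def by (intro mult_left_mono) auto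
  then have "CARD('n) * r \<le> e" by simp
  then have "cball x (CARD('n) * r) \<subseteq> cball x e" by (rule subset_cball)
  moreover have "cube x r \<subseteq> cball x (CARD('n) * r)" using r by (intro cube_subset_cball) simp
  ultimately have "cube x r \<subseteq> \<Omega>" using e by blast
  with r show thesis by (rule that)
qed

text \<open>A single constant serves for all heights \<open>B\<close>, since the rearrangement bound
  of \<open>rearr_layers\<close> does not depend on the number of summands.\<close>

lemma peak_functions:
  obtains C x0 where "0 \<le> C" "x0 \<in> \<Omega>"
    "\<And>B. \<exists>u. smooth u \<and> B \<le> u x0 \<and> (\<forall>j\<le>m. \<forall>s. 0 < s \<longrightarrow> s < 1 \<longrightarrow>
      rearr \<Omega> (\<lambda>x. ennreal \<bar>weak_grad_norm \<Omega> j u x\<bar>) (V * s) \<le> ennreal (C * profile s))"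
proof -
  obtain c R0 where R0: "0 < R0" "R0 \<le> 1" "cube c R0 \<subseteq> \<Omega>" by (rule cube_in_dom)
  obtain M where M: "0 \<le> M"
    "\<And>js x. length js \<le> m \<Longrightarrow> \<bar>iter_partial js (bump :: real^'n \<Rightarrow> real) x\<bar> \<le> M * indicator (cube 0 1) x"
    by (rule bump_derivatives_bounded[where m = m]) blast
  define x0 where "x0 = c + (R0 / 2) *\<^sub>R One"
  define r where "r k = R0 / 2 ^ k" for k :: nat
  define B where "B k = cube (x0 - (r k / 2) *\<^sub>R One) (r k)" for k
  define arg where "arg k x = - ((1 / r k) *\<^sub>R (x0 - (r k / 2) *\<^sub>R One)) + (1 / r k) *\<^sub>R x" for k x
  define U where "U J x = (\<Sum>k\<in>{..J}. amplitude k * bump (arg k x))" for J x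
  \<comment> \<open>The power of n counts derivatives, \<open>M\<close> bounds those of the bump,
    and the power of 1/R0 comes from rescaling it to the first cube.\<close>
  define K where "K = real CARD('n) ^ m * (M * (1 / R0) ^ m)"
  have r: "0 < r k" for k using R0 by (simp add: r_def)
  have K0: "0 \<le> K" using M R0 by (simp add: K_def)
  have arg: "arg k x \<in> cube 0 1 \<longleftrightarrow> x \<in> B k" for k x
  proof -
    have "arg k x = (1 / r k) *\<^sub>R (x - (x0 - (r k / 2) *\<^sub>R One))" by (simp add: arg_def algebra_simps)
    then show ?thesis unfolding B_def using mem_cube_affine[OF r] by simp
  qed
  have Bm: "emeasure lebesgue (B k) = ennreal (R0 ^ CARD('n) * scale k)" for k
    unfolding B_def using r[of k] by (subst emeasure_cube) (auto simp: r_def scale_def power_divide)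
  have Bsub: "B k \<subseteq> B l" if "l \<le> k" for l k
  proof -
    have "(2::real) ^ l \<le> 2 ^ k" using that by (intro power_increasing) auto
    then have le: "r k \<le> r l" unfolding r_def using R0 by (intro divide_left_mono) auto
    show ?thesis
    proof
      fix y assume "y \<in> B k"
      then have y: "x0 $ i - r k / 2 \<le> y $ i" "y $ i \<le> x0 $ i + r k / 2" for i
        by (auto simp: B_def mem_cube algebra_simps)
      have "x0 $ i - r l / 2 \<le> y $ i" "y $ i \<le> x0 $ i - r l / 2 + r l" for i using y[of i] le by linarith+
      then show "y \<in> B l" by (simp add: B_def mem_cube)
    qed
  qed
  have RV: "R0 ^ CARD('n) \<le> V"
  proof -
    have "measure lebesgue (cube c R0) \<le> V"
      by (rule measure_mono_fmeasurable[OF R0(3) cube_sets dom_lmeasurable])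
    then show ?thesis unfolding measure_cube[OF less_imp_le[OF R0(1)]] .
  qed
  have smooth_U: "smooth (U J)" for J
    unfolding U_def arg_def by (intro smooth_sum smooth_cmult smooth_affine smooth_bump)
  have deriv: "\<bar>iter_partial js (U J) x\<bar> \<le> (M * (1 / R0) ^ m) * (\<Sum>k\<le>J. amplitude k * 2 ^ (k * m) * indicator (B k) x)"
    if js: "length js \<le> m" for js J x
  proof -
    have "iter_partial js (U J) x = (\<Sum>k\<in>{..J}. amplitude k * (1 / r k) ^ length js * iter_partial js bump (arg k x))"
      unfolding U_def arg_def by (subst iter_partial_affine_sum[OF smooth_bump]) (rule HOL.refl)
    also have "\<bar>\<dots>\<bar> \<le> (\<Sum>k\<in>{..J}. \<bar>amplitude k * (1 / r k) ^ length js * iter_partial js bump (arg k x)\<bar>)"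
      by (rule sum_abs)
    also have "\<dots> \<le> (\<Sum>k\<in>{..J}. (M * (1 / R0) ^ m) * (amplitude k * 2 ^ (k * m) * indicator (B k) x))"
    proof (rule sum_mono)
      fix k
      \<comment> \<open>Sides are at most 1, so lower order derivatives obey the bound for order
        m.\<close>
      have "1 \<le> 1 / r k" using R0 by (simp add: r_def divide_le_eq) (metis dual_order.trans one_le_numeral one_le_power)
      then have "(1 / r k) ^ length js \<le> (1 / r k) ^ m" using js by (intro power_increasing) auto
      also have "\<dots> = 2 ^ (k * m) * (1 / R0) ^ m" by (simp add: r_def power_divide power_mult)
      finally have p: "(1 / r k) ^ length js \<le> 2 ^ (k * m) * (1 / R0) ^ m" .
      have i: "\<bar>iter_partial js bump (arg k x)\<bar> \<le> M * indicator (B k) x"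
        using M(2)[OF js, of "arg k x"] arg[of k x] by (simp add: indicator_def)
      have "\<bar>amplitude k * (1 / r k) ^ length js * iter_partial js bump (arg k x)\<bar>
          = amplitude k * ((1 / r k) ^ length js * \<bar>iter_partial js bump (arg k x)\<bar>)"
        using amplitude_pos[of k] r[of k] by (simp add: abs_mult)
      also have "\<dots> \<le> amplitude k * ((2 ^ (k * m) * (1 / R0) ^ m) * (M * indicator (B k) x))"
        using amplitude_pos[of k] R0 r[of k] M(1) by (intro mult_left_mono mult_mono[OF p i]) auto
      finally show "\<bar>amplitude k * (1 / r k) ^ length js * iter_partial js bump (arg k x)\<bar>
          \<le> (M * (1 / R0) ^ m) * (amplitude k * 2 ^ (k * m) * indicator (B k) x)" by (simp only: mult_ac)
    qed
    finally show ?thesis by (simp only: sum_distrib_left)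
  qed
  have x0: "x0 \<in> \<Omega>"
  proof -
    have "x0 \<in> cube c R0" using R0 by (simp add: x0_def mem_cube)
    then show ?thesis using R0 by blast
  qed
  \<comment> \<open>All the copies are centred at x0, so each contributes the same positive bump
    value and U J x0 is a multiple of the sum of the amplitudes.\<close>
  have arg_x0: "arg k x0 = (1 / 2) *\<^sub>R One" for k using r[of k] by (simp add: arg_def algebra_simps)
  define d where "d = bump ((1 / 2) *\<^sub>R One :: real^'n)"
  have d: "0 < d" unfolding d_def bump_pos by (simp add: mem_box_cart)
  show thesis
  proof (rule that[of "4 * K" x0])
    show "0 \<le> 4 * K" using K0 by simp
    show "x0 \<in> \<Omega>" by (rule x0)
    fix b :: real
    obtain J where J: "b / d \<le> (\<Sum>k\<le>J. amplitude k)" using sum_amplitude_unbounded by blast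
    have "b \<le> d * (\<Sum>k\<le>J. amplitude k)" using J d by (simp add: divide_le_eq mult.commute)
    also have "\<dots> = U J x0" unfolding U_def arg_x0 d_def[symmetric] by (simp add: sum_distrib_left mult.commute)
    finally have b: "b \<le> U J x0" .
    have "rearr \<Omega> (\<lambda>x. ennreal \<bar>weak_grad_norm \<Omega> j (U J) x\<bar>) (V * s) \<le> ennreal (4 * K * profile s)"
      if j: "j \<le> m" and s: "0 < s" "s < 1" for j s
    proof (rule rearr_layers[where B = B and v = "R0 ^ CARD('n)" and J = J])
      let ?\<Psi> = "\<lambda>x. \<Sum>k\<le>J. amplitude k * 2 ^ (k * m) * indicator (B k) x"
      have \<Psi>: "0 \<le> ?\<Psi> x" for x
        by (intro sum_nonneg mult_nonneg_nonneg) (auto intro: less_imp_le[OF amplitude_pos])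
      have nj: "real CARD('n) ^ j \<le> real CARD('n) ^ m"
        using j by (intro power_increasing) (auto simp: Suc_le_eq)
      have "AE x in lebesgue. x \<in> \<Omega> \<longrightarrow> weak_grad_norm \<Omega> j (U J) x \<le> real CARD('n) ^ j * ((M * (1 / R0) ^ m) * ?\<Psi> x)"
        using j by (intro weak_grad_norm_le dom smooth_U deriv) simp
      then show "AE x in lebesgue. x \<in> \<Omega> \<longrightarrow> ennreal \<bar>weak_grad_norm \<Omega> j (U J) x\<bar> \<le> ennreal (K * ?\<Psi> x)"
      proof eventually_elim
        case (elim x)
        show ?case
        proof (intro impI ennreal_leI)
          assume "x \<in> \<Omega>"
          have "\<bar>weak_grad_norm \<Omega> j (U J) x\<bar> = weak_grad_norm \<Omega> j (U J) x"
            unfolding weak_grad_norm_def by (intro abs_of_nonneg real_sqrt_ge_zero sum_nonneg) simp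
          also have "\<dots> \<le> real CARD('n) ^ j * ((M * (1 / R0) ^ m) * ?\<Psi> x)" using elim \<open>x \<in> \<Omega>\<close> by blast
          also have "\<dots> \<le> real CARD('n) ^ m * ((M * (1 / R0) ^ m) * ?\<Psi> x)"
            using nj M(1) R0 \<Psi>[of x] by (intro mult_right_mono mult_nonneg_nonneg) auto
          also have "\<dots> = K * ?\<Psi> x" by (simp only: K_def mult.assoc)
          finally show "\<bar>weak_grad_norm \<Omega> j (U J) x\<bar> \<le> K * ?\<Psi> x" .
        qed
      qed
    qed (use Bm Bsub RV R0 K0 s in \<open>auto simp: B_def\<close>)
    then show "\<exists>u. smooth u \<and> b \<le> u x0 \<and> (\<forall>j\<le>m. \<forall>s. 0 < s \<longrightarrow> s < 1 \<longrightarrow>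
      rearr \<Omega> (\<lambda>x. ennreal \<bar>weak_grad_norm \<Omega> j u x\<bar>) (V * s) \<le> ennreal (4 * K * profile s))"
      by (intro exI[of _ "U J"] conjI smooth_U b) blast
  qed
qed

text \<open>If \<open>X\<close> is bounded on all functions below a multiple of the profile, the
  Sobolev norms of the peak functions stay below (m+1) N while their values at x0 do not, which no
  embedding constant survives.\<close>

lemma not_embeds:
  assumes X: "\<And>C. 0 \<le> C \<Longrightarrow> \<exists>N<\<infinity>. \<forall>\<phi>. (\<forall>s. 0 < s \<longrightarrow> s < 1 \<longrightarrow> \<phi> s \<le> ennreal (C * profile s)) \<longrightarrow> X \<phi> \<le> N"
  shows "\<not> sobolev_embeds_Cb m X \<Omega>"
proof
  assume "sobolev_embeds_Cb m X \<Omega>"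
  then obtain C1 where C1: "\<And>u. u \<in> sobolev_space m X \<Omega> \<Longrightarrow> \<exists>g\<in>Cb_space \<Omega>. (AE x in lebesgue_on \<Omega>. g x = u x) \<and>
      ennreal (Cb_norm \<Omega> g) \<le> ennreal C1 * sobolev_norm m X \<Omega> u"
    unfolding sobolev_embeds_Cb_def by blast
  obtain C x0 where C: "0 \<le> C" "x0 \<in> \<Omega>"
    "\<And>B. \<exists>u. smooth u \<and> B \<le> u x0 \<and> (\<forall>j\<le>m. \<forall>s. 0 < s \<longrightarrow> s < 1 \<longrightarrow>
      rearr \<Omega> (\<lambda>x. ennreal \<bar>weak_grad_norm \<Omega> j u x\<bar>) (V * s) \<le> ennreal (C * profile s))"
    by (rule peak_functions) blast
  obtain N where N: "N < \<infinity>" "\<And>\<phi>. (\<forall>s. 0 < s \<longrightarrow> s < 1 \<longrightarrow> \<phi> s \<le> ennreal (C * profile s)) \<Longrightarrow> X \<phi> \<le> N"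
    using X[OF C(1)] by blast
  define T where "T = ennreal C1 * (of_nat (Suc m) * N)"
  have T: "T < \<infinity>" unfolding T_def using N(1) by (simp add: ennreal_mult_less_top of_nat_less_top)
  obtain u where u: "smooth u" "enn2real T + 1 \<le> u x0"
    "\<And>j s. j \<le> m \<Longrightarrow> 0 < s \<Longrightarrow> s < 1 \<Longrightarrow>
      rearr \<Omega> (\<lambda>x. ennreal \<bar>weak_grad_norm \<Omega> j u x\<bar>) (V * s) \<le> ennreal (C * profile s)"
    using C(3)[of "enn2real T + 1"] by blast
  have wd: "weakly_differentiable j \<Omega> u" for j
    unfolding weakly_differentiable_def using smooth_has_weak_derivative[OF u(1)] by blast
  have norm: "fn_norm X \<Omega> (weak_grad_norm \<Omega> j u) \<le> N" if "j \<le> m" for j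
    unfolding fn_norm_def using u(3)[OF that] by (intro N(2)) blast
  have "u \<in> sobolev_space m X \<Omega>"
    unfolding sobolev_space_def fn_space_def
    using wd borel_measurable_weak_grad_norm[OF dom(1) wd] le_less_trans[OF norm N(1)] by blast
  from C1[OF this] obtain g where g: "g \<in> Cb_space \<Omega>" "AE x in lebesgue_on \<Omega>. g x = u x"
    "ennreal (Cb_norm \<Omega> g) \<le> ennreal C1 * sobolev_norm m X \<Omega> u" by blast
  have "g x0 = u x0"
    using g(1) by (intro continuous_AE_eq_imp_eq[OF dom(1) _ smooth_continuous_on[OF u(1)] g(2) C(2)])
      (simp add: Cb_space_def)
  moreover have "\<bar>g x0\<bar> \<le> Cb_norm \<Omega> g"
    unfolding Cb_norm_def
  proof (rule cSUP_upper[OF C(2)])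
    from g(1) obtain b where "\<And>x. x \<in> \<Omega> \<Longrightarrow> \<bar>g x\<bar> \<le> b" by (auto simp: Cb_space_def bounded_iff)
    then show "bdd_above ((\<lambda>x. \<bar>g x\<bar>) ` \<Omega>)" by (intro bdd_aboveI2) blast
  qed
  ultimately have "ennreal (enn2real T + 1) \<le> ennreal (Cb_norm \<Omega> g)" using u(2) by (intro ennreal_leI) linarith
  also have "\<dots> \<le> ennreal C1 * sobolev_norm m X \<Omega> u" by (rule g(3))
  also have "\<dots> \<le> T"
    unfolding T_def
  proof (rule mult_left_mono)
    have "sobolev_norm m X \<Omega> u \<le> (\<Sum>j\<le>m. N)" unfolding sobolev_norm_def using norm by (intro sum_mono) auto
    then show "sobolev_norm m X \<Omega> u \<le> of_nat (Suc m) * N" by simp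
  qed simp
  also have "T = ennreal (enn2real T)" using T by simp
  finally show False by (simp add: ennreal_le_iff)
qed

end

text \<open>Writes s^(-1/q) as (1/(s L))^(1/q) L^(1/q), with L the logarithmic weight of exponent p'
  > 1. The first factor has an integrable q-th power, and the rest is bounded by hypothesis.\<close>

lemma Lq_norm01_weight_finite:
  fixes g :: "real \<Rightarrow> real"
  assumes q: "1 \<le> q" and g: "g \<in> borel_measurable borel" "\<And>s. 0 < s \<Longrightarrow> s < 1 \<Longrightarrow> 0 \<le> g s"
    and A: "1 \<le> A" and p': "1 < p'" and C: "0 \<le> C" "0 \<le> C'"
    and le: "\<And>s. 0 < s \<Longrightarrow> s < 1 \<Longrightarrow>
      s powr recip p * ell s powr \<alpha> * ellell s powr \<beta> * log_weight A p' s powr recip q * g s \<le> C'"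
  shows "Lq_norm01 q (\<lambda>s. ennreal (LZ_weight p q \<alpha> \<beta> s) * ennreal (C * g s)) < \<infinity>"
proof (rule Lq_norm01_finite[OF q _ A p'])
  show "(\<lambda>s. ennreal (LZ_weight p q \<alpha> \<beta> s) * ennreal (C * g s)) \<in> borel_measurable (lebesgue_on {0<..<1})"
  proof (rule measurable_restrict_space1)
    have "(\<lambda>s. ennreal (LZ_weight p q \<alpha> \<beta> s) * ennreal (C * g s)) \<in> borel_measurable borel"
      using g(1) by measurable
    then show "(\<lambda>s. ennreal (LZ_weight p q \<alpha> \<beta> s) * ennreal (C * g s)) \<in> borel_measurable lebesgue"
      by (simp add: measurable_completion)
  qed
  show "0 \<le> C * C'" using C by simp
  fix s :: real assume s: "0 < s" "s < 1"
  let ?\<rho> = "recip q"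
  have D: "0 < log_weight A p' s" using A s by (intro log_weight_pos shifted_log_ge_1) auto
  have "LZ_weight p q \<alpha> \<beta> s * (C * g s)
      = C * (s powr recip p * ell s powr \<alpha> * ellell s powr \<beta> * log_weight A p' s powr ?\<rho> * g s) * (1 / (s * log_weight A p' s)) powr ?\<rho>"
    using s D by (simp add: LZ_weight_def powr_diff powr_divide powr_mult)
  also have "\<dots> \<le> C * C' * (1 / (s * log_weight A p' s)) powr ?\<rho>"
    using le[OF s] C by (intro mult_right_mono mult_left_mono) auto
  finally show "ennreal (LZ_weight p q \<alpha> \<beta> s) * ennreal (C * g s) \<le> ennreal (C * C' * (1 / (s * log_weight A p' s)) powr ?\<rho>)"
    using LZ_weight_pos[OF s(1), of p q \<alpha> \<beta>] by (subst ennreal_mult'[symmetric]) (auto intro: ennreal_leI)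
qed

context peak
begin

lemma log_weight_ge_1:
  assumes "0 < s" "s < 1"
  shows "1 \<le> log_weight A0 1 s"
proof -
  obtain y Y Z where "1 \<le> y" "1 \<le> Y" "1 \<le> Z" "\<And>p. log_weight A0 p s = y * Y * Z powr p"
    by (rule log_weight_factors[OF A0(1) assms(1) less_imp_le[OF assms(2)]]) blast
  moreover from this have "1 * 1 * 1 \<le> y * Y * Z" by (intro mult_mono) auto
  ultimately show ?thesis by simp
qed

text \<open>If 1/p exceeds m/n a positive power of s remains and \<open>slow_bound\<close> applies;
  at equality the powers of s cancel and \<open>critical_bound\<close> compares the
  logarithms.\<close>

lemma LZ_not_embeds:
  assumes q: "1 \<le> q"
    and cond: "m / CARD('n) < recip p \<or> recip p = m / CARD('n) \<and>
      (\<alpha> < 1 - recip q \<or> \<alpha> = 1 - recip q \<and> \<beta> \<le> 1 - recip q) \<and> \<not> (recip q = 1 \<and> \<alpha> = 0 \<and> \<beta> = 0)"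
  shows "\<not> sobolev_embeds_Cb m (LZ_norm p q \<alpha> \<beta>) \<Omega>"
proof (rule not_embeds)
  let ?\<mu> = "m / CARD('n)"
  note \<rho> = recip_bounds[OF q]
  have "\<exists>C' p'. 0 < C' \<and> 1 < p' \<and> (\<forall>s. 0 < s \<longrightarrow> s < 1 \<longrightarrow>
      s powr (recip p - ?\<mu>) * ell s powr \<alpha> * ellell s powr \<beta> * log_weight A0 p' s powr recip q \<le> C' * log_weight A0 1 s)"
  proof (cases "?\<mu> < recip p")
    case True
    then have "0 < recip p - ?\<mu>" by simp
    then obtain C' where C': "0 < C'" "\<And>s. 0 < s \<Longrightarrow> s < 1 \<Longrightarrow>
        s powr (recip p - ?\<mu>) * ell s powr \<alpha> * ellell s powr \<beta> * log_weight A0 2 s powr recip q \<le> C'"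
      by (rule slow_bound[OF _ A0(1) \<rho>(1), where p = 2 and \<alpha> = \<alpha> and \<beta> = \<beta>]) auto
    have "s powr (recip p - ?\<mu>) * ell s powr \<alpha> * ellell s powr \<beta> * log_weight A0 2 s powr recip q \<le> C' * log_weight A0 1 s"
      if s: "0 < s" "s < 1" for s
    proof -
      have "C' * 1 \<le> C' * log_weight A0 1 s" using log_weight_ge_1[OF s] C'(1) by (intro mult_left_mono) simp_all
      then show ?thesis using C'(2)[OF s] by linarith
    qed
    moreover have "(1::real) < 2" by simp
    ultimately show ?thesis using C'(1) by blast
  next
    case False
    then have eq: "recip p - ?\<mu> = 0" and bad: "\<alpha> < 1 - recip q \<or> \<alpha> = 1 - recip q \<and> \<beta> \<le> 1 - recip q"
      "\<not> (recip q = 1 \<and> \<alpha> = 0 \<and> \<beta> = 0)" using cond by auto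
    obtain C' p' where "0 < C'" "1 < p'" "\<And>s. 0 < s \<Longrightarrow> s < 1 \<Longrightarrow>
        ell s powr \<alpha> * ellell s powr \<beta> * log_weight A0 p' s powr recip q \<le> C' * log_weight A0 1 s"
      by (rule critical_bound[OF A0(1) \<rho> bad]) blast
    then show ?thesis unfolding eq by (intro exI[of _ C'] exI[of _ p']) auto
  qed
  then obtain C' p' where C': "0 < C'" "1 < p'" "\<And>s. 0 < s \<Longrightarrow> s < 1 \<Longrightarrow>
      s powr (recip p - ?\<mu>) * ell s powr \<alpha> * ellell s powr \<beta> * log_weight A0 p' s powr recip q \<le> C' * log_weight A0 1 s"
    by blast
  fix C :: real assume C: "0 \<le> C"
  let ?N = "Lq_norm01 q (\<lambda>s. ennreal (LZ_weight p q \<alpha> \<beta> s) * ennreal (C * profile s))"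
  have "?N < \<infinity>"
  proof (rule Lq_norm01_weight_finite[OF q _ _ A0(1) C'(2) C less_imp_le[OF C'(1)]])
    show "profile \<in> borel_measurable borel" unfolding profile_def log_weight_def shifted_log_def by measurable
    fix s :: real assume s: "0 < s" "s < 1"
    then show "0 \<le> profile s" by (intro profile_nonneg) auto
    let ?X = "ell s powr \<alpha> * ellell s powr \<beta> * log_weight A0 p' s powr recip q"
    have D: "0 < log_weight A0 1 s" using s by (intro log_weight_gt_0) auto
    have "s powr recip p * ell s powr \<alpha> * ellell s powr \<beta> * log_weight A0 p' s powr recip q * profile s
        = s powr (recip p - ?\<mu>) * ?X / log_weight A0 1 s"
      using s by (simp add: profile_def powr_diff powr_minus_divide)
    also have "\<dots> \<le> C'" using C'(3)[OF s] D by (simp add: divide_le_eq mult.assoc)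
    finally show "s powr recip p * ell s powr \<alpha> * ellell s powr \<beta> * log_weight A0 p' s powr recip q * profile s \<le> C'" .
  qed
  moreover have "LZ_norm p q \<alpha> \<beta> \<phi> \<le> ?N" if \<phi>: "\<forall>s. 0 < s \<longrightarrow> s < 1 \<longrightarrow> \<phi> s \<le> ennreal (C * profile s)" for \<phi>
    unfolding LZ_norm_def
  proof (rule Lq_norm01_mono[OF q])
    show "(\<lambda>s. ennreal (LZ_weight p q \<alpha> \<beta> s) * rearr {0<..<1} \<phi> s) \<in> borel_measurable (lebesgue_on {0<..<1})"
    proof (rule measurable_restrict_space1)
      have "(\<lambda>s. ennreal (LZ_weight p q \<alpha> \<beta> s) * rearr {0<..<1} \<phi> s) \<in> borel_measurable borel" by measurable
      then show "(\<lambda>s. ennreal (LZ_weight p q \<alpha> \<beta> s) * rearr {0<..<1} \<phi> s) \<in> borel_measurable lebesgue"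
        by (simp add: measurable_completion)
    qed
    fix s :: real assume s: "0 < s" "s < 1"
    have "rearr {0<..<1} \<phi> s \<le> ennreal (C * profile s)"
    proof (rule rearr_unit_le)
      fix x assume x: "s \<le> x" "0 < x" "x < 1"
      have "ennreal (C * profile x) \<le> ennreal (C * profile s)" using s x C by (intro ennreal_leI mult_left_mono profile_antimono) auto
      then show "\<phi> x \<le> ennreal (C * profile s)" using \<phi> x by (blast intro: order_trans)
    qed (use s in simp)
    then show "ennreal (LZ_weight p q \<alpha> \<beta> s) * rearr {0<..<1} \<phi> s \<le> ennreal (LZ_weight p q \<alpha> \<beta> s) * ennreal (C * profile s)"
      by (rule mult_left_mono) simp
  qed
  ultimately show "\<exists>N<\<infinity>. \<forall>\<phi>. (\<forall>s. 0 < s \<longrightarrow> s < 1 \<longrightarrow> \<phi> s \<le> ennreal (C * profile s)) \<longrightarrow> LZ_norm p q \<alpha> \<beta> \<phi> \<le> N"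
    by blast
qed

lemma LZ_max_not_embeds:
  assumes q: "1 \<le> q"
  shows "\<not> sobolev_embeds_Cb m (LZ_max_norm 1 q \<alpha> \<beta>) \<Omega>"
proof (rule not_embeds)
  let ?\<mu> = "m / CARD('n)"
  have \<mu>: "0 \<le> ?\<mu>" "?\<mu> < 1" using m by simp_all
  have \<theta>: "0 < 1 - ?\<mu>" using \<mu> by simp
  obtain C' where C': "0 < C'" "\<And>s. 0 < s \<Longrightarrow> s < 1 \<Longrightarrow>
      s powr (1 - ?\<mu>) * ell s powr \<alpha> * ellell s powr \<beta> * log_weight 1 2 s powr recip q \<le> C'"
    by (rule slow_bound[OF \<theta> order_refl[of 1] recip_bounds(1)[OF q], where p = 2 and \<alpha> = \<alpha> and \<beta> = \<beta>]) simp_all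
  fix C :: real assume C: "0 \<le> C"
  define E where "E = C / (1 - ?\<mu>)"
  have E: "0 \<le> E" unfolding E_def using C \<theta> by simp
  let ?N = "Lq_norm01 q (\<lambda>s. ennreal (LZ_weight 1 q \<alpha> \<beta> s) * ennreal (E * s powr - ?\<mu>))"
  have "?N < \<infinity>"
  proof (rule Lq_norm01_weight_finite[OF q _ _ _ _ E less_imp_le[OF C'(1)], where A = 1 and p' = 2])
    fix s :: real assume s: "0 < s" "s < 1"
    have split: "s powr recip 1 * ell s powr \<alpha> * ellell s powr \<beta> * log_weight 1 2 s powr recip q * s powr - ?\<mu>
        = (s powr recip 1 * s powr - ?\<mu>) * ell s powr \<alpha> * ellell s powr \<beta> * log_weight 1 2 s powr recip q"
      by (simp only: mult_ac)
    have pow: "s powr recip 1 * s powr - ?\<mu> = s powr (1 - ?\<mu>)"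
      using s by (simp add: powr_diff powr_minus_divide)
    show "s powr recip 1 * ell s powr \<alpha> * ellell s powr \<beta> * log_weight 1 2 s powr recip q * s powr - ?\<mu> \<le> C'"
      unfolding split pow by (rule C'(2)[OF s])
  qed auto
  moreover have "LZ_max_norm 1 q \<alpha> \<beta> \<phi> \<le> ?N"
    if \<phi>: "\<forall>s. 0 < s \<longrightarrow> s < 1 \<longrightarrow> \<phi> s \<le> ennreal (C * profile s)" for \<phi>
    unfolding LZ_max_norm_def
  proof (rule Lq_norm01_mono[OF q])
    let ?F = "\<lambda>s. \<integral>\<^sup>+t. rearr {0<..<1} \<phi> t * indicator {0<..<s} t \<partial>lebesgue"
    have max_rearr_eq: "max_rearr {0<..<1} \<phi> s = ?F s / ennreal s" for s
      unfolding max_rearr_def by (subst nn_integral_restrict_space) auto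
    \<comment> \<open>The integral increases with its upper limit, so reflecting s makes it antitone
      and hence Borel measurable.\<close>
    have "antimono (\<lambda>s. ?F (- s))"
      by (intro antimonoI nn_integral_mono mult_left_mono) (auto simp: indicator_def)
    from measurable_compose[OF borel_measurable_uminus[OF measurable_ident] antimono_borel_measurable[OF this]]
    have F: "?F \<in> borel_measurable borel" by simp
    show "(\<lambda>s. ennreal (LZ_weight 1 q \<alpha> \<beta> s) * max_rearr {0<..<1} \<phi> s) \<in> borel_measurable (lebesgue_on {0<..<1})"
    proof (rule measurable_restrict_space1)
      have "(\<lambda>s. ennreal (LZ_weight 1 q \<alpha> \<beta> s) * (?F s / ennreal s)) \<in> borel_measurable borel"
        using F by measurable
      then show "(\<lambda>s. ennreal (LZ_weight 1 q \<alpha> \<beta> s) * max_rearr {0<..<1} \<phi> s) \<in> borel_measurable lebesgue"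
        unfolding max_rearr_eq by (simp add: measurable_completion)
    qed
    fix s :: real assume s: "0 < s" "s < 1"
    have rearr: "rearr {0<..<1} \<phi> t \<le> ennreal (C * t powr - ?\<mu>)" if t: "0 < t" "t < 1" for t
    proof (rule rearr_unit_le)
      fix x assume x: "t \<le> x" "0 < x" "x < 1"
      have "profile x \<le> x powr - ?\<mu>" unfolding profile_def using log_weight_ge_1[OF x(2,3)] by (simp add: divide_le_eq mult_le_cancel_left1)
      also have "\<dots> \<le> t powr - ?\<mu>" using t x \<mu> by (intro powr_mono2') auto
      finally have "ennreal (C * profile x) \<le> ennreal (C * t powr - ?\<mu>)" using C by (intro ennreal_leI mult_left_mono)
      then show "\<phi> x \<le> ennreal (C * t powr - ?\<mu>)" using \<phi> x by (blast intro: order_trans)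
    qed (use t in simp)
    have "?F s \<le> (\<integral>\<^sup>+t. indicator {0..s} t * ennreal (C * t powr - ?\<mu>) \<partial>lebesgue)"
      using rearr s by (intro nn_integral_mono) (auto simp: indicator_def)
    also have "\<dots> = ennreal (C * (s powr (- ?\<mu> + 1) / (- ?\<mu> + 1)))"
    proof -
      have "((\<lambda>t. C * t powr - ?\<mu>) has_integral C * (s powr (- ?\<mu> + 1) / (- ?\<mu> + 1))) {0..s}"
        using \<mu> s by (intro has_integral_mult_right has_integral_powr_from_0) auto
      from nn_integral_has_integral_lebesgue'[OF _ this] show ?thesis
        using C by (simp add: nn_integral_completion mult.commute)
    qed
    finally have "?F s / ennreal s \<le> ennreal (C * (s powr (- ?\<mu> + 1) / (- ?\<mu> + 1))) / ennreal s"
      by (rule divide_right_mono_ennreal)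
    also have "\<dots> = ennreal (C * (s powr (- ?\<mu> + 1) / (- ?\<mu> + 1)) / s)"
      using s C \<mu> by (intro divide_ennreal mult_nonneg_nonneg divide_nonneg_nonneg) auto
    also have "C * (s powr (- ?\<mu> + 1) / (- ?\<mu> + 1)) / s = E * s powr - ?\<mu>"
    proof -
      have pow: "s powr (- ?\<mu> + 1) = s powr - ?\<mu> * s"
        by (subst powr_add) (use s in simp)
      have one: "- ?\<mu> + 1 = 1 - ?\<mu>" by simp
      have "C * (X * s / e) / s = C / e * X" for X e using s by simp
      then show ?thesis unfolding pow E_def unfolding one .
    qed
    finally show "ennreal (LZ_weight 1 q \<alpha> \<beta> s) * max_rearr {0<..<1} \<phi> s
        \<le> ennreal (LZ_weight 1 q \<alpha> \<beta> s) * ennreal (E * s powr - ?\<mu>)"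
      unfolding max_rearr_eq by (rule mult_left_mono) simp
  qed
  ultimately show "\<exists>N<\<infinity>. \<forall>\<phi>. (\<forall>s. 0 < s \<longrightarrow> s < 1 \<longrightarrow> \<phi> s \<le> ennreal (C * profile s)) \<longrightarrow> LZ_max_norm 1 q \<alpha> \<beta> \<phi> \<le> N"
    by blast
qed

end

section \<open>The two directions combined\<close>

lemma LZ_embeds:
  fixes \<Omega> :: "(real^'n::finite) set"
  assumes \<Omega>: "bounded \<Omega>" "jones_domain \<Omega>" and m: "1 \<le> m" "m < CARD('n)"
    and q: "1 \<le> q" and p: "1 \<le> p"
    and cond: "recip p < m / CARD('n) \<or> recip p = m / CARD('n) \<and>
      (1 - recip q = 0 \<and> \<alpha> = 0 \<and> \<beta> = 0 \<or> \<alpha> = 1 - recip q \<and> 1 - recip q < \<beta> \<or> 1 - recip q < \<alpha>)"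
  shows "sobolev_embeds_Cb m (LZ_norm p q \<alpha> \<beta>) \<Omega>"
proof -
  have dom: "open \<Omega>" "\<Omega> \<noteq> {}" using \<Omega>(2) by (auto simp: jones_domain_def is_domain_def)
  have "\<Omega> \<in> lmeasurable" by (rule lmeasurable_open[OF \<Omega>(1) dom(1)])
  moreover have "\<not> negligible \<Omega>" by (rule open_not_negligible[OF dom])
  ultimately have meas: "\<Omega> \<in> sets lebesgue" "0 < measure lebesgue \<Omega>"
    by (auto simp: negligible_iff_measure zero_less_measure_iff fmeasurableD less_le)
  obtain K where K: "0 \<le> K" "\<And>u A. sobolev_bound \<Omega> m u A \<Longrightarrow>
      \<exists>g\<in>Cb_space \<Omega>. (AE x in lebesgue_on \<Omega>. g x = u x) \<and> Cb_norm \<Omega> g \<le> K * A"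
    by (rule embedding_estimate[OF \<Omega> m]) blast
  obtain C where C: "0 \<le> C" "\<And>f. f \<in> borel_measurable (lebesgue_on \<Omega>) \<Longrightarrow>
      potential \<Omega> m f \<le> ennreal C * LZ_norm p q \<alpha> \<beta> (\<lambda>s. rearr \<Omega> f (measure lebesgue \<Omega> * s))"
    by (rule potential_le_LZ_norm[OF q p meas cond]) blast
  show ?thesis
    unfolding sobolev_embeds_Cb_def
  proof (intro exI[of _ "K * C"] ballI)
    let ?X = "LZ_norm p q \<alpha> \<beta>"
    fix u assume "u \<in> sobolev_space m ?X \<Omega>"
    then have wd: "weakly_differentiable m \<Omega> u"
      and G: "\<And>j. j \<le> m \<Longrightarrow> weak_grad_norm \<Omega> j u \<in> borel_measurable (lebesgue_on \<Omega>)"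
        "\<And>j. j \<le> m \<Longrightarrow> fn_norm ?X \<Omega> (weak_grad_norm \<Omega> j u) < \<infinity>"
      by (auto simp: sobolev_space_def fn_space_def)
    let ?S = "sobolev_norm m ?X \<Omega> u"
    have "?S < top" unfolding sobolev_norm_def using G(2) by (subst ennreal_sum_less_top) auto
    then have S: "?S < \<infinity>" by simp
    have S': "ennreal (C * enn2real ?S) = ennreal C * ?S" using S C by (simp add: ennreal_mult')
    have "sobolev_bound \<Omega> m u (C * enn2real ?S)"
    proof
      fix j assume j: "j \<le> m"
      have "(\<lambda>x. ennreal \<bar>weak_grad_norm \<Omega> j u x\<bar>) \<in> borel_measurable (lebesgue_on \<Omega>)"
        using G(1)[OF j] by measurable
      from C(2)[OF this] have "potential \<Omega> m (\<lambda>x. ennreal \<bar>weak_grad_norm \<Omega> j u x\<bar>) \<le> ennreal C * fn_norm ?X \<Omega> (weak_grad_norm \<Omega> j u)"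
        by (simp add: fn_norm_def)
      also have "\<dots> \<le> ennreal C * ?S"
        unfolding sobolev_norm_def using j by (intro mult_left_mono member_le_sum) auto
      finally show "potential \<Omega> m (\<lambda>x. ennreal \<bar>weak_grad_norm \<Omega> j u x\<bar>) \<le> ennreal (C * enn2real ?S)"
        unfolding S' .
    qed (use \<Omega> dom m wd G(1) C(1) in auto)
    from K(2)[OF this] obtain g where g: "g \<in> Cb_space \<Omega>" "AE x in lebesgue_on \<Omega>. g x = u x"
      "Cb_norm \<Omega> g \<le> K * (C * enn2real ?S)" by blast
    from g(3) have "ennreal (Cb_norm \<Omega> g) \<le> ennreal (K * (C * enn2real ?S))" by (rule ennreal_leI)
    also have "\<dots> = ennreal (K * C) * ?S" using K(1) C(1) S by (simp add: ennreal_mult' mult.assoc)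
    finally show "\<exists>g\<in>Cb_space \<Omega>. (AE x in lebesgue_on \<Omega>. g x = u x) \<and> ennreal (Cb_norm \<Omega> g) \<le> ennreal (K * C) * ?S"
      using g by blast
  qed
qed

theorem theorem3p3:
  fixes \<Omega> :: "(real^'n::finite) set" and m :: nat
  assumes "CARD('n) \<ge> 2" and "1 \<le> m" and "m < CARD('n)"
    and "bounded \<Omega>" and "jones_domain \<Omega>"
  shows "(\<forall>(p::ennreal) (q::ennreal) (\<alpha>::real) (\<beta>::real).
            1 \<le> p \<and> 1 \<le> q \<and> LZ_admissible p q \<alpha> \<beta> \<longrightarrow>
            (sobolev_embeds_Cb m (LZ_norm p q \<alpha> \<beta>) \<Omega> \<longleftrightarrow>
               (p = ennreal (real CARD('n) / real m) \<and> q = 1 \<and> \<alpha> = 0 \<and> \<beta> = 0) \<or>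
               (p = ennreal (real CARD('n) / real m) \<and>
                  \<alpha> = recip (conj_exp q) \<and> \<beta> > recip (conj_exp q)) \<or>
               (p = ennreal (real CARD('n) / real m) \<and> \<alpha> > recip (conj_exp q)) \<or>
               p > ennreal (real CARD('n) / real m))) \<and>
         (\<forall>(q::ennreal) (\<alpha>::real) (\<beta>::real).
            1 \<le> q \<and> L1_admissible q \<alpha> \<beta> \<longrightarrow>
            \<not> sobolev_embeds_Cb m (LZ_max_norm 1 q \<alpha> \<beta>) \<Omega>)"
proof (intro conjI allI impI)
  interpret peak \<Omega> m
    by standard (use assms in \<open>auto simp: jones_domain_def is_domain_def\<close>)
  let ?a = "ennreal (real CARD('n) / real m)"
  have nm: "0 < real CARD('n)" "0 < real m" using assms by auto
  {
    fix q :: ennreal and \<alpha> \<beta> :: real assume "1 \<le> q \<and> L1_admissible q \<alpha> \<beta>"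
    then show "\<not> sobolev_embeds_Cb m (LZ_max_norm 1 q \<alpha> \<beta>) \<Omega>" by (intro LZ_max_not_embeds) simp
  }
  fix p q :: ennreal and \<alpha> \<beta> :: real
  assume "1 \<le> p \<and> 1 \<le> q \<and> LZ_admissible p q \<alpha> \<beta>"
  then have p: "1 \<le> p" and q: "1 \<le> q" by auto
  have q1: "recip q = 1 \<longleftrightarrow> q = 1" using q by (cases q rule: exponent_cases) auto
  \<comment> \<open>Exponents are compared through their reciprocals, because both halves of the
    proof depend on p only through 1/p and its position relative to m/n.\<close>
  consider "?a < p" "recip p < m / CARD('n)" | "p = ?a" "recip p = m / CARD('n)" | "p < ?a" "m / CARD('n) < recip p"
    using recip_less[OF p nm] recip_ennreal_div[OF nm] by (cases p ?a rule: linorder_cases) auto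
  then show "sobolev_embeds_Cb m (LZ_norm p q \<alpha> \<beta>) \<Omega> \<longleftrightarrow>
               (p = ?a \<and> q = 1 \<and> \<alpha> = 0 \<and> \<beta> = 0) \<or>
               (p = ?a \<and> \<alpha> = recip (conj_exp q) \<and> \<beta> > recip (conj_exp q)) \<or>
               (p = ?a \<and> \<alpha> > recip (conj_exp q)) \<or> p > ?a" (is "?embeds \<longleftrightarrow> ?cond")
  proof cases
    case 1
    then show ?thesis using LZ_embeds[OF assms(4,5,2,3) q p] by simp
  next
    case 2
    show ?thesis
    proof
      show ?embeds if ?cond
        using that 2 q1 by (intro LZ_embeds[OF assms(4,5,2,3) q p]) (auto simp: recip_conj_exp[OF q])
      show ?cond if ?embeds
      proof (rule ccontr)
        assume "\<not> ?cond"
        \<comment> \<open>At p = n/m, with 1/q' = 1 - 1/q, the negation of the listed conditions is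
          exactly the critical case of \<open>LZ_not_embeds\<close>.\<close>
        then have "(\<alpha> < 1 - recip q \<or> \<alpha> = 1 - recip q \<and> \<beta> \<le> 1 - recip q) \<and> \<not> (recip q = 1 \<and> \<alpha> = 0 \<and> \<beta> = 0)"
          using 2(1) by (auto simp: recip_conj_exp[OF q] q1 not_less)
        with LZ_not_embeds[OF q, of p \<alpha> \<beta>] 2(2) that show False by blast
      qed
    qed
  next
    case 3
    then show ?thesis using LZ_not_embeds[OF q, of p \<alpha> \<beta>] by auto
  qed
qed

end
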